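(* Let $\alpha>-1$, $r\in\mathbb{N}$, and $0<\theta<1$ be fixed. For $n\in\mathbb{N}$ let $m_n$ be the largest integer such that $2j(m_n)\le n$. Then $Q^{\mathrm{2TL}}_{j(m_n)}$ uses at most $n$ nodes, and there are constants $C_1,C_2>0$ independent of $n$ such that for all $n\in\mathbb{N}$ \[ C_1 n^{-3r/4}\;\le\;\mathrm{Int}_n\big(\mathbf{W}^r_{1,w_r}(\mathbb{R})\big)\;\le\;\sup_{f\in \mathbf{W}^r_{1,w_r}(\mathbb{R})}\Big|\int_{\mathbb{R}} f(x)w(x)\,dx-Q^{\mathrm{2TL}}_{j(m_n)}f\Big|\;\le\; C_2\, n^{-r/2}. \]
   Context: For $r\in\mathbb{N}_0$ let $w_r(x)=|x|^{\alpha+r/2}e^{-|x|}$ on $\mathbb{R}$ and $w:=w_0$. The space $L_{1,w_r}(\mathbb{R})$ consists of measurable $f$ with $\|f\|_{L_{1,w_r}}=\int_{\mathbb{R}}|f(x)w_r(x)|\,dx<\infty$; $W^r_{1,w_r}(\mathbb{R})$ consists of $f\in L_{1,w_r}(\mathbb{R})$ with weak derivatives $f^{(k)}\in L_{1,w_r}(\mathbb{R})$ for $0\le k\le r$, normed by $\sum_{k=0}^r\|f^{(k)}\|_{L_{1,w_r}}$; its elements are identified with their continuous representatives, and $\mathbf{W}^r_{1,w_r}(\mathbb{R})$ is its closed unit ball. For a set $\mathbf{F}$ of continuous functions on $\mathbb{R}$, $\mathrm{Int}_n(\mathbf{F})=\inf_Q\sup_{f\in\mathbf{F}}\big|\int_{\mathbb{R}}f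 w\,dx-Qf\big|$, the infimum over all quadratures $Qf=\sum_{i=1}^k\lambda_if(x_i)$ with $k\le n$, arbitrary nodes $x_i\in\mathbb{R}$ and real weights $\lambda_i$. Let $p_m$ be the orthonormal polynomials on $(0,\infty)$ for the Laguerre weight $x^\alpha e^{-x}$, with zeros $x_{m,1}<\dots<x_{m,m}$ and Cotes numbers $\lambda_{m,k}=\int_0^\infty\ell_k(x)x^\alpha e^{-x}dx$, $\ell_k(x)=\prod_{i\ne k}\frac{x-x_{m,i}}{x_{m,k}-x_{m,i}}$. For fixed $\theta\in(0,1)$, $j(m)$ is the largest integer with $x_{m,j(m)}\le4\theta m$, and $Q^{\mathrm{2TL}}_{j(m)}f=\sum_{k=1}^{j(m)}\lambda_{m,k}\big(f(x_{m,k})+f(-x_{m,k})\big)$. *)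

theory Defs
  imports "HOL-Analysis.Analysis" "HOL-Computational_Algebra.Polynomial"
begin

definition wr :: "real \<Rightarrow> nat \<Rightarrow> real \<Rightarrow> real" where
  "wr \<alpha> r x = \<bar>x\<bar> powr (\<alpha> + real r / 2) * exp (- \<bar>x\<bar>)"

definition test_fun :: "(real \<Rightarrow> real) \<Rightarrow> bool" where
  "test_fun \<phi> \<longleftrightarrow> (\<forall>k x. ((deriv ^^ k) \<phi>) differentiable (at x)) \<and> bounded {x. \<phi> x \<noteq> 0}"

definition loc_integrable :: "(real \<Rightarrow> real) \<Rightarrow> bool" where
  "loc_integrable g \<longleftrightarrow> (\<forall>a b. set_integrable lborel {a..b} g)"

definition weak_deriv :: "nat \<Rightarrow> (real \<Rightarrow> real) \<Rightarrow> (real \<Rightarrow> real) \<Rightarrow> bool" where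
  "weak_deriv k f g \<longleftrightarrow> loc_integrable f \<and> loc_integrable g \<and>
     (\<forall>\<phi>. test_fun \<phi> \<longrightarrow>
        (\<integral>x. f x * (deriv ^^ k) \<phi> x \<partial>lborel) = (-1) ^ k * (\<integral>x. g x * \<phi> x \<partial>lborel))"

text \<open>Closed unit ball of W^r_{1,w_r}(R), elements identified with continuous representatives.\<close>
definition sobolev_ball :: "real \<Rightarrow> nat \<Rightarrow> (real \<Rightarrow> real) set" where
  "sobolev_ball \<alpha> r = {f. continuous_on UNIV f \<and>
     (\<exists>g :: nat \<Rightarrow> real \<Rightarrow> real. g 0 = f \<and>
        (\<forall>k\<le>r. weak_deriv k f (g k) \<and> integrable lborel (\<lambda>x. g k x * wr \<alpha> r x)) \<and>
        (\<Sum>k\<le>r. \<integral>x. \<bar>g k x * wr \<alpha> r x\<bar> \<partial>lborel) \<le> 1)}"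

definition quad :: "(real \<times> real) list \<Rightarrow> (real \<Rightarrow> real) \<Rightarrow> real" where
  "quad Q f = (\<Sum>(x, l) \<leftarrow> Q. l * f x)"

definition quad_err :: "real \<Rightarrow> (real \<times> real) list \<Rightarrow> (real \<Rightarrow> real) \<Rightarrow> real" where
  "quad_err \<alpha> Q f = \<bar>(\<integral>x. f x * wr \<alpha> 0 x \<partial>lborel) - quad Q f\<bar>"

definition worst_err :: "real \<Rightarrow> (real \<Rightarrow> real) set \<Rightarrow> (real \<times> real) list \<Rightarrow> ereal" where
  "worst_err \<alpha> F Q = (SUP f\<in>F. ereal (quad_err \<alpha> Q f))"

definition Int_n :: "real \<Rightarrow> nat \<Rightarrow> (real \<Rightarrow> real) set \<Rightarrow> ereal" where
  "Int_n \<alpha> n F = (INF Q\<in>{Q. length Q \<le> n}. worst_err \<alpha> F Q)"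

definition lag_w :: "real \<Rightarrow> real \<Rightarrow> real" where
  "lag_w \<alpha> x = x powr \<alpha> * exp (- x)"

definition laguerre_orthonormal :: "real \<Rightarrow> (nat \<Rightarrow> real poly) \<Rightarrow> bool" where
  "laguerre_orthonormal \<alpha> p \<longleftrightarrow> (\<forall>m. degree (p m) = m \<and> lead_coeff (p m) > 0) \<and>
     (\<forall>i j. (LINT x:{0<..}|lborel. poly (p i) x * poly (p j) x * lag_w \<alpha> x) =
            (if i = j then 1 else 0))"

definition lag_p :: "real \<Rightarrow> nat \<Rightarrow> real poly" where
  "lag_p \<alpha> = (SOME p. laguerre_orthonormal \<alpha> p)"

text \<open>x_{m,k} for k = 1..m (1-based), zeros in increasing order.\<close>
definition lag_zero :: "real \<Rightarrow> nat \<Rightarrow> nat \<Rightarrow> real" where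
  "lag_zero \<alpha> m k = sorted_list_of_set {x. poly (lag_p \<alpha> m) x = 0} ! (k - 1)"

definition lagrange_basis :: "real \<Rightarrow> nat \<Rightarrow> nat \<Rightarrow> real \<Rightarrow> real" where
  "lagrange_basis \<alpha> m k x = (\<Prod>i\<in>{1..m} - {k}. (x - lag_zero \<alpha> m i) / (lag_zero \<alpha> m k - lag_zero \<alpha> m i))"

definition cotes :: "real \<Rightarrow> nat \<Rightarrow> nat \<Rightarrow> real" where
  "cotes \<alpha> m k = (LINT x:{0<..}|lborel. lagrange_basis \<alpha> m k x * lag_w \<alpha> x)"

definition j_idx :: "real \<Rightarrow> real \<Rightarrow> nat \<Rightarrow> nat" where
  "j_idx \<alpha> \<theta> m = (GREATEST j. j = 0 \<or> (1 \<le> j \<and> j \<le> m \<and> lag_zero \<alpha> m j \<le> 4 * \<theta> * real m))"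

definition Q2TL :: "real \<Rightarrow> real \<Rightarrow> nat \<Rightarrow> (real \<times> real) list" where
  "Q2TL \<alpha> \<theta> m = concat (map (\<lambda>k. [(lag_zero \<alpha> m k, cotes \<alpha> m k), (- lag_zero \<alpha> m k, cotes \<alpha> m k)])
                      [1..<j_idx \<alpha> \<theta> m + 1])"

definition m_n :: "real \<Rightarrow> real \<Rightarrow> nat \<Rightarrow> nat" where
  "m_n \<alpha> \<theta> n = (GREATEST m. 2 * j_idx \<alpha> \<theta> m \<le> n)"

end

theory Submission
  imports Defs
begin

text \<open>
  Upper bound. Since the weight is even, it suffices to treat the truncated Gauss--Laguerre rule on the
  half-line. Interpolating the indicator of \<open>(-\<infinity>, z]\<close>, \<open>z\<close> a Gauss node, at the nodes (doubly except
  at \<open>z\<close>) gives one-sided polynomial approximants, as in the Markov--Stieltjes inequalities, whose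
  \<open>L\<^sub>1\<close> error is the Cotes number \<open>\<lambda>\<^sub>z\<close>. The Laguerre equation in the variable \<open>t = \<surd>x\<close> is nearly a
  harmonic oscillator of frequency \<open>2\<surd>m\<close>; Sturm comparison and an energy estimate yield
  \<open>\<lambda>\<^sub>z \<le> C \<surd>(z/m) w(z)\<close> for \<open>z \<le> 4\<theta>m\<close>. Writing \<open>g\<close> as a superposition of step functions with
  density \<open>g'\<close>, both the error of weighted \<open>L\<^sub>1\<close> approximation and the truncated quadrature error are
  at most \<open>C m\<^sup>-\<^sup>1\<^sup>/\<^sup>2\<close> times the norm of \<open>g'\<close> with weight \<open>\<surd>x w(x)\<close>, up to boundary terms. Iterating
  the approximation result \<open>r - 1\<close> times with degrees a small fraction of \<open>m\<close>, so that the approximating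
  polynomials contribute exponentially little beyond \<open>4\<theta>m\<close>, and applying the quadrature estimate to
  the remainder gives \<open>m\<^sup>-\<^sup>r\<^sup>/\<^sup>2\<close>.

  Lower bound. Among the \<open>n + 1\<close> unit intervals \<open>(n+i, n+i+1)\<close>, \<open>i \<le> n\<close>, one contains no node, and a
  bump supported there, normalised in the Sobolev norm, has integral of order \<open>n\<^sup>-\<^sup>r\<^sup>/\<^sup>2 \<ge> n\<^sup>-\<^sup>3\<^sup>r\<^sup>/\<^sup>4\<close>.
\<close>

subsection \<open>The Laguerre measure\<close>

text \<open>Half powers in the weights organise the argument. In \<open>t = sqrt x\<close> the nodes
  lie about \<open>1 / sqrt m\<close> apart, hence about \<open>sqrt (x / m)\<close> in
  \<open>x\<close>: each derivative brings a factor \<open>sqrt x / sqrt m\<close>, and the natural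
  weight exponent for the k-th derivative is \<open>\<alpha> + k/2\<close>. This is why the
  single-step estimates pass from exponent \<open>b\<close> to \<open>b + 1/2\<close> and are proved
  for all \<open>b > -1\<close>. The Sobolev norm uses \<open>\<alpha> + r/2\<close> for every k,
  which near 0 is weaker than wanted for \<open>k < r\<close>; a Hardy-type inequality closes this
  gap. The obstacle at the far end is the truncation: exactness of the Gauss rule is lost through
  the nodes beyond \<open>T = 4 \<theta> m\<close>, where a polynomial may be large. A polynomial of
  degree about \<open>\<theta> m / 20\<close> is harmless there: with \<open>N\<close> about
  \<open>\<theta> m\<close>, the bound \<open>(z / T) ^ N >= 1\<close> trades the dropped nodes for
  a moment of order near \<open>N\<close>, and \<open>N! / T ^ N <= 4 ^ (-N)\<close> outweighs the
  growth of the polynomial.\<close>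

definition lagm :: "real \<Rightarrow> real measure" where
  "lagm b = density lborel (\<lambda>x. ennreal (indicator {0<..} x * lag_w b x))"

lemma sets_lagm [simp, measurable_cong]: "sets (lagm b) = sets borel"
  by (simp add: lagm_def)

lemma space_lagm [simp]: "space (lagm b) = UNIV"
  by (simp add: lagm_def)

lemma lag_w_measurable [measurable]: "lag_w b \<in> borel_measurable borel"
  unfolding lag_w_def by measurable

lemma lag_w_nonneg [simp]: "lag_w b x \<ge> 0"
  by (simp add: lag_w_def)

lemma lag_w_pos: "x > 0 \<Longrightarrow> lag_w b x > 0"
  by (simp add: lag_w_def)

lemma nn_integral_lagm:
  assumes [measurable]: "f \<in> borel_measurable borel"
  shows "(\<integral>\<^sup>+x. f x \<partial>lagm b) = (\<integral>\<^sup>+x. ennreal (indicator {0<..} x * lag_w b x) * f x \<partial>lborel)"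
  unfolding lagm_def by (subst nn_integral_density) auto

lemma integral_lagm:
  fixes f :: "real \<Rightarrow> real"
  assumes [measurable]: "f \<in> borel_measurable borel"
  shows "(\<integral>x. f x \<partial>lagm b) = (LINT x:{0<..}|lborel. f x * lag_w b x)"
  unfolding lagm_def set_lebesgue_integral_def
  by (subst integral_density) (auto simp: mult_ac)

lemma integrable_lagm_iff:
  fixes f :: "real \<Rightarrow> real"
  assumes [measurable]: "f \<in> borel_measurable borel"
  shows "integrable (lagm b) f \<longleftrightarrow> set_integrable lborel {0<..} (\<lambda>x. f x * lag_w b x)"
  unfolding lagm_def set_integrable_def
  by (subst integrable_density) (auto simp: mult_ac)

lemma AE_lagm_pos: "AE x in lagm b. x > 0"
  unfolding lagm_def by (subst AE_density) (auto simp: indicator_def intro!: AE_I2)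

lemma nn_moment_lagm:
  assumes "b > -1"
  shows "(\<integral>\<^sup>+x. ennreal (x ^ j) \<partial>lagm b) = ennreal (Gamma (b + 1 + real j))"
proof -
  have "(\<integral>\<^sup>+x. ennreal (x ^ j) \<partial>lagm b)
      = (\<integral>\<^sup>+x. ennreal (indicator {0<..} x * lag_w b x) * ennreal (x ^ j) \<partial>lborel)"
    by (rule nn_integral_lagm) simp
  also have "\<dots> = (\<integral>\<^sup>+t. ennreal (indicator {0..} t * t powr (b + 1 + real j - 1) / exp t) \<partial>lborel)"
  proof (intro nn_integral_cong)
    fix x :: real
    consider "x < 0" | "x = 0" | "x > 0" by linarith
    then show "ennreal (indicator {0<..} x * lag_w b x) * ennreal (x ^ j)
        = ennreal (indicator {0..} x * x powr (b + 1 + real j - 1) / exp x)"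
      by cases (auto simp: lag_w_def powr_add powr_realpow exp_minus field_simps simp flip: ennreal_mult)
  qed
  also have "\<dots> = ennreal (Gamma (b + 1 + real j))"
    using assms by (subst Gamma_conv_nn_integral_real) auto
  finally show ?thesis .
qed

lemma has_integral_moment_lagm:
  assumes "b > -1"
  shows "has_bochner_integral (lagm b) (\<lambda>x. x ^ j) (Gamma (b + 1 + real j))"
proof (rule has_bochner_integral_nn_integral)
  show "AE x in lagm b. 0 \<le> x ^ j"
    using AE_lagm_pos[of b] by eventually_elim simp
  show "0 \<le> Gamma (b + 1 + real j)"
    using assms by (intro less_imp_le Gamma_real_pos) auto
qed (use nn_moment_lagm[OF assms, of j] in auto)

lemma integrable_power_lagm: "b > -1 \<Longrightarrow> integrable (lagm b) (\<lambda>x. x ^ j)"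
  using has_integral_moment_lagm[of b j] by (simp add: has_bochner_integral_iff)

lemma integrable_poly_lagm:
  assumes "b > -1"
  shows "integrable (lagm b) (poly p)"
  unfolding poly_altdef[abs_def]
  using integrable_power_lagm[OF assms] by (intro Bochner_Integration.integrable_sum integrable_mult_right)

lemma finite_measure_lagm:
  assumes "b > -1"
  shows "finite_measure (lagm b)"
proof (rule finite_measureI)
  show "emeasure (lagm b) (space (lagm b)) \<noteq> \<infinity>"
    using nn_moment_lagm[OF assms, of 0] by simp
qed

definition Lam :: "real \<Rightarrow> real poly \<Rightarrow> real" where
  "Lam b p = (\<integral>x. poly p x \<partial>lagm b)"

context
  fixes b :: real assumes b: "b > -1"
begin

lemma Lam_add: "Lam b (p + q) = Lam b p + Lam b q"
  using integrable_poly_lagm[OF b] by (simp add: Lam_def cong: Bochner_Integration.integral_cong) 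

lemma Lam_diff: "Lam b (p - q) = Lam b p - Lam b q"
  using integrable_poly_lagm[OF b] by (simp add: Lam_def cong: Bochner_Integration.integral_cong) 

lemma Lam_sum: "Lam b (\<Sum>i\<in>A. f i) = (\<Sum>i\<in>A. Lam b (f i))"
  unfolding Lam_def poly_sum using integrable_poly_lagm[OF b] by simp

lemma Lam_smult: "Lam b (smult c p) = c * Lam b p"
  using integrable_poly_lagm[OF b] by (simp add: Lam_def cong: Bochner_Integration.integral_cong) 

lemma Lam_monom: "Lam b (monom c i) = c * Gamma (b + 1 + real i)"
  unfolding Lam_def poly_monom using has_integral_moment_lagm[OF b, of i]
  by (simp add: has_bochner_integral_iff)

text \<open>Integration by parts against the weight. On monomials it is the functional equation of
  \<open>Gamma\<close>, so boundary terms at 0 and infinity never appear; linearity does the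
  rest.\<close>

lemma Lam_by_parts: "Lam b (pCons 0 (pderiv p)) = Lam b (pCons 0 p) - (b + 1) * Lam b p"
proof -
  have mono: "Lam b (pCons 0 (pderiv (monom c i)))
      = Lam b (pCons 0 (monom c i)) - (b + 1) * Lam b (monom c i)" for c i
  proof -
    have 1: "pCons 0 (monom c i) = monom c (Suc i)" by (simp add: monom_Suc)
    have 2: "pCons 0 (pderiv (monom c i)) = monom (of_nat i * c) i"
      by (cases i) (simp_all only: pderiv_monom, simp_all add: monom_Suc)
    have "Gamma (b + 1 + real (Suc i)) = (b + 1 + real i) * Gamma (b + 1 + real i)"
      using Gamma_plus1[of "b + 1 + real i"] b by (auto simp: nonpos_Ints_def add_ac)
    then show ?thesis unfolding 1 2 Lam_monom by (simp add: algebra_simps)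
  qed
  have pds: "pderiv (\<Sum>i\<in>A. f i) = (\<Sum>i\<in>A. pderiv (f i))" for A and f :: "nat \<Rightarrow> real poly"
    by (rule poly_eqI) (simp add: coeff_pderiv coeff_sum sum_distrib_left)
  have pc: "pCons 0 (\<Sum>i\<in>A. f i) = (\<Sum>i\<in>A. pCons 0 (f i))" for A and f :: "nat \<Rightarrow> real poly"
  proof (induction A rule: infinite_finite_induct)
    case (insert x F)
    then show ?case using add_pCons[of 0 "f x" 0 "sum f F"] by simp
  qed auto
  have "Lam b (pCons 0 (pderiv (\<Sum>i\<le>degree p. monom (coeff p i) i)))
     = Lam b (pCons 0 (\<Sum>i\<le>degree p. monom (coeff p i) i))
       - (b + 1) * Lam b (\<Sum>i\<le>degree p. monom (coeff p i) i)"
    unfolding pds pc Lam_sum mono by (simp add: sum_subtractf sum_distrib_left)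
  then show ?thesis by (simp add: poly_as_sum_of_monoms)
qed

end

subsection \<open>Laguerre polynomials\<close>

text \<open>The terminating Kummer series \<open>1F1(-m; b+1; x)\<close>, a positive multiple of the
  classical Laguerre polynomial. The value 1 at the origin supplies the starting value for the
  energy estimate.\<close>

definition lag :: "real \<Rightarrow> nat \<Rightarrow> real poly" where
  "lag b m = (\<Sum>i\<le>m. monom ((-1) ^ i * real (m choose i) / pochhammer (b + 1) i) i)"

lemma coeff_lag: "coeff (lag b m) i = (-1) ^ i * real (m choose i) / pochhammer (b + 1) i"
  by (auto simp: lag_def coeff_sum if_distrib sum.delta' binomial_eq_0 cong: if_cong)

lemma poch_pos: "b > -1 \<Longrightarrow> pochhammer (b + 1 :: real) i > 0"
  by (intro pochhammer_pos) auto

lemma degree_lag: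
  assumes "b > -1" shows "degree (lag b m) = m"
proof (rule antisym)
  show "degree (lag b m) \<le> m"
    by (intro degree_le) (auto simp: coeff_lag binomial_eq_0)
  show "m \<le> degree (lag b m)"
    using poch_pos[OF assms, of m] by (intro le_degree) (auto simp: coeff_lag)
qed

lemma lag_0: "poly (lag b m) 0 = 1"
  by (simp add: poly_0_coeff_0 coeff_lag)

text \<open>Comparing coefficients reduces the equation to a two-term recursion between neighbouring
  coefficients, which is the absorption identity for binomials.\<close>

lemma lag_ode:
  assumes "b > -1"
  shows "pCons 0 (pderiv (pderiv (lag b m))) + [:b + 1, -1:] * pderiv (lag b m) + smult (real m) (lag b m) = 0"
proof (rule poly_eqI)
  fix i
  let ?c = "coeff (lag b m)"
  have e: "coeff (pCons 0 (pderiv (pderiv (lag b m)))) i = real i * real (Suc i) * ?c (Suc i)"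
    by (cases i) (auto simp: coeff_pderiv)
  have e2: "coeff ([:b + 1, -1:] * pderiv (lag b m)) i = (b + 1) * real (Suc i) * ?c (Suc i) - real i * ?c i"
    by (cases i) (auto simp: coeff_pderiv)
  have "(real i + b + 1) * real (Suc i) * ?c (Suc i) = - ((real m - real i) * ?c i)"
  proof -
    have p: "pochhammer (b + 1) i > 0" "b + 1 + real i > 0" using poch_pos[OF assms] assms by auto
    have "real (Suc i) * real (m choose Suc i) = (real m - real i) * real (m choose i)"
    proof (cases "i \<le> m")
      case True
      have "Suc i * (m choose Suc i) = (m - i) * (m choose i)"
        by (simp only: binomial_absorption binomial_absorb_comp)
      then show ?thesis using True by (metis of_nat_diff of_nat_mult)
    qed (simp add: binomial_eq_0)
    moreover have "(real i + b + 1) * real (Suc i) * ?c (Suc i)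
        = - ((-1) ^ i / pochhammer (b + 1) i * (real (Suc i) * real (m choose Suc i)))"
    proof -
      define P D where "P = pochhammer (b + 1) i" and "D = b + 1 + real i"
      have PD: "P > 0" "D > 0" using p by (auto simp: P_def D_def)
      have "?c (Suc i) = - ((-1) ^ i * real (m choose Suc i)) / (P * D)"
        by (simp add: coeff_lag pochhammer_Suc P_def D_def)
      then have "D * ?c (Suc i) = - ((-1) ^ i * real (m choose Suc i)) / P"
        using PD by (simp add: field_simps)
      then have "D * real (Suc i) * ?c (Suc i) = - ((-1) ^ i / P * (real (Suc i) * real (m choose Suc i)))"
      proof -
        assume e: "D * ?c (Suc i) = - ((-1) ^ i * real (m choose Suc i)) / P"
        have "D * real (Suc i) * ?c (Suc i) = real (Suc i) * (D * ?c (Suc i))" by (simp only: mult_ac)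
        then show ?thesis unfolding e by (simp del: of_nat_Suc add: mult_ac)
      qed
      moreover have "D = real i + b + 1" by (simp add: D_def)
      ultimately show ?thesis by (simp only: P_def)
    qed
    ultimately show ?thesis by (simp add: coeff_lag)
  qed
  then show "coeff (pCons 0 (pderiv (pderiv (lag b m))) + [:b + 1, -1:] * pderiv (lag b m)
      + smult (real m) (lag b m)) i = coeff 0 i"
    unfolding coeff_add e e2 by (simp add: algebra_simps)
qed

text \<open>The sum is an \<open>m\<close>-th finite difference of a polynomial of degree \<open>j\<close>.\<close>
lemma alternating_pochhammer_sum:
  fixes a :: real
  shows "j < m \<Longrightarrow> (\<Sum>i\<le>m. (-1) ^ i * real (m choose i) * pochhammer (a + real i) j) = 0"
    and "(\<Sum>i\<le>m. (-1) ^ i * real (m choose i) * pochhammer (a + real i) m) = (-1) ^ m * fact m"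
proof -
  define S where "S = (\<lambda>m j (a::real). \<Sum>i\<le>m. (-1) ^ i * real (m choose i) * pochhammer (a + real i) j)"
  have step: "S (Suc m) j a = S m j a - S m j (a + 1)" for m j a
  proof -
    have "S (Suc m) j a = (\<Sum>i\<le>Suc m. (-1) ^ i * (real (m choose i) + (if i = 0 then 0 else real (m choose (i - 1)))) * pochhammer (a + real i) j)"
      unfolding S_def
      by (intro sum.cong refl) (auto simp: gr0_conv_Suc elim!: lessE)
    also have "\<dots> = (\<Sum>i\<le>Suc m. (-1) ^ i * real (m choose i) * pochhammer (a + real i) j)
        + (\<Sum>i\<le>Suc m. (-1) ^ i * (if i = 0 then 0 else real (m choose (i - 1))) * pochhammer (a + real i) j)"
      by (simp only: distrib_left distrib_right sum.distrib)
    also have "(\<Sum>i\<le>Suc m. (-1) ^ i * real (m choose i) * pochhammer (a + real i) j) = S m j a"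
      unfolding S_def by (simp add: binomial_eq_0)
    also have "(\<Sum>i\<le>Suc m. (-1) ^ i * (if i = 0 then 0 else real (m choose (i - 1))) * pochhammer (a + real i) j) = - S m j (a + 1)"
      unfolding S_def by (subst sum.atMost_Suc_shift) (simp add: sum_negf add_ac)
    finally show ?thesis by simp
  qed
  have dp: "pochhammer (a + real i) (Suc j) - pochhammer (a + 1 + real i) (Suc j) = - (real (Suc j) * pochhammer (a + 1 + real i) j)" for a i j
    unfolding pochhammer_rec[of "a + real i"] pochhammer_rec'[of "a + 1 + real i"]
    by (simp add: algebra_simps)
  have step2: "S (Suc m) (Suc j) a = - real (Suc j) * S m j (a + 1)" for m j a
    unfolding step unfolding S_def sum_subtractf[symmetric] sum_distrib_left
    by (intro sum.cong refl) (simp only: mult.assoc right_diff_distrib[symmetric] dp, simp add: algebra_simps)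
  have s0: "S (Suc m) 0 a = 0" for m a unfolding step by (simp add: S_def)
  have z: "j < m \<Longrightarrow> S m j a = 0" for m j a
  proof (induction m arbitrary: j a)
    case (Suc m) then show ?case by (cases j) (auto simp: s0 step2)
  qed simp
  have f: "S m m a = (-1) ^ m * fact m" for m a
  proof (induction m arbitrary: a)
    case 0 then show ?case by (simp add: S_def)
  next
    case (Suc m) then show ?case by (simp only: step2 Suc.IH) (simp add: algebra_simps)
  qed
  show "j < m \<Longrightarrow> (\<Sum>i\<le>m. (-1) ^ i * real (m choose i) * pochhammer (a + real i) j) = 0"
    using z unfolding S_def .
  show "(\<Sum>i\<le>m. (-1) ^ i * real (m choose i) * pochhammer (a + real i) m) = (-1) ^ m * fact m"
    using f unfolding S_def .
qed

text \<open>In the moment \<open>Gamma (b + 1 + i + j)\<close> the factor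
  \<open>pochhammer (b + 1) i\<close> splits off and cancels the denominator of the i-th
  coefficient; what remains is an alternating binomial sum of a polynomial in \<open>i\<close> of
  degree \<open>j\<close>.\<close>

lemma Lam_lag_monom:
  assumes "b > -1"
  shows "Lam b (lag b m * monom 1 j) = Gamma (b + 1) * (\<Sum>i\<le>m. (-1) ^ i * real (m choose i) * pochhammer (b + 1 + real i) j)"
proof -
  have G: "Gamma (b + 1 + real i + real j) = pochhammer (b + 1) i * pochhammer (b + 1 + real i) j * Gamma (b + 1)" for i
  proof -
    have "pochhammer (b + 1) (i + j) = Gamma (b + 1 + real (i + j)) / Gamma (b + 1)"
      using assms by (intro pochhammer_Gamma) (auto simp: nonpos_Ints_def)
    moreover have "Gamma (b + 1) > 0" using assms by (intro Gamma_real_pos) auto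
    ultimately show ?thesis by (simp add: pochhammer_product' field_simps)
  qed
  have "lag b m * monom 1 j = (\<Sum>i\<le>m. monom ((-1) ^ i * real (m choose i) / pochhammer (b + 1) i) (i + j))"
    unfolding lag_def sum_distrib_right by (simp add: mult_monom)
  then have "Lam b (lag b m * monom 1 j) = (\<Sum>i\<le>m. (-1) ^ i * real (m choose i) / pochhammer (b + 1) i * Gamma (b + 1 + real i + real j))"
    by (simp add: Lam_sum[OF assms] Lam_monom[OF assms] add_ac)
  also have "\<dots> = (\<Sum>i\<le>m. Gamma (b + 1) * ((-1) ^ i * real (m choose i) * pochhammer (b + 1 + real i) j))"
    unfolding G using poch_pos[OF assms] by (intro sum.cong refl) (simp add: field_simps less_imp_neq[symmetric])
  finally show ?thesis by (simp add: sum_distrib_left)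
qed

lemma Lam_lag_orth:
  assumes "b > -1" "degree q < m"
  shows "Lam b (lag b m * q) = 0"
proof -
  have "Lam b (lag b m * (\<Sum>i\<le>degree q. monom (coeff q i) i)) = 0"
  proof -
    have "lag b m * monom c i = smult c (lag b m * monom 1 i)" for c i
      by (metis mult_smult_right smult_monom mult.right_neutral)
    then have "Lam b (lag b m * monom c i) = c * Lam b (lag b m * monom 1 i)" for c i
      by (metis Lam_smult[OF assms(1)])
    moreover have "Lam b (lag b m * monom 1 i) = 0" if "i \<le> degree q" for i
      using assms that alternating_pochhammer_sum(1)[of i m "b + 1"] unfolding Lam_lag_monom[OF assms(1)] by simp
    ultimately show ?thesis
      unfolding sum_distrib_left Lam_sum[OF assms(1)] by (intro sum.neutral ballI) (metis atMost_iff mult_zero_right)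
  qed
  then show ?thesis by (simp add: poly_as_sum_of_monoms)
qed

text \<open>The squared norm of \<open>lag b m\<close> with respect to \<open>lagm b\<close>, see
  \<open>Lam_lag_lag\<close>.\<close>

definition lag_h :: "real \<Rightarrow> nat \<Rightarrow> real" where
  "lag_h b m = Gamma (b + 1) * fact m / pochhammer (b + 1) m"

lemma lag_h_pos: "b > -1 \<Longrightarrow> lag_h b m > 0"
  unfolding lag_h_def using poch_pos[of b m] Gamma_real_pos[of "b+1"] by simp

lemma Lam_lag_lead:
  assumes "b > -1" "degree q \<le> m"
  shows "Lam b (lag b m * q) = coeff q m / coeff (lag b m) m * lag_h b m"
proof -
  define c where "c = coeff q m"
  have q: "q = (q - monom c m) + smult c (monom 1 m)" by (simp add: smult_monom)
  have "Lam b (lag b m * (q - monom c m)) = 0"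
  proof (cases "q - monom c m = 0")
    case True then show ?thesis by (simp add: Lam_def)
  next
    case False
    have "degree (q - monom c m) \<le> m" using assms by (intro degree_diff_le degree_monom_le)
    moreover have "coeff (q - monom c m) m = 0" by (simp add: c_def)
    ultimately have "degree (q - monom c m) < m"
      using False by (metis leading_coeff_0_iff le_neq_implies_less)
    then show ?thesis by (rule Lam_lag_orth[OF assms(1)])
  qed
  moreover have "Lam b (lag b m * monom 1 m) = Gamma (b + 1) * ((-1) ^ m * fact m)"
    using alternating_pochhammer_sum(2)[of m "b + 1"] unfolding Lam_lag_monom[OF assms(1)] by simp
  ultimately have "Lam b (lag b m * q) = c * (Gamma (b + 1) * ((-1) ^ m * fact m))"
    by (subst q) (simp only: distrib_left Lam_add[OF assms(1)] mult_smult_right Lam_smult[OF assms(1)])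
  moreover have "(-1::real) ^ m * (-1) ^ m = 1" by (simp flip: power_mult_distrib)
  ultimately show ?thesis using poch_pos[OF assms(1), of m]
    by (simp add: coeff_lag lag_h_def c_def field_simps)
qed

text \<open>\<open>Gamma_series (b + 1) m\<close> equals
  \<open>m! m^(b+1) / ((b+1)_m (b+1+m))\<close> and converges, hence is bounded; solving for
  \<open>m! / (b+1)_m\<close> leaves the order \<open>m^(-b)\<close>.\<close>

lemma lag_h_bound:
  assumes "b > -1"
  shows "\<exists>C>0. \<forall>m\<ge>1. lag_h b m \<le> C * real m powr (- b)"
proof -
  have "Gamma_series (b + 1) \<longlonglongrightarrow> Gamma (b + 1)" by (rule Gamma_series_LIMSEQ)
  then obtain B where B: "B > 0" "\<And>n. \<bar>Gamma_series (b + 1) n\<bar> \<le> B"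
    using convergent_imp_Bseq[of "Gamma_series (b + 1)"] unfolding Bseq_def convergent_def by auto
  define C where "C = Gamma (b + 1) * B * (b + 2)"
  have Gp: "Gamma (b + 1) > 0" using assms by (intro Gamma_real_pos) auto
  have "lag_h b m \<le> C * real m powr (- b)" if m: "m \<ge> 1" for m
  proof -
    have p: "pochhammer (b + 1) m > 0" "b + 1 + real m > 0" using poch_pos[OF assms] assms by auto
    have "Gamma_series (b + 1) m = fact m * exp ((b + 1) * ln (real m)) / pochhammer (b + 1) (Suc m)"
      by (simp add: Gamma_series_def)
    also have "exp ((b + 1) * ln (real m)) = real m powr (b + 1)" using m by (simp add: powr_def)
    finally have "fact m * real m powr (b + 1) / (pochhammer (b + 1) m * (b + 1 + real m)) \<le> B"
      using abs_le_D1[OF B(2)[of m]] by (simp add: pochhammer_Suc)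
    then have "fact m / pochhammer (b + 1) m \<le> B * (b + 1 + real m) * real m powr (-(b + 1))"
    proof -
      define P D R where "P = pochhammer (b + 1) m" and "D = b + 1 + real m" and "R = real m powr (b + 1)"
      assume a: "fact m * real m powr (b + 1) / (pochhammer (b + 1) m * (b + 1 + real m)) \<le> B"
      have PDR: "P > 0" "D > 0" "R > 0" using p m by (auto simp: P_def D_def R_def)
      have "fact m / P \<le> B * D * inverse R"
        using a[folded P_def D_def R_def] PDR by (simp add: field_simps)
      then show ?thesis unfolding powr_minus P_def D_def R_def by simp
    qed
    also have "\<dots> \<le> B * ((b + 2) * real m) * real m powr (-(b + 1))"
    proof -
      have "b + 1 \<le> (b + 1) * real m" using m assms by simp
      then show ?thesis using B(1) m by (intro mult_right_mono mult_left_mono) (auto simp: algebra_simps)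
    qed
    also have "\<dots> = B * (b + 2) * real m powr (-b)"
      using m by (simp add: powr_diff powr_minus field_simps powr_add)
    finally have "Gamma (b + 1) * (fact m / pochhammer (b + 1) m) \<le> Gamma (b + 1) * (B * (b + 2) * real m powr (-b))"
      using Gp by (intro mult_left_mono) auto
    then show ?thesis by (simp add: lag_h_def C_def mult_ac)
  qed
  moreover have "C > 0" using Gp B(1) assms by (simp add: C_def)
  ultimately show ?thesis by blast
qed

subsection \<open>Gauss--Laguerre quadrature\<close>

lemma lagm_finite_null:
  assumes "finite A" shows "AE x in lagm b. x \<notin> A"
proof -
  have "AE x in lborel. x \<notin> A"
    using assms by (intro AE_not_in) (simp add: finite_imp_null_set_lborel)
  then show ?thesis unfolding lagm_def by (subst AE_density) auto
qed

lemma lagm_UNIV_pos: "b > -1 \<Longrightarrow> emeasure (lagm b) UNIV = ennreal (Gamma (b + 1))"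
  using nn_moment_lagm[of b 0] by simp

lemma not_AE_False_lagm:
  assumes "b > -1" "AE x in lagm b. False" shows False
proof -
  have "emeasure (lagm b) UNIV = 0"
    using assms(2) by (auto simp: AE_iff_null null_sets_def)
  then show False using lagm_UNIV_pos[OF assms(1)] Gamma_real_pos[of "b + 1"] assms by simp
qed

lemma Lam_pos:
  assumes "b > -1" "r \<noteq> 0" "\<And>x. x > 0 \<Longrightarrow> poly r x \<ge> 0"
  shows "Lam b r > 0"
proof -
  have nn: "AE x in lagm b. 0 \<le> poly r x"
    using AE_lagm_pos[of b] by eventually_elim (use assms in auto)
  have "Lam b r \<ge> 0" unfolding Lam_def by (rule integral_nonneg_AE) (rule nn)
  moreover have "Lam b r \<noteq> 0"
  proof
    assume "Lam b r = 0"
    then have "AE x in lagm b. poly r x = 0"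
      unfolding Lam_def using integral_nonneg_eq_0_iff_AE[OF integrable_poly_lagm[OF assms(1)] nn] by simp
    moreover have "AE x in lagm b. x \<notin> {x. poly r x = 0}"
      using assms(2) by (intro lagm_finite_null poly_roots_finite)
    ultimately have "AE x in lagm b. False" by eventually_elim auto
    then show False by (rule not_AE_False_lagm[OF assms(1)])
  qed
  ultimately show ?thesis by simp
qed

text \<open>\<open>S\<close> collects the positive roots of odd multiplicity, the places where
  \<open>p\<close> changes sign. In the induction over the degree, dividing out a root
  \<open>a\<close> toggles its membership in \<open>S\<close>.\<close>

lemma sign_fixing_roots:
  fixes p :: "real poly"
  assumes "p \<noteq> 0"
  shows "\<exists>S. finite S \<and> S \<subseteq> {x. x > 0 \<and> poly p x = 0} \<and>
    ((\<forall>x>0. 0 \<le> (\<Prod>s\<in>S. x - s) * poly p x) \<or> (\<forall>x>0. (\<Prod>s\<in>S. x - s) * poly p x \<le> 0))"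
  using assms
proof (induction "degree p" arbitrary: p rule: less_induct)
  case less
  show ?case
  proof (cases "\<exists>a>0. poly p a = 0")
    case False
    have "(\<forall>x>0. 0 \<le> poly p x) \<or> (\<forall>x>0. poly p x \<le> 0)"
    proof (rule ccontr)
      assume "\<not> ?thesis"
      then obtain x y where xy: "x > 0" "poly p x < 0" "y > 0" "poly p y > 0" by force
      then have "x \<noteq> y" by auto
      then have "\<exists>c. min x y < c \<and> c < max x y \<and> poly p c = 0"
        using poly_IVT_pos[of x y p] poly_IVT_neg[of y x p] xy by (cases "x < y") (auto simp: min_def max_def)
      then show False using False xy by (metis less_trans min_less_iff_conj)
    qed
    then show ?thesis by (intro exI[of _ "{}"]) auto
  next
    case True
    then obtain a where a: "a > 0" "poly p a = 0" by blast
    then obtain q where q: "p = [:-a, 1:] * q" by (metis poly_eq_0_iff_dvd dvdE)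
    have "q \<noteq> 0" using q less.prems by auto
    then have "degree q < degree p" unfolding q by (subst degree_mult_eq) auto
    from less.hyps[OF this \<open>q \<noteq> 0\<close>] obtain S where S: "finite S" "S \<subseteq> {x. x > 0 \<and> poly q x = 0}"
      "(\<forall>x>0. 0 \<le> (\<Prod>s\<in>S. x - s) * poly q x) \<or> (\<forall>x>0. (\<Prod>s\<in>S. x - s) * poly q x \<le> 0)" by blast
    show ?thesis
    proof (cases "a \<in> S")
      case True
      have "(\<Prod>s\<in>S - {a}. x - s) * poly p x = (\<Prod>s\<in>S. x - s) * poly q x" for x
        using S(1) True by (subst prod.remove[of S a]) (auto simp: q algebra_simps)
      then show ?thesis using S by (intro exI[of _ "S - {a}"]) (auto simp: q)
    next
      case False
      have "(\<Prod>s\<in>insert a S. x - s) * poly p x = (x - a) ^ 2 * ((\<Prod>s\<in>S. x - s) * poly q x)" for x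
        using S(1) False by (simp add: q power2_eq_square algebra_simps)
      moreover have "insert a S \<subseteq> {x. x > 0 \<and> poly p x = 0}" using S(2) a by (auto simp: q)
      moreover have "finite (insert a S)" using S(1) by simp
      moreover from S(3) have "(\<forall>x>0. 0 \<le> (x - a) ^ 2 * ((\<Prod>s\<in>S. x - s) * poly q x)) \<or>
          (\<forall>x>0. (x - a) ^ 2 * ((\<Prod>s\<in>S. x - s) * poly q x) \<le> 0)"
        by (meson mult_nonneg_nonneg mult_nonneg_nonpos zero_le_power2)
      ultimately show ?thesis by (intro exI[of _ "insert a S"]) metis
    qed
  qed
qed

definition Zs :: "real \<Rightarrow> nat \<Rightarrow> real set" where
  "Zs b m = {x. poly (lag b m) x = 0}"

lemma lag_nz: "lag b m \<noteq> 0"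
  using lag_0[of b m] by auto

lemma finite_Zs [simp, intro]: "finite (Zs b m)"
  unfolding Zs_def by (intro poly_roots_finite lag_nz)

lemma degree_prod_linear:
  fixes c :: "real \<Rightarrow> real"
  assumes "finite S" "\<And>s. s \<in> S \<Longrightarrow> c s \<noteq> 0"
  shows "degree (\<Prod>s\<in>S. smult (c s) [:- s, 1:]) = card S"
  using assms by (subst degree_prod_eq_sum_degree) auto

text \<open>With fewer than \<open>m\<close> sign changes on the positive axis, the product of the
  corresponding linear factors would be orthogonal to \<open>lag b m\<close>, although its product
  with \<open>lag b m\<close> has constant sign. So there are \<open>m\<close> of them, and they
  exhaust the roots.\<close>

lemma Zs_props:
  assumes "b > -1"
  shows "card (Zs b m) = m" "Zs b m \<subseteq> {0<..}"
proof -
  obtain S where S: "finite S" "S \<subseteq> {x. x > 0 \<and> poly (lag b m) x = 0}"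
      "(\<forall>x>0. 0 \<le> (\<Prod>s\<in>S. x - s) * poly (lag b m) x) \<or> (\<forall>x>0. (\<Prod>s\<in>S. x - s) * poly (lag b m) x \<le> 0)"
    using sign_fixing_roots[OF lag_nz] by metis
  define q where "q = (\<Prod>s\<in>S. smult 1 [:- s, 1::real:])"
  have dq: "degree q = card S" unfolding q_def using S(1) by (intro degree_prod_linear) auto
  have pq: "poly q x = (\<Prod>s\<in>S. x - s)" for x unfolding q_def by (simp add: poly_prod)
  have "q \<noteq> 0" unfolding q_def using S(1) by auto
  have "\<not> card S < m"
  proof
    assume "card S < m"
    then have 0: "Lam b (lag b m * q) = 0" using Lam_lag_orth[OF assms] dq by simp
    have "lag b m * q \<noteq> 0" using lag_nz \<open>q \<noteq> 0\<close> by simp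
    from S(3) show False
    proof
      assume "\<forall>x>0. 0 \<le> (\<Prod>s\<in>S. x - s) * poly (lag b m) x"
      then have "Lam b (lag b m * q) > 0"
        using \<open>lag b m * q \<noteq> 0\<close> by (intro Lam_pos[OF assms]) (auto simp: pq mult.commute)
      then show False using 0 by simp
    next
      assume "\<forall>x>0. (\<Prod>s\<in>S. x - s) * poly (lag b m) x \<le> 0"
      then have "Lam b (smult (-1) (lag b m * q)) > 0"
        using \<open>lag b m * q \<noteq> 0\<close> by (intro Lam_pos[OF assms]) (auto simp: pq mult.commute)
      then show False using 0 by (simp only: Lam_smult[OF assms])
    qed
  qed
  moreover have "card (Zs b m) \<le> m"
    using card_poly_roots_bound[OF lag_nz, of b m] degree_lag[OF assms] unfolding Zs_def by simp
  moreover have SZ: "S \<subseteq> Zs b m" using S(2) by (auto simp: Zs_def)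
  ultimately have "S = Zs b m" "card S = m"
    using card_mono[OF finite_Zs SZ] card_seteq[OF finite_Zs SZ] by auto
  then show "card (Zs b m) = m" "Zs b m \<subseteq> {0<..}" using S(2) by auto
qed

section \<open>Lagrange basis, exactness of the Gauss rule, Cotes numbers\<close>

definition lbas :: "real \<Rightarrow> nat \<Rightarrow> real \<Rightarrow> real poly" where
  "lbas b m z = (\<Prod>y\<in>Zs b m - {z}. smult (1 / (z - y)) [:- y, 1:])"

text \<open>The Cotes number is indexed by the node itself rather than by its position, so that sums
  run over subsets of \<open>Zs b m\<close>; \<open>cotes_eq\<close> translates.\<close>

definition lamz :: "real \<Rightarrow> nat \<Rightarrow> real \<Rightarrow> real" where
  "lamz b m z = Lam b (lbas b m z)"

lemma poly_lbas:
  assumes "z \<in> Zs b m" "u \<in> Zs b m"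
  shows "poly (lbas b m z) u = (if u = z then 1 else 0)"
proof (cases "u = z")
  case True
  then show ?thesis unfolding lbas_def poly_prod
    by (auto intro!: prod.neutral simp flip: diff_divide_distrib)
next
  case False
  then show ?thesis using assms unfolding lbas_def poly_prod by (auto intro!: prod_zero)
qed

lemma degree_lbas:
  assumes "b > -1" "z \<in> Zs b m"
  shows "degree (lbas b m z) = m - 1"
  unfolding lbas_def using assms Zs_props(1)[OF assms(1), of m]
  by (subst degree_prod_linear) (auto simp: card_Diff_singleton)

lemma lagrange_interp:
  assumes "b > -1" "degree q < m"
  shows "q = (\<Sum>z\<in>Zs b m. smult (poly q z) (lbas b m z))"
proof (rule poly_eqI_degree[of "Zs b m"])
  show "poly q x = poly (\<Sum>z\<in>Zs b m. smult (poly q z) (lbas b m z)) x" if "x \<in> Zs b m" for x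
  proof -
    have "(\<Sum>z\<in>Zs b m. poly q z * poly (lbas b m z) x) = (\<Sum>z\<in>Zs b m. if x = z then poly q z else 0)"
      using that by (intro sum.cong refl) (auto simp: poly_lbas)
    then show ?thesis using that by (simp add: poly_sum)
  qed
  show "card (Zs b m) > degree q" using assms Zs_props(1)[OF assms(1)] by simp
  have "degree (\<Sum>z\<in>Zs b m. smult (poly q z) (lbas b m z)) \<le> m - 1"
    by (intro degree_sum_le order.trans[OF degree_smult_le]) (auto simp: degree_lbas[OF assms(1)])
  then show "card (Zs b m) > degree (\<Sum>z\<in>Zs b m. smult (poly q z) (lbas b m z))"
    using assms Zs_props(1)[OF assms(1)] by simp
qed

lemma gauss:
  assumes "b > -1" "degree q < 2 * m"
  shows "Lam b q = (\<Sum>z\<in>Zs b m. lamz b m z * poly q z)"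
proof -
  define s r where "s = q div lag b m" and "r = q mod lag b m"
  have q: "q = lag b m * s + r" by (simp add: s_def r_def)
  have dl: "degree (lag b m) = m" by (rule degree_lag[OF assms(1)])
  have m: "m > 0" using assms by simp
  have dr: "degree r < m"
    using degree_mod_less'[of "lag b m" q] lag_nz dl m unfolding r_def by (cases "q mod lag b m = 0") auto
  have ds: "degree s < m"
  proof (rule ccontr)
    assume "\<not> degree s < m"
    then have "s \<noteq> 0" using m by auto
    then have "degree (lag b m * s) = m + degree s" using lag_nz dl by (subst degree_mult_eq) auto
    then have "degree q = m + degree s" unfolding q using dr by (subst degree_add_eq_left) auto
    then show False using assms \<open>\<not> degree s < m\<close> by simp
  qed
  have "Lam b q = Lam b r" unfolding q using Lam_lag_orth[OF assms(1) ds] by (simp add: Lam_add[OF assms(1)])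
  also have "\<dots> = Lam b (\<Sum>z\<in>Zs b m. smult (poly r z) (lbas b m z))"
    using lagrange_interp[OF assms(1) dr] by simp
  also have "\<dots> = (\<Sum>z\<in>Zs b m. lamz b m z * poly r z)"
    by (simp add: Lam_sum[OF assms(1)] Lam_smult[OF assms(1)] lamz_def mult.commute)
  also have "\<dots> = (\<Sum>z\<in>Zs b m. lamz b m z * poly q z)"
    by (intro sum.cong refl) (auto simp: q Zs_def)
  finally show ?thesis .
qed

lemma Zs_pos: "b > -1 \<Longrightarrow> z \<in> Zs b m \<Longrightarrow> m > 0"
  using Zs_props(1)[of b m] by (metis card_0_eq empty_iff finite_Zs gr0I)

text \<open>\<open>lbas\<close> and its square agree at the nodes and the rule is exact for both, so
  the weight is the integral of a square.\<close>

lemma lamz_pos: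
  assumes "b > -1" "z \<in> Zs b m"
  shows "lamz b m z > 0"
proof -
  have "lbas b m z \<noteq> 0" using poly_lbas[OF assms(2) assms(2)] by auto
  have "degree (lbas b m z * lbas b m z) \<le> (m - 1) + (m - 1)"
    by (rule order.trans[OF degree_mult_le]) (simp add: degree_lbas[OF assms])
  then have "Lam b (lbas b m z * lbas b m z) = (\<Sum>u\<in>Zs b m. lamz b m u * poly (lbas b m z * lbas b m z) u)"
    using Zs_pos[OF assms] by (intro gauss[OF assms(1)]) auto
  also have "\<dots> = (\<Sum>u\<in>Zs b m. if u = z then lamz b m u else 0)"
    using assms by (intro sum.cong refl) (auto simp: poly_lbas)
  also have "\<dots> = lamz b m z" using assms(2) by simp
  finally have "lamz b m z = Lam b (lbas b m z * lbas b m z)" ..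
  also have "\<dots> > 0" using \<open>lbas b m z \<noteq> 0\<close> by (intro Lam_pos[OF assms(1)]) auto
  finally show ?thesis .
qed

text \<open>Gauss exactness applied to \<open>x \<cdot> lag / (x - z) \<cdot> lag'\<close>.\<close>
lemma lamz_formula:
  assumes b: "b > -1" and z: "z \<in> Zs b m"
  shows "lamz b m z * z * (poly (pderiv (lag b m)) z)\<^sup>2 = lag_h b m"
proof -
  let ?y = "lag b m"
  have m: "m > 0" by (rule Zs_pos[OF assms])
  obtain l where l: "?y = [:-z, 1:] * l" using z unfolding Zs_def by (metis mem_Collect_eq poly_eq_0_iff_dvd dvdE)
  have "l \<noteq> 0" using l lag_nz[of b m] by auto
  then have dl: "degree l = m - 1" using degree_lag[OF b, of m] unfolding l by (subst (asm) degree_mult_eq) auto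
  have dy: "poly (pderiv ?y) z = poly l z" unfolding l pderiv_mult by (simp add: pderiv_pCons)
  have l0: "poly l u = 0" if "u \<in> Zs b m" "u \<noteq> z" for u
    using that unfolding Zs_def l by simp
  have xl: "pCons 0 l = ?y + smult z l" unfolding l by simp
  have "degree (pCons 0 (l * pderiv ?y)) \<le> Suc ((m - 1) + (m - 1))"
    using degree_mult_le[of l "pderiv ?y"] dl degree_lag[OF b, of m]
    by (intro order.trans[OF degree_pCons_le]) (simp add: degree_pderiv)
  then have "Lam b (pCons 0 (l * pderiv ?y)) = (\<Sum>u\<in>Zs b m. lamz b m u * poly (pCons 0 (l * pderiv ?y)) u)"
    using m by (intro gauss[OF b]) auto
  also have "\<dots> = (\<Sum>u\<in>Zs b m. if u = z then lamz b m z * z * (poly (pderiv ?y) z)\<^sup>2 else 0)"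
    by (intro sum.cong refl) (auto simp: l0 dy power2_eq_square)
  finally have 1: "Lam b (pCons 0 (l * pderiv ?y)) = lamz b m z * z * (poly (pderiv ?y) z)\<^sup>2" using z by simp
  \<comment> \<open>\<open>Lam_by_parts\<close> is applied to \<open>l * ?y\<close>. Two of the
    resulting terms pair \<open>?y\<close> with a polynomial of degree below \<open>m\<close> and
    vanish; the survivors are the node term from \<open>1\<close> and the squared norm of
    \<open>?y\<close>.\<close>
  have "pCons 0 (pderiv (l * ?y)) = pCons 0 (l * pderiv ?y) + ?y * pCons 0 (pderiv l)"
    using add_pCons[of 0 "l * pderiv ?y" 0 "?y * pderiv l"] by (simp add: pderiv_mult)
  moreover have "pCons 0 (l * ?y) = ?y * pCons 0 l" by (simp add: mult.commute)
  ultimately have 2: "Lam b (pCons 0 (l * pderiv ?y)) + Lam b (?y * pCons 0 (pderiv l))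
      = Lam b (?y * pCons 0 l) - (b + 1) * Lam b (?y * l)"
    using Lam_by_parts[OF b, of "l * ?y"] by (simp only: Lam_add[OF b] mult.commute)
  have "degree (pCons 0 (pderiv l)) < m"
    using dl m by (cases "pderiv l = 0") (auto simp: degree_pderiv pderiv_eq_0_iff)
  then have 3: "Lam b (?y * pCons 0 (pderiv l)) = 0" by (rule Lam_lag_orth[OF b])
  have 4: "Lam b (?y * l) = 0" using dl m by (intro Lam_lag_orth[OF b]) auto
  have cy: "coeff ?y m \<noteq> 0" using poch_pos[OF b, of m] by (simp add: coeff_lag)
  have "?y * pCons 0 l = ?y * ?y + smult z (?y * l)" unfolding xl by (simp only: distrib_left mult_smult_right)
  then have "Lam b (?y * pCons 0 l) = Lam b (?y * ?y)"
    using 4 by (simp only: Lam_add[OF b] Lam_smult[OF b] mult_zero_right add_0_right)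
  also have "\<dots> = lag_h b m"
    using Lam_lag_lead[OF b, of ?y m] degree_lag[OF b, of m] cy by simp
  finally show ?thesis using 1 2 3 4 by simp
qed

subsection \<open>One-sided approximation of step functions\<close>

text \<open>Interpolating the indicator of a down-closed set \<open>I\<close> at points \<open>as\<close> inside and \<open>bs\<close> outside of \<open>I\<close>
  (repetitions allowed); \<open>\<rho>\<close> is the divided difference in the error formula, whose sign follows from
  the recursion for divided differences.\<close>
lemma step_interpolation:
  fixes as bs :: "real list" and I :: "real set"
  assumes "\<And>x y. x \<in> I \<Longrightarrow> y \<notin> I \<Longrightarrow> x < y"
    and "set as \<subseteq> I" and "set bs \<inter> I = {}"
  shows "\<exists>(H :: real poly) \<rho>. degree H \<le> length as + length bs - 1 \<and>
    (\<forall>x. indicator I x - poly H x = (\<Prod>a\<leftarrow>as. x - a) * (\<Prod>b\<leftarrow>bs. x - b) * \<rho> x) \<and>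
    (\<forall>x\<in>I. (-1) ^ length bs * \<rho> x \<ge> 0) \<and> (\<forall>x. x \<notin> I \<longrightarrow> (-1) ^ length bs * \<rho> x \<le> 0)"
  using assms(2,3)
proof (induction "length as + length bs" arbitrary: as bs rule: less_induct)
  case less
  show ?case
  proof (cases as)
    case Nil
    define \<rho> where "\<rho> = (\<lambda>x. if x \<in> I then 1 / (\<Prod>b\<leftarrow>bs. x - b) else 0)"
    have pos: "(-1) ^ length bs * (\<Prod>b\<leftarrow>bs. x - b) > 0" if "x \<in> I" for x
    proof -
      have "\<forall>b\<in>set bs. x < b" using less.prems that assms(1) by blast
      then show ?thesis by (induction bs) (auto simp: mult_less_0_iff zero_less_mult_iff)
    qed
    have "(-1) ^ length bs * \<rho> x \<ge> 0" if "x \<in> I" for x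
    proof -
      have "((-1) ^ length bs * \<rho> x) * ((\<Prod>b\<leftarrow>bs. x - b))\<^sup>2 = (-1) ^ length bs * (\<Prod>b\<leftarrow>bs. x - b)"
        using that pos[OF that] by (simp add: \<rho>_def power2_eq_square)
      then have "((-1) ^ length bs * \<rho> x) * ((\<Prod>b\<leftarrow>bs. x - b))\<^sup>2 > 0" using pos[OF that] by (simp only:)
      then show ?thesis by (metis less_eq_real_def linorder_not_le mult_nonpos_nonneg zero_le_power2)
    qed
    moreover have "indicator I x - poly 0 x = (\<Prod>b\<leftarrow>bs. x - b) * \<rho> x" for x
      using pos[of x] by (auto simp: \<rho>_def indicator_def)
    ultimately show ?thesis using Nil by (intro exI[of _ 0] exI[of _ \<rho>]) (auto simp: \<rho>_def)
  next
    case (Cons a as')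
    show ?thesis
    proof (cases bs)
      case Nil
      define \<rho> where "\<rho> = (\<lambda>x. if x \<in> I then 0 else - 1 / (\<Prod>a\<leftarrow>as. x - a))"
      have pos: "(\<Prod>a\<leftarrow>as. x - a) > 0" if "x \<notin> I" for x
      proof -
        have "\<forall>a\<in>set as. a < x" using less.prems that assms(1) by blast
        then show ?thesis by (induction as) auto
      qed
      have "indicator I x - poly 1 x = (\<Prod>a\<leftarrow>as. x - a) * \<rho> x" for x
        using pos[of x] by (cases "x \<in> I") (auto simp: \<rho>_def)
      moreover have "\<rho> x \<le> 0" if "x \<notin> I" for x using pos[OF that] that by (simp add: \<rho>_def)
      ultimately show ?thesis using Nil by (intro exI[of _ 1] exI[of _ \<rho>]) (auto simp: \<rho>_def)
    next
      case (Cons b bs')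
      note asC = \<open>as = a # as'\<close> and bsC = \<open>bs = b # bs'\<close>
      have ab: "a < b" using less.prems assms(1) asC bsC by auto
      have "\<exists>(H1 :: real poly) \<rho>1. degree H1 \<le> length as' + length bs - 1 \<and>
    (\<forall>x. indicator I x - poly H1 x = (\<Prod>a\<leftarrow>as'. x - a) * (\<Prod>b\<leftarrow>bs. x - b) * \<rho>1 x) \<and>
    (\<forall>x\<in>I. (-1) ^ length bs * \<rho>1 x \<ge> 0) \<and> (\<forall>x. x \<notin> I \<longrightarrow> (-1) ^ length bs * \<rho>1 x \<le> 0)"
        by (rule less.hyps) (use less.prems asC bsC in auto)
      then obtain H1 \<rho>1 where c1: "degree H1 \<le> length as' + length bs - 1 \<and>
    (\<forall>x. indicator I x - poly H1 x = (\<Prod>a\<leftarrow>as'. x - a) * (\<Prod>b\<leftarrow>bs. x - b) * \<rho>1 x) \<and>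
    (\<forall>x\<in>I. (-1) ^ length bs * \<rho>1 x \<ge> 0) \<and> (\<forall>x. x \<notin> I \<longrightarrow> (-1) ^ length bs * \<rho>1 x \<le> 0)" by blast
      note 1 = c1[THEN conjunct1] c1[THEN conjunct2, THEN conjunct1, rule_format]
        c1[THEN conjunct2, THEN conjunct2, THEN conjunct1, rule_format] c1[THEN conjunct2, THEN conjunct2, THEN conjunct2, rule_format]
      have "\<exists>(H2 :: real poly) \<rho>2. degree H2 \<le> length as + length bs' - 1 \<and>
    (\<forall>x. indicator I x - poly H2 x = (\<Prod>a\<leftarrow>as. x - a) * (\<Prod>b\<leftarrow>bs'. x - b) * \<rho>2 x) \<and>
    (\<forall>x\<in>I. (-1) ^ length bs' * \<rho>2 x \<ge> 0) \<and> (\<forall>x. x \<notin> I \<longrightarrow> (-1) ^ length bs' * \<rho>2 x \<le> 0)"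
        by (rule less.hyps) (use less.prems asC bsC in auto)
      then obtain H2 \<rho>2 where c2: "degree H2 \<le> length as + length bs' - 1 \<and>
    (\<forall>x. indicator I x - poly H2 x = (\<Prod>a\<leftarrow>as. x - a) * (\<Prod>b\<leftarrow>bs'. x - b) * \<rho>2 x) \<and>
    (\<forall>x\<in>I. (-1) ^ length bs' * \<rho>2 x \<ge> 0) \<and> (\<forall>x. x \<notin> I \<longrightarrow> (-1) ^ length bs' * \<rho>2 x \<le> 0)" by blast
      note 2 = c2[THEN conjunct1] c2[THEN conjunct2, THEN conjunct1, rule_format]
        c2[THEN conjunct2, THEN conjunct2, THEN conjunct1, rule_format] c2[THEN conjunct2, THEN conjunct2, THEN conjunct2, rule_format]
      \<comment> \<open>Neville's recursion: \<open>H1\<close> leaves out the node \<open>a\<close>,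
        \<open>H2\<close> leaves out \<open>b\<close>. The remainder factor becomes the divided
        difference of \<open>\<rho>1\<close> and \<open>\<rho>2\<close>; dropping \<open>b\<close>
        flips the sign \<open>(-1) ^ length bs\<close>, so this difference is a sum of two terms of
        equal sign.\<close>
      define H where "H = smult (1 / (b - a)) ([:- a, 1:] * H1 - [:- b, 1:] * H2)"
      define \<rho> where "\<rho> = (\<lambda>x. (\<rho>1 x - \<rho>2 x) / (b - a))"
      have "degree H \<le> length as + length bs - 1"
        unfolding H_def using 1(1) 2(1) asC bsC
        by (intro order.trans[OF degree_smult_le] degree_diff_le order.trans[OF degree_mult_le]) auto
      moreover have "indicator I x - poly H x = (\<Prod>a\<leftarrow>as. x - a) * (\<Prod>b\<leftarrow>bs. x - b) * \<rho> x" for x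
      proof -
        have "indicator I x - poly H x = ((x - a) * (indicator I x - poly H1 x) - (x - b) * (indicator I x - poly H2 x)) / (b - a)"
          unfolding H_def using ab by (simp add: field_simps)
        also have "\<dots> = (\<Prod>a\<leftarrow>as. x - a) * (\<Prod>b\<leftarrow>bs. x - b) * \<rho> x"
          unfolding 1(2) 2(2) asC bsC \<rho>_def using ab by (simp add: field_simps)
        finally show ?thesis .
      qed
      moreover have "(-1) ^ length bs * \<rho> x = ((-1) ^ length bs * \<rho>1 x + (-1) ^ length bs' * \<rho>2 x) / (b - a)" for x
        unfolding \<rho>_def bsC using ab by (simp add: field_simps)
      ultimately show ?thesis using 1(3,4) 2(3,4) ab
        by (intro exI[of _ H] exI[of _ \<rho>]) (auto intro!: divide_nonneg_pos divide_nonpos_pos add_nonneg_nonneg add_nonpos_nonpos)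
    qed
  qed
qed

lemma step_interpolationE:
  fixes as bs :: "real list" and I :: "real set"
  assumes "\<And>x y. x \<in> I \<Longrightarrow> y \<notin> I \<Longrightarrow> x < y" "set as \<subseteq> I" "set bs \<inter> I = {}"
  obtains H :: "real poly" and \<rho> where "degree H \<le> length as + length bs - 1"
    "\<And>x. indicator I x - poly H x = (\<Prod>a\<leftarrow>as. x - a) * (\<Prod>b\<leftarrow>bs. x - b) * \<rho> x"
    "\<And>x. x \<in> I \<Longrightarrow> (-1) ^ length bs * \<rho> x \<ge> 0" "\<And>x. x \<notin> I \<Longrightarrow> (-1) ^ length bs * \<rho> x \<le> 0"
proof -
  have "\<exists>(H :: real poly) \<rho>. degree H \<le> length as + length bs - 1 \<and>
    (\<forall>x. indicator I x - poly H x = (\<Prod>a\<leftarrow>as. x - a) * (\<Prod>b\<leftarrow>bs. x - b) * \<rho> x) \<and>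
    (\<forall>x\<in>I. (-1) ^ length bs * \<rho> x \<ge> 0) \<and> (\<forall>x. x \<notin> I \<longrightarrow> (-1) ^ length bs * \<rho> x \<le> 0)"
    by (rule step_interpolation) (fact assms)+
  then show ?thesis by (elim exE conjE) (rule that; blast)
qed

section \<open>One-sided polynomials at the Gauss nodes and Markov-Stieltjes inequalities\<close>

definition nodes_below :: "real \<Rightarrow> nat \<Rightarrow> real \<Rightarrow> real list" where
  "nodes_below b m z = sorted_list_of_set {u \<in> Zs b m. u < z}"

definition nodes_above :: "real \<Rightarrow> nat \<Rightarrow> real \<Rightarrow> real list" where
  "nodes_above b m z = sorted_list_of_set {u \<in> Zs b m. u > z}"

lemma prod_list_square: "(\<Prod>a\<leftarrow>L @ L. x - a) = (\<Prod>a\<leftarrow>L. x - a :: real)\<^sup>2"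
  by (simp add: power2_eq_square)

lemma length_nodes:
  assumes "b > -1" "z \<in> Zs b m"
  shows "length (nodes_below b m z) + length (nodes_above b m z) + 1 = m"
proof -
  have "card ({u \<in> Zs b m. u < z} \<union> {u \<in> Zs b m. u > z}) = card {u \<in> Zs b m. u < z} + card {u \<in> Zs b m. u > z}"
    by (intro card_Un_disjoint) auto
  moreover have "{u \<in> Zs b m. u < z} \<union> {u \<in> Zs b m. u > z} = Zs b m - {z}" by auto
  moreover have "card (Zs b m) = Suc (card (Zs b m - {z}))" using assms(2) by (intro card.remove) auto
  ultimately have "card (Zs b m) = card {u \<in> Zs b m. u < z} + card {u \<in> Zs b m. u > z} + 1" by simp
  then show ?thesis using Zs_props(1)[OF assms(1), of m]
    by (simp add: nodes_below_def nodes_above_def)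
qed

text \<open>With every node but \<open>z\<close> doubled, the remainder consists of squares times
  \<open>(x - z) * \<rho> x\<close>, whose two factors change sign together at \<open>z\<close>.
  Counting \<open>z\<close> inside the half-line gives a majorant, outside (as in
  \<open>one_sided_below\<close>) a minorant. There are \<open>2m - 1\<close> interpolation
  conditions, hence degree at most \<open>2m - 2\<close>, within reach of the Gauss rule.\<close>

lemma one_sided_above:
  assumes "b > -1" "z \<in> Zs b m"
  shows "\<exists>P :: real poly. degree P < 2 * m \<and> (\<forall>x. indicator {..z} x \<le> poly P x) \<and>
    (\<forall>u\<in>Zs b m. poly P u = indicator {..z} u)"
proof -
  let ?A = "nodes_below b m z" and ?B = "nodes_above b m z"
  have sets: "set ?A = {u \<in> Zs b m. u < z}" "set ?B = {u \<in> Zs b m. u > z}"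
    by (auto simp: nodes_below_def nodes_above_def)
  obtain H \<rho> where H: "degree H \<le> length (z # ?A @ ?A) + length (?B @ ?B) - 1"
     "\<And>x. indicator {..z} x - poly H x = (\<Prod>a\<leftarrow>z # ?A @ ?A. x - a) * (\<Prod>b\<leftarrow>?B @ ?B. x - b) * \<rho> x"
     "\<And>x. x \<le> z \<Longrightarrow> (-1) ^ length (?B @ ?B) * \<rho> x \<ge> 0"
     "\<And>x. x > z \<Longrightarrow> (-1) ^ length (?B @ ?B) * \<rho> x \<le> 0"
    by (rule step_interpolationE[of "{..z}" "z # ?A @ ?A" "?B @ ?B"]) (use sets in \<open>auto simp: not_less not_le\<close>)
  have even: "(-1) ^ length (?B @ ?B) = (1::real)" by (simp add: power_add)
  have e: "indicator {..z} x - poly H x = (x - z) * \<rho> x * ((\<Prod>a\<leftarrow>?A. x - a)\<^sup>2 * (\<Prod>b\<leftarrow>?B. x - b)\<^sup>2)" for x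
    unfolding H(2) by (simp only: list.map prod_list.Cons prod_list_square mult_ac)
  have "indicator {..z} x \<le> poly H x" for x
  proof -
    have "(x - z) * \<rho> x \<le> 0" using H(3,4)[of x] unfolding even
      by (cases "x \<le> z") (auto intro: mult_nonpos_nonneg mult_nonneg_nonpos)
    then have "(x - z) * \<rho> x * ((\<Prod>a\<leftarrow>?A. x - a)\<^sup>2 * (\<Prod>b\<leftarrow>?B. x - b)\<^sup>2) \<le> 0"
      by (rule mult_nonpos_nonneg) auto
    then show ?thesis using e[of x] by simp
  qed
  moreover have "poly H u = indicator {..z} u" if "u \<in> Zs b m" for u
  proof -
    have "(u - z) * ((\<Prod>a\<leftarrow>?A. u - a)\<^sup>2 * (\<Prod>b\<leftarrow>?B. u - b)\<^sup>2) = 0"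
      using that sets by (cases u z rule: linorder_cases) (auto simp: prod_list_zero_iff image_iff)
    then show ?thesis using e[of u] by auto
  qed
  moreover have "degree H < 2 * m" using H(1) length_nodes[OF assms] by simp
  ultimately show ?thesis by blast
qed

lemma one_sided_below:
  assumes "b > -1" "z \<in> Zs b m"
  shows "\<exists>P :: real poly. degree P < 2 * m \<and> (\<forall>x. poly P x \<le> indicator {..<z} x) \<and>
    (\<forall>u\<in>Zs b m. poly P u = indicator {..<z} u)"
proof -
  let ?A = "nodes_below b m z" and ?B = "nodes_above b m z"
  have sets: "set ?A = {u \<in> Zs b m. u < z}" "set ?B = {u \<in> Zs b m. u > z}"
    by (auto simp: nodes_below_def nodes_above_def)
  obtain H \<rho> where H: "degree H \<le> length (?A @ ?A) + length (z # ?B @ ?B) - 1"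
     "\<And>x. indicator {..<z} x - poly H x = (\<Prod>a\<leftarrow>?A @ ?A. x - a) * (\<Prod>b\<leftarrow>z # ?B @ ?B. x - b) * \<rho> x"
     "\<And>x. x < z \<Longrightarrow> (-1) ^ length (z # ?B @ ?B) * \<rho> x \<ge> 0"
     "\<And>x. \<not> x < z \<Longrightarrow> (-1) ^ length (z # ?B @ ?B) * \<rho> x \<le> 0"
    by (rule step_interpolationE[of "{..<z}" "?A @ ?A" "z # ?B @ ?B"]) (use sets in \<open>auto simp: not_less not_le\<close>)
  have odd: "(-1) ^ length (z # ?B @ ?B) = (-1::real)" by (simp add: power_add)
  have e: "indicator {..<z} x - poly H x = (x - z) * \<rho> x * ((\<Prod>a\<leftarrow>?A. x - a)\<^sup>2 * (\<Prod>b\<leftarrow>?B. x - b)\<^sup>2)" for x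
    unfolding H(2) by (simp only: list.map prod_list.Cons prod_list_square mult_ac)
  have "poly H x \<le> indicator {..<z} x" for x
  proof -
    have "(x - z) * \<rho> x \<ge> 0" using H(3,4)[of x] unfolding odd
      by (cases "x < z") (auto intro: mult_nonneg_nonneg mult_nonpos_nonpos)
    then have "(x - z) * \<rho> x * ((\<Prod>a\<leftarrow>?A. x - a)\<^sup>2 * (\<Prod>b\<leftarrow>?B. x - b)\<^sup>2) \<ge> 0"
      by (rule mult_nonneg_nonneg) auto
    then show ?thesis using e[of x] by simp
  qed
  moreover have "poly H u = indicator {..<z} u" if "u \<in> Zs b m" for u
  proof -
    have "(u - z) * ((\<Prod>a\<leftarrow>?A. u - a)\<^sup>2 * (\<Prod>b\<leftarrow>?B. u - b)\<^sup>2) = 0"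
      using that sets by (cases u z rule: linorder_cases) (auto simp: prod_list_zero_iff image_iff)
    then show ?thesis using e[of u] by auto
  qed
  moreover have "degree H < 2 * m" using H(1) length_nodes[OF assms] by simp
  ultimately show ?thesis by blast
qed

lemma sum_indicator_Zs:
  "(\<Sum>u\<in>Zs b m. lamz b m u * indicator A u) = (\<Sum>u\<in>{u\<in>Zs b m. u \<in> A}. lamz b m u)"
  unfolding sum.inter_filter[OF finite_Zs] by (intro sum.cong) (auto simp: indicator_def)

lemma integrable_indicator_lagm:
  assumes "b > -1" "A \<in> sets borel"
  shows "integrable (lagm b) (indicator A :: real \<Rightarrow> real)"
proof -
  interpret finite_measure "lagm b" by (rule finite_measure_lagm[OF assms(1)])
  show ?thesis using assms(2) by (intro integrable_real_indicator) (auto simp: less_top[symmetric])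
qed

lemma markov_stieltjes_below:
  assumes "b > -1" "z \<in> Zs b m"
  shows "(\<Sum>u\<in>{u\<in>Zs b m. u < z}. lamz b m u) \<le> measure (lagm b) {..<z}"
proof -
  obtain P where P: "degree P < 2 * m" "\<And>x. poly P x \<le> indicator {..<z} x"
     "\<And>u. u \<in> Zs b m \<Longrightarrow> poly P u = indicator {..<z} u"
    using one_sided_below[OF assms] by blast
  have "(\<Sum>u\<in>{u\<in>Zs b m. u < z}. lamz b m u) = Lam b P"
    using sum_indicator_Zs[of b m "{..<z}"] by (simp add: gauss[OF assms(1) P(1)] P(3))
  also have "\<dots> \<le> (\<integral>x. indicator {..<z} x \<partial>lagm b)" unfolding Lam_def
    by (intro integral_mono integrable_poly_lagm integrable_indicator_lagm assms P(2)) auto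
  finally show ?thesis by simp
qed

text \<open>One-sidedness turns the \<open>L\<^sub>1\<close> distance into a difference of integrals.\<close>
lemma step_poly:
  assumes "b > -1" "z \<in> Zs b m"
  shows "\<exists>P :: real poly. degree P < 2 * m \<and> Lam b P = (\<Sum>u\<in>{u\<in>Zs b m. u \<le> z}. lamz b m u) \<and>
    measure (lagm b) {..z} \<le> Lam b P \<and>
    (\<integral>\<^sup>+x. ennreal \<bar>indicator {..z} x - poly P x\<bar> \<partial>lagm b) \<le> ennreal (lamz b m z)"
proof -
  obtain P where P: "degree P < 2 * m" "\<And>x. indicator {..z} x \<le> poly P x"
     "\<And>u. u \<in> Zs b m \<Longrightarrow> poly P u = indicator {..z} u"
    using one_sided_above[OF assms] by blast
  have int: "integrable (lagm b) (poly P)" "integrable (lagm b) (indicator {..z} :: real \<Rightarrow> real)"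
    by (intro integrable_poly_lagm integrable_indicator_lagm assms; simp)+
  have L: "Lam b P = (\<Sum>u\<in>{u\<in>Zs b m. u \<le> z}. lamz b m u)"
    using sum_indicator_Zs[of b m "{..z}"] by (simp add: gauss[OF assms(1) P(1)] P(3))
  have le: "measure (lagm b) {..z} \<le> Lam b P"
  proof -
    have "(\<integral>x. indicator {..z} x \<partial>lagm b) \<le> Lam b P" unfolding Lam_def
      by (intro integral_mono int P(2))
    then show ?thesis by simp
  qed
  have "{u\<in>Zs b m. u \<le> z} = insert z {u\<in>Zs b m. u < z}" using assms(2) by auto
  then have "Lam b P = lamz b m z + (\<Sum>u\<in>{u\<in>Zs b m. u < z}. lamz b m u)" unfolding L by simp
  also have "\<dots> \<le> lamz b m z + measure (lagm b) {..<z}"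
    using markov_stieltjes_below[OF assms] by simp
  also have "measure (lagm b) {..<z} \<le> measure (lagm b) {..z}"
  proof -
    interpret finite_measure "lagm b" by (rule finite_measure_lagm[OF assms(1)])
    show ?thesis by (rule finite_measure_mono) auto
  qed
  finally have "Lam b P - measure (lagm b) {..z} \<le> lamz b m z" by simp
  moreover have "(\<integral>\<^sup>+x. ennreal \<bar>indicator {..z} x - poly P x\<bar> \<partial>lagm b) = (\<integral>\<^sup>+x. ennreal (poly P x - indicator {..z} x) \<partial>lagm b)"
    using P(2) by (intro nn_integral_cong) (metis abs_minus_commute abs_of_nonneg diff_ge_0_iff_ge)
  moreover have "\<dots> = ennreal (Lam b P - measure (lagm b) {..z})"
    using int P(2) by (subst nn_integral_eq_integral) (auto simp: Lam_def)
  ultimately show ?thesis using P(1) L le by (auto simp: ennreal_leI)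
qed

subsection \<open>Oscillation of Laguerre functions and size of the Cotes numbers\<close>

lemma lag_ode_eval:
  assumes "b > -1"
  shows "x * poly (pderiv (pderiv (lag b m))) x + (b + 1 - x) * poly (pderiv (lag b m)) x + real m * poly (lag b m) x = 0"
proof -
  have "poly (pCons 0 (pderiv (pderiv (lag b m))) + [:b + 1, -1:] * pderiv (lag b m) + smult (real m) (lag b m)) x = 0"
    by (subst lag_ode[OF assms]) simp
  then show ?thesis by (simp add: algebra_simps)
qed

text \<open>The substitution \<open>x = t\<^sup>2\<close> brings the Laguerre equation to the normal form
  \<open>v'' + (4m + 2b + 2 - t\<^sup>2 + (1/4 - b\<^sup>2)/t\<^sup>2) v = 0\<close>.\<close>
definition lv :: "real \<Rightarrow> nat \<Rightarrow> real \<Rightarrow> real" where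
  "lv b m t = t powr (b + 1/2) * exp (- t\<^sup>2 / 2) * poly (lag b m) (t\<^sup>2)"

definition ldv :: "real \<Rightarrow> nat \<Rightarrow> real \<Rightarrow> real" where
  "ldv b m t = t powr (b + 1/2) * exp (- t\<^sup>2 / 2) *
     (((b + 1/2) / t - t) * poly (lag b m) (t\<^sup>2) + 2 * t * poly (pderiv (lag b m)) (t\<^sup>2))"

lemma lv_deriv:
  assumes "t > 0"
  shows "(lv b m has_real_derivative ldv b m t) (at t)"
proof -
  define a where "a = b + 1/2"
  have pw: "t powr (a - 1) = t powr a / t" using assms by (simp add: powr_diff)
  have 1: "((\<lambda>t. t powr a) has_real_derivative t powr a * a / t) (at t)"
    using assms by (auto intro!: derivative_eq_intros simp: pw)
  have 2: "((\<lambda>t. exp (- t\<^sup>2 / 2)) has_real_derivative - t * exp (- t\<^sup>2 / 2)) (at t)"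
    by (auto intro!: derivative_eq_intros simp: power2_eq_square)
  have 3: "((\<lambda>t. poly p (t\<^sup>2)) has_real_derivative 2 * t * poly (pderiv p) (t\<^sup>2)) (at t)" for p :: "real poly"
    by (rule derivative_eq_intros DERIV_chain2[OF poly_DERIV] refl | simp)+
  show ?thesis
    unfolding lv_def[abs_def] ldv_def a_def[symmetric]
    by (rule DERIV_cong[OF DERIV_mult[OF DERIV_mult[OF 1 2] 3]])
       (use assms in \<open>simp add: field_simps\<close>)
qed

lemma ldv_deriv:
  assumes "b > -1" "t > 0"
  shows "(ldv b m has_real_derivative - (4 * real m + 2 * b + 2 - t\<^sup>2 + (1/4 - b\<^sup>2) / t\<^sup>2) * lv b m t) (at t)"
proof -
  define a where "a = b + 1/2"
  have pw: "t powr (a - 1) = t powr a / t" using assms by (simp add: powr_diff)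
  have 1: "((\<lambda>t. t powr a) has_real_derivative t powr a * a / t) (at t)"
    using assms by (auto intro!: derivative_eq_intros simp: pw)
  have 2: "((\<lambda>t. exp (- t\<^sup>2 / 2)) has_real_derivative - t * exp (- t\<^sup>2 / 2)) (at t)"
    by (auto intro!: derivative_eq_intros simp: power2_eq_square)
  have 3: "((\<lambda>t. poly p (t\<^sup>2)) has_real_derivative 2 * t * poly (pderiv p) (t\<^sup>2)) (at t)" for p :: "real poly"
    by (rule derivative_eq_intros DERIV_chain2[OF poly_DERIV] refl | simp)+
  have 4: "((\<lambda>t. a / t - t) has_real_derivative - a / t\<^sup>2 - 1) (at t)"
    using assms by (auto intro!: derivative_eq_intros simp: power2_eq_square)
  have 5: "((\<lambda>t. 2 * t) has_real_derivative 2) (at t)" by (auto intro!: derivative_eq_intros)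
  define W Y Y1 Y2 where "W = t powr a * exp (- t\<^sup>2 / 2)" and "Y = poly (lag b m) (t\<^sup>2)"
    and "Y1 = poly (pderiv (lag b m)) (t\<^sup>2)" and "Y2 = poly (pderiv (pderiv (lag b m))) (t\<^sup>2)"
  have ode: "t\<^sup>2 * Y2 = - (a + 1/2 - t\<^sup>2) * Y1 - real m * Y"
  proof -
    have "a + 1/2 = b + 1" by (simp add: a_def)
    then have "t\<^sup>2 * Y2 + (a + 1/2 - t\<^sup>2) * Y1 + real m * Y = 0"
      using lag_ode_eval[OF assms(1), of "t\<^sup>2" m] by (simp only: Y_def Y1_def Y2_def)
    then show ?thesis by algebra
  qed
  have q: "a / t * t = a" "a / t\<^sup>2 * t\<^sup>2 = a" using assms by auto
  have d: "(ldv b m has_real_derivative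
      ((t powr a * a / t) * exp (- t\<^sup>2 / 2) + (- t * exp (- t\<^sup>2 / 2)) * t powr a) * ((a / t - t) * Y + 2 * t * Y1)
      + ((- a / t\<^sup>2 - 1) * Y + (2 * t * Y1) * (a / t - t) + (2 * Y1 + (2 * t * Y2) * (2 * t))) * W) (at t)"
    unfolding ldv_def[abs_def] a_def[symmetric] Y_def Y1_def Y2_def W_def
    by (intro DERIV_mult DERIV_add 1 2 3 4 5)
  have e1: "((t powr a * a / t) * exp (- t\<^sup>2 / 2) + (- t * exp (- t\<^sup>2 / 2)) * t powr a) = W * (a / t - t)"
    by (simp add: W_def algebra_simps)
  have e2: "W * (a / t - t) * ((a / t - t) * Y + 2 * t * Y1)
      + ((- a / t\<^sup>2 - 1) * Y + (2 * t * Y1) * (a / t - t) + (2 * Y1 + (2 * t * Y2) * (2 * t))) * W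
      = W * (((a / t - t)\<^sup>2 - a / t\<^sup>2 - 1) * Y + 4 * (a / t * t - t\<^sup>2) * Y1 + 2 * Y1 + 4 * (t\<^sup>2 * Y2))"
    by (simp add: power2_eq_square algebra_simps)
  have e3: "W * (((a / t - t)\<^sup>2 - a / t\<^sup>2 - 1) * Y + 4 * (a / t * t - t\<^sup>2) * Y1 + 2 * Y1 + 4 * (t\<^sup>2 * Y2)) = W * (((a / t - t)\<^sup>2 - a / t\<^sup>2 - 1) * Y - 4 * real m * Y)"
    unfolding ode q by (simp add: algebra_simps)
  have e4: "(a / t - t)\<^sup>2 - a / t\<^sup>2 - 1 = - (2 * b + 2 - t\<^sup>2 + (1/4 - b\<^sup>2) / t\<^sup>2)"
    using assms unfolding a_def by (simp add: field_simps power2_eq_square)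
  have e5: "W * (- (2 * b + 2 - t\<^sup>2 + (1/4 - b\<^sup>2) / t\<^sup>2) * Y - 4 * real m * Y)
     = - (4 * real m + 2 * b + 2 - t\<^sup>2 + (1/4 - b\<^sup>2) / t\<^sup>2) * lv b m t"
    unfolding lv_def W_def Y_def a_def by (simp add: algebra_simps)
  show ?thesis by (rule DERIV_cong[OF d]) (unfold e1, unfold e2, unfold e3, unfold e4, unfold e5, rule refl)
qed

section \<open>Energy estimate, Sturm comparison and the Cotes numbers\<close>

text \<open>The term \<open>k / t^2\<close> is kept out of the energy \<open>E\<close> and treated
  as a perturbation. One has \<open>E' = - 2 k v v' / t^2 - 2 t v^2\<close>, and since
  \<open>E >= v'^2 + \<mu> v^2\<close>, this is at least
  \<open>- (|k| / (t^2 sqrt \<mu>) + 2 t / \<mu>) E\<close>. \<open>G\<close> is an antiderivative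
  of this rate, so \<open>E exp G\<close> is nondecreasing.\<close>

lemma energy_lower_bound:
  fixes v dv :: "real \<Rightarrow> real"
  assumes v: "\<And>t. t > 0 \<Longrightarrow> (v has_real_derivative dv t) (at t)"
    and dv: "\<And>t. t > 0 \<Longrightarrow> (dv has_real_derivative - (A - t\<^sup>2 + k / t\<^sup>2) * v t) (at t)"
    and t: "0 < t1" "t1 \<le> t2" and mu: "\<mu> > 0" "\<mu> \<le> A - t2\<^sup>2"
  shows "((dv t1)\<^sup>2 + (A - t1\<^sup>2) * (v t1)\<^sup>2) * exp (- (t2\<^sup>2 / \<mu> + \<bar>k\<bar> / (t1 * sqrt \<mu>)))
     \<le> (dv t2)\<^sup>2 + (A - t2\<^sup>2) * (v t2)\<^sup>2"
proof -
  define E where "E t = (dv t)\<^sup>2 + (A - t\<^sup>2) * (v t)\<^sup>2" for t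
  define G where "G t = t\<^sup>2 / \<mu> - \<bar>k\<bar> / sqrt \<mu> / t" for t
  have Em: "(dv t)\<^sup>2 + \<mu> * (v t)\<^sup>2 \<le> E t" if "t1 \<le> t" "t \<le> t2" for t
  proof -
    have "t\<^sup>2 \<le> t2\<^sup>2" using that t by (intro power_mono) auto
    then show ?thesis using mu unfolding E_def by (intro add_left_mono mult_right_mono) auto
  qed
  have E0: "E t \<ge> 0" if "t1 \<le> t" "t \<le> t2" for t
    by (rule order.trans[OF _ Em[OF that]]) (use mu in auto)
  have "E t1 * exp (G t1) \<le> E t2 * exp (G t2)"
  proof (rule DERIV_nonneg_imp_nondecreasing[OF t(2)])
    fix t assume tt: "t1 \<le> t" "t \<le> t2"
    then have tp: "t > 0" using t by simp
    let ?D = "(- 2 * k * v t * dv t / t\<^sup>2 - 2 * t * (v t)\<^sup>2) * exp (G t) + (2 * t / \<mu> + \<bar>k\<bar> / sqrt \<mu> / t\<^sup>2) * exp (G t) * E t"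
    have dE: "(E has_real_derivative (- 2 * k * v t * dv t / t\<^sup>2 - 2 * t * (v t)\<^sup>2)) (at t)"
      unfolding E_def[abs_def]
      by (auto intro!: derivative_eq_intros v[OF tp] dv[OF tp]) (use tp in \<open>simp add: field_simps power2_eq_square\<close>)
    have dG: "(G has_real_derivative (2 * t / \<mu> + \<bar>k\<bar> / sqrt \<mu> / t\<^sup>2)) (at t)"
      unfolding G_def[abs_def]
      by (auto intro!: derivative_eq_intros) (use tp mu in \<open>simp_all add: field_simps power2_eq_square\<close>)
    have "((\<lambda>t. E t * exp (G t)) has_real_derivative ?D) (at t)"
      by (rule DERIV_cong[OF DERIV_mult[OF dE DERIV_chain2[OF DERIV_exp dG]]]) (simp add: mult_ac)
    moreover have "?D \<ge> 0"
    proof -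
      have s: "sqrt \<mu> > 0" "sqrt \<mu> * sqrt \<mu> = \<mu>" using mu by auto
      have "0 \<le> (\<bar>dv t\<bar> - sqrt \<mu> * \<bar>v t\<bar>)\<^sup>2" by simp
      then have "2 * sqrt \<mu> * (\<bar>v t\<bar> * \<bar>dv t\<bar>) \<le> (dv t)\<^sup>2 + \<mu> * (v t)\<^sup>2"
        using s(2) by (simp add: power2_diff power_mult_distrib algebra_simps)
      then have "2 * (\<bar>v t\<bar> * \<bar>dv t\<bar>) \<le> E t / sqrt \<mu>"
        using Em[OF tt] s by (simp add: field_simps)
      then have "\<bar>k\<bar> / t\<^sup>2 * (2 * (\<bar>v t\<bar> * \<bar>dv t\<bar>)) \<le> \<bar>k\<bar> / t\<^sup>2 * (E t / sqrt \<mu>)"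
        by (intro mult_left_mono) auto
      moreover have "2 * k * v t * dv t / t\<^sup>2 \<le> \<bar>k\<bar> / t\<^sup>2 * (2 * (\<bar>v t\<bar> * \<bar>dv t\<bar>))"
      proof -
        have "2 * k * v t * dv t / t\<^sup>2 \<le> \<bar>2 * k * v t * dv t / t\<^sup>2\<bar>" by (rule abs_ge_self)
        then show ?thesis by (simp add: abs_mult mult_ac)
      qed
      moreover have "\<mu> * (v t)\<^sup>2 \<le> E t" using Em[OF tt] zero_le_power2[of "dv t"] by linarith
      then have "(v t)\<^sup>2 \<le> E t / \<mu>" using mu by (simp add: field_simps)
      then have "2 * t * (v t)\<^sup>2 \<le> 2 * t * (E t / \<mu>)" using tp by (intro mult_left_mono) auto
      ultimately have "0 \<le> (- 2 * k * v t * dv t / t\<^sup>2 - 2 * t * (v t)\<^sup>2) + (2 * t / \<mu> + \<bar>k\<bar> / sqrt \<mu> / t\<^sup>2) * E t"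
        by (simp add: algebra_simps)
      then have "0 \<le> ((- 2 * k * v t * dv t / t\<^sup>2 - 2 * t * (v t)\<^sup>2) + (2 * t / \<mu> + \<bar>k\<bar> / sqrt \<mu> / t\<^sup>2) * E t) * exp (G t)"
        by (intro mult_nonneg_nonneg) auto
      then show ?thesis by (simp add: algebra_simps)
    qed
    ultimately show "\<exists>y. ((\<lambda>t. E t * exp (G t)) has_real_derivative y) (at t) \<and> 0 \<le> y" by blast
  qed
  then have "E t1 * exp (G t1 - G t2) \<le> E t2"
    by (simp add: exp_diff field_simps)
  moreover have "E t1 * exp (- (t2\<^sup>2 / \<mu> + \<bar>k\<bar> / (t1 * sqrt \<mu>))) \<le> E t1 * exp (G t1 - G t2)"
  proof -
    have "- (t2\<^sup>2 / \<mu> + \<bar>k\<bar> / (t1 * sqrt \<mu>)) \<le> G t1 - G t2"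
    proof -
      have "\<bar>k\<bar> / (t1 * sqrt \<mu>) = \<bar>k\<bar> / sqrt \<mu> / t1" by simp
      moreover have "t1\<^sup>2 / \<mu> \<ge> 0" "\<bar>k\<bar> / sqrt \<mu> / t2 \<ge> 0" using t mu by auto
      ultimately show ?thesis unfolding G_def by linarith
    qed
    then show ?thesis using E0[of t1] t by (intro mult_left_mono) auto
  qed
  ultimately show ?thesis unfolding E_def by linarith
qed

text \<open>Comparison with \<open>sin (k * (t - a))\<close>, which is nonnegative on the interval.
  If \<open>v\<close> kept the sign of \<open>s\<close>, the Wronskian \<open>\<phi>\<close> would
  be nonincreasing, yet it is negative at the left end and positive at the right end.\<close>

lemma sturm_zero:
  fixes v dv :: "real \<Rightarrow> real"
  assumes v: "\<And>t. t > 0 \<Longrightarrow> (v has_real_derivative dv t) (at t)"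
    and dv: "\<And>t. t > 0 \<Longrightarrow> (dv has_real_derivative - S t * v t) (at t)"
    and a: "a > 0" and k: "k > 0" and S: "\<And>t. a \<le> t \<Longrightarrow> t \<le> a + pi / k \<Longrightarrow> k\<^sup>2 \<le> S t"
  shows "\<exists>t. a \<le> t \<and> t \<le> a + pi / k \<and> v t = 0"
proof (rule ccontr)
  assume neg: "\<not> ?thesis"
  define c where "c = a + pi / k"
  have ac: "a < c" using k by (simp add: c_def)
  have cont: "continuous_on {a..c} v"
    by (intro continuous_at_imp_continuous_on ballI) (rule DERIV_isCont, rule v, use a in auto)
  have main: False if pos: "\<And>t. a \<le> t \<Longrightarrow> t \<le> c \<Longrightarrow> s * v t > 0" for s
  proof -
    define \<phi> where "\<phi> t = s * (dv t * sin (k * (t - a)) - v t * (k * cos (k * (t - a))))" for t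
    have "\<phi> c \<le> \<phi> a"
    proof (rule DERIV_nonpos_imp_nonincreasing[OF less_imp_le[OF ac]])
      fix t assume t: "a \<le> t" "t \<le> c"
      then have tp: "t > 0" using a by simp
      have "(\<phi> has_real_derivative (k\<^sup>2 - S t) * (s * v t) * sin (k * (t - a))) (at t)"
        unfolding \<phi>_def[abs_def]
        by (auto intro!: derivative_eq_intros v[OF tp] dv[OF tp]) (simp add: algebra_simps power2_eq_square)
      moreover have "sin (k * (t - a)) \<ge> 0"
        using t k by (intro sin_ge_zero) (auto simp: c_def field_simps)
      then have "(k\<^sup>2 - S t) * (s * v t) * sin (k * (t - a)) \<le> 0"
        using S[of t] t pos[of t] by (intro mult_nonpos_nonneg mult_nonpos_nonneg) (auto simp: c_def)
      ultimately show "\<exists>y. (\<phi> has_real_derivative y) (at t) \<and> y \<le> 0" by blast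
    qed
    moreover have "\<phi> a = - k * (s * v a)" by (simp add: \<phi>_def)
    moreover have "\<phi> c = k * (s * v c)" using k by (simp add: \<phi>_def c_def)
    ultimately show False using pos[of a] pos[of c] ac k
      by (smt (verit, best) mult_minus_left mult_pos_pos)
  qed
  have nz: "v t \<noteq> 0" if "a \<le> t" "t \<le> c" for t using neg that unfolding c_def by blast
  have sgn: "v a * v t > 0" if "a \<le> t" "t \<le> c" for t
  proof (rule ccontr)
    assume "\<not> ?thesis"
    then have "v a * v t < 0" using nz[OF that] nz[of a] ac by (simp add: mult_less_0_iff zero_less_mult_iff; linarith)
    moreover have ct: "continuous_on {a..t} v" using cont that by (auto intro: continuous_on_subset)
    ultimately have "\<exists>x\<ge>a. x \<le> t \<and> v x = 0"
      using IVT'[of v a 0 t] IVT2'[of v t 0 a] that by (auto simp: mult_less_0_iff)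
    then show False using nz that by fastforce
  qed
  then show False by (rule main)
qed

text \<open>After the constant term 1, the terms are dominated by a geometric series of ratio 1/4
  with sum at most 1/3.\<close>

lemma lag_ge_half:
  assumes b: "b > -1" and x: "0 \<le> x" "real m * x \<le> min (b + 1) 1 / 4"
  shows "poly (lag b m) x \<ge> 1/2"
proof -
  define a where "a = min (b + 1) 1"
  define u where "u = real m * x"
  have a: "a > 0" "a \<le> 1" using b by (auto simp: a_def)
  have u: "0 \<le> u" "u \<le> a / 4" using x by (auto simp: u_def a_def)
  have pb: "pochhammer (b + 1) (Suc i) \<ge> a" for i
  proof -
    have "pochhammer (b + 1 + 1) i \<ge> 1" unfolding pochhammer_prod using b by (intro prod_ge_1) auto
    then have "(b + 1) * 1 \<le> (b + 1) * pochhammer (b + 1 + 1) i" using b by (intro mult_left_mono) auto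
    then show ?thesis by (simp add: pochhammer_rec a_def)
  qed
  have tm: "\<bar>coeff (lag b m) (Suc i) * x ^ Suc i\<bar> \<le> u / a * (1/4) ^ i" if "i < m" for i
  proof -
    have "real (m choose Suc i) \<le> real (m ^ Suc i)"
      using that binomial_le_pow[of "Suc i" m] by (subst of_nat_le_iff) auto
    then have "\<bar>coeff (lag b m) (Suc i) * x ^ Suc i\<bar> \<le> real m ^ Suc i * x ^ Suc i / a"
      using pb[of i] a x(1) unfolding coeff_lag by (auto simp: abs_mult intro!: frac_le mult_mono simp del: power_Suc pochhammer_Suc)
    also have "\<dots> = u * u ^ i / a" unfolding u_def by (simp add: power_mult_distrib)
    also have "\<dots> \<le> u * (1/4) ^ i / a" using u a by (intro divide_right_mono mult_left_mono power_mono) auto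
    finally show ?thesis by (simp add: mult_ac)
  qed
  have "poly (lag b m) x = (\<Sum>i\<le>m. coeff (lag b m) i * x ^ i)" by (simp add: poly_altdef degree_lag[OF b])
  also have "\<dots> = 1 + (\<Sum>i<m. coeff (lag b m) (Suc i) * x ^ Suc i)"
    unfolding lessThan_Suc_atMost[symmetric] by (subst sum.lessThan_Suc_shift) (simp add: coeff_lag)
  finally have e: "poly (lag b m) x = 1 + (\<Sum>i<m. coeff (lag b m) (Suc i) * x ^ Suc i)" .
  have "\<bar>\<Sum>i<m. coeff (lag b m) (Suc i) * x ^ Suc i\<bar> \<le> (\<Sum>i<m. u / a * (1/4) ^ i)"
    by (rule order.trans[OF sum_abs]) (intro sum_mono tm, simp)
  also have "\<dots> = u / a * (\<Sum>i<m. (1/4) ^ i)" by (simp add: sum_distrib_left)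
  also have "\<dots> \<le> u / a * (4/3)"
  proof (rule mult_left_mono)
    show "(\<Sum>i<m. (1/4::real) ^ i) \<le> 4/3"
      by (subst sum_gp_strict) (auto simp: field_simps)
  qed (use u a in auto)
  also have "\<dots> \<le> 1/3" using u a by (simp add: field_simps)
  finally show ?thesis unfolding e by linarith
qed

lemma Zs_lower:
  assumes "b > -1" "z \<in> Zs b m"
  shows "z > min (b + 1) 1 / (4 * real m)"
proof (rule ccontr)
  assume "\<not> ?thesis"
  then have "real m * z \<le> min (b + 1) 1 / 4" using Zs_pos[OF assms] by (simp add: not_less pos_le_divide_eq mult_ac)
  moreover have "z > 0" using Zs_props(2)[OF assms(1)] assms(2) by auto
  ultimately have "poly (lag b m) z \<ge> 1/2" by (intro lag_ge_half[OF assms(1)]) auto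
  then show False using assms(2) by (simp add: Zs_def)
qed

text \<open>At a node \<open>lv\<close> vanishes, so the energy there is the square of
  \<open>ldv\<close>, which by \<open>lamz_formula\<close> equals
  \<open>4 sqrt z * lag_w b z * lag_h b m / lamz b m z\<close>. A lower bound for the energy is thus
  an upper bound for the Cotes number.\<close>

lemma lamz_bound:
  assumes b: "b > -1" and th: "0 < \<theta>" "\<theta> < 1"
  shows "\<exists>C>0. \<forall>m\<ge>1. \<forall>z\<in>Zs b m. z \<le> 4 * \<theta> * real m \<longrightarrow> lamz b m z \<le> C * sqrt (z / real m) * lag_w b z"
proof -
  obtain Ch where Ch: "Ch > 0" "\<And>m. m \<ge> 1 \<Longrightarrow> lag_h b m \<le> Ch * real m powr (- b)"
    using lag_h_bound[OF b] by auto
  define a where "a = min (b + 1) 1"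
  have a: "a > 0" "a \<le> 1" using b by (auto simp: a_def)
  \<comment> \<open>\<open>D\<close> dominates the exponent in \<open>energy_lower_bound\<close>:
    with starting point \<open>sqrt (a / (4 m))\<close> and
    \<open>\<mu> = 4 m (1 - \<theta>)\<close>, the powers of \<open>m\<close> cancel.\<close>
  define D where "D = \<theta> / (1 - \<theta>) + \<bar>1/4 - b\<^sup>2\<bar> / sqrt (a * (1 - \<theta>))"
  define c where "c = 3/4 * exp (-1) * (a / 4) powr (b + 1/2)"
  have c: "c > 0" using a by (simp add: c_def)
  define C where "C = 4 * Ch * exp D / c"
  have "lamz b m z \<le> C * sqrt (z / real m) * lag_w b z"
    if m: "m \<ge> 1" and z: "z \<in> Zs b m" "z \<le> 4 * \<theta> * real m" for m z
  proof -
    have m0: "real m \<ge> 1" using m by simp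
    have zp: "z > 0" using Zs_props(2)[OF b] z by auto
    \<comment> \<open>The energy estimate starts to the left of every node by
      \<open>Zs_lower\<close>, and still inside the range of \<open>lag_ge_half\<close>.\<close>
    define x1 where "x1 = a / (4 * real m)"
    have x1: "x1 > 0" "x1 < z" "x1 \<le> 1/4" "real m * x1 = a / 4"
      using a m0 Zs_lower[OF b z(1)] by (auto simp: x1_def a_def field_simps)
    define E where "E t = (ldv b m t)\<^sup>2 + (4 * real m + 2 * b + 2 - t\<^sup>2) * (lv b m t)\<^sup>2" for t
    define \<mu> where "\<mu> = 4 * real m * (1 - \<theta>)"
    have mu: "\<mu> > 0" using th m0 by (simp add: \<mu>_def)
    have "E (sqrt x1) * exp (- ((sqrt z)\<^sup>2 / \<mu> + \<bar>1/4 - b\<^sup>2\<bar> / (sqrt x1 * sqrt \<mu>))) \<le> E (sqrt z)"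
      unfolding E_def
    proof (rule energy_lower_bound[of "lv b m" "ldv b m"])
      show "\<mu> \<le> 4 * real m + 2 * b + 2 - (sqrt z)\<^sup>2"
        using z zp b by (simp add: \<mu>_def algebra_simps)
    qed (use lv_deriv ldv_deriv[OF b] x1 mu in auto)
    moreover have "(sqrt z)\<^sup>2 / \<mu> + \<bar>1/4 - b\<^sup>2\<bar> / (sqrt x1 * sqrt \<mu>) \<le> D"
    proof -
      have "sqrt x1 * sqrt \<mu> = sqrt (a * (1 - \<theta>))"
        using m0 by (simp add: x1_def \<mu>_def flip: real_sqrt_mult)
      moreover have "(sqrt z)\<^sup>2 / \<mu> \<le> \<theta> / (1 - \<theta>)"
        using z zp th m0 by (simp add: \<mu>_def divide_simps)
      ultimately show ?thesis by (simp add: D_def)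
    qed
    moreover have E1: "E (sqrt x1) \<ge> c * real m powr (1/2 - b)"
    proof -
      have y: "poly (lag b m) x1 \<ge> 1/2" using x1 by (intro lag_ge_half[OF b]) (auto simp: a_def)
      have v: "(lv b m (sqrt x1))\<^sup>2 = x1 powr (b + 1/2) * exp (- x1) * (poly (lag b m) x1)\<^sup>2"
      proof -
        have "(sqrt x1 powr (b + 1/2))\<^sup>2 = x1 powr (b + 1/2)"
          using x1 by (simp add: powr_half_sqrt[symmetric] powr_powr power2_eq_square flip: powr_add)
        moreover have "(exp (- x1 / 2))\<^sup>2 = exp (- x1)" by (simp flip: exp_double)
        ultimately show ?thesis using x1 by (simp add: lv_def power_mult_distrib)
      qed
      have "(1/2)\<^sup>2 \<le> (poly (lag b m) x1)\<^sup>2" using y by (intro power_mono) auto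
      then have y2: "1/4 \<le> (poly (lag b m) x1)\<^sup>2" by (simp add: power2_eq_square)
      have "c * real m powr (1/2 - b) = 3 * real m * (x1 powr (b + 1/2) * exp (-1) * (1/4))"
      proof -
        have "x1 powr (b + 1/2) = (a / 4) powr (b + 1/2) / real m powr (b + 1/2)"
          using a m0 by (simp add: x1_def flip: powr_divide)
        moreover have "real m powr (1/2 - b) = real m / real m powr (b + 1/2)"
        proof -
          have "real m powr (1 - (b + 1/2)) = real m powr 1 / real m powr (b + 1/2)" by (rule powr_diff)
          then show ?thesis using m0 by (simp add: algebra_simps)
        qed
        ultimately show ?thesis by (simp add: c_def mult_ac)
      qed
      also have "\<dots> \<le> (4 * real m + 2 * b + 2 - x1) * (x1 powr (b + 1/2) * exp (- x1) * (poly (lag b m) x1)\<^sup>2)"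
        using m0 b x1 y2 by (intro mult_mono) auto
      also have "\<dots> \<le> E (sqrt x1)" unfolding E_def v using x1 by simp
      finally show ?thesis .
    qed
    ultimately have "c * real m powr (1/2 - b) * exp (- D) \<le> E (sqrt z)"
    proof -
      assume 1: "E (sqrt x1) * exp (- ((sqrt z)\<^sup>2 / \<mu> + \<bar>1/4 - b\<^sup>2\<bar> / (sqrt x1 * sqrt \<mu>))) \<le> E (sqrt z)"
        and 2: "(sqrt z)\<^sup>2 / \<mu> + \<bar>1/4 - b\<^sup>2\<bar> / (sqrt x1 * sqrt \<mu>) \<le> D"
      have "c * real m powr (1/2 - b) * exp (- D)
          \<le> E (sqrt x1) * exp (- ((sqrt z)\<^sup>2 / \<mu> + \<bar>1/4 - b\<^sup>2\<bar> / (sqrt x1 * sqrt \<mu>)))"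
        using E1 2 c by (intro mult_mono order.trans[OF _ E1]) auto
      then show ?thesis using 1 by linarith
    qed
    moreover have Ez: "E (sqrt z) * lamz b m z = 4 * sqrt z * lag_w b z * lag_h b m"
    proof -
      have y0: "poly (lag b m) z = 0" using z by (simp add: Zs_def)
      have "(sqrt z powr (b + 1/2))\<^sup>2 = z powr b * sqrt z"
        using zp by (simp add: powr_half_sqrt[symmetric] powr_powr power2_eq_square flip: powr_add)
      moreover have "(exp (- z / 2))\<^sup>2 = exp (- z)" by (simp flip: exp_double)
      ultimately have "E (sqrt z) = z powr b * sqrt z * exp (- z) * (4 * z * (poly (pderiv (lag b m)) z)\<^sup>2)"
        using zp y0 by (simp add: E_def lv_def ldv_def power_mult_distrib)
      then have "E (sqrt z) * lamz b m z = 4 * sqrt z * lag_w b z * (lamz b m z * z * (poly (pderiv (lag b m)) z)\<^sup>2)"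
        by (simp add: lag_w_def)
      then show ?thesis using lamz_formula[OF b z(1)] by simp
    qed
    ultimately have "c * real m powr (1/2 - b) * exp (- D) * lamz b m z \<le> 4 * sqrt z * lag_w b z * lag_h b m"
      using lamz_pos[OF b z(1)] by (metis less_imp_le mult_right_mono)
    also have "\<dots> \<le> 4 * sqrt z * lag_w b z * (Ch * real m powr (- b))"
      using Ch(2)[OF m] zp by (intro mult_left_mono) auto
    finally have f: "c * real m powr (1/2 - b) * exp (- D) * lamz b m z \<le> 4 * sqrt z * lag_w b z * (Ch * real m powr (- b))" .
    have pm: "real m powr (1/2 - b) = sqrt (real m) * real m powr (- b)"
      using m0 by (simp add: powr_half_sqrt[symmetric] flip: powr_add)
    define R where "R = real m powr (- b)"
    have R: "R > 0" using m0 by (simp add: R_def)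
    have "(c * sqrt (real m) * exp (- D) * lamz b m z) * R \<le> (4 * sqrt z * lag_w b z * Ch) * R"
      using f unfolding pm R_def by (simp add: mult_ac)
    then have "c * sqrt (real m) * exp (- D) * lamz b m z \<le> 4 * sqrt z * lag_w b z * Ch" using R by simp
    then show ?thesis
      using c m0 by (simp add: C_def real_sqrt_divide exp_minus field_simps)
  qed
  moreover have "C > 0" using Ch c by (simp add: C_def)
  ultimately show ?thesis by blast
qed

text \<open>The square of this number is a lower bound for the potential in the normal form above on the
  range of \<open>t\<close> where nodes are sought.\<close>
definition kap :: "real \<Rightarrow> nat \<Rightarrow> real" where
  "kap \<theta> m = sqrt (2 * real m * (1 - \<theta>))"

text \<open>The normal form offers at least \<open>4 m (1 - \<theta>)\<close> up to the singular
  term. Half of it is spent there: the lower limit for \<open>a\<close> keeps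
  \<open>b^2 / t^2\<close> below the square of \<open>kap \<theta> m\<close>; the other half is that
  square again.\<close>

lemma node_in_interval:
  assumes b: "b > -1" and th: "0 < \<theta>" "\<theta> < 1" and m: "m \<ge> 1"
    and a: "(\<bar>b\<bar> + 1) / kap \<theta> m \<le> a" "a + pi / kap \<theta> m \<le> 2 * sqrt (\<theta> * real m)"
  shows "\<exists>z\<in>Zs b m. a \<le> sqrt z \<and> sqrt z \<le> a + pi / kap \<theta> m"
proof -
  define k where "k = kap \<theta> m"
  have k: "k > 0" "k\<^sup>2 = 2 * real m * (1 - \<theta>)" using th m by (auto simp: k_def kap_def)
  have T0: "(\<bar>b\<bar> + 1) / k > 0" using k by simp
  have ap: "a > 0" using a T0 by (simp add: k_def)
  have "\<exists>t. a \<le> t \<and> t \<le> a + pi / k \<and> lv b m t = 0"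
  proof (rule sturm_zero[where dv = "ldv b m" and S = "\<lambda>t. 4 * real m + 2 * b + 2 - t\<^sup>2 + (1/4 - b\<^sup>2) / t\<^sup>2"])
    fix t assume t: "a \<le> t" "t \<le> a + pi / k"
    then have tp: "t > 0" using ap by simp
    have "t \<le> 2 * sqrt (\<theta> * real m)" using t a by (simp add: k_def)
    then have "t\<^sup>2 \<le> (2 * sqrt (\<theta> * real m))\<^sup>2" using tp by (intro power_mono) auto
    then have 1: "t\<^sup>2 \<le> 4 * \<theta> * real m" using th by (simp add: power_mult_distrib)
    have "b\<^sup>2 \<le> (k * t)\<^sup>2"
    proof -
      have "\<bar>b\<bar> + 1 \<le> k * t" 
      proof -
        have "(\<bar>b\<bar> + 1) / k \<le> t" using a(1) t by (simp add: k_def)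
        then show ?thesis using k by (simp add: pos_divide_le_eq mult.commute)
      qed
      then have "\<bar>b\<bar> \<le> \<bar>k * t\<bar>" by linarith
      then show ?thesis by (rule abs_le_square_iff[THEN iffD1])
    qed
    then have "b\<^sup>2 / t\<^sup>2 \<le> k\<^sup>2" using tp by (simp add: field_simps power_mult_distrib)
    moreover have "(1/4 - b\<^sup>2) / t\<^sup>2 \<ge> - (b\<^sup>2 / t\<^sup>2)" using tp by (simp add: field_simps)
    ultimately show "k\<^sup>2 \<le> 4 * real m + 2 * b + 2 - t\<^sup>2 + (1/4 - b\<^sup>2) / t\<^sup>2"
      using 1 k(2) b by (simp add: algebra_simps)
  qed (use lv_deriv ldv_deriv[OF b] ap k in auto)
  then obtain t where t: "a \<le> t" "t \<le> a + pi / k" "lv b m t = 0" by blast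
  then have tp: "t > 0" using ap by simp
  then have "t\<^sup>2 \<in> Zs b m" using t(3) by (auto simp: lv_def Zs_def)
  then show ?thesis using t tp by (intro bexI[of _ "t\<^sup>2"]) (auto simp: k_def)
qed

section \<open>Step approximants for arbitrary thresholds\<close>

lemma borel_measurable_poly [measurable]: "poly (p :: real poly) \<in> borel_measurable borel"
  by (intro borel_measurable_continuous_onI continuous_intros)

text \<open>Writes the step function sending \<open>s\<close> to \<open>F\<close> at the largest
  point of \<open>Z\<close> up to \<open>s\<close> as a sum of jumps, starting from 0. The
  description of the jumps serves to bound their degrees when \<open>F\<close> takes polynomial
  values.\<close>

lemma telescoping_max:
  fixes F :: "real \<Rightarrow> 'a :: ab_group_add"
  assumes "finite Z"
  shows "\<exists>D. (\<forall>s. (\<Sum>z\<in>{z\<in>Z. z \<le> s}. D z) = (if {z\<in>Z. z \<le> s} = {} then 0 else F (Max {z\<in>Z. z \<le> s}))) \<and>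
    (\<forall>z\<in>Z. D z = F z \<or> (\<exists>y\<in>Z. D z = F z - F y))"
  using assms
proof (induction rule: finite_linorder_max_induct)
  case empty
  then show ?case by simp
next
  case (insert b A)
  then obtain D where D: "\<And>s. (\<Sum>z\<in>{z\<in>A. z \<le> s}. D z) = (if {z\<in>A. z \<le> s} = {} then 0 else F (Max {z\<in>A. z \<le> s}))"
      "\<And>z. z \<in> A \<Longrightarrow> D z = F z \<or> (\<exists>y\<in>A. D z = F z - F y)"
    by blast
  define D' where "D' = D(b := F b - (\<Sum>z\<in>A. D z))"
  have bA: "b \<notin> A" using insert by blast
  have eq: "(\<Sum>z\<in>B. D' z) = (\<Sum>z\<in>B. D z)" if "B \<subseteq> A" for B
    using that bA by (intro sum.cong) (auto simp: D'_def)
  have "{z\<in>A. z \<le> b} = A" using insert(2) by fastforce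
  then have "(\<Sum>z\<in>A. D z) = (if A = {} then 0 else F (Max A))" using D(1)[of b] by simp
  moreover have "A \<noteq> {} \<Longrightarrow> Max A \<in> A" using insert(1) by simp
  ultimately have Db: "D' b = F b \<or> (\<exists>y\<in>insert b A. D' b = F b - F y)"
    by (cases "A = {}") (auto simp: D'_def)
  have "D' z = F z \<or> (\<exists>y\<in>insert b A. D' z = F z - F y)" if "z \<in> insert b A" for z
  proof (cases "z = b")
    case False
    then show ?thesis using that D(2)[of z] by (auto simp: D'_def)
  qed (use Db in auto)
  moreover have "(\<Sum>z\<in>{z \<in> insert b A. z \<le> s}. D' z) = (if {z \<in> insert b A. z \<le> s} = {} then 0 else F (Max {z \<in> insert b A. z \<le> s}))" for s
  proof (cases "b \<le> s")
    case True
    then have *: "{z \<in> insert b A. z \<le> s} = insert b A" using insert(2) by fastforce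
    have "Max (insert b A) = b" using insert(1,2) by (intro Max_eqI) (auto intro: less_imp_le)
    then show ?thesis unfolding * using insert(1) bA by (simp add: eq) (simp add: D'_def)
  next
    case False
    then have *: "{z \<in> insert b A. z \<le> s} = {z \<in> A. z \<le> s}" by auto
    show ?thesis unfolding * by (subst eq) (use D in auto)
  qed
  ultimately show ?case by blast
qed

text \<open>Moves bounds on Cotes numbers from a node to a nearby threshold. The two ratio
  conditions handle the powers in either sign of \<open>b\<close>; the additive one handles the
  exponential.\<close>

lemma lag_w_comparable:
  assumes uv: "u > 0" "v > 0" and K: "u \<le> K * v" "v \<le> K * u" "v \<le> u + K"
  shows "sqrt u * lag_w b u \<le> sqrt K * K powr \<bar>b\<bar> * exp K * (sqrt v * lag_w b v)"
proof -
  have Kp: "K > 0" using uv K(1) by (metis less_le_trans not_less zero_less_mult_pos2)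
  have 1: "sqrt u \<le> sqrt K * sqrt v" using K(1) by (simp flip: real_sqrt_mult)
  have 2: "u powr b \<le> K powr \<bar>b\<bar> * v powr b"
  proof (cases "b \<ge> 0")
    case True
    then have "u powr b \<le> (K * v) powr b" using uv K by (intro powr_mono2) auto
    then show ?thesis using True Kp uv by (simp add: powr_mult)
  next
    case False
    have "(K * u) powr b \<le> v powr b" using uv K False by (intro powr_mono2') auto
    then have "K powr b * u powr b \<le> v powr b" using Kp uv by (simp add: powr_mult)
    then have "K powr (- b) * (K powr b * u powr b) \<le> K powr (- b) * v powr b" by (intro mult_left_mono) auto
    moreover have "K powr (- b) * K powr b = 1" using Kp by (simp flip: powr_add)
    ultimately show ?thesis using False by (simp add: mult.assoc[symmetric])
  qed
  have 3: "exp (- u) \<le> exp K * exp (- v)" using K(3) by (simp flip: exp_add)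
  have "sqrt u * (u powr b * exp (- u)) \<le> (sqrt K * sqrt v) * ((K powr \<bar>b\<bar> * v powr b) * (exp K * exp (- v)))"
    using uv Kp by (intro mult_mono 1 2 3) auto
  then show ?thesis by (simp add: lag_w_def mult_ac)
qed

lemma measure_lagm_near_0:
  assumes "b > -1" "s > 0"
  shows "measure (lagm b) {..s} \<le> s powr (b + 1) / (b + 1)"
proof -
  interpret finite_measure "lagm b" by (rule finite_measure_lagm[OF assms(1)])
  have "emeasure (lagm b) {..s} = (\<integral>\<^sup>+x. indicator {..s} x \<partial>lagm b)" by simp
  also have "\<dots> = (\<integral>\<^sup>+x. ennreal (indicator {0<..} x * lag_w b x) * indicator {..s} x \<partial>lborel)"
    by (intro nn_integral_lagm) auto
  also have "\<dots> \<le> (\<integral>\<^sup>+x. ennreal (indicator {0..s} x * x powr b) \<partial>lborel)"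
    by (intro nn_integral_mono) (auto simp: indicator_def lag_w_def intro!: ennreal_leI mult_left_le)
  also have "\<dots> = ennreal (s powr (b + 1) / (b + 1))"
    using nn_integral_has_integral_lebesgue[OF _ has_integral_powr_from_0[of b s]] assms
    by (simp add: nn_integral_completion)
  finally show ?thesis using assms by (subst (asm) emeasure_eq_measure) simp
qed

text \<open>The mass up to \<open>z'\<close> is at most the sum of the Cotes numbers up to
  \<open>z'\<close>, while the Cotes numbers below \<open>z\<close> sum to at most the mass below
  \<open>z\<close>. Subtracting leaves the two Cotes numbers at \<open>z\<close> and
  \<open>z'\<close>.\<close>

lemma measure_between_nodes:
  assumes b: "b > -1" and z: "z \<in> Zs b m" "z' \<in> Zs b m" "z < z'" "\<And>u. u \<in> Zs b m \<Longrightarrow> u \<le> z \<or> z' \<le> u"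
    and s: "s < z'"
  shows "measure (lagm b) {z<..s} \<le> lamz b m z + lamz b m z'"
proof -
  interpret finite_measure "lagm b" by (rule finite_measure_lagm[OF b])
  have "measure (lagm b) {..<z} + measure (lagm b) {z<..s} = measure (lagm b) ({..<z} \<union> {z<..s})"
    by (intro finite_measure_Union[symmetric]) auto
  also have "\<dots> \<le> measure (lagm b) {..z'}" using z(3) s by (intro finite_measure_mono) auto
  also have "\<dots> \<le> (\<Sum>u\<in>{u\<in>Zs b m. u \<le> z'}. lamz b m u)"
    using step_poly[OF b z(2)] by auto
  also have "{u\<in>Zs b m. u \<le> z'} = insert z (insert z' {u\<in>Zs b m. u < z})"
    using z by (auto dest: z(4))
  also have "(\<Sum>u\<in>\<dots>. lamz b m u) = lamz b m z + lamz b m z' + (\<Sum>u\<in>{u\<in>Zs b m. u < z}. lamz b m u)"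
    using z(3) by (simp add: add.assoc)
  also have "(\<Sum>u\<in>{u\<in>Zs b m. u < z}. lamz b m u) \<le> measure (lagm b) {..<z}"
    by (rule markov_stieltjes_below[OF b z(1)])
  finally show ?thesis by simp
qed

text \<open>\<open>D z\<close> is an approximation to the indicator of the interval from the preceding node to \<open>z\<close>, so
  that partial sums approximate the indicators of half-lines.\<close>
definition step_sum :: "real \<Rightarrow> nat \<Rightarrow> (real \<Rightarrow> real poly) \<Rightarrow> real \<Rightarrow> real poly" where
  "step_sum b m D s = (\<Sum>z\<in>{z\<in>Zs b m. z \<le> s}. D z)"

text \<open>The condition on \<open>Lam\<close> assigns each partial sum the value of the Gauss rule
  on the indicator; this makes the integral of a superposition of these approximants a truncated
  quadrature sum.\<close>

definition step_bound :: "real \<Rightarrow> real \<Rightarrow> real \<Rightarrow> nat \<Rightarrow> (real \<Rightarrow> real poly) \<Rightarrow> bool" where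
  "step_bound b \<theta> C m D \<longleftrightarrow> (\<forall>z\<in>Zs b m. degree (D z) < 2 * m) \<and>
    (\<forall>s. Lam b (step_sum b m D s) = (\<Sum>z\<in>{z\<in>Zs b m. z \<le> s}. lamz b m z)) \<and>
    (\<forall>s. 0 < s \<and> s \<le> 4 * \<theta> * real m \<longrightarrow>
      (\<integral>\<^sup>+x. ennreal \<bar>indicator {..s} x - poly (step_sum b m D s) x\<bar> \<partial>lagm b)
        \<le> ennreal (C * sqrt (s / real m) * lag_w b s))"

text \<open>For \<open>s\<close> between consecutive nodes \<open>z <= s < z'\<close> the polynomial
  of \<open>z\<close> is used; the additional error is the mass of \<open>{z<..s}\<close>, at most
  two Cotes numbers. Below the first node the approximant is 0 and the error is the mass near the
  origin.\<close>

lemma step_approximation: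
  assumes b: "b > -1" and th: "0 < \<theta>" "\<theta> < 1"
  shows "\<exists>C>0. \<exists>m0\<ge>1. \<forall>m\<ge>m0. \<exists>D. step_bound b \<theta> C m D"
proof -
  \<comment> \<open>The node following \<open>s\<close> may lie beyond \<open>4 \<theta> m\<close>;
    \<open>\<theta>'\<close> leaves room for it.\<close>
  define \<theta>' where "\<theta>' = (1 + \<theta>) / 2"
  have th': "0 < \<theta>'" "\<theta>' < 1" "\<theta> < \<theta>'" using th by (auto simp: \<theta>'_def)
  obtain C1 where C1: "C1 > 0" "\<And>m z. m \<ge> 1 \<Longrightarrow> z \<in> Zs b m \<Longrightarrow> z \<le> 4 * \<theta>' * real m \<Longrightarrow>
      lamz b m z \<le> C1 * sqrt (z / real m) * lag_w b z"
    using lamz_bound[OF b th'(1,2)] by metis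
  define q where "q = sqrt (2 * (1 - \<theta>'))"
  have q: "q > 0" using th' by (simp add: q_def)
  \<comment> \<open>\<open>d / sqrt m\<close> is the smallest admissible \<open>a\<close> of
    \<open>node_in_interval\<close> plus two interval lengths; in the variable \<open>sqrt x\<close>
    it bounds the distance from \<open>s\<close> to its neighbouring nodes.\<close>
  define d where "d = (\<bar>b\<bar> + 1 + 2 * pi) / q"
  have d: "d > 0" using q pi_gt_zero unfolding d_def by (intro divide_pos_pos add_nonneg_pos) auto
  \<comment> \<open>\<open>e0 / sqrt m\<close> is the lower bound for \<open>sqrt z\<close> from
    \<open>Zs_lower\<close>; it converts the distance \<open>d / sqrt m\<close> into a
    ratio.\<close>
  define e0 where "e0 = sqrt (min (b + 1) 1 / 4)"
  have e0: "e0 > 0" using b by (simp add: e0_def)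
  \<comment> \<open>The square bounds the ratios between \<open>s\<close> and its neighbouring
    nodes. The term \<open>4 * d\<close> bounds \<open>s - z\<close>, factored as a difference of
    square roots, at most \<open>d / sqrt m\<close>, times their sum, at most
    \<open>4 sqrt m\<close>.\<close>
  define K where "K = (1 + d / e0)\<^sup>2 + 4 * d"
  have K1: "K \<ge> 1" "(1 + d / e0)\<^sup>2 \<le> K" "4 * d \<le> K"
  proof -
    have "(1 + d / e0)\<^sup>2 \<ge> 1" using d e0 by (intro one_le_power) auto
    then show "K \<ge> 1" "(1 + d / e0)\<^sup>2 \<le> K" "4 * d \<le> K" using d by (auto simp: K_def)
  qed
  define K2 where "K2 = sqrt K * K powr \<bar>b\<bar> * exp K"
  have K2: "K2 > 0" using K1 by (simp add: K2_def)
  \<comment> \<open>The first summand pays for three Cotes numbers, the second for thresholds below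
    the first node.\<close>
  define C where "C = 3 * C1 * K2 + d * exp (d\<^sup>2) / (b + 1)"
  have C: "C > 0" "3 * C1 * K2 \<le> C" "d * exp (d\<^sup>2) / (b + 1) \<le> C"
    using C1(1) K2 d b by (auto simp: C_def intro!: add_pos_pos)
  \<comment> \<open>From here on \<open>2 sqrt (\<theta> m) + d / sqrt m\<close> stays below
    \<open>2 sqrt (\<theta>' m)\<close>.\<close>
  define m0 where "m0 = nat \<lceil>d / (2 * (sqrt \<theta>' - sqrt \<theta>))\<rceil> + 1"
  have "\<exists>D. step_bound b \<theta> C m D" if m: "m \<ge> m0" for m
  proof -
    have m1: "m \<ge> 1" "real m \<ge> 1" using m by (auto simp: m0_def)
    define R where "R = sqrt (real m)"
    have R: "R \<ge> 1" "R * R = real m" using m1 by (auto simp: R_def)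
    have mb: "2 * sqrt (\<theta> * real m) + d / R \<le> 2 * sqrt (\<theta>' * real m)"
    proof -
      have "d / (2 * (sqrt \<theta>' - sqrt \<theta>)) \<le> real m"
        using m unfolding m0_def by linarith
      then have "d \<le> 2 * (sqrt \<theta>' - sqrt \<theta>) * (R * R)" unfolding R(2) using th' by (simp add: field_simps)
      then have "d / R \<le> 2 * (sqrt \<theta>' - sqrt \<theta>) * R" using R(1) by (simp add: pos_divide_le_eq mult.assoc)
      then show ?thesis by (simp add: real_sqrt_mult R_def algebra_simps)
    qed
    define k where "k = kap \<theta>' m"
    have k: "k = R * q" by (simp add: k_def kap_def R_def q_def mult_ac flip: real_sqrt_mult)
    have kp: "k > 0" using R q by (simp add: k)
    define T0 where "T0 = (\<bar>b\<bar> + 1) / k"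
    define \<delta> where "\<delta> = pi / k"
    have \<delta>: "\<delta> > 0" "T0 > 0" using kp by (auto simp: \<delta>_def T0_def)
    have H: "T0 + 2 * \<delta> = d / R" using R q by (simp add: T0_def \<delta>_def k d_def field_simps)
    have node: "\<exists>z\<in>Zs b m. a \<le> sqrt z \<and> sqrt z \<le> a + \<delta>" if "T0 \<le> a" "a + \<delta> \<le> 2 * sqrt (\<theta>' * real m)" for a
      using node_in_interval[OF b th'(1,2) m1(1), of a] that by (simp add: T0_def \<delta>_def k_def)
    define F where "F z = (SOME P :: real poly. degree P < 2 * m \<and> Lam b P = (\<Sum>u\<in>{u\<in>Zs b m. u \<le> z}. lamz b m u) \<and>
        measure (lagm b) {..z} \<le> Lam b P \<and>
        (\<integral>\<^sup>+x. ennreal \<bar>indicator {..z} x - poly P x\<bar> \<partial>lagm b) \<le> ennreal (lamz b m z))" for z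
    have F: "degree (F z) < 2 * m" "Lam b (F z) = (\<Sum>u\<in>{u\<in>Zs b m. u \<le> z}. lamz b m u)"
        "(\<integral>\<^sup>+x. ennreal \<bar>indicator {..z} x - poly (F z) x\<bar> \<partial>lagm b) \<le> ennreal (lamz b m z)"
      if "z \<in> Zs b m" for z
      using someI_ex[OF step_poly[OF b that]] unfolding F_def by auto
    obtain D where D: "\<And>s. (\<Sum>z\<in>{z\<in>Zs b m. z \<le> s}. D z) = (if {z\<in>Zs b m. z \<le> s} = {} then 0 else F (Max {z\<in>Zs b m. z \<le> s}))"
        "\<And>z. z \<in> Zs b m \<Longrightarrow> D z = F z \<or> (\<exists>y\<in>Zs b m. D z = F z - F y)"
      using telescoping_max[OF finite_Zs[of b m], of F] by blast
    have degD: "degree (D z) < 2 * m" if "z \<in> Zs b m" for z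
      using D(2)[OF that] F(1) that by (auto intro!: degree_diff_less)
    have mx: "Max {z\<in>Zs b m. z \<le> s} \<in> Zs b m" "Max {z\<in>Zs b m. z \<le> s} \<le> s"
      if "{z\<in>Zs b m. z \<le> s} \<noteq> {}" for s
      using Max_in[OF _ that] by auto
    have LamD: "Lam b (step_sum b m D s) = (\<Sum>z\<in>{z\<in>Zs b m. z \<le> s}. lamz b m z)" for s
    proof (cases "{z\<in>Zs b m. z \<le> s} = {}")
      case True
      then show ?thesis unfolding step_sum_def True by (simp add: Lam_def)
    next
      case False
      have e: "{u\<in>Zs b m. u \<le> Max {z\<in>Zs b m. z \<le> s}} = {z\<in>Zs b m. z \<le> s}"
        using mx[OF False] by (auto intro!: Max_ge)
      have "step_sum b m D s = F (Max {z\<in>Zs b m. z \<le> s})"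
        unfolding step_sum_def D(1) by (rule if_not_P[OF False])
      then show ?thesis using F(2)[OF mx(1)[OF False]] unfolding e by (simp only:)
    qed
    have bound: "(\<integral>\<^sup>+x. ennreal \<bar>indicator {..s} x - poly (step_sum b m D s) x\<bar> \<partial>lagm b)
        \<le> ennreal (C * sqrt (s / real m) * lag_w b s)" if s: "0 < s" "s \<le> 4 * \<theta> * real m" for s
    proof -
      define t where "t = sqrt s"
      have t: "t > 0" "t\<^sup>2 = s" using s by (auto simp: t_def)
      have tm: "t \<le> 2 * sqrt (\<theta> * real m)"
      proof -
        have "sqrt s \<le> sqrt (4 * (\<theta> * real m))" using s by (intro real_sqrt_le_mono) auto
        then show ?thesis by (simp add: t_def real_sqrt_mult)
      qed
      have tR: "t \<le> 2 * R"
      proof -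
        have "sqrt (\<theta> * real m) \<le> sqrt (1 * real m)" using th by (intro real_sqrt_le_mono mult_right_mono) auto
        then show ?thesis using tm unfolding R_def mult_1 by linarith
      qed
      have sm: "sqrt (s / real m) = t / R" by (simp add: t_def R_def real_sqrt_divide)
      have below: "\<exists>z\<in>Zs b m. z \<le> s \<and> t - \<delta> \<le> sqrt z" if le: "T0 + \<delta> \<le> t"
      proof -
        have "t - \<delta> + \<delta> \<le> 2 * sqrt (\<theta>' * real m)" using tm mb divide_pos_pos[OF d] R(1) by (smt (verit))
        then obtain z where z: "z \<in> Zs b m" "t - \<delta> \<le> sqrt z" "sqrt z \<le> t - \<delta> + \<delta>"
          using node[of "t - \<delta>"] le by auto
        then show ?thesis using real_sqrt_le_iff[of z s] by (auto simp: t_def)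
      qed
      show ?thesis
      proof (cases "{z\<in>Zs b m. z \<le> s} = {}")
        case True
        then have "t < T0 + \<delta>" using below by force
        then have td: "t \<le> d / R" using H \<delta> by linarith
        have "(\<integral>\<^sup>+x. ennreal \<bar>indicator {..s} x - poly (step_sum b m D s) x\<bar> \<partial>lagm b) = (\<integral>\<^sup>+x. indicator {..s} x \<partial>lagm b)"
          unfolding step_sum_def True by (intro nn_integral_cong) (simp add: indicator_def)
        also have "\<dots> = ennreal (measure (lagm b) {..s})"
        proof -
          interpret finite_measure "lagm b" by (rule finite_measure_lagm[OF b])
          show ?thesis by (simp add: emeasure_eq_measure)
        qed
        also have "\<dots> \<le> ennreal (C * sqrt (s / real m) * lag_w b s)"
        proof (rule ennreal_leI)
          have sd: "s \<le> d\<^sup>2"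
          proof -
            have "d / R \<le> d / 1" using R d by (intro divide_left_mono) auto
            then have "t \<le> d" using td by simp
            then show ?thesis using t power_mono[of t d 2] by simp
          qed
          have "measure (lagm b) {..s} \<le> s powr (b + 1) / (b + 1)" by (rule measure_lagm_near_0[OF b s(1)])
          also have "s powr (b + 1) = t * (t * s powr b)" using s t by (simp add: powr_add power2_eq_square)
          also have "\<dots> \<le> (d / R) * (t * (s powr b * (exp (d\<^sup>2) * exp (- s))))"
          proof -
            have "1 \<le> exp (d\<^sup>2) * exp (- s)" using sd by (simp flip: exp_add)
            then have "s powr b * 1 \<le> s powr b * (exp (d\<^sup>2) * exp (- s))" by (intro mult_left_mono) auto
            then show ?thesis using td t R d by (intro mult_mono) auto
          qed
          also have "\<dots> = d * exp (d\<^sup>2) * (t / R * lag_w b s)" by (simp add: lag_w_def)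
          finally have "measure (lagm b) {..s} \<le> d * exp (d\<^sup>2) / (b + 1) * (t / R * lag_w b s)"
            using b by (simp add: divide_right_mono mult.commute)
          also have "\<dots> \<le> C * (t / R * lag_w b s)" using C t R by (intro mult_right_mono) auto
          finally show "measure (lagm b) {..s} \<le> C * sqrt (s / real m) * lag_w b s" by (simp add: sm)
        qed
        finally show ?thesis .
      next
        case False
        define z where "z = Max {z\<in>Zs b m. z \<le> s}"
        have z: "z \<in> Zs b m" "z \<le> s" using mx[OF False] by (auto simp: z_def)
        have zmax: "u \<le> z" if "u \<in> Zs b m" "u \<le> s" for u using that by (auto simp: z_def)
        have "z > 0" using Zs_props(2)[OF b] z by auto
        define z' where "z' = Min {u\<in>Zs b m. u > s}"
        have ub: "max t T0 + \<delta> + \<delta> \<le> t + d / R" using H \<delta> t by (auto simp: max_def)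
        have ub2: "t + d / R \<le> 2 * sqrt (\<theta>' * real m)" using tm mb by linarith
        have "T0 \<le> max t T0 + \<delta>" "max t T0 + \<delta> + \<delta> \<le> 2 * sqrt (\<theta>' * real m)"
          using ub ub2 \<delta> by (auto simp: max_def)
        from node[OF this] obtain z2 where
          z2: "z2 \<in> Zs b m" "max t T0 + \<delta> \<le> sqrt z2" "sqrt z2 \<le> max t T0 + \<delta> + \<delta>" by blast
        have "t < sqrt z2" using z2(2) \<delta> by linarith
        then have "s < z2" unfolding t_def by (simp only: real_sqrt_less_iff)
        then have z2s: "z2 \<in> {u\<in>Zs b m. u > s}" using z2 by auto
        then have "z' \<in> {u\<in>Zs b m. u > s}" unfolding z'_def by (intro Min_in) auto
        then have z': "z' \<in> Zs b m" "z' > s" by auto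
        have "z' \<le> z2" using z2s by (auto simp: z'_def)
        then have sz': "sqrt z' \<le> t + d / R" using z2(3) ub by (meson order.trans real_sqrt_le_mono)
        have zmin: "z' \<le> u" if "u \<in> Zs b m" "u > s" for u using that by (auto simp: z'_def)
        have z'th: "z' \<le> 4 * \<theta>' * real m"
        proof -
          have "(sqrt z')\<^sup>2 \<le> (2 * sqrt (\<theta>' * real m))\<^sup>2"
            using sz' ub2 z' s by (intro power_mono) auto
          then show ?thesis using z' s th' by (simp add: power_mult_distrib)
        qed
        have tz: "t \<le> sqrt z + d / R"
        proof (cases "T0 + \<delta> \<le> t")
          case True
          then obtain y where "y \<in> Zs b m" "y \<le> s" "t - \<delta> \<le> sqrt y" using below by blast
          moreover from this have "sqrt y \<le> sqrt z" using zmax by simp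
          ultimately show ?thesis using H \<delta> by linarith
        next
          case False
          then have "t \<le> d / R" using H \<delta> by linarith
          moreover have "sqrt z \<ge> 0" using \<open>z > 0\<close> by simp
          ultimately show ?thesis by linarith
        qed
        have z0: "e0 / R \<le> sqrt z"
        proof -
          have "min (b + 1) 1 / 4 / real m \<le> z" using Zs_lower[OF b z(1)] by simp
          then have "sqrt (min (b + 1) 1 / 4 / real m) \<le> sqrt z" by (rule real_sqrt_le_mono)
          then show ?thesis by (simp only: e0_def R_def real_sqrt_divide)
        qed
        have dR: "d / R \<le> sqrt z * (d / e0)"
        proof -
          have "(e0 / R) * (d / e0) \<le> sqrt z * (d / e0)" using z0 d e0 by (intro mult_right_mono) auto
          then show ?thesis using e0 by simp
        qed
        have szt: "sqrt z \<le> t" using z by (simp add: t_def)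
        have c1: "sqrt z * lag_w b z \<le> K2 * (sqrt s * lag_w b s)"
          unfolding K2_def
        proof (rule lag_w_comparable)
          show "z \<le> K * s" using z K1 s by (smt (verit) mult_le_cancel_right1)
          have "t \<le> sqrt z * (1 + d / e0)" using tz dR by (simp add: algebra_simps)
          then have "t\<^sup>2 \<le> (sqrt z * (1 + d / e0))\<^sup>2" using t by (intro power_mono) auto
          then have "s \<le> (1 + d / e0)\<^sup>2 * z" using t \<open>z > 0\<close> by (simp add: power_mult_distrib mult.commute)
          also have "\<dots> \<le> K * z" using K1 \<open>z > 0\<close> by (intro mult_right_mono) auto
          finally show "s \<le> K * z" .
          have "s - z = (t - sqrt z) * (t + sqrt z)" using t \<open>z > 0\<close> by (simp add: algebra_simps power2_eq_square)
          also have "\<dots> \<le> (d / R) * (4 * R)"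
            using tz tR szt d R t \<open>z > 0\<close> by (intro mult_mono) auto
          also have "\<dots> = 4 * d" using R by simp
          finally show "s \<le> z + K" using K1 by linarith
        qed (use s \<open>z > 0\<close> in auto)
        have c2: "sqrt z' * lag_w b z' \<le> K2 * (sqrt s * lag_w b s)"
          unfolding K2_def
        proof (rule lag_w_comparable)
          show "s \<le> z' + K" using z' K1 by linarith
          show "s \<le> K * z'" using z' K1 s by (smt (verit) mult_le_cancel_right1)
          have "sqrt z * (d / e0) \<le> t * (d / e0)" using szt d e0 by (intro mult_right_mono) auto
          then have "sqrt z' \<le> t * (1 + d / e0)" using sz' dR by (simp add: algebra_simps)
          then have "(sqrt z')\<^sup>2 \<le> (t * (1 + d / e0))\<^sup>2" using z' s by (intro power_mono) auto
          then have "z' \<le> (1 + d / e0)\<^sup>2 * s" using t z' s by (simp add: power_mult_distrib mult.commute)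
          also have "\<dots> \<le> K * s" using K1 s by (intro mult_right_mono) auto
          finally show "z' \<le> K * s" .
        qed (use s z' in auto)
        have lam: "lamz b m u \<le> C1 * K2 * (t / R * lag_w b s)"
          if "u \<in> Zs b m" "u \<le> 4 * \<theta>' * real m" "sqrt u * lag_w b u \<le> K2 * (sqrt s * lag_w b s)" for u
        proof -
          have "lamz b m u \<le> C1 * sqrt (u / real m) * lag_w b u" by (rule C1(2)[OF m1(1) that(1,2)])
          also have "\<dots> = C1 / R * (sqrt u * lag_w b u)" by (simp add: real_sqrt_divide R_def)
          also have "\<dots> \<le> C1 / R * (K2 * (sqrt s * lag_w b s))" using that(3) C1 R by (intro mult_left_mono) auto
          also have "\<dots> = C1 * K2 * (t / R * lag_w b s)" by (simp add: t_def)
          finally show ?thesis .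
        qed
        have "z \<le> 4 * \<theta>' * real m" using z(2) z' z'th by linarith
        note l1 = lam[OF z(1) this c1] and l2 = lam[OF z'(1) z'th c2]
        have P: "step_sum b m D s = F z" unfolding step_sum_def D(1) z_def by (rule if_not_P[OF False])
        have "(\<integral>\<^sup>+x. ennreal \<bar>indicator {..s} x - poly (F z) x\<bar> \<partial>lagm b)
            \<le> (\<integral>\<^sup>+x. ennreal \<bar>indicator {..z} x - poly (F z) x\<bar> + indicator {z<..s} x \<partial>lagm b)"
        proof (intro nn_integral_mono)
          fix x
          have "\<bar>indicator {..s} x - poly (F z) x\<bar> \<le> \<bar>indicator {..z} x - poly (F z) x\<bar> + indicator {z<..s} x"
            using z by (auto simp: indicator_def)
          then have "ennreal \<bar>indicator {..s} x - poly (F z) x\<bar> \<le> ennreal (\<bar>indicator {..z} x - poly (F z) x\<bar> + indicator {z<..s} x)"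
            by (rule ennreal_leI)
          then show "ennreal \<bar>indicator {..s} x - poly (F z) x\<bar> \<le> ennreal \<bar>indicator {..z} x - poly (F z) x\<bar> + indicator {z<..s} x"
            by (simp add: ennreal_plus ennreal_indicator)
        qed
        also have "\<dots> = (\<integral>\<^sup>+x. ennreal \<bar>indicator {..z} x - poly (F z) x\<bar> \<partial>lagm b) + emeasure (lagm b) {z<..s}"
          by (subst nn_integral_add) auto
        also have "\<dots> \<le> ennreal (lamz b m z) + ennreal (lamz b m z + lamz b m z')"
        proof (intro add_mono F(3) z(1))
          interpret finite_measure "lagm b" by (rule finite_measure_lagm[OF b])
          have "measure (lagm b) {z<..s} \<le> lamz b m z + lamz b m z'"
            using z z' zmax zmin by (intro measure_between_nodes[OF b]) force+
          then show "emeasure (lagm b) {z<..s} \<le> ennreal (lamz b m z + lamz b m z')"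
            by (simp add: emeasure_eq_measure ennreal_leI)
        qed
        also have "\<dots> = ennreal (lamz b m z + (lamz b m z + lamz b m z'))"
          using lamz_pos[OF b z(1)] lamz_pos[OF b z'(1)] by (simp flip: ennreal_plus)
        also have "\<dots> \<le> ennreal (C * sqrt (s / real m) * lag_w b s)"
        proof (rule ennreal_leI)
          define X where "X = t / R * lag_w b s"
          have "lamz b m z + (lamz b m z + lamz b m z') \<le> C1 * K2 * X + (C1 * K2 * X + C1 * K2 * X)"
            using l1 l2 unfolding X_def by (intro add_mono)
          also have "\<dots> = 3 * C1 * K2 * (t / R * lag_w b s)" unfolding X_def[symmetric] by simp
          also have "\<dots> \<le> C * (t / R * lag_w b s)" using C t R by (intro mult_right_mono) auto
          finally show "lamz b m z + (lamz b m z + lamz b m z') \<le> C * sqrt (s / real m) * lag_w b s"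
            by (simp add: sm)
        qed
        finally show ?thesis unfolding P .
      qed
    qed
    show ?thesis unfolding step_bound_def using degD LamD bound by blast
  qed
  moreover have "m0 \<ge> 1" by (simp add: m0_def)
  ultimately show ?thesis using C(1) by blast
qed

subsection \<open>Weighted approximation by polynomials\<close>

text \<open>\<open>h\<close> is the derivative of a locally absolutely continuous \<open>g\<close>
  on the open half-line. Intervals stay away from 0, where the weight may allow \<open>h\<close> to
  be non-integrable.\<close>

definition prim :: "(real \<Rightarrow> real) \<Rightarrow> (real \<Rightarrow> real) \<Rightarrow> bool" where
  "prim g h \<longleftrightarrow> g \<in> borel_measurable borel \<and> h \<in> borel_measurable borel \<and>
    (\<forall>a b. 0 < a \<longrightarrow> a \<le> b \<longrightarrow> set_integrable lborel {a..b} h \<and> g b - g a = (LINT s:{a..b}|lborel. h s))"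

text \<open>Extended-valued, so that it makes sense before integrability is established and can pass
  through Tonelli's theorem.\<close>

definition wnorm :: "real \<Rightarrow> (real \<Rightarrow> real) \<Rightarrow> ennreal" where
  "wnorm b g = (\<integral>\<^sup>+x. ennreal \<bar>g x\<bar> \<partial>lagm b)"

lemma primD:
  assumes "prim g h"
  shows "g \<in> borel_measurable borel" "h \<in> borel_measurable borel"
    "\<And>a b. 0 < a \<Longrightarrow> a \<le> b \<Longrightarrow> set_integrable lborel {a..b} h"
    "\<And>a b. 0 < a \<Longrightarrow> a \<le> b \<Longrightarrow> g b - g a = (LINT s:{a..b}|lborel. h s)"
  using assms unfolding prim_def by blast+

lemma prim_poly: "prim (poly p) (poly (pderiv p))"
  unfolding prim_def
proof (intro conjI allI impI)
  fix a b :: real assume "0 < a" "a \<le> b"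
  show "set_integrable lborel {a..b} (poly (pderiv p))"
    unfolding set_integrable_def by (intro borel_integrable_compact continuous_intros) simp
  show "poly p b - poly p a = (LINT s:{a..b}|lborel. poly (pderiv p) s)"
    unfolding set_lebesgue_integral_def
    by (simp only: real_scaleR_def mult.commute[of "indicator _ _"])
       (rule integral_FTC_Icc_real[symmetric], use \<open>a \<le> b\<close> in \<open>auto intro!: poly_DERIV\<close>)
qed measurable

lemma prim_diff:
  assumes "prim g h" "prim g' h'"
  shows "prim (\<lambda>x. g x - g' x) (\<lambda>x. h x - h' x)"
proof -
  note [measurable] = primD(1,2)[OF assms(1)] primD(1,2)[OF assms(2)]
  show ?thesis unfolding prim_def
  proof (intro conjI allI impI)
    fix a b :: real assume ab: "0 < a" "a \<le> b"
    note i = primD(3)[OF assms(1) ab] primD(3)[OF assms(2) ab]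
    show "set_integrable lborel {a..b} (\<lambda>x. h x - h' x)" using i by (rule set_integral_diff(1))
    show "g b - g' b - (g a - g' a) = (LINT s:{a..b}|lborel. h s - h' s)"
      unfolding set_integral_diff(2)[OF i] using primD(4)[OF assms(1) ab] primD(4)[OF assms(2) ab] by simp
  qed measurable
qed

lemma lag_w_half: "s > 0 \<Longrightarrow> lag_w (b + 1/2) s = sqrt s * lag_w b s"
  by (simp add: lag_w_def powr_add powr_half_sqrt)

lemma wnorm_half:
  assumes [measurable]: "h \<in> borel_measurable borel"
  shows "wnorm (b + 1/2) h = (\<integral>\<^sup>+s. ennreal (indicator {0<..} s * (sqrt s * lag_w b s)) * ennreal \<bar>h s\<bar> \<partial>lborel)"
  unfolding wnorm_def
  by (subst nn_integral_lagm) (auto intro!: nn_integral_cong simp: indicator_def lag_w_half)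

section \<open>Tail masses and a Hardy-type inequality\<close>

lemma lag_w_tendsto_0: "(lag_w b \<longlongrightarrow> 0) at_top"
proof -
  define k where "k = nat \<lceil>\<bar>b\<bar>\<rceil>"
  have k: "b \<le> real k" unfolding k_def by linarith
  have "((\<lambda>x::real. x ^ k / exp x) \<longlongrightarrow> 0) at_top" by (rule tendsto_power_div_exp_0)
  moreover have "\<forall>\<^sub>F x::real in at_top. norm (lag_w b x) \<le> x ^ k / exp x"
    using eventually_ge_at_top[of 1]
  proof eventually_elim
    case (elim x)
    have "x powr b \<le> x powr real k" using elim k by (intro powr_mono) auto
    then show ?case using elim by (simp add: lag_w_def powr_realpow exp_minus field_simps)
  qed
  ultimately show ?thesis by (rule Lim_null_comparison[rotated])
qed

text \<open>Beyond \<open>s0\<close> one has \<open>2 b / x <= 1\<close>, so the weight is at most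
  the derivative of \<open>- 2 * lag_w b x\<close>, which integrates exactly. Between 1 and
  \<open>s0\<close> the total mass is compared with a lower bound for the weight.\<close>

lemma lagm_tail:
  assumes b: "b > -1"
  shows "\<exists>C>0. \<forall>s\<ge>1. emeasure (lagm b) {s..} \<le> ennreal (C * lag_w b s)"
proof -
  define s0 where "s0 = 2 * \<bar>b\<bar> + 1"
  have s0: "s0 \<ge> 1" by (simp add: s0_def)
  have G: "Gamma (b + 1) > 0" using b by (intro Gamma_real_pos) auto
  define C where "C = 2 + Gamma (b + 1) * (s0 powr \<bar>b\<bar> * exp s0)"
  have C: "C \<ge> 2" "C > 0" using G by (auto simp: C_def intro!: add_pos_nonneg)
  have "emeasure (lagm b) {s..} \<le> ennreal (C * lag_w b s)" if s: "s \<ge> 1" for s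
  proof (cases "s \<ge> s0")
    case True
    have "emeasure (lagm b) {s..} = (\<integral>\<^sup>+x. indicator {s..} x \<partial>lagm b)" by simp
    also have "\<dots> = (\<integral>\<^sup>+x. ennreal (indicator {0<..} x * lag_w b x) * indicator {s..} x \<partial>lborel)"
      by (intro nn_integral_lagm) auto
    also have "\<dots> \<le> (\<integral>\<^sup>+x. ennreal (2 * lag_w b x - 2 * b / x * lag_w b x) * indicator {s..} x \<partial>lborel)"
    proof (intro nn_integral_mono)
      fix x
      have "lag_w b x \<le> 2 * lag_w b x - 2 * b / x * lag_w b x" if "x \<ge> s"
      proof -
        have "2 * b / x \<le> 1" using that True s by (simp add: s0_def field_simps)
        then have "2 * b / x * lag_w b x \<le> 1 * lag_w b x" by (intro mult_right_mono) auto
        then show ?thesis by simp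
      qed
      then show "ennreal (indicator {0<..} x * lag_w b x) * indicator {s..} x
          \<le> ennreal (2 * lag_w b x - 2 * b / x * lag_w b x) * indicator {s..} x"
        using s by (auto simp: indicator_def intro!: ennreal_leI)
    qed
    also have "\<dots> = ennreal (0 - (- 2 * lag_w b s))"
    proof (rule nn_integral_FTC_atLeast)
      show "(\<lambda>x. 2 * lag_w b x - 2 * b / x * lag_w b x) \<in> borel_measurable borel" by measurable
      show "((\<lambda>x. - 2 * lag_w b x) has_real_derivative 2 * lag_w b x - 2 * b / x * lag_w b x) (at x)" if "s \<le> x" for x
      proof -
        have "x powr (b - 1) = x powr b / x" using that s by (simp add: powr_diff)
        then show ?thesis using that s unfolding lag_w_def
          by (auto intro!: derivative_eq_intros simp: field_simps)
      qed
      show "0 \<le> 2 * lag_w b x - 2 * b / x * lag_w b x" if "s \<le> x" for x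
      proof -
        have "2 * b / x \<le> 1" using that True s by (simp add: s0_def field_simps)
        then have "2 * b / x * lag_w b x \<le> 1 * lag_w b x" by (intro mult_right_mono) auto
        then show ?thesis using lag_w_nonneg[of b x] by linarith
      qed
      show "((\<lambda>x. - 2 * lag_w b x) \<longlongrightarrow> 0) at_top"
        using tendsto_mult[OF tendsto_const[of "- 2"] lag_w_tendsto_0[of b]] by simp
    qed
    also have "\<dots> \<le> ennreal (C * lag_w b s)" using C by (intro ennreal_leI) (simp add: mult_right_mono)
    finally show ?thesis .
  next
    case False
    have "emeasure (lagm b) {s..} \<le> emeasure (lagm b) UNIV" by (intro emeasure_mono) auto
    also have "\<dots> = ennreal (Gamma (b + 1))" by (rule lagm_UNIV_pos[OF b])
    also have "\<dots> \<le> ennreal (C * lag_w b s)"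
    proof (rule ennreal_leI)
      have "s powr (- b) \<le> s0 powr \<bar>b\<bar>"
      proof -
        have "s powr (- b) \<le> s powr \<bar>b\<bar>" using s by (intro powr_mono) auto
        also have "\<dots> \<le> s0 powr \<bar>b\<bar>" using s False by (intro powr_mono2) auto
        finally show ?thesis .
      qed
      moreover have "exp s \<le> exp s0" using False by simp
      ultimately have "s powr (- b) * exp s \<le> s0 powr \<bar>b\<bar> * exp s0" by (intro mult_mono) auto
      then have "(s powr (- b) * exp s) * lag_w b s \<le> (s0 powr \<bar>b\<bar> * exp s0) * lag_w b s"
        by (intro mult_right_mono) auto
      moreover have "(s powr (- b) * exp s) * lag_w b s = 1"
        using s by (simp add: lag_w_def powr_minus exp_minus field_simps)
      ultimately have "Gamma (b + 1) * 1 \<le> Gamma (b + 1) * ((s0 powr \<bar>b\<bar> * exp s0) * lag_w b s)"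
        using G by (intro mult_left_mono) auto
      also have "\<dots> \<le> C * lag_w b s" by (simp add: C_def algebra_simps)
      finally show "Gamma (b + 1) \<le> C * lag_w b s" by simp
    qed
    finally show ?thesis .
  qed
  then show ?thesis using C by blast
qed

lemma prim_abs_diff_le:
  assumes "prim g h" "0 < a" "a \<le> b"
  shows "ennreal \<bar>g b - g a\<bar> \<le> (\<integral>\<^sup>+s. indicator {a..b} s * ennreal \<bar>h s\<bar> \<partial>lborel)"
proof -
  note [measurable] = primD(1,2)[OF assms(1)]
  have "ennreal \<bar>g b - g a\<bar> = ennreal (norm (\<integral>s. indicator {a..b} s *\<^sub>R h s \<partial>lborel))"
    using primD(4)[OF assms] by (simp add: set_lebesgue_integral_def)
  also have "\<dots> \<le> (\<integral>\<^sup>+s. norm (indicator {a..b} s *\<^sub>R h s) \<partial>lborel)"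
    using primD(3)[OF assms] unfolding set_integrable_def by (rule integral_norm_bound_ennreal)
  also have "\<dots> = (\<integral>\<^sup>+s. indicator {a..b} s * ennreal \<bar>h s\<bar> \<partial>lborel)"
    by (intro nn_integral_cong) (simp add: indicator_def)
  finally show ?thesis .
qed

lemma sigma_finite_lagm: "b > -1 \<Longrightarrow> sigma_finite_measure (lagm b)"
  using finite_measure_lagm[of b] by (simp add: finite_measure_def)

lemma lagm_Fubini:
  assumes b: "b > -1" and [measurable]: "case_prod f \<in> borel_measurable (borel \<Otimes>\<^sub>M borel)"
  shows "(\<integral>\<^sup>+x. \<integral>\<^sup>+s. f s x \<partial>lborel \<partial>lagm b) = (\<integral>\<^sup>+s. \<integral>\<^sup>+x. f s x \<partial>lagm b \<partial>lborel)"
proof -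
  interpret L: sigma_finite_measure "lagm b" by (rule sigma_finite_lagm[OF b])
  interpret pair_sigma_finite lborel "lagm b" ..
  show ?thesis by (rule Fubini') measurable
qed

text \<open>Writing the difference as an integral of \<open>h\<close> from \<open>T\<close> to
  \<open>x\<close> and exchanging the integrals leaves the mass to the right of \<open>s\<close> as
  kernel; \<open>head_diff_bound\<close> is the mirror image with the mass to the left.\<close>

lemma tail_diff_bound:
  assumes b: "b > -1" and g: "prim g h" and T: "T > 0"
  shows "(\<integral>\<^sup>+x. ennreal \<bar>g x - g (min x T)\<bar> \<partial>lagm b)
    \<le> (\<integral>\<^sup>+s. indicator {T..} s * ennreal \<bar>h s\<bar> * emeasure (lagm b) {s..} \<partial>lborel)"
proof -
  note [measurable] = primD(1,2)[OF g]
  have "(\<integral>\<^sup>+x. ennreal \<bar>g x - g (min x T)\<bar> \<partial>lagm b)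
      \<le> (\<integral>\<^sup>+x. \<integral>\<^sup>+s. (if T \<le> s \<and> s \<le> x then ennreal \<bar>h s\<bar> else 0) \<partial>lborel \<partial>lagm b)"
  proof (intro nn_integral_mono)
    fix x
    show "ennreal \<bar>g x - g (min x T)\<bar> \<le> (\<integral>\<^sup>+s. (if T \<le> s \<and> s \<le> x then ennreal \<bar>h s\<bar> else 0) \<partial>lborel)"
    proof (cases "x \<le> T")
      case False
      then have "ennreal \<bar>g x - g T\<bar> \<le> (\<integral>\<^sup>+s. indicator {T..x} s * ennreal \<bar>h s\<bar> \<partial>lborel)"
        using T by (intro prim_abs_diff_le[OF g]) auto
      also have "\<dots> = (\<integral>\<^sup>+s. (if T \<le> s \<and> s \<le> x then ennreal \<bar>h s\<bar> else 0) \<partial>lborel)"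
        by (intro nn_integral_cong) (auto simp: indicator_def)
      finally show ?thesis using False by (simp add: min_def)
    qed (simp add: min_def)
  qed
  also have "\<dots> = (\<integral>\<^sup>+s. \<integral>\<^sup>+x. (if T \<le> s \<and> s \<le> x then ennreal \<bar>h s\<bar> else 0) \<partial>lagm b \<partial>lborel)"
    by (rule lagm_Fubini[OF b]) measurable
  also have "\<dots> = (\<integral>\<^sup>+s. indicator {T..} s * ennreal \<bar>h s\<bar> * emeasure (lagm b) {s..} \<partial>lborel)"
  proof (intro nn_integral_cong)
    fix s
    have "(\<integral>\<^sup>+x. (if T \<le> s \<and> s \<le> x then ennreal \<bar>h s\<bar> else 0) \<partial>lagm b)
        = (\<integral>\<^sup>+x. (indicator {T..} s * ennreal \<bar>h s\<bar>) * indicator {s..} x \<partial>lagm b)"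
      by (intro nn_integral_cong) (auto simp: indicator_def)
    also have "\<dots> = indicator {T..} s * ennreal \<bar>h s\<bar> * emeasure (lagm b) {s..}"
      by (subst nn_integral_cmult) auto
    finally show "(\<integral>\<^sup>+x. (if T \<le> s \<and> s \<le> x then ennreal \<bar>h s\<bar> else 0) \<partial>lagm b)
        = indicator {T..} s * ennreal \<bar>h s\<bar> * emeasure (lagm b) {s..}" .
  qed
  finally show ?thesis .
qed

lemma head_diff_bound:
  assumes b: "b > -1" and g: "prim g h" and T: "T > 0"
  shows "(\<integral>\<^sup>+x. ennreal \<bar>g T - g (min x T)\<bar> \<partial>lagm b)
    \<le> (\<integral>\<^sup>+s. indicator {0<..T} s * ennreal \<bar>h s\<bar> * emeasure (lagm b) {..s} \<partial>lborel)"
proof -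
  note [measurable] = primD(1,2)[OF g]
  have "(\<integral>\<^sup>+x. ennreal \<bar>g T - g (min x T)\<bar> \<partial>lagm b)
      \<le> (\<integral>\<^sup>+x. \<integral>\<^sup>+s. (if 0 < s \<and> s \<le> T \<and> x \<le> s then ennreal \<bar>h s\<bar> else 0) \<partial>lborel \<partial>lagm b)"
  proof (rule nn_integral_mono_AE)
    show "AE x in lagm b. ennreal \<bar>g T - g (min x T)\<bar>
        \<le> (\<integral>\<^sup>+s. (if 0 < s \<and> s \<le> T \<and> x \<le> s then ennreal \<bar>h s\<bar> else 0) \<partial>lborel)"
      using AE_lagm_pos[of b]
    proof eventually_elim
      case (elim x)
      show ?case
      proof (cases "x \<le> T")
        case True
        then have "ennreal \<bar>g T - g x\<bar> \<le> (\<integral>\<^sup>+s. indicator {x..T} s * ennreal \<bar>h s\<bar> \<partial>lborel)"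
          using elim by (intro prim_abs_diff_le[OF g]) auto
        also have "\<dots> = (\<integral>\<^sup>+s. (if 0 < s \<and> s \<le> T \<and> x \<le> s then ennreal \<bar>h s\<bar> else 0) \<partial>lborel)"
          using elim by (intro nn_integral_cong) (auto simp: indicator_def)
        finally show ?thesis using True by (simp add: min_def)
      qed (simp add: min_def)
    qed
  qed
  also have "\<dots> = (\<integral>\<^sup>+s. \<integral>\<^sup>+x. (if 0 < s \<and> s \<le> T \<and> x \<le> s then ennreal \<bar>h s\<bar> else 0) \<partial>lagm b \<partial>lborel)"
    by (rule lagm_Fubini[OF b]) measurable
  also have "\<dots> = (\<integral>\<^sup>+s. indicator {0<..T} s * ennreal \<bar>h s\<bar> * emeasure (lagm b) {..s} \<partial>lborel)"
  proof (intro nn_integral_cong)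
    fix s
    have "(\<integral>\<^sup>+x. (if 0 < s \<and> s \<le> T \<and> x \<le> s then ennreal \<bar>h s\<bar> else 0) \<partial>lagm b)
        = (\<integral>\<^sup>+x. (indicator {0<..T} s * ennreal \<bar>h s\<bar>) * indicator {..s} x \<partial>lagm b)"
      by (intro nn_integral_cong) (auto simp: indicator_def)
    also have "\<dots> = indicator {0<..T} s * ennreal \<bar>h s\<bar> * emeasure (lagm b) {..s}"
      by (subst nn_integral_cmult) auto
    finally show "(\<integral>\<^sup>+x. (if 0 < s \<and> s \<le> T \<and> x \<le> s then ennreal \<bar>h s\<bar> else 0) \<partial>lagm b)
        = indicator {0<..T} s * ennreal \<bar>h s\<bar> * emeasure (lagm b) {..s}" .
  qed
  finally show ?thesis .
qed

text \<open>Both kernels are at most a constant times \<open>sqrt s * lag_w b s\<close>: below 1 the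
  mass near the origin has order \<open>s powr (b + 1)\<close> and \<open>s <= sqrt s\<close>; above
  1 the tail has order \<open>lag_w b s\<close> and \<open>1 <= sqrt s\<close>.\<close>

lemma poincare:
  assumes b: "b > -1"
  shows "\<exists>C>0. \<forall>g h. prim g h \<longrightarrow> wnorm b (\<lambda>x. g x - g 1) \<le> ennreal C * wnorm (b + 1/2) h"
proof -
  obtain C1 where C1: "C1 > 0" "\<And>s. s \<ge> 1 \<Longrightarrow> emeasure (lagm b) {s..} \<le> ennreal (C1 * lag_w b s)"
    using lagm_tail[OF b] by blast
  define C where "C = C1 + exp 1 / (b + 1)"
  have C: "C > 0" "C1 \<le> C" "exp 1 / (b + 1) \<le> C" using C1(1) b by (auto simp: C_def intro!: add_pos_pos)
  have "wnorm b (\<lambda>x. g x - g 1) \<le> ennreal (2 * C) * wnorm (b + 1/2) h" if g: "prim g h" for g h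
  proof -
    note [measurable] = primD(1,2)[OF g]
    have "wnorm b (\<lambda>x. g x - g 1) \<le> (\<integral>\<^sup>+x. ennreal \<bar>g 1 - g (min x 1)\<bar> + ennreal \<bar>g x - g (min x 1)\<bar> \<partial>lagm b)"
      unfolding wnorm_def
      by (intro nn_integral_mono) (auto simp: min_def abs_minus_commute)
    also have "\<dots> = (\<integral>\<^sup>+x. ennreal \<bar>g 1 - g (min x 1)\<bar> \<partial>lagm b) + (\<integral>\<^sup>+x. ennreal \<bar>g x - g (min x 1)\<bar> \<partial>lagm b)"
      by (rule nn_integral_add) auto
    also have "\<dots> \<le> ennreal C * wnorm (b + 1/2) h + ennreal C * wnorm (b + 1/2) h"
    proof (rule add_mono)
      have "(\<integral>\<^sup>+x. ennreal \<bar>g 1 - g (min x 1)\<bar> \<partial>lagm b)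
        \<le> (\<integral>\<^sup>+s. indicator {0<..1} s * ennreal \<bar>h s\<bar> * emeasure (lagm b) {..s} \<partial>lborel)"
        by (rule head_diff_bound[OF b g]) simp
      also have "\<dots> \<le> (\<integral>\<^sup>+s. ennreal C * (ennreal (indicator {0<..} s * (sqrt s * lag_w b s)) * ennreal \<bar>h s\<bar>) \<partial>lborel)"
      proof (intro nn_integral_mono)
        fix s
        show "indicator {0<..1} s * ennreal \<bar>h s\<bar> * emeasure (lagm b) {..s}
          \<le> ennreal C * (ennreal (indicator {0<..} s * (sqrt s * lag_w b s)) * ennreal \<bar>h s\<bar>)"
        proof (cases "0 < s \<and> s \<le> 1")
          case True
          interpret finite_measure "lagm b" by (rule finite_measure_lagm[OF b])
          have "measure (lagm b) {..s} \<le> s powr (b + 1) / (b + 1)" using True by (intro measure_lagm_near_0[OF b]) auto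
          also have "s powr (b + 1) = s powr b * (sqrt s * sqrt s)" using True by (simp add: powr_add)
          also have "\<dots> \<le> s powr b * (sqrt s * (exp 1 * exp (- s)))"
          proof -
            have "sqrt s \<le> 1" "1 \<le> exp 1 * exp (- s)" using True by (auto simp flip: exp_add)
            then have "sqrt s \<le> exp 1 * exp (- s)" by (rule order.trans)
            then show ?thesis using True by (intro mult_left_mono) auto
          qed
          also have "\<dots> / (b + 1) = exp 1 / (b + 1) * (sqrt s * lag_w b s)" by (simp add: lag_w_def)
          also have "\<dots> \<le> C * (sqrt s * lag_w b s)" using C True by (intro mult_right_mono) auto
          finally have m: "measure (lagm b) {..s} \<le> C * (sqrt s * lag_w b s)" using b by (simp add: divide_right_mono)
          have "indicator {0<..1} s * ennreal \<bar>h s\<bar> * emeasure (lagm b) {..s} = ennreal \<bar>h s\<bar> * ennreal (measure (lagm b) {..s})"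
            using True by (simp add: emeasure_eq_measure)
          also have "\<dots> \<le> ennreal \<bar>h s\<bar> * ennreal (C * (sqrt s * lag_w b s))" by (intro mult_left_mono ennreal_leI m) auto
          also have "\<dots> = ennreal C * (ennreal (indicator {0<..} s * (sqrt s * lag_w b s)) * ennreal \<bar>h s\<bar>)"
            using True C by (simp add: mult_ac flip: ennreal_mult)
          finally show ?thesis .
        qed auto
      qed
      also have "\<dots> = ennreal C * wnorm (b + 1/2) h"
        by (subst wnorm_half) (auto intro!: nn_integral_cmult)
      finally show "(\<integral>\<^sup>+x. ennreal \<bar>g 1 - g (min x 1)\<bar> \<partial>lagm b) \<le> ennreal C * wnorm (b + 1/2) h" .
    next
      have "(\<integral>\<^sup>+x. ennreal \<bar>g x - g (min x 1)\<bar> \<partial>lagm b)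
        \<le> (\<integral>\<^sup>+s. indicator {1..} s * ennreal \<bar>h s\<bar> * emeasure (lagm b) {s..} \<partial>lborel)"
        by (rule tail_diff_bound[OF b g]) simp
      also have "\<dots> \<le> (\<integral>\<^sup>+s. ennreal C * (ennreal (indicator {0<..} s * (sqrt s * lag_w b s)) * ennreal \<bar>h s\<bar>) \<partial>lborel)"
      proof (intro nn_integral_mono)
        fix s
        show "indicator {1..} s * ennreal \<bar>h s\<bar> * emeasure (lagm b) {s..}
          \<le> ennreal C * (ennreal (indicator {0<..} s * (sqrt s * lag_w b s)) * ennreal \<bar>h s\<bar>)"
        proof (cases "s \<ge> 1")
          case True
          have "indicator {1..} s * ennreal \<bar>h s\<bar> * emeasure (lagm b) {s..} \<le> ennreal \<bar>h s\<bar> * ennreal (C1 * lag_w b s)"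
            using True C1(2)[OF True] by (auto intro!: mult_left_mono)
          also have "\<dots> \<le> ennreal \<bar>h s\<bar> * ennreal (C * (sqrt s * lag_w b s))"
          proof (intro mult_left_mono ennreal_leI)
            have "1 * lag_w b s \<le> sqrt s * lag_w b s" using True by (intro mult_right_mono) auto
            then show "C1 * lag_w b s \<le> C * (sqrt s * lag_w b s)" using C C1(1) by (intro mult_mono) auto
          qed auto
          also have "\<dots> = ennreal C * (ennreal (indicator {0<..} s * (sqrt s * lag_w b s)) * ennreal \<bar>h s\<bar>)"
            using True C by (simp add: mult_ac flip: ennreal_mult)
          finally show ?thesis .
        qed auto
      qed
      also have "\<dots> = ennreal C * wnorm (b + 1/2) h"
        by (subst wnorm_half) (auto intro!: nn_integral_cmult)
      finally show "(\<integral>\<^sup>+x. ennreal \<bar>g x - g (min x 1)\<bar> \<partial>lagm b) \<le> ennreal C * wnorm (b + 1/2) h" .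
    qed
    also have "\<dots> = ennreal (2 * C) * wnorm (b + 1/2) h"
      using C by (simp add: ennreal_mult mult.assoc flip: mult_2)
    finally show ?thesis .
  qed
  then show ?thesis using C by (intro exI[of _ "2 * C"]) auto
qed

section \<open>Superposition of step approximants\<close>

lemma Lam_step_increment:
  assumes b: "b > -1" and D: "step_bound b \<theta> C m D" and z: "z \<in> Zs b m"
  shows "Lam b (D z) = lamz b m z"
proof -
  define e where "e u = Lam b (D u) - lamz b m u" for u
  have e0: "(\<Sum>u\<in>{u\<in>Zs b m. u \<le> s}. e u) = 0" for s
    using D unfolding step_bound_def step_sum_def by (simp add: e_def sum_subtractf Lam_sum[OF b])
  have "(\<Sum>u\<in>{u\<in>Zs b m. u < z}. e u) = 0"
  proof (cases "{u\<in>Zs b m. u < z} = {}")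
    case False
    have "Max {u\<in>Zs b m. u < z} \<in> {u\<in>Zs b m. u < z}" using False by (intro Max_in) auto
    moreover have "u \<le> Max {u\<in>Zs b m. u < z}" if "u \<in> Zs b m" "u < z" for u
      using that by (intro Max_ge) auto
    ultimately have "{u\<in>Zs b m. u < z} = {u\<in>Zs b m. u \<le> Max {u\<in>Zs b m. u < z}}" by fastforce
    then show ?thesis using e0 by metis
  next
    case True
    show ?thesis unfolding True by simp
  qed
  moreover have "{u\<in>Zs b m. u \<le> z} = insert z {u\<in>Zs b m. u < z}" using z by auto
  then have "(\<Sum>u\<in>{u\<in>Zs b m. u \<le> z}. e u) = e z + (\<Sum>u\<in>{u\<in>Zs b m. u < z}. e u)" by simp
  ultimately show ?thesis using e0[of z] by (simp add: e_def)
qed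

text \<open>This is \<open>g(T) - \<integral>\<^sub>0\<^sup>T g'(s) P\<^sub>s ds\<close> with the step approximants \<open>P\<^sub>s = step_sum b m D s\<close>, which
  are constant in \<open>s\<close> between the nodes.\<close>
definition step_approx :: "real \<Rightarrow> nat \<Rightarrow> (real \<Rightarrow> real poly) \<Rightarrow> real \<Rightarrow> (real \<Rightarrow> real) \<Rightarrow> real poly" where
  "step_approx b m D T g = [:g T:] - (\<Sum>z\<in>{z\<in>Zs b m. z \<le> T}. smult (g T - g z) (D z))"

text \<open>The constant \<open>g T\<close> is distributed over all \<open>m\<close> nodes and then
  replaced by \<open>g z\<close> at the nodes up to \<open>T\<close>. The nodes beyond
  \<open>T\<close> keep \<open>g T\<close>, and this is the origin of the boundary term in the
  quadrature error.\<close>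

lemma Lam_step_approx:
  assumes b: "b > -1" and D: "step_bound b \<theta> C m D" and m: "m \<ge> 1"
  shows "Lam b (step_approx b m D T g)
    = (\<Sum>z\<in>{z\<in>Zs b m. z \<le> T}. lamz b m z * g z) + g T * (\<Sum>z\<in>{z\<in>Zs b m. z > T}. lamz b m z)"
proof -
  have "Lam b [:g T:] = (\<Sum>z\<in>Zs b m. lamz b m z * g T)" using m by (subst gauss[OF b]) auto
  also have "\<dots> = (\<Sum>z\<in>{z\<in>Zs b m. z \<le> T} \<union> {z\<in>Zs b m. z > T}. lamz b m z * g T)"
    by (intro sum.cong) auto
  also have "\<dots> = (\<Sum>z\<in>{z\<in>Zs b m. z \<le> T}. lamz b m z * g T) + (\<Sum>z\<in>{z\<in>Zs b m. z > T}. lamz b m z * g T)"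
    by (intro sum.union_disjoint) auto
  finally have 1: "Lam b [:g T:] = \<dots>" .
  have "Lam b (\<Sum>z\<in>{z\<in>Zs b m. z \<le> T}. smult (g T - g z) (D z)) = (\<Sum>z\<in>{z\<in>Zs b m. z \<le> T}. (g T - g z) * lamz b m z)"
    unfolding Lam_sum[OF b] Lam_smult[OF b]
    by (intro sum.cong refl) (simp add: Lam_step_increment[OF b D])
  then show ?thesis unfolding step_approx_def Lam_diff[OF b] 1
    by (simp add: sum_distrib_left algebra_simps sum_subtractf)
qed

lemma degree_step_approx:
  assumes "step_bound b \<theta> C m D" "m \<ge> 1"
  shows "degree (step_approx b m D T g) < 2 * m"
proof -
  have "degree (D z) \<le> 2 * m - 1" if "z \<in> Zs b m" for z
    using assms that unfolding step_bound_def by force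
  then have "degree (step_approx b m D T g) \<le> 2 * m - 1"
    unfolding step_approx_def
    by (intro degree_diff_le degree_sum_le order.trans[OF degree_smult_le]) auto
  then show ?thesis using assms(2) by simp
qed

text \<open>The difference is minus the integral over \<open>s\<close> of \<open>h s\<close> times
  \<open>k s x\<close>, the error of the step approximant at threshold \<open>s\<close>. Tonelli's
  theorem then inserts the bound of \<open>step_bound\<close> for each \<open>s\<close>.\<close>

lemma step_approx_error:
  assumes b: "b > -1" and D: "step_bound b \<theta> C m D" and C: "C > 0" and m: "m \<ge> 1" and th: "0 < \<theta>"
    and g: "prim g h" and T: "T = 4 * \<theta> * real m"
  shows "(\<integral>\<^sup>+x. ennreal \<bar>g (min x T) - poly (step_approx b m D T g) x\<bar> \<partial>lagm b)
    \<le> ennreal (C / sqrt (real m)) * wnorm (b + 1/2) h"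
proof -
  note [measurable] = primD(1,2)[OF g]
  have Tp: "T > 0" using th m T by simp
  define k where "k s x = (if x \<le> s then 1 else 0) - (\<Sum>z\<in>Zs b m. if z \<le> s then poly (D z) x else 0)" for s x :: real
  have k_eq: "k s x = indicator {..s} x - poly (step_sum b m D s) x" for s x
    unfolding k_def step_sum_def poly_sum by (simp add: indicator_def sum.inter_filter)
  have "(\<integral>\<^sup>+x. ennreal \<bar>g (min x T) - poly (step_approx b m D T g) x\<bar> \<partial>lagm b)
     \<le> (\<integral>\<^sup>+x. \<integral>\<^sup>+s. (if 0 < s \<and> s \<le> T then ennreal \<bar>h s\<bar> * ennreal \<bar>k s x\<bar> else 0) \<partial>lborel \<partial>lagm b)"
  proof (rule nn_integral_mono_AE)
    show "AE x in lagm b. ennreal \<bar>g (min x T) - poly (step_approx b m D T g) x\<bar>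
        \<le> (\<integral>\<^sup>+s. (if 0 < s \<and> s \<le> T then ennreal \<bar>h s\<bar> * ennreal \<bar>k s x\<bar> else 0) \<partial>lborel)"
      using AE_lagm_pos[of b]
    proof eventually_elim
      case (elim x)
      \<comment> \<open>\<open>h\<close> may fail to be integrable at 0. For thresholds below
        \<open>x\<close> and below all nodes the kernel \<open>k s x\<close> vanishes, so integrals
        over \<open>{\<epsilon>..T}\<close> suffice.\<close>
      define \<epsilon> where "\<epsilon> = Min (insert x (insert T (Zs b m)))"
      have eps: "\<epsilon> > 0" "\<epsilon> \<le> x" "\<epsilon> \<le> T" "\<And>z. z \<in> Zs b m \<Longrightarrow> \<epsilon> \<le> z"
        unfolding \<epsilon>_def
      proof -
        show "Min (insert x (insert T (Zs b m))) > 0"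
          using elim Tp Zs_props(2)[OF b, of m] by (subst Min_gr_iff) auto
      qed (rule Min_le; simp)+
      have int: "integrable lborel (\<lambda>s. indicator {\<epsilon>..T} s * h s)"
        using primD(3)[OF g eps(1,3)] by (simp add: set_integrable_def)
      have inta: "integrable lborel (\<lambda>s. (if a \<le> s then 1 else 0) * (indicator {\<epsilon>..T} s * h s))" for a :: real
        by (rule Bochner_Integration.integrable_bound[OF int]) (auto simp: abs_mult)
      have ga: "g T - g a = (\<integral>s. (if a \<le> s then 1 else 0) * (indicator {\<epsilon>..T} s * h s) \<partial>lborel)"
        if "\<epsilon> \<le> a" "a \<le> T" for a
      proof -
        have "g T - g a = (\<integral>s. indicator {a..T} s * h s \<partial>lborel)"
          using primD(4)[OF g, of a T] that eps by (simp add: set_lebesgue_integral_def)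
        also have "\<dots> = (\<integral>s. (if a \<le> s then 1 else 0) * (indicator {\<epsilon>..T} s * h s) \<partial>lborel)"
          using that by (intro Bochner_Integration.integral_cong) (auto simp: indicator_def)
        finally show ?thesis .
      qed
      have gx: "g T - g (min x T) = (\<integral>s. (if x \<le> s then 1 else 0) * (indicator {\<epsilon>..T} s * h s) \<partial>lborel)"
      proof (cases "x \<le> T")
        case True
        then show ?thesis using ga[of x] eps by (simp add: min_def)
      next
        case False
        have "(\<lambda>s. (if x \<le> s then 1 else 0) * (indicator {\<epsilon>..T} s * h s)) = (\<lambda>s. 0)"
          using False by (auto simp: indicator_def fun_eq_iff)
        then show ?thesis using False by (simp add: min_def)
      qed
      have sum_eq: "(\<Sum>z\<in>{z\<in>Zs b m. z \<le> T}. (g T - g z) * poly (D z) x)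
          = (\<integral>s. (\<Sum>z\<in>{z\<in>Zs b m. z \<le> T}. poly (D z) x * ((if z \<le> s then 1 else 0) * (indicator {\<epsilon>..T} s * h s))) \<partial>lborel)"
      proof (subst Bochner_Integration.integral_sum)
        show "integrable lborel (\<lambda>s. poly (D z) x * ((if z \<le> s then 1 else 0) * (indicator {\<epsilon>..T} s * h s)))" for z
          by (rule integrable_mult_right[OF inta])
        show "(\<Sum>z\<in>{z\<in>Zs b m. z \<le> T}. (g T - g z) * poly (D z) x)
          = (\<Sum>z\<in>{z\<in>Zs b m. z \<le> T}. \<integral>s. poly (D z) x * ((if z \<le> s then 1 else 0) * (indicator {\<epsilon>..T} s * h s)) \<partial>lborel)"
        proof (intro sum.cong refl)
          fix z assume z: "z \<in> {z\<in>Zs b m. z \<le> T}"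
          then have "g T - g z = (\<integral>s. (if z \<le> s then 1 else 0) * (indicator {\<epsilon>..T} s * h s) \<partial>lborel)"
            using eps by (intro ga) auto
          then show "(g T - g z) * poly (D z) x = (\<integral>s. poly (D z) x * ((if z \<le> s then 1 else 0) * (indicator {\<epsilon>..T} s * h s)) \<partial>lborel)"
            by (simp only: integral_mult_right_zero mult.commute)
        qed
      qed
      have "g (min x T) - poly (step_approx b m D T g) x
          = (\<Sum>z\<in>{z\<in>Zs b m. z \<le> T}. (g T - g z) * poly (D z) x) - (g T - g (min x T))"
        unfolding step_approx_def by (simp add: poly_sum)
      also have "\<dots> = (\<integral>s. (\<Sum>z\<in>{z\<in>Zs b m. z \<le> T}. poly (D z) x * ((if z \<le> s then 1 else 0) * (indicator {\<epsilon>..T} s * h s)))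
          - (if x \<le> s then 1 else 0) * (indicator {\<epsilon>..T} s * h s) \<partial>lborel)"
        unfolding sum_eq gx using inta
        by (subst Bochner_Integration.integral_diff) (auto intro!: Bochner_Integration.integrable_sum)
      also have "\<dots> = (\<integral>s. - k s x * (indicator {\<epsilon>..T} s * h s) \<partial>lborel)"
      proof (intro Bochner_Integration.integral_cong refl)
        fix s
        show "(\<Sum>z\<in>{z\<in>Zs b m. z \<le> T}. poly (D z) x * ((if z \<le> s then 1 else 0) * (indicator {\<epsilon>..T} s * h s)))
          - (if x \<le> s then 1 else 0) * (indicator {\<epsilon>..T} s * h s) = - k s x * (indicator {\<epsilon>..T} s * h s)"
        proof (cases "s \<le> T")
          case True
          have "(\<Sum>z\<in>{z\<in>Zs b m. z \<le> T}. poly (D z) x * ((if z \<le> s then 1 else 0) * (indicator {\<epsilon>..T} s * h s)))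
             = (\<Sum>z\<in>Zs b m. (if z \<le> s then poly (D z) x else 0) * (indicator {\<epsilon>..T} s * h s))"
            unfolding sum.inter_filter[OF finite_Zs] using True by (intro sum.cong) auto
          then show ?thesis unfolding k_def by (simp only: sum_distrib_right[symmetric] minus_diff_eq left_diff_distrib)
        qed simp
      qed
      finally have eq: "g (min x T) - poly (step_approx b m D T g) x = (\<integral>s. - k s x * (indicator {\<epsilon>..T} s * h s) \<partial>lborel)" .
      have "k s x * (indicator {\<epsilon>..T} s * h s) = (if x \<le> s then 1 else 0) * (indicator {\<epsilon>..T} s * h s)
           - (\<Sum>z\<in>Zs b m. poly (D z) x * ((if z \<le> s then 1 else 0) * (indicator {\<epsilon>..T} s * h s)))" for s
        unfolding k_def left_diff_distrib sum_distrib_right by (auto intro!: sum.cong)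
      then have "integrable lborel (\<lambda>s. k s x * (indicator {\<epsilon>..T} s * h s))"
        using inta by (auto intro!: Bochner_Integration.integrable_diff Bochner_Integration.integrable_sum)
      then have ik: "integrable lborel (\<lambda>s. - k s x * (indicator {\<epsilon>..T} s * h s))"
        using Bochner_Integration.integrable_minus by fastforce
      have "ennreal \<bar>g (min x T) - poly (step_approx b m D T g) x\<bar>
         \<le> (\<integral>\<^sup>+s. norm (- k s x * (indicator {\<epsilon>..T} s * h s)) \<partial>lborel)"
        unfolding eq using integral_norm_bound_ennreal[OF ik] by simp
      also have "\<dots> \<le> (\<integral>\<^sup>+s. (if 0 < s \<and> s \<le> T then ennreal \<bar>h s\<bar> * ennreal \<bar>k s x\<bar> else 0) \<partial>lborel)"
        using eps(1) by (intro nn_integral_mono) (auto simp: indicator_def abs_mult mult.commute simp flip: ennreal_mult)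
      finally show ?case .
    qed
  qed
  also have "\<dots> = (\<integral>\<^sup>+s. \<integral>\<^sup>+x. (if 0 < s \<and> s \<le> T then ennreal \<bar>h s\<bar> * ennreal \<bar>k s x\<bar> else 0) \<partial>lagm b \<partial>lborel)"
    unfolding k_def by (rule lagm_Fubini[OF b]) measurable
  also have "\<dots> \<le> (\<integral>\<^sup>+s. ennreal (C / sqrt (real m)) * (ennreal (indicator {0<..} s * (sqrt s * lag_w b s)) * ennreal \<bar>h s\<bar>) \<partial>lborel)"
  proof (intro nn_integral_mono)
    fix s
    show "(\<integral>\<^sup>+x. (if 0 < s \<and> s \<le> T then ennreal \<bar>h s\<bar> * ennreal \<bar>k s x\<bar> else 0) \<partial>lagm b)
       \<le> ennreal (C / sqrt (real m)) * (ennreal (indicator {0<..} s * (sqrt s * lag_w b s)) * ennreal \<bar>h s\<bar>)"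
    proof (cases "0 < s \<and> s \<le> T")
      case True
      have "(\<integral>\<^sup>+x. (if 0 < s \<and> s \<le> T then ennreal \<bar>h s\<bar> * ennreal \<bar>k s x\<bar> else 0) \<partial>lagm b)
         = ennreal \<bar>h s\<bar> * (\<integral>\<^sup>+x. ennreal \<bar>k s x\<bar> \<partial>lagm b)"
        using True unfolding k_eq by (simp add: nn_integral_cmult)
      also have "\<dots> \<le> ennreal \<bar>h s\<bar> * ennreal (C * sqrt (s / real m) * lag_w b s)"
        using D True T unfolding step_bound_def k_eq by (intro mult_left_mono) auto
      also have "\<dots> = ennreal (C / sqrt (real m)) * (ennreal (indicator {0<..} s * (sqrt s * lag_w b s)) * ennreal \<bar>h s\<bar>)"
        using True C m by (simp add: real_sqrt_divide mult_ac flip: ennreal_mult)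
      finally show ?thesis .
    next
      case False
      then show ?thesis by (simp only: if_False nn_integral_const) simp
    qed
  qed
  also have "\<dots> = ennreal (C / sqrt (real m)) * wnorm (b + 1/2) h"
    by (subst wnorm_half) (auto intro!: nn_integral_cmult)
  finally show ?thesis .
qed

text \<open>On \<open>s >= T\<close> the tail bound gains the factor
  \<open>sqrt s / sqrt T >= 1\<close>.\<close>

lemma tail_diff_wnorm:
  assumes b: "b > -1"
  shows "\<exists>C>0. \<forall>g h T. prim g h \<longrightarrow> T \<ge> 1 \<longrightarrow>
    (\<integral>\<^sup>+x. ennreal \<bar>g x - g (min x T)\<bar> \<partial>lagm b) \<le> ennreal (C / sqrt T) * wnorm (b + 1/2) h"
proof -
  obtain C where C: "C > 0" "\<And>s. s \<ge> 1 \<Longrightarrow> emeasure (lagm b) {s..} \<le> ennreal (C * lag_w b s)"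
    using lagm_tail[OF b] by blast
  have "(\<integral>\<^sup>+x. ennreal \<bar>g x - g (min x T)\<bar> \<partial>lagm b) \<le> ennreal (C / sqrt T) * wnorm (b + 1/2) h"
    if g: "prim g h" and T: "T \<ge> 1" for g h T
  proof -
    note [measurable] = primD(1,2)[OF g]
    have "(\<integral>\<^sup>+x. ennreal \<bar>g x - g (min x T)\<bar> \<partial>lagm b)
      \<le> (\<integral>\<^sup>+s. indicator {T..} s * ennreal \<bar>h s\<bar> * emeasure (lagm b) {s..} \<partial>lborel)"
      using T by (intro tail_diff_bound[OF b g]) simp
    also have "\<dots> \<le> (\<integral>\<^sup>+s. ennreal (C / sqrt T) * (ennreal (indicator {0<..} s * (sqrt s * lag_w b s)) * ennreal \<bar>h s\<bar>) \<partial>lborel)"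
    proof (intro nn_integral_mono)
      fix s
      show "indicator {T..} s * ennreal \<bar>h s\<bar> * emeasure (lagm b) {s..}
        \<le> ennreal (C / sqrt T) * (ennreal (indicator {0<..} s * (sqrt s * lag_w b s)) * ennreal \<bar>h s\<bar>)"
      proof (cases "s \<ge> T")
        case True
        then have s1: "s \<ge> 1" using T by simp
        have "indicator {T..} s * ennreal \<bar>h s\<bar> * emeasure (lagm b) {s..} \<le> ennreal \<bar>h s\<bar> * ennreal (C * lag_w b s)"
          using True C(2)[OF s1] by (auto intro!: mult_left_mono)
        also have "\<dots> \<le> ennreal \<bar>h s\<bar> * ennreal (C / sqrt T * (sqrt s * lag_w b s))"
        proof (intro mult_left_mono ennreal_leI)
          have "1 \<le> sqrt s / sqrt T" using True T by simp
          then have "C * 1 * lag_w b s \<le> C * (sqrt s / sqrt T) * lag_w b s"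
            using C(1) by (intro mult_right_mono mult_left_mono) auto
          then show "C * lag_w b s \<le> C / sqrt T * (sqrt s * lag_w b s)" by simp
        qed auto
        also have "\<dots> = ennreal (C / sqrt T) * (ennreal (indicator {0<..} s * (sqrt s * lag_w b s)) * ennreal \<bar>h s\<bar>)"
          using s1 T C by (simp add: mult_ac flip: ennreal_mult)
        finally show ?thesis .
      qed simp
    qed
    also have "\<dots> = ennreal (C / sqrt T) * wnorm (b + 1/2) h"
      by (subst wnorm_half) (auto intro!: nn_integral_cmult)
    finally show ?thesis .
  qed
  then show ?thesis using C(1) by blast
qed

text \<open>A Favard-type estimate. With \<open>\<theta> = 1/2\<close> the cut-off is
  \<open>T = 2 n\<close>, so the part beyond \<open>T\<close> costs \<open>1 / sqrt n\<close> just
  like the superposition of step approximants below \<open>T\<close>.\<close>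

lemma favard:
  assumes b: "b > -1"
  shows "\<exists>C>0. \<exists>n0\<ge>1. \<forall>n\<ge>n0. \<forall>g h. prim g h \<longrightarrow>
    (\<exists>p. degree p < 2 * n \<and> wnorm b (\<lambda>x. g x - poly p x) \<le> ennreal (C / sqrt (real n)) * wnorm (b + 1/2) h)"
proof -
  obtain C m0 where C: "C > 0" "m0 \<ge> 1" "\<And>m. m \<ge> m0 \<Longrightarrow> \<exists>D. step_bound b (1/2) C m D"
    using step_approximation[OF b, of "1/2"] by auto
  obtain C2 where C2: "C2 > 0" "\<And>g h T. prim g h \<Longrightarrow> T \<ge> 1 \<Longrightarrow>
      (\<integral>\<^sup>+x. ennreal \<bar>g x - g (min x T)\<bar> \<partial>lagm b) \<le> ennreal (C2 / sqrt T) * wnorm (b + 1/2) h"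
    using tail_diff_wnorm[OF b] by blast
  have "\<exists>p. degree p < 2 * n \<and> wnorm b (\<lambda>x. g x - poly p x) \<le> ennreal ((C + C2) / sqrt (real n)) * wnorm (b + 1/2) h"
    if n: "n \<ge> m0" and g: "prim g h" for n g h
  proof -
    note [measurable] = primD(1,2)[OF g]
    have n1: "n \<ge> 1" using n C(2) by simp
    obtain D where D: "step_bound b (1/2) C n D" using C(3)[OF n] by blast
    define T where "T = 4 * (1/2) * real n"
    define p where "p = step_approx b n D T g"
    have "wnorm b (\<lambda>x. g x - poly p x) \<le> (\<integral>\<^sup>+x. ennreal \<bar>g (min x T) - poly p x\<bar> + ennreal \<bar>g x - g (min x T)\<bar> \<partial>lagm b)"
      unfolding wnorm_def by (intro nn_integral_mono) (auto simp flip: ennreal_plus intro!: ennreal_leI)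
    also have "\<dots> = (\<integral>\<^sup>+x. ennreal \<bar>g (min x T) - poly p x\<bar> \<partial>lagm b) + (\<integral>\<^sup>+x. ennreal \<bar>g x - g (min x T)\<bar> \<partial>lagm b)"
      by (rule nn_integral_add) auto
    also have "\<dots> \<le> ennreal (C / sqrt (real n)) * wnorm (b + 1/2) h + ennreal (C2 / sqrt (real n)) * wnorm (b + 1/2) h"
    proof (rule add_mono)
      show "(\<integral>\<^sup>+x. ennreal \<bar>g (min x T) - poly p x\<bar> \<partial>lagm b) \<le> ennreal (C / sqrt (real n)) * wnorm (b + 1/2) h"
        unfolding p_def by (rule step_approx_error[OF b D C(1) n1 _ g T_def]) simp
      have "(\<integral>\<^sup>+x. ennreal \<bar>g x - g (min x T)\<bar> \<partial>lagm b) \<le> ennreal (C2 / sqrt T) * wnorm (b + 1/2) h"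
        using n1 by (intro C2(2)[OF g]) (simp add: T_def)
      also have "\<dots> \<le> ennreal (C2 / sqrt (real n)) * wnorm (b + 1/2) h"
        using n1 C2(1) by (intro mult_right_mono ennreal_leI divide_left_mono) (auto simp: T_def)
      finally show "(\<integral>\<^sup>+x. ennreal \<bar>g x - g (min x T)\<bar> \<partial>lagm b) \<le> ennreal (C2 / sqrt (real n)) * wnorm (b + 1/2) h" .
    qed
    also have "\<dots> = ennreal ((C + C2) / sqrt (real n)) * wnorm (b + 1/2) h"
      using C(1) C2(1) by (simp add: add_divide_distrib ennreal_plus distrib_right)
    finally show ?thesis using degree_step_approx[OF D n1, of T g] unfolding p_def by blast
  qed
  moreover have "C + C2 > 0" using C C2 by simp
  ultimately show ?thesis using C(2) by blast
qed

section \<open>Error of the truncated Gauss rule in terms of the first derivative\<close>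

definition trunc_err :: "real \<Rightarrow> nat \<Rightarrow> real \<Rightarrow> (real \<Rightarrow> real) \<Rightarrow> real" where
  "trunc_err b m T g = (\<integral>x. g x \<partial>lagm b) - (\<Sum>z\<in>{z\<in>Zs b m. z \<le> T}. lamz b m z * g z)"

text \<open>The error splits into the variation of \<open>g\<close> beyond \<open>T\<close>, the
  error of \<open>step_approx\<close>, and \<open>g T\<close> times the total weight of the dropped
  nodes. That weight differs from the mass beyond \<open>T\<close> by at most the step error at
  threshold \<open>T\<close>, and both have order \<open>lag_w b T\<close>.\<close>

lemma trunc_err_bound:
  assumes b: "b > -1" and th: "0 < \<theta>" "\<theta> < 1"
  shows "\<exists>C>0. \<exists>m0\<ge>1. \<forall>m\<ge>m0. \<forall>g h. prim g h \<longrightarrow> integrable (lagm b) g \<longrightarrow>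
    ennreal \<bar>trunc_err b m (4 * \<theta> * real m) g\<bar> \<le> ennreal (C / sqrt (real m)) * wnorm (b + 1/2) h
      + ennreal (C * lag_w b (4 * \<theta> * real m) * \<bar>g (4 * \<theta> * real m)\<bar>)"
proof -
  obtain C m0 where C: "C > 0" "m0 \<ge> 1" "\<And>m. m \<ge> m0 \<Longrightarrow> \<exists>D. step_bound b \<theta> C m D"
    using step_approximation[OF b th] by auto
  obtain C2 where C2: "C2 > 0" "\<And>g h T. prim g h \<Longrightarrow> T \<ge> 1 \<Longrightarrow>
      (\<integral>\<^sup>+x. ennreal \<bar>g x - g (min x T)\<bar> \<partial>lagm b) \<le> ennreal (C2 / sqrt T) * wnorm (b + 1/2) h"
    using tail_diff_wnorm[OF b] by blast
  obtain C3 where C3: "C3 > 0" "\<And>s. s \<ge> 1 \<Longrightarrow> emeasure (lagm b) {s..} \<le> ennreal (C3 * lag_w b s)"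
    using lagm_tail[OF b] by blast
  define C4 where "C4 = C + C2 / sqrt (4 * \<theta>) + C3 + C * sqrt (4 * \<theta>)"
  have C4: "C4 > 0" "C + C2 / sqrt (4 * \<theta>) \<le> C4" "C3 + C * sqrt (4 * \<theta>) \<le> C4"
    using C C2 C3 th by (auto simp: C4_def intro!: add_pos_pos add_nonneg_nonneg)
  \<comment> \<open>The second argument ensures \<open>T >= 1\<close>, as the tail estimates
    require.\<close>
  define m1 where "m1 = max m0 (nat \<lceil>1 / (4 * \<theta>)\<rceil>)"
  have "ennreal \<bar>trunc_err b m T g\<bar> \<le> ennreal (C4 / sqrt (real m)) * wnorm (b + 1/2) h + ennreal (C4 * lag_w b T * \<bar>g T\<bar>)"
    if m: "m \<ge> m1" and g: "prim g h" and ig: "integrable (lagm b) g" and T: "T = 4 * \<theta> * real m" for m g h T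
  proof -
    note [measurable] = primD(1,2)[OF g]
    have mm: "m \<ge> 1" "m \<ge> m0" using m C(2) by (auto simp: m1_def)
    have "1 / (4 * \<theta>) \<le> real m" using m unfolding m1_def by linarith
    then have T1: "T \<ge> 1" using th by (simp add: T field_simps)
    obtain D where D: "step_bound b \<theta> C m D" using C(3) mm by blast
    define p where "p = step_approx b m D T g"
    interpret finite_measure "lagm b" by (rule finite_measure_lagm[OF b])
    have i2: "integrable (lagm b) (\<lambda>x. g (min x T))"
    proof (rule Bochner_Integration.integrable_bound)
      show "integrable (lagm b) (\<lambda>x. \<bar>g x\<bar> + \<bar>g T\<bar>)" using ig by (intro Bochner_Integration.integrable_add) auto
      show "AE x in lagm b. norm (g (min x T)) \<le> norm (\<bar>g x\<bar> + \<bar>g T\<bar>)" by (auto simp: min_def)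
    qed measurable
    have i3: "integrable (lagm b) (poly p)" by (rule integrable_poly_lagm[OF b])
    let ?S = "\<Sum>z\<in>{z\<in>Zs b m. z > T}. lamz b m z"
    have "trunc_err b m T g = (\<integral>x. g x - g (min x T) \<partial>lagm b) + (\<integral>x. g (min x T) - poly p x \<partial>lagm b) + g T * ?S"
      using Lam_step_approx[OF b D mm(1), of T g] ig i2 i3
      by (simp add: trunc_err_def Lam_def p_def)
    then have "ennreal \<bar>trunc_err b m T g\<bar> \<le> ennreal \<bar>\<integral>x. g x - g (min x T) \<partial>lagm b\<bar>
        + ennreal \<bar>\<integral>x. g (min x T) - poly p x \<partial>lagm b\<bar> + ennreal \<bar>g T * ?S\<bar>"
      by (simp flip: ennreal_plus)
    also have "\<dots> \<le> ennreal (C2 / sqrt T) * wnorm (b + 1/2) h + ennreal (C / sqrt (real m)) * wnorm (b + 1/2) h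
        + ennreal (C4 * lag_w b T * \<bar>g T\<bar>)"
    proof (intro add_mono)
      have "ennreal \<bar>\<integral>x. g x - g (min x T) \<partial>lagm b\<bar> \<le> (\<integral>\<^sup>+x. ennreal \<bar>g x - g (min x T)\<bar> \<partial>lagm b)"
        using integral_norm_bound_ennreal[of "lagm b" "\<lambda>x. g x - g (min x T)"] ig i2 by simp
      also have "\<dots> \<le> ennreal (C2 / sqrt T) * wnorm (b + 1/2) h" by (rule C2(2)[OF g T1])
      finally show "ennreal \<bar>\<integral>x. g x - g (min x T) \<partial>lagm b\<bar> \<le> ennreal (C2 / sqrt T) * wnorm (b + 1/2) h" .
      have "ennreal \<bar>\<integral>x. g (min x T) - poly p x \<partial>lagm b\<bar> \<le> (\<integral>\<^sup>+x. ennreal \<bar>g (min x T) - poly p x\<bar> \<partial>lagm b)"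
        using integral_norm_bound_ennreal[of "lagm b" "\<lambda>x. g (min x T) - poly p x"] i2 i3 by simp
      also have "\<dots> \<le> ennreal (C / sqrt (real m)) * wnorm (b + 1/2) h"
        unfolding p_def by (rule step_approx_error[OF b D C(1) mm(1) th(1) g T])
      finally show "ennreal \<bar>\<integral>x. g (min x T) - poly p x \<partial>lagm b\<bar> \<le> ennreal (C / sqrt (real m)) * wnorm (b + 1/2) h" .
      show "ennreal \<bar>g T * ?S\<bar> \<le> ennreal (C4 * lag_w b T * \<bar>g T\<bar>)"
      proof (rule ennreal_leI)
        have S0: "?S \<ge> 0" using lamz_pos[OF b] by (intro sum_nonneg) (auto intro: less_imp_le)
        have "measure (lagm b) UNIV = Lam b 1" by (simp add: Lam_def)
        also have "\<dots> = (\<Sum>z\<in>Zs b m. lamz b m z)" using mm by (subst gauss[OF b]) auto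
        also have "\<dots> = (\<Sum>z\<in>{z\<in>Zs b m. z \<le> T} \<union> {z\<in>Zs b m. z > T}. lamz b m z)" by (intro sum.cong) auto
        also have "\<dots> = (\<Sum>z\<in>{z\<in>Zs b m. z \<le> T}. lamz b m z) + ?S" by (intro sum.union_disjoint) auto
        also have "(\<Sum>z\<in>{z\<in>Zs b m. z \<le> T}. lamz b m z) = Lam b (step_sum b m D T)"
          using D unfolding step_bound_def by simp
        finally have S: "?S = measure (lagm b) UNIV - Lam b (step_sum b m D T)" by simp
        have "measure (lagm b) UNIV = measure (lagm b) {..T} + measure (lagm b) {T<..}"
        proof -
          have "UNIV = {..T} \<union> {T<..}" by auto
          moreover have "measure (lagm b) ({..T} \<union> {T<..}) = measure (lagm b) {..T} + measure (lagm b) {T<..}"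
            by (rule finite_measure_Union) auto
          ultimately show ?thesis by simp
        qed
        moreover have "measure (lagm b) {T<..} \<le> C3 * lag_w b T"
        proof -
          have "measure (lagm b) {T<..} \<le> measure (lagm b) {T..}" by (intro finite_measure_mono) auto
          also have "\<dots> \<le> C3 * lag_w b T" using C3(2)[OF T1] C3(1) by (simp add: emeasure_eq_measure)
          finally show ?thesis .
        qed
        moreover have "measure (lagm b) {..T} - Lam b (step_sum b m D T) \<le> C * sqrt (4 * \<theta>) * lag_w b T"
        proof -
          have ii: "integrable (lagm b) (indicator {..T} :: real \<Rightarrow> real)" "integrable (lagm b) (poly (step_sum b m D T))"
            by (intro integrable_indicator_lagm integrable_poly_lagm b; simp)+
          then have "measure (lagm b) {..T} - Lam b (step_sum b m D T) = (\<integral>x. indicator {..T} x - poly (step_sum b m D T) x \<partial>lagm b)"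
            by (simp add: Lam_def)
          also have "ennreal (norm \<dots>) \<le> (\<integral>\<^sup>+x. ennreal (norm (indicator {..T} x - poly (step_sum b m D T) x)) \<partial>lagm b)"
            by (rule integral_norm_bound_ennreal) (use ii in auto)
          also have "\<dots> \<le> ennreal (C * sqrt (T / real m) * lag_w b T)"
          proof -
            have "0 < T \<and> T \<le> 4 * \<theta> * real m" using T1 by (simp add: T)
            then show ?thesis using D unfolding step_bound_def real_norm_def by blast
          qed
          also have "T / real m = 4 * \<theta>" using T mm by simp
          finally show ?thesis using C(1) th by (simp add: abs_le_iff)
        qed
        ultimately have "?S \<le> (C3 + C * sqrt (4 * \<theta>)) * lag_w b T" unfolding S by (simp add: algebra_simps)
        also have "\<dots> \<le> C4 * lag_w b T" using C4 by (intro mult_right_mono) auto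
        finally have "\<bar>g T\<bar> * ?S \<le> \<bar>g T\<bar> * (C4 * lag_w b T)" by (intro mult_left_mono) auto
        then show "\<bar>g T * ?S\<bar> \<le> C4 * lag_w b T * \<bar>g T\<bar>" using S0 by (simp add: abs_mult mult_ac)
      qed
    qed
    also have "ennreal (C2 / sqrt T) * wnorm (b + 1/2) h + ennreal (C / sqrt (real m)) * wnorm (b + 1/2) h
       = ennreal ((C + C2 / sqrt (4 * \<theta>)) / sqrt (real m)) * wnorm (b + 1/2) h"
    proof -
      have "sqrt T = sqrt (4 * \<theta>) * sqrt (real m)" unfolding T by (rule real_sqrt_mult)
      then have "(C + C2 / sqrt (4 * \<theta>)) / sqrt (real m) = C2 / sqrt T + C / sqrt (real m)"
        by (simp add: add_divide_distrib)
      then show ?thesis using C C2 T1 by (simp add: ennreal_plus distrib_right)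
    qed
    also have "\<dots> \<le> ennreal (C4 / sqrt (real m)) * wnorm (b + 1/2) h"
      using C4 by (intro mult_right_mono ennreal_leI divide_right_mono) auto
    finally show ?thesis by (simp add: add_right_mono)
  qed
  moreover have "m1 \<ge> 1" using C(2) by (simp add: m1_def)
  ultimately show ?thesis using C4(1) by (intro exI[of _ C4] conjI exI[of _ m1]) blast+
qed

subsection \<open>Growth of polynomials beyond the nodes\<close>

lemma prod_abs_index_diff:
  assumes "i \<le> d"
  shows "(\<Prod>l\<in>{..d} - {i}. \<bar>real i - real l\<bar>) = fact i * fact (d - i)"
proof -
  have eq: "{..d} - {i} = {..<i} \<union> {i<..d}" using assms by auto
  have "(\<Prod>l\<in>{..d} - {i}. \<bar>real i - real l\<bar>) = (\<Prod>l\<in>{..<i}. \<bar>real i - real l\<bar>) * (\<Prod>l\<in>{i<..d}. \<bar>real i - real l\<bar>)"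
    unfolding eq by (rule prod.union_disjoint) auto
  also have "(\<Prod>l\<in>{..<i}. \<bar>real i - real l\<bar>) = (\<Prod>k\<in>{1..i}. real k)"
    by (rule prod.reindex_bij_witness[of _ "\<lambda>k. i - k" "\<lambda>l. i - l"]) (auto simp: of_nat_diff)
  also have "\<dots> = fact i" by (simp add: fact_prod)
  also have "(\<Prod>l\<in>{i<..d}. \<bar>real i - real l\<bar>) = (\<Prod>k\<in>{1..d - i}. real k)"
    by (rule prod.reindex_bij_witness[of _ "\<lambda>k. i + k" "\<lambda>l. l - i"]) (auto simp: of_nat_diff)
  also have "\<dots> = fact (d - i)" by (simp add: fact_prod)
  finally show ?thesis .
qed

text \<open>Lagrange interpolation at points \<open>y\<^sub>i \<in> [2i+1, 2i+2]\<close> where \<open>\<bar>p\<bar>\<close> is controlled by its mean.\<close>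
lemma poly_growth:
  assumes b: "b > -1" and p: "degree p \<le> d" and M: "M \<ge> 0" "wnorm b (poly p) \<le> ennreal M"
    and x: "x \<ge> 2 * real d + 2"
  shows "\<bar>poly p x\<bar> \<le> M * ((2 * real d + 2) * exp (2 * real d + 2) * 2 ^ d / fact d) * x ^ d"
proof -
  define A where "A = M * ((2 * real d + 2) * exp (2 * real d + 2))"
  \<comment> \<open>A lower bound for the weight on \<open>[1, 2 d + 2]\<close>, obtained from
    \<open>u powr b >= 1 / u\<close>; \<open>A\<close> is \<open>M / c\<close>.\<close>
  define c where "c = exp (- (2 * real d + 2)) / (2 * real d + 2)"
  have c: "c > 0" by (simp add: c_def)
  have "\<exists>y. 2 * real i + 1 \<le> y \<and> y \<le> 2 * real i + 2 \<and> \<bar>poly p y\<bar> \<le> A" if i: "i \<le> d" for i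
  proof -
    let ?I = "{2 * real i + 1..2 * real i + 2}"
    have "\<exists>y\<in>?I. \<forall>u\<in>?I. \<bar>poly p y\<bar> \<le> \<bar>poly p u\<bar>"
      by (intro continuous_attains_inf) (auto intro!: continuous_intros)
    then obtain y where y: "y \<in> ?I" "\<And>u. u \<in> ?I \<Longrightarrow> \<bar>poly p y\<bar> \<le> \<bar>poly p u\<bar>" by blast
    have w: "c \<le> lag_w b u" if u: "u \<in> ?I" for u
    proof -
      have u': "1 \<le> u" "u \<le> 2 * real d + 2" using u i by auto
      have "1 / (2 * real d + 2) \<le> 1 / u" using u' by (intro divide_left_mono) auto
      also have "1 / u = u powr (- 1)" using u' by (simp add: powr_minus_divide)
      also have "\<dots> \<le> u powr b" using u' b by (intro powr_mono) auto
      finally have "1 / (2 * real d + 2) * exp (- (2 * real d + 2)) \<le> u powr b * exp (- u)"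
        using u' by (intro mult_mono) auto
      then show ?thesis by (simp add: c_def lag_w_def)
    qed
    have "ennreal (\<bar>poly p y\<bar> * c) = (\<integral>\<^sup>+u. ennreal (\<bar>poly p y\<bar> * c) * indicator ?I u \<partial>lborel)"
      by (subst nn_integral_cmult_indicator) auto
    also have "\<dots> \<le> (\<integral>\<^sup>+u. ennreal (indicator {0<..} u * lag_w b u) * ennreal \<bar>poly p u\<bar> \<partial>lborel)"
    proof (intro nn_integral_mono)
      fix u
      show "ennreal (\<bar>poly p y\<bar> * c) * indicator ?I u \<le> ennreal (indicator {0<..} u * lag_w b u) * ennreal \<bar>poly p u\<bar>"
      proof (cases "u \<in> ?I")
        case True
        then have "\<bar>poly p y\<bar> * c \<le> \<bar>poly p u\<bar> * lag_w b u" using y(2) w c by (intro mult_mono) auto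
        then have "ennreal (\<bar>poly p y\<bar> * c) \<le> ennreal (\<bar>poly p u\<bar> * lag_w b u)" by (rule ennreal_leI)
        then show ?thesis using True by (simp add: ennreal_mult mult.commute)
      qed simp
    qed
    also have "\<dots> = wnorm b (poly p)" unfolding wnorm_def by (subst nn_integral_lagm) auto
    also have "\<dots> \<le> ennreal M" by (rule M)
    finally have "\<bar>poly p y\<bar> * c \<le> M" using M by simp
    then have "\<bar>poly p y\<bar> * c * ((2 * real d + 2) * exp (2 * real d + 2)) \<le> M * ((2 * real d + 2) * exp (2 * real d + 2))"
      by (intro mult_right_mono) auto
    moreover have "c * ((2 * real d + 2) * exp (2 * real d + 2)) = 1"
    proof -
      define k where "k = 2 * real d + 2"
      have "k > 0" by (simp add: k_def)
      then show ?thesis unfolding c_def k_def[symmetric] by (simp add: exp_minus)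
    qed
    ultimately have "\<bar>poly p y\<bar> \<le> A" unfolding A_def mult.assoc by simp
    then show ?thesis using y(1) by auto
  qed
  then obtain y where y: "\<And>i. i \<le> d \<Longrightarrow> 2 * real i + 1 \<le> y i" "\<And>i. i \<le> d \<Longrightarrow> y i \<le> 2 * real i + 2"
      "\<And>i. i \<le> d \<Longrightarrow> \<bar>poly p (y i)\<bar> \<le> A" by metis
  have A0: "A \<ge> 0" using M by (simp add: A_def)
  \<comment> \<open>The gaps between the intervals give a distance of at least
    \<open>2 |i - l| - 1\<close>, and this is at least \<open>|i - l|\<close> for distinct
    indices.\<close>
  have sep: "\<bar>real i - real l\<bar> \<le> \<bar>y i - y l\<bar>" if "i \<le> d" "l \<le> d" for i l
  proof (cases i l rule: linorder_cases)
    case less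
    then have "real i + 1 \<le> real l" by linarith
    then show ?thesis using y(1)[of l] y(2)[of i] that by linarith
  next
    case greater
    then have "real l + 1 \<le> real i" by linarith
    then show ?thesis using y(1)[of i] y(2)[of l] that by linarith
  qed simp
  have inj: "inj_on y {..d}"
  proof (rule inj_onI)
    fix i l assume "i \<in> {..d}" "l \<in> {..d}" "y i = y l"
    then show "i = l" using sep[of i l] by simp
  qed
  define L where "L i = (\<Prod>l\<in>{..d} - {i}. smult (1 / (y i - y l)) [:- y l, 1:])" for i
  have degL: "degree (L i) \<le> d" if "i \<le> d" for i
  proof -
    have "degree (L i) \<le> (\<Sum>l\<in>{..d} - {i}. degree (smult (1 / (y i - y l)) [:- y l, 1:]))"
      unfolding L_def using degree_prod_sum_le[of "{..d} - {i}" "\<lambda>l. smult (1 / (y i - y l)) [:- y l, 1:]"]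
      by (simp add: o_def)
    also have "\<dots> \<le> (\<Sum>l\<in>{..d} - {i}. 1)" by (intro sum_mono) (simp add: degree_smult_eq)
    also have "\<dots> = d" using that by simp
    finally show ?thesis .
  qed
  have Lval: "poly (L i) (y k) = (if k = i then 1 else 0)" if "i \<le> d" "k \<le> d" for i k
  proof (cases "k = i")
    case True
    have "y i - y l \<noteq> 0" if "l \<in> {..d} - {i}" for l
      using that \<open>i \<le> d\<close> inj by (auto dest: inj_onD)
    then have "(1 / (y i - y l)) * (y i - y l) = 1" if "l \<in> {..d} - {i}" for l using that by simp
    moreover have "poly (L i) (y i) = (\<Prod>l\<in>{..d} - {i}. (1 / (y i - y l)) * (y i - y l))"
      unfolding L_def poly_prod by (intro prod.cong refl) (simp flip: diff_divide_distrib)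
    ultimately show ?thesis using True by simp
  next
    case False
    then show ?thesis using that unfolding L_def poly_prod by (auto intro!: prod_zero)
  qed
  have "p = (\<Sum>i\<le>d. smult (poly p (y i)) (L i))"
  proof (rule poly_eqI_degree[of "y ` {..d}"])
    fix u assume "u \<in> y ` {..d}"
    then obtain k where k: "k \<le> d" "u = y k" by auto
    have "poly (\<Sum>i\<le>d. smult (poly p (y i)) (L i)) u = (\<Sum>i\<le>d. if i = k then poly p (y i) else 0)"
      unfolding poly_sum using k by (intro sum.cong) (auto simp: Lval)
    then show "poly p u = poly (\<Sum>i\<le>d. smult (poly p (y i)) (L i)) u" using k by simp
  next
    show "card (y ` {..d}) > degree p" using p inj by (simp add: card_image)
    have "degree (\<Sum>i\<le>d. smult (poly p (y i)) (L i)) \<le> d"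
      by (intro degree_sum_le order.trans[OF degree_smult_le]) (auto intro: degL)
    then show "card (y ` {..d}) > degree (\<Sum>i\<le>d. smult (poly p (y i)) (L i))" using inj by (simp add: card_image)
  qed
  then have "\<bar>poly p x\<bar> = \<bar>\<Sum>i\<le>d. poly p (y i) * poly (L i) x\<bar>" by (metis (no_types, lifting) poly_smult poly_sum sum.cong)
  also have "\<dots> \<le> (\<Sum>i\<le>d. A * (x ^ d / (fact i * fact (d - i))))"
  proof (rule order.trans[OF sum_abs], rule sum_mono)
    fix i assume i: "i \<in> {..d}"
    have "\<bar>poly (L i) x\<bar> = (\<Prod>l\<in>{..d} - {i}. \<bar>x - y l\<bar> / \<bar>y i - y l\<bar>)"
      unfolding L_def poly_prod abs_prod by (intro prod.cong refl) (simp flip: diff_divide_distrib add: abs_divide)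
    also have "\<dots> \<le> (\<Prod>l\<in>{..d} - {i}. x / \<bar>real i - real l\<bar>)"
    proof (intro prod_mono conjI frac_le)
      fix l assume l: "l \<in> {..d} - {i}"
      have "y l \<le> x" "0 \<le> y l" using y(1,2)[of l] l x by auto
      then show "\<bar>x - y l\<bar> \<le> x" by simp
      show "\<bar>real i - real l\<bar> \<le> \<bar>y i - y l\<bar>" using l i by (intro sep) auto
    qed (use x in auto)
    also have "\<dots> = x ^ d / (fact i * fact (d - i))"
      using i by (simp add: prod_dividef prod_abs_index_diff)
    finally show "\<bar>poly p (y i) * poly (L i) x\<bar> \<le> A * (x ^ d / (fact i * fact (d - i)))"
      unfolding abs_mult using y(3)[of i] i A0 by (intro mult_mono) auto
  qed
  also have "\<dots> = A * x ^ d / fact d * (\<Sum>i\<le>d. real (d choose i))"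
    unfolding sum_distrib_left by (intro sum.cong refl) (simp add: binomial_fact)
  also have "(\<Sum>i\<le>d. real (d choose i)) = 2 ^ d"
    by (metis choose_row_sum of_nat_numeral of_nat_power of_nat_sum)
  finally show ?thesis by (simp add: A_def mult_ac)
qed

text \<open>Beyond \<open>T\<close> the factor \<open>(z / T) ^ N\<close> is at least 1. After
  inserting it, the sum may be extended to all nodes, where it is a moment computed exactly by the
  Gauss rule.\<close>

lemma nodes_tail_sum:
  assumes b: "b > -1" and T: "T > 0" and e: "N + e < 2 * m" and B: "B \<ge> 0"
    and P: "\<And>z. z > T \<Longrightarrow> \<bar>P z\<bar> \<le> B * z ^ e"
  shows "\<bar>\<Sum>z\<in>{z\<in>Zs b m. z > T}. lamz b m z * P z\<bar> \<le> B * Gamma (b + 1 + real (N + e)) / T ^ N"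
proof -
  have "\<bar>\<Sum>z\<in>{z\<in>Zs b m. z > T}. lamz b m z * P z\<bar> \<le> (\<Sum>z\<in>{z\<in>Zs b m. z > T}. B / T ^ N * (lamz b m z * z ^ (N + e)))"
  proof (rule order.trans[OF sum_abs], rule sum_mono)
    fix z assume z: "z \<in> {z\<in>Zs b m. z > T}"
    have "T ^ N \<le> z ^ N" using z T by (intro power_mono) auto
    then have "1 \<le> z ^ N / T ^ N" using T by simp
    then have "B * z ^ e * 1 \<le> B * z ^ e * (z ^ N / T ^ N)" using B z T by (intro mult_left_mono) auto
    then have "\<bar>P z\<bar> \<le> B / T ^ N * z ^ (N + e)" using P[of z] z by (simp add: power_add mult_ac)
    then have "lamz b m z * \<bar>P z\<bar> \<le> lamz b m z * (B / T ^ N * z ^ (N + e))"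
      using lamz_pos[OF b, of z m] z by (intro mult_left_mono) auto
    then show "\<bar>lamz b m z * P z\<bar> \<le> B / T ^ N * (lamz b m z * z ^ (N + e))"
      using lamz_pos[OF b, of z m] z by (simp add: abs_mult mult_ac)
  qed
  also have "\<dots> \<le> (\<Sum>z\<in>Zs b m. B / T ^ N * (lamz b m z * z ^ (N + e)))"
    using Zs_props(2)[OF b, of m] lamz_pos[OF b, of _ m] B T
    by (intro sum_mono2 mult_nonneg_nonneg divide_nonneg_pos zero_le_power) (auto intro: less_imp_le)
  also have "\<dots> = B / T ^ N * Lam b (monom 1 (N + e))"
    using e by (subst gauss[OF b]) (auto simp: degree_monom_eq poly_monom sum_distrib_left)
  also have "\<dots> = B * Gamma (b + 1 + real (N + e)) / T ^ N" by (simp add: Lam_monom[OF b])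
  finally show ?thesis .
qed

lemma Gamma_le_fact:
  fixes b :: real
  assumes "b > -1"
  shows "\<exists>a C. C > 0 \<and> (\<forall>j. Gamma (b + 1 + real j) \<le> C * fact (j + a))"
proof -
  define a where "a = nat \<lceil>b + 1\<rceil>"
  have a: "b + 1 \<le> real a" "a \<ge> 1" using assms unfolding a_def by linarith+
  have G: "Gamma (b + 1) > 0" using assms by (intro Gamma_real_pos) auto
  have "Gamma (b + 1 + real j) \<le> Gamma (b + 1) * fact (j + a)" for j
  proof -
    have "pochhammer (b + 1) j = Gamma (b + 1 + real j) / Gamma (b + 1)"
      using assms by (intro pochhammer_Gamma) (auto simp: nonpos_Ints_def)
    then have "Gamma (b + 1 + real j) = Gamma (b + 1) * pochhammer (b + 1) j" using G by simp
    moreover have "pochhammer (b + 1) j \<le> pochhammer (real a) j"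
      unfolding pochhammer_prod using a assms by (intro prod_mono) auto
    moreover have "pochhammer (real a) j \<le> fact (j + a)"
    proof -
      have "pochhammer (1::real) ((a - 1) + j) = pochhammer 1 (a - 1) * pochhammer (1 + real (a - 1)) j"
        by (rule pochhammer_product')
      then have "fact (a - 1 + j) = fact (a - 1) * pochhammer (real a) j" using a by (simp add: pochhammer_fact of_nat_diff)
      moreover have "pochhammer (real a) j \<ge> 0" using a by (intro pochhammer_nonneg) auto
      then have "1 * pochhammer (real a) j \<le> fact (a - 1) * pochhammer (real a) j"
        by (intro mult_right_mono) (auto simp: fact_ge_1)
      moreover have "(fact (a - 1 + j) :: real) \<le> fact (j + a)" by (intro fact_mono) auto
      ultimately show ?thesis by linarith
    qed
    ultimately show ?thesis using G by (metis less_imp_le mult_left_mono order.trans)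
  qed
  then show ?thesis using G by blast
qed

lemma power_le_exp: "y \<ge> 0 \<Longrightarrow> k \<ge> 1 \<Longrightarrow> y ^ k \<le> real k ^ k * exp (y :: real)"
proof -
  assume y: "y \<ge> 0" "k \<ge> 1"
  have "y / real k \<le> exp (y / real k)" using exp_ge_add_one_self[of "y / real k"] by linarith
  then have "(y / real k) ^ k \<le> exp (y / real k) ^ k" using y by (intro power_mono) auto
  also have "\<dots> = exp y" using y by (simp flip: exp_of_nat_mult)
  finally show ?thesis using y by (simp add: power_divide field_simps)
qed

lemma fact_add_le: "(fact (n + k) :: real) \<le> fact n * real (n + k) ^ k"
proof (induction k)
  case (Suc k)
  have "(fact (n + Suc k) :: real) = real (n + Suc k) * fact (n + k)" by simp
  also have "\<dots> \<le> real (n + Suc k) * (fact n * real (n + k) ^ k)" by (intro mult_left_mono Suc) auto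
  also have "\<dots> \<le> real (n + Suc k) * (fact n * real (n + Suc k) ^ k)"
    by (intro mult_left_mono power_mono) auto
  finally show ?case by (simp add: mult_ac)
qed simp

text \<open>The factor \<open>fact d\<close> cancels, \<open>fact N / (4 \<theta> m) ^ N\<close> is
  at most \<open>4 ^ (-N)\<close>, and the remaining exponentials are \<open>2 ^ (N + d)\<close>,
  \<open>2 ^ d\<close> and \<open>exp (2 d) <= 8 ^ d\<close>. Together they give
  \<open>2 ^ (5 d - N)\<close>, at most \<open>2 ^ (- N / 2)\<close> because
  \<open>10 * d <= N\<close>; this beats every power of \<open>m\<close>.\<close>

lemma tail_small:
  fixes \<alpha> \<theta> :: real and r :: nat
  assumes al: "\<alpha> > -1" and th: "0 < \<theta>" "\<theta> < 1"
  shows "\<exists>C>0. \<forall>(m::nat) N d. m \<ge> 1 \<longrightarrow> real N \<le> \<theta> * real m \<longrightarrow> \<theta> * real m \<le> real N + 1 \<longrightarrow> 10 * d \<le> N \<longrightarrow>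
    ((2 * real d + 2) * exp (2 * real d + 2) * 2 ^ d / fact d) * Gamma (\<alpha> + 1 + real (N + (d + 1))) / (4 * \<theta> * real m) ^ N
      \<le> C * real m powr (- real r / 2)"
proof -
  obtain a CG where G: "CG > 0" "\<And>j. Gamma (\<alpha> + 1 + real j) \<le> CG * fact (j + a)"
    using Gamma_le_fact[OF al] by blast
  \<comment> \<open>The total power to be absorbed: \<open>a + 2\<close> factors \<open>Y\<close>
    from the estimate and \<open>r\<close> more from \<open>m powr (r / 2)\<close>.\<close>
  define k where "k = a + 2 + r"
  define C where "C = exp 2 * CG * ((16 / \<theta>) ^ k * (real k ^ k * exp (real (a + 2) / 8)))"
  have C: "C > 0" using G th by (simp add: C_def k_def)
  have "((2 * real d + 2) * exp (2 * real d + 2) * 2 ^ d / fact d) * Gamma (\<alpha> + 1 + real (N + (d + 1))) / (4 * \<theta> * real m) ^ N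
      \<le> C * real m powr (- real r / 2)"
    if m: "m \<ge> 1" and N: "real N \<le> \<theta> * real m" "\<theta> * real m \<le> real N + 1" and d: "10 * d \<le> N" for m N d :: nat
  proof -
    \<comment> \<open>One quantity dominating all the polynomial factors; it has the order of
      \<open>m\<close>.\<close>
    define Y where "Y = real (2 * N + a + 2)"
    have Y: "Y \<ge> 1" by (simp add: Y_def)
    have tm: "\<theta> * real m > 0" using th m by simp
    have f1: "Gamma (\<alpha> + 1 + real (N + (d + 1))) \<le> CG * (fact N * fact d * 2 ^ (N + d) * Y ^ (a + 1))"
    proof -
      have "(fact (N + (d + 1) + a) :: real) = fact ((N + d) + (a + 1))" by (simp add: ac_simps)
      also have "\<dots> \<le> fact (N + d) * real (N + d + (a + 1)) ^ (a + 1)" by (rule fact_add_le)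
      also have "\<dots> \<le> fact (N + d) * Y ^ (a + 1)"
        using d unfolding Y_def by (intro mult_left_mono power_mono) auto
      also have "(fact (N + d) :: real) = fact N * fact d * real ((N + d) choose d)"
        by (simp add: binomial_fact)
      also have "\<dots> \<le> fact N * fact d * 2 ^ (N + d)"
      proof (rule mult_left_mono)
        have "real ((N + d) choose d) \<le> real (2 ^ (N + d))" using binomial_le_pow2[of "N + d" d] by (simp only: of_nat_le_iff)
        then show "real ((N + d) choose d) \<le> 2 ^ (N + d)" by simp
      qed simp
      finally have "(fact (N + (d + 1) + a) :: real) \<le> fact N * fact d * 2 ^ (N + d) * Y ^ (a + 1)"
        using Y by (simp add: mult_right_mono)
      then show ?thesis using G(2)[of "N + (d + 1)"] G(1) by (meson mult_left_mono less_imp_le order.trans)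
    qed
    have f2: "fact N / (4 * \<theta> * real m) ^ N \<le> (1/4) ^ N"
    proof -
      have "(fact N :: real) \<le> real N ^ N" using fact_le_power[of N, where 'a = real] by simp
      also have "\<dots> \<le> (\<theta> * real m) ^ N" using N by (intro power_mono) auto
      finally have "fact N / (4 * \<theta> * real m) ^ N \<le> (\<theta> * real m) ^ N / (4 * \<theta> * real m) ^ N"
        using tm by (intro divide_right_mono) auto
      also have "\<dots> = ((\<theta> * real m) / (4 * \<theta> * real m)) ^ N" by (rule power_divide[symmetric])
      also have "(\<theta> * real m) / (4 * \<theta> * real m) = 1/4" using th m by simp
      finally show ?thesis .
    qed
    have e8: "exp (2 * real d) \<le> 8 ^ d"
    proof -
      have "exp (2::real) \<le> 8"
      proof -
        have "exp (1::real) \<le> 272/100" using e_less_272 by simp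
        then have "exp (1::real) * exp 1 \<le> 272/100 * (272/100)" by (intro mult_mono) auto
        then show ?thesis by (simp flip: exp_add)
      qed
      then have "exp (2::real) ^ d \<le> 8 ^ d" by (intro power_mono) auto
      then show ?thesis by (simp add: exp_of_nat_mult[symmetric] mult.commute)
    qed
    have f3: "exp (2 * real d) * 2 ^ d * 2 ^ d * 2 ^ N * (1/4) ^ N \<le> exp (- real N / 4)"
    proof -
      have "exp (2 * real d) * 2 ^ d * 2 ^ d * 2 ^ N * (1/4) ^ N \<le> 8 ^ d * 2 ^ d * 2 ^ d * 2 ^ N * (1/4) ^ N"
        using e8 by (intro mult_right_mono) auto
      also have "\<dots> = (8 * 2 * 2) ^ d * (2 * (1/4)) ^ N" by (simp only: power_mult_distrib mult.assoc)
      also have "\<dots> = 2 ^ (5 * d) * (1/2) ^ N" by (simp add: power_mult)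
      also have "\<dots> = 2 powr (5 * real d - real N)"
      proof -
        have "2 powr (real (5 * d) - real N) = (2::real) ^ (5 * d) / 2 ^ N"
          by (simp only: powr_diff powr_realpow zero_less_numeral)
        moreover have "real (5 * d) = 5 * real d" by simp
        moreover have "(1/2::real) ^ N = 1 / 2 ^ N" by (rule power_one_over)
        ultimately show ?thesis by (simp only: times_divide_eq_right mult_1_right)
      qed
      also have "\<dots> \<le> 2 powr (- real N / 2)" using d by (intro powr_mono) auto
      also have "\<dots> = exp (- real N / 2 * ln 2)" by (simp add: powr_def)
      also have "\<dots> \<le> exp (- real N / 4)"
      proof -
        have "ln (2::real) \<ge> 1/2" using ln2_ge_two_thirds by simp
        then have "real N / 2 * (1/2) \<le> real N / 2 * ln 2" by (intro mult_left_mono) auto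
        then show ?thesis by simp
      qed
      finally show ?thesis .
    qed
    have "((2 * real d + 2) * exp (2 * real d + 2) * 2 ^ d / fact d) * Gamma (\<alpha> + 1 + real (N + (d + 1))) / (4 * \<theta> * real m) ^ N
      \<le> ((2 * real d + 2) * exp (2 * real d + 2) * 2 ^ d / fact d) * (CG * (fact N * fact d * 2 ^ (N + d) * Y ^ (a + 1))) / (4 * \<theta> * real m) ^ N"
      using f1 tm by (intro divide_right_mono mult_left_mono) auto
    also have "\<dots> = exp 2 * CG * ((2 * real d + 2) * Y ^ (a + 1)) * (exp (2 * real d) * 2 ^ d * 2 ^ d * 2 ^ N * (fact N / (4 * \<theta> * real m) ^ N))"
      by (simp add: exp_add power_add)
    also have "\<dots> \<le> exp 2 * CG * ((2 * real d + 2) * Y ^ (a + 1)) * (exp (2 * real d) * 2 ^ d * 2 ^ d * 2 ^ N * (1/4) ^ N)"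
      using f2 G Y by (intro mult_left_mono) auto
    also have "\<dots> \<le> exp 2 * CG * ((2 * real d + 2) * Y ^ (a + 1)) * exp (- real N / 4)"
      using f3 G Y by (intro mult_left_mono) auto
    also have "\<dots> \<le> exp 2 * CG * (Y * Y ^ (a + 1)) * exp (- real N / 4)"
      using d G Y by (intro mult_right_mono mult_left_mono) (auto simp: Y_def)
    finally have 1: "((2 * real d + 2) * exp (2 * real d + 2) * 2 ^ d / fact d) * Gamma (\<alpha> + 1 + real (N + (d + 1))) / (4 * \<theta> * real m) ^ N
      \<le> exp 2 * CG * (Y ^ (a + 2) * exp (- real N / 4))" by (simp add: mult_ac)
    have "Y ^ (a + 2) * exp (- real N / 4) * real m powr (real r / 2) \<le> (16 / \<theta>) ^ k * (real k ^ k * exp (real (a + 2) / 8))"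
    proof -
      have mY: "real m \<le> Y / \<theta>" using N(2) th by (simp add: Y_def field_simps)
      have "real m powr (real r / 2) \<le> real m powr real r" using m by (intro powr_mono) auto
      also have "\<dots> = real m ^ r" using m by (simp add: powr_realpow)
      also have "\<dots> \<le> (Y / \<theta>) ^ r" using mY by (intro power_mono) auto
      finally have "Y ^ (a + 2) * exp (- real N / 4) * real m powr (real r / 2) \<le> (Y / \<theta>) ^ (a + 2) * exp (- real N / 4) * (Y / \<theta>) ^ r"
        using Y th by (intro mult_mono power_mono) (auto simp: field_simps)
      also have "\<dots> = (Y / \<theta>) ^ k * exp (- real N / 4)" by (simp add: k_def power_add)
      also have "\<dots> \<le> ((16 / \<theta>) ^ k * (real k ^ k * exp (Y / 16))) * exp (- real N / 4)"
      proof (rule mult_right_mono)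
        have "(Y / \<theta>) ^ k = (16 / \<theta>) ^ k * (Y / 16) ^ k" by (simp flip: power_mult_distrib)
        also have "\<dots> \<le> (16 / \<theta>) ^ k * (real k ^ k * exp (Y / 16))"
          using Y th by (intro mult_left_mono power_le_exp) (auto simp: k_def)
        finally show "(Y / \<theta>) ^ k \<le> (16 / \<theta>) ^ k * (real k ^ k * exp (Y / 16))" .
      qed simp
      also have "\<dots> = (16 / \<theta>) ^ k * (real k ^ k * exp (Y / 16 + (- real N / 4)))"
        by (simp only: exp_add mult.assoc)
      also have "\<dots> \<le> (16 / \<theta>) ^ k * (real k ^ k * exp (real (a + 2) / 8))"
      proof -
        have "Y / 16 + (- real N / 4) \<le> real (a + 2) / 8" unfolding Y_def by (simp add: field_simps)
        then show ?thesis using th by (intro mult_left_mono) auto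
      qed
      finally show ?thesis .
    qed
    then have "exp 2 * CG * (Y ^ (a + 2) * exp (- real N / 4) * real m powr (real r / 2)) \<le> C"
      unfolding C_def using G by (intro mult_left_mono) auto
    then have "exp 2 * CG * (Y ^ (a + 2) * exp (- real N / 4)) \<le> C * real m powr (- real r / 2)"
      using m by (simp add: powr_minus field_simps)
    then show ?thesis using 1 by linarith
  qed
  then show ?thesis using C by blast
qed

subsection \<open>The quadrature error on the half-line\<close>

lemma poly_antideriv:
  fixes p :: "real poly"
  shows "\<exists>q. pderiv q = p \<and> degree q \<le> degree p + 1"
proof -
  define q where "q = (\<Sum>i\<le>degree p. monom (coeff p i / real (Suc i)) (Suc i))"
  have c: "coeff q (Suc i) = coeff p i / real (Suc i)" for i
    unfolding q_def coeff_sum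
    by (simp add: if_distrib sum.delta coeff_eq_0 del: of_nat_Suc cong: if_cong)
  have "pderiv q = p" by (rule poly_eqI) (simp add: coeff_pderiv c del: of_nat_Suc)
  moreover have "degree q \<le> degree p + 1"
    unfolding q_def by (intro degree_sum_le order.trans[OF degree_monom_le]) auto
  ultimately show ?thesis by blast
qed

definition chain :: "(nat \<Rightarrow> real \<Rightarrow> real) \<Rightarrow> nat \<Rightarrow> bool" where
  "chain F r \<longleftrightarrow> (\<forall>k<r. prim (F k) (F (Suc k)))"

lemma chain_measurable:
  assumes "chain F r" "r \<ge> 1" "k \<le> r"
  shows "F k \<in> borel_measurable borel"
proof (cases "k < r")
  case True
  then show ?thesis using assms primD(1) unfolding chain_def by blast
next
  case False
  then have "k = Suc (r - 1)" "r - 1 < r" using assms by auto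
  then show ?thesis using assms primD(2) unfolding chain_def by metis
qed

lemma wnorm_add_le:
  assumes [measurable]: "f \<in> borel_measurable borel" "g \<in> borel_measurable borel"
  shows "wnorm b f \<le> wnorm b (\<lambda>x. f x - g x) + wnorm b g"
proof -
  have "wnorm b f \<le> (\<integral>\<^sup>+x. ennreal \<bar>f x - g x\<bar> + ennreal \<bar>g x\<bar> \<partial>lagm b)"
    unfolding wnorm_def by (intro nn_integral_mono) (auto simp flip: ennreal_plus intro!: ennreal_leI)
  also have "\<dots> = wnorm b (\<lambda>x. f x - g x) + wnorm b g" unfolding wnorm_def by (rule nn_integral_add) auto
  finally show ?thesis .
qed

lemma wnorm_const: "b > -1 \<Longrightarrow> wnorm b (\<lambda>x. c) = ennreal (\<bar>c\<bar> * Gamma (b + 1))"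
  unfolding wnorm_def by (simp add: lagm_UNIV_pos ennreal_mult)

lemma wnorm_minus_commute: "wnorm b (\<lambda>x. f x - g x) = wnorm b (\<lambda>x. g x - f x)"
  unfolding wnorm_def by (simp add: abs_minus_commute)

text \<open>\<open>|g x|\<close> is at most \<open>|g s|\<close> plus the integral of
  \<open>|h|\<close>, averaged over \<open>s\<close> in \<open>{x..x + 1}\<close>; the weight varies
  only by a bounded factor there.\<close>

lemma point_bound:
  fixes c :: real
  shows "\<exists>K>0. \<forall>x\<ge>1. \<forall>g h. prim g h \<longrightarrow> ennreal (lag_w c x * \<bar>g x\<bar>) \<le> ennreal K * (wnorm c g + wnorm c h)"
proof -
  define K where "K = exp 1 * 2 powr \<bar>c\<bar>"
  have K: "K > 0" by (simp add: K_def)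
  have cmp: "lag_w c x \<le> K * lag_w c s" if "x \<ge> 1" "x \<le> s" "s \<le> x + 1" for x s :: real
  proof -
    have "x powr c \<le> 2 powr \<bar>c\<bar> * s powr c"
    proof (cases "c \<ge> 0")
      case True
      then have "x powr c \<le> 1 * s powr c" using that by (simp add: powr_mono2)
      also have "\<dots> \<le> 2 powr \<bar>c\<bar> * s powr c" by (intro mult_right_mono) (auto intro: ge_one_powr_ge_zero)
      finally show ?thesis .
    next
      case False
      then have "(2 * x) powr c \<le> s powr c" using that by (intro powr_mono2') auto
      then have "2 powr (- c) * (2 powr c * x powr c) \<le> 2 powr (- c) * s powr c"
        using that by (simp add: powr_mult)
      moreover have "2 powr (- c) * (2 powr c * x powr c) = x powr c"
        by (simp add: mult.assoc[symmetric] flip: powr_add)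
      ultimately show ?thesis using False by simp
    qed
    moreover have "exp (- x) \<le> exp 1 * exp (- s)" using that by (simp flip: exp_add)
    ultimately have "x powr c * exp (- x) \<le> (2 powr \<bar>c\<bar> * s powr c) * (exp 1 * exp (- s))"
      by (intro mult_mono) auto
    then show ?thesis by (simp add: lag_w_def K_def mult_ac)
  qed
  have "ennreal (lag_w c x * \<bar>g x\<bar>) \<le> ennreal K * (wnorm c g + wnorm c h)" if x: "x \<ge> 1" and g: "prim g h" for x g h
  proof -
    note [measurable] = primD(1,2)[OF g]
    let ?I = "{x..x + 1}"
    have local: "ennreal (lag_w c x) * (\<integral>\<^sup>+s. indicator ?I s * ennreal \<bar>u s\<bar> \<partial>lborel) \<le> ennreal K * wnorm c u"
      if [measurable]: "u \<in> borel_measurable borel" for u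
    proof -
      have "ennreal (lag_w c x) * (\<integral>\<^sup>+s. indicator ?I s * ennreal \<bar>u s\<bar> \<partial>lborel)
          = (\<integral>\<^sup>+s. ennreal (lag_w c x) * (indicator ?I s * ennreal \<bar>u s\<bar>) \<partial>lborel)"
        by (subst nn_integral_cmult) auto
      also have "\<dots> \<le> (\<integral>\<^sup>+s. ennreal K * (ennreal (indicator {0<..} s * lag_w c s) * ennreal \<bar>u s\<bar>) \<partial>lborel)"
      proof (intro nn_integral_mono)
        fix s
        show "ennreal (lag_w c x) * (indicator ?I s * ennreal \<bar>u s\<bar>)
           \<le> ennreal K * (ennreal (indicator {0<..} s * lag_w c s) * ennreal \<bar>u s\<bar>)"
        proof (cases "s \<in> ?I")
          case True
          then have "lag_w c x * \<bar>u s\<bar> \<le> K * lag_w c s * \<bar>u s\<bar>" using x by (intro mult_right_mono cmp) auto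
          then have "ennreal (lag_w c x * \<bar>u s\<bar>) \<le> ennreal (K * lag_w c s * \<bar>u s\<bar>)" by (rule ennreal_leI)
          then show ?thesis using True x K by (simp add: ennreal_mult mult_ac)
        qed simp
      qed
      also have "\<dots> = ennreal K * wnorm c u"
        unfolding wnorm_def by (subst nn_integral_cmult) (auto simp: nn_integral_lagm)
      finally show ?thesis .
    qed
    define H where "H = (\<integral>\<^sup>+s. indicator ?I s * ennreal \<bar>h s\<bar> \<partial>lborel)"
    have "ennreal \<bar>g x\<bar> = (\<integral>\<^sup>+s. ennreal \<bar>g x\<bar> * indicator ?I s \<partial>lborel)"
      by (subst nn_integral_cmult_indicator) auto
    also have "\<dots> \<le> (\<integral>\<^sup>+s. indicator ?I s * ennreal \<bar>g s\<bar> + H * indicator ?I s \<partial>lborel)"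
    proof (intro nn_integral_mono)
      fix s
      show "ennreal \<bar>g x\<bar> * indicator ?I s \<le> indicator ?I s * ennreal \<bar>g s\<bar> + H * indicator ?I s"
      proof (cases "s \<in> ?I")
        case True
        have "ennreal \<bar>g x\<bar> \<le> ennreal \<bar>g s\<bar> + ennreal \<bar>g s - g x\<bar>"
          by (auto simp flip: ennreal_plus intro!: ennreal_leI)
        also have "ennreal \<bar>g s - g x\<bar> \<le> (\<integral>\<^sup>+u. indicator {x..s} u * ennreal \<bar>h u\<bar> \<partial>lborel)"
          using True x by (intro prim_abs_diff_le[OF g]) auto
        also have "\<dots> \<le> H" unfolding H_def
          using True by (intro nn_integral_mono mult_right_mono) (auto simp: indicator_def)
        finally show ?thesis using True by (simp add: add_left_mono)
      qed simp
    qed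
    also have "\<dots> = (\<integral>\<^sup>+s. indicator ?I s * ennreal \<bar>g s\<bar> \<partial>lborel) + H"
      by (subst nn_integral_add) (auto simp: nn_integral_cmult_indicator)
    finally have "ennreal (lag_w c x) * ennreal \<bar>g x\<bar>
        \<le> ennreal (lag_w c x) * ((\<integral>\<^sup>+s. indicator ?I s * ennreal \<bar>g s\<bar> \<partial>lborel) + H)"
      by (rule mult_left_mono) simp
    also have "\<dots> \<le> ennreal K * wnorm c g + ennreal K * wnorm c h"
      unfolding distrib_left H_def by (intro add_mono local) auto
    finally show ?thesis by (simp add: ennreal_mult distrib_left)
  qed
  then show ?thesis using K by blast
qed

text \<open>If \<open>p\<close> approximates \<open>F 1\<close> and \<open>q\<close> is an
  antiderivative of \<open>p\<close>, then \<open>favard\<close> applied to \<open>F 0 - q\<close>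
  sees only the derivative \<open>F 1 - p\<close>, which is already small. Each level raises the
  degree by at most 1 and the weight exponent by 1/2.\<close>

lemma favard_iter:
  fixes b :: real
  assumes "b > -1"
  shows "\<exists>C>0. \<exists>n0\<ge>1. \<forall>n\<ge>n0. \<forall>F. chain F j \<longrightarrow> F j \<in> borel_measurable borel \<longrightarrow>
    (\<exists>p. degree p \<le> 2 * n + j \<and> wnorm b (\<lambda>x. F 0 x - poly p x) \<le> ennreal (C / sqrt (real n) ^ j) * wnorm (b + real j / 2) (F j))"
  using assms
proof (induction j arbitrary: b)
  case 0
  show ?case by (intro exI[of _ 1] conjI allI impI exI[of _ 0]) auto
next
  case (Suc j)
  obtain C n0 where C: "C > 0" "n0 \<ge> 1"
    "\<And>n F. n \<ge> n0 \<Longrightarrow> chain F j \<Longrightarrow> F j \<in> borel_measurable borel \<Longrightarrow>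
      \<exists>p. degree p \<le> 2 * n + j \<and> wnorm (b + 1/2) (\<lambda>x. F 0 x - poly p x) \<le> ennreal (C / sqrt (real n) ^ j) * wnorm (b + 1/2 + real j / 2) (F j)"
    using Suc.IH[of "b + 1/2"] Suc.prems by auto
  obtain C' n1 where C': "C' > 0" "n1 \<ge> 1"
    "\<And>n g h. n \<ge> n1 \<Longrightarrow> prim g h \<Longrightarrow> \<exists>p. degree p < 2 * n \<and>
        wnorm b (\<lambda>x. g x - poly p x) \<le> ennreal (C' / sqrt (real n)) * wnorm (b + 1/2) h"
    using favard[OF Suc.prems] by blast
  have "\<exists>p. degree p \<le> 2 * n + Suc j \<and> wnorm b (\<lambda>x. F 0 x - poly p x)
      \<le> ennreal ((C' * C) / sqrt (real n) ^ Suc j) * wnorm (b + real (Suc j) / 2) (F (Suc j))"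
    if n: "n \<ge> max n0 n1" and F: "chain F (Suc j)" "F (Suc j) \<in> borel_measurable borel" for n F
  proof -
    have n': "n \<ge> n0" "n \<ge> n1" using n by auto
    have "chain (\<lambda>k. F (Suc k)) j" using F(1) by (simp add: chain_def)
    from C(3)[OF n'(1) this F(2)] obtain p where p: "degree p \<le> 2 * n + j"
      "wnorm (b + 1/2) (\<lambda>x. F (Suc 0) x - poly p x) \<le> ennreal (C / sqrt (real n) ^ j) * wnorm (b + 1/2 + real j / 2) (F (Suc j))"
      by auto
    obtain q where q: "pderiv q = p" "degree q \<le> degree p + 1" using poly_antideriv by blast
    have "prim (F 0) (F (Suc 0))" using F(1) by (simp add: chain_def)
    then have "prim (\<lambda>x. F 0 x - poly q x) (\<lambda>x. F (Suc 0) x - poly p x)"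
      using prim_diff[OF _ prim_poly[of q]] q(1) by simp
    from C'(3)[OF n'(2) this] obtain p' where p': "degree p' < 2 * n"
      "wnorm b (\<lambda>x. F 0 x - poly q x - poly p' x) \<le> ennreal (C' / sqrt (real n)) * wnorm (b + 1/2) (\<lambda>x. F (Suc 0) x - poly p x)"
      by blast
    have "wnorm b (\<lambda>x. F 0 x - poly (q + p') x) \<le> ennreal (C' / sqrt (real n)) * (ennreal (C / sqrt (real n) ^ j) * wnorm (b + 1/2 + real j / 2) (F (Suc j)))"
      using p'(2) mult_left_mono[OF p(2)] by (simp add: diff_diff_eq) (meson order.trans zero_le)
    also have "\<dots> = ennreal ((C' * C) / sqrt (real n) ^ Suc j) * wnorm (b + real (Suc j) / 2) (F (Suc j))"
    proof -
      have "C' / sqrt (real n) * (C / sqrt (real n) ^ j) = (C' * C) / sqrt (real n) ^ Suc j" by simp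
      moreover have "b + 1/2 + real j / 2 = b + real (Suc j) / 2" by (simp add: field_simps)
      ultimately show ?thesis using C(1) C'(1) by (simp only: mult.assoc[symmetric] ennreal_mult[symmetric] divide_nonneg_nonneg real_sqrt_ge_zero zero_le_power of_nat_0_le_iff less_imp_le)
    qed
    finally have "wnorm b (\<lambda>x. F 0 x - poly (q + p') x) \<le> ennreal ((C' * C) / sqrt (real n) ^ Suc j) * wnorm (b + real (Suc j) / 2) (F (Suc j))" .
    moreover have "degree (q + p') \<le> 2 * n + Suc j" using q(2) p(1) p'(1) by (intro degree_add_le) auto
    ultimately show ?thesis by blast
  qed
  moreover have "C' * C > 0" "max n0 n1 \<ge> 1" using C(1,2) C'(1) by auto
  ultimately show ?case by blast
qed

section \<open>Bounds uniform over the half-line version of the unit ball\<close>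

definition unit_chain :: "real \<Rightarrow> nat \<Rightarrow> (nat \<Rightarrow> real \<Rightarrow> real) \<Rightarrow> bool" where
  "unit_chain \<alpha> r F \<longleftrightarrow> chain F r \<and> (\<forall>k\<le>r. wnorm (\<alpha> + real r / 2) (F k) \<le> 1)"

lemma unit_chain_point:
  fixes \<alpha> :: real
  shows "\<exists>K>0. \<forall>F x k. unit_chain \<alpha> r F \<longrightarrow> x \<ge> 1 \<longrightarrow> k < r \<longrightarrow> lag_w (\<alpha> + real r / 2) x * \<bar>F k x\<bar> \<le> K"
proof -
  obtain K where K: "K > 0" "\<And>x g h. x \<ge> 1 \<Longrightarrow> prim g h \<Longrightarrow>
      ennreal (lag_w (\<alpha> + real r / 2) x * \<bar>g x\<bar>) \<le> ennreal K * (wnorm (\<alpha> + real r / 2) g + wnorm (\<alpha> + real r / 2) h)"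
    using point_bound[of "\<alpha> + real r / 2"] by blast
  have "lag_w (\<alpha> + real r / 2) x * \<bar>F k x\<bar> \<le> K * 2" if F: "unit_chain \<alpha> r F" "x \<ge> 1" "k < r" for F x k
  proof -
    have "ennreal (lag_w (\<alpha> + real r / 2) x * \<bar>F k x\<bar>) \<le> ennreal K * (wnorm (\<alpha> + real r / 2) (F k) + wnorm (\<alpha> + real r / 2) (F (Suc k)))"
      using F by (intro K(2)) (auto simp: unit_chain_def chain_def)
    also have "\<dots> \<le> ennreal K * (1 + 1)" using F by (intro mult_left_mono add_mono) (auto simp: unit_chain_def)
    also have "\<dots> = ennreal (K * 2)" using K(1) by (simp add: ennreal_mult one_add_one)
    finally show ?thesis using K(1) by simp
  qed
  then show ?thesis using K(1) by (intro exI[of _ "K * 2"]) auto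
qed

text \<open>Hardy's inequality trades one derivative for a factor \<open>\<surd>x\<close> at the origin.\<close>
lemma hardy:
  fixes \<alpha> :: real
  assumes al: "\<alpha> > -1" and r: "r \<ge> 1"
  shows "j \<le> r \<Longrightarrow> \<exists>K>0. \<forall>F. unit_chain \<alpha> r F \<longrightarrow> wnorm (\<alpha> + real (r - j) / 2) (F (r - j)) \<le> ennreal K"
proof (induction j)
  case 0
  show ?case by (intro exI[of _ 1]) (auto simp: unit_chain_def)
next
  case (Suc j)
  define k where "k = r - Suc j"
  have k: "Suc k = r - j" "k < r" using Suc.prems by (auto simp: k_def)
  obtain K where K: "K > 0" "\<And>F. unit_chain \<alpha> r F \<Longrightarrow> wnorm (\<alpha> + real (Suc k) / 2) (F (Suc k)) \<le> ennreal K"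
    using Suc by (auto simp: k)
  define b where "b = \<alpha> + real k / 2"
  have b: "b > -1" using al by (simp add: b_def)
  obtain C where C: "C > 0" "\<And>g h. prim g h \<Longrightarrow> wnorm b (\<lambda>x. g x - g 1) \<le> ennreal C * wnorm (b + 1/2) h"
    using poincare[OF b] by blast
  obtain K' where K': "K' > 0" "\<And>F x k. unit_chain \<alpha> r F \<Longrightarrow> x \<ge> 1 \<Longrightarrow> k < r \<Longrightarrow> lag_w (\<alpha> + real r / 2) x * \<bar>F k x\<bar> \<le> K'"
    using unit_chain_point[of \<alpha> r] by blast
  define w1 where "w1 = lag_w (\<alpha> + real r / 2) 1"
  have w1: "w1 > 0" by (simp add: w1_def lag_w_pos)
  have G: "Gamma (b + 1) > 0" using b by (intro Gamma_real_pos) auto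
  have "wnorm b (F k) \<le> ennreal (C * K + K' / w1 * Gamma (b + 1))" if F: "unit_chain \<alpha> r F" for F
  proof -
    have pr: "prim (F k) (F (Suc k))" using F k by (auto simp: unit_chain_def chain_def)
    note [measurable] = primD(1,2)[OF pr]
    have "wnorm b (F k) \<le> wnorm b (\<lambda>x. F k x - F k 1) + wnorm b (\<lambda>x. F k 1)"
      by (rule wnorm_add_le) auto
    also have "\<dots> \<le> ennreal (C * K) + ennreal (K' / w1 * Gamma (b + 1))"
    proof (rule add_mono)
      have "wnorm b (\<lambda>x. F k x - F k 1) \<le> ennreal C * wnorm (b + 1/2) (F (Suc k))" by (rule C(2)[OF pr])
      also have "b + 1/2 = \<alpha> + real (Suc k) / 2" by (simp add: b_def field_simps)
      also have "ennreal C * wnorm (\<alpha> + real (Suc k) / 2) (F (Suc k)) \<le> ennreal C * ennreal K"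
        by (intro mult_left_mono K(2) F) auto
      finally show "wnorm b (\<lambda>x. F k x - F k 1) \<le> ennreal (C * K)" using C(1) K(1) by (simp add: ennreal_mult)
      have "\<bar>F k 1\<bar> \<le> K' / w1" using K'(2)[OF F, of 1 k] k w1 by (simp add: w1_def field_simps)
      then show "wnorm b (\<lambda>x. F k 1) \<le> ennreal (K' / w1 * Gamma (b + 1))"
        unfolding wnorm_const[OF b] using G by (intro ennreal_leI mult_right_mono) auto
    qed
    also have "\<dots> = ennreal (C * K + K' / w1 * Gamma (b + 1))"
      using C(1) K(1) K'(1) w1 G by (intro ennreal_plus[symmetric]) auto
    finally show ?thesis .
  qed
  moreover have "C * K + K' / w1 * Gamma (b + 1) > 0" using C(1) K(1) K'(1) w1 G by (intro add_pos_pos) auto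
  ultimately show ?case unfolding k_def[symmetric] b_def[symmetric] by blast
qed

lemma unit_chain_integrable:
  assumes al: "\<alpha> > -1" and r: "r \<ge> 1" and F: "unit_chain \<alpha> r F"
  shows "integrable (lagm \<alpha>) (F 0)"
proof -
  have [measurable]: "F 0 \<in> borel_measurable borel"
    using F r by (intro chain_measurable[of F r]) (auto simp: unit_chain_def)
  obtain K where "wnorm \<alpha> (F 0) \<le> ennreal K" using hardy[OF al r, of r] F by auto
  then show ?thesis unfolding wnorm_def
    by (intro integrableI_bounded) (auto intro: le_less_trans ennreal_less_top)
qed

text \<open>With \<open>p\<close> approximating \<open>F 1\<close> and \<open>q\<close> an
  antiderivative of \<open>p\<close>, the first-order bound \<open>trunc_err_bound\<close> applied
  to \<open>F 0 - q\<close> gains the order \<open>r - 1\<close> from the approximation, and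
  \<open>q\<close> itself is nearly integrated exactly.\<close>

lemma half_line_error:
  fixes \<alpha> \<theta> :: real and r :: nat
  assumes al: "\<alpha> > -1" and r: "r \<ge> 1" and th: "0 < \<theta>" "\<theta> < 1"
  shows "\<exists>C>0. \<exists>m0\<ge>1. \<forall>m\<ge>m0. \<forall>F. unit_chain \<alpha> r F \<longrightarrow>
    \<bar>trunc_err \<alpha> m (4 * \<theta> * real m) (F 0)\<bar> \<le> C * real m powr (- real r / 2)"
proof -
  obtain C1 m1 where C1: "C1 > 0" "m1 \<ge> 1" "\<And>m g h. m \<ge> m1 \<Longrightarrow> prim g h \<Longrightarrow> integrable (lagm \<alpha>) g \<Longrightarrow>
      ennreal \<bar>trunc_err \<alpha> m (4 * \<theta> * real m) g\<bar> \<le> ennreal (C1 / sqrt (real m)) * wnorm (\<alpha> + 1/2) h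
        + ennreal (C1 * lag_w \<alpha> (4 * \<theta> * real m) * \<bar>g (4 * \<theta> * real m)\<bar>)"
    using trunc_err_bound[OF al th] by blast
  have al2: "\<alpha> + 1/2 > -1" using al by simp
  obtain C2 n0 where C2: "C2 > 0" "n0 \<ge> 1"
    "\<And>n F. n \<ge> n0 \<Longrightarrow> chain F (r - 1) \<Longrightarrow> F (r - 1) \<in> borel_measurable borel \<Longrightarrow>
    \<exists>p. degree p \<le> 2 * n + (r - 1) \<and> wnorm (\<alpha> + 1/2) (\<lambda>x. F 0 x - poly p x)
      \<le> ennreal (C2 / sqrt (real n) ^ (r - 1)) * wnorm (\<alpha> + 1/2 + real (r - 1) / 2) (F (r - 1))"
    using favard_iter[OF al2, of "r - 1"] by blast
  obtain K1 where K1: "K1 > 0" "\<And>F. unit_chain \<alpha> r F \<Longrightarrow> wnorm (\<alpha> + 1/2) (F 1) \<le> ennreal K1"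
    using hardy[OF al r, of "r - 1"] r by auto
  obtain K2 where K2: "K2 > 0" "\<And>F x. unit_chain \<alpha> r F \<Longrightarrow> x \<ge> 1 \<Longrightarrow> lag_w (\<alpha> + real r / 2) x * \<bar>F 0 x\<bar> \<le> K2"
    using unit_chain_point[of \<alpha> r] r by (metis less_le_trans zero_less_one)
  obtain C3 where C3: "C3 > 0" "\<And>m N d. m \<ge> 1 \<Longrightarrow> real N \<le> \<theta> * real m \<Longrightarrow> \<theta> * real m \<le> real N + 1 \<Longrightarrow> 10 * d \<le> N \<Longrightarrow>
    ((2 * real d + 2) * exp (2 * real d + 2) * 2 ^ d / fact d) * Gamma (\<alpha> + 1 + real (N + (d + 1))) / (4 * \<theta> * real m) ^ N
      \<le> C3 * real m powr (- real r / 2)"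
    using tail_small[OF al th, of r] by blast
  \<comment> \<open>Bounds the norm of the approximating polynomial \<open>p\<close>, through that
    of \<open>F 1\<close> plus the approximation error.\<close>
  define M where "M = K1 + C2"
  have M: "M > 0" using K1(1) C2(1) by (simp add: M_def)
  \<comment> \<open>Below, \<open>n >= \<theta> m / 160\<close>, so
    \<open>s * sqrt m <= sqrt n\<close>.\<close>
  define s where "s = sqrt (\<theta> / 160)"
  have s: "s > 0" using th by (simp add: s_def)
  \<comment> \<open>The summands belong to the remainder \<open>F 0 - q\<close>, to the boundary
    value at \<open>T\<close>, and to \<open>q\<close> at the dropped nodes.\<close>
  define C where "C = C1 * C2 / s ^ (r - 1) + C1 * K2 * (4 * \<theta>) powr (- real r / 2) + M * C3"
  have C: "C > 0" unfolding C_def using C1(1) C2(1) K2(1) M C3(1) s th by (intro add_pos_pos) auto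
  \<comment> \<open>Forces \<open>N >= 80 + 20 r + 40 n0\<close>, which gives room both for
    \<open>n >= n0\<close> and for \<open>10 * d <= N\<close>.\<close>
  define m0 where "m0 = m1 + nat \<lceil>(80 + 20 * real r + 40 * real n0) / \<theta>\<rceil> + 2"
  have "\<bar>trunc_err \<alpha> m (4 * \<theta> * real m) (F 0)\<bar> \<le> C * real m powr (- real r / 2)"
    if m: "m \<ge> m0" and F: "unit_chain \<alpha> r F" for m F
  proof -
    have mm: "m \<ge> m1" "m \<ge> 2" using m by (auto simp: m0_def)
    have "(80 + 20 * real r + 40 * real n0) / \<theta> \<le> real m - 2" using m unfolding m0_def by linarith
    then have "80 + 20 * real r + 40 * real n0 \<le> \<theta> * (real m - 2)" using th by (simp add: pos_divide_le_eq mult.commute)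
    then have tm: "82 + 20 * real r + 40 * real n0 \<le> \<theta> * real m + 2 - 2 * \<theta>" by (simp add: algebra_simps)
    define T where "T = 4 * \<theta> * real m"
    define N where "N = nat \<lfloor>\<theta> * real m\<rfloor>"
    have N: "real N \<le> \<theta> * real m" "\<theta> * real m \<le> real N + 1" "\<theta> * real m < real N + 1"
      unfolding N_def using th by (auto simp: of_nat_nat)
    have "80 + 20 * real r + 40 * real n0 < real N + 1" using tm N th by linarith
    then have N2: "80 + 20 * r + 40 * n0 \<le> N" by linarith
    \<comment> \<open>Since \<open>d\<close> is about \<open>2 n\<close>, the divisor 40 makes
      \<open>20 n\<close> at most half of \<open>N\<close>; the other half of the bound
      \<open>10 * d <= N\<close> pays for the summand \<open>r - 1\<close> in
      \<open>d\<close>.\<close>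
    define n where "n = N div 40"
    have n0: "n \<ge> n0" unfolding n_def using N2 by linarith
    have n1: "n \<ge> 1" using n0 C2(2) by simp
    have nN: "40 * n \<le> N" "N < 40 * n + 40" unfolding n_def by presburger+
    define d where "d = 2 * n + (r - 1)"
    have "d \<le> 2 * n + r" by (simp add: d_def)
    then have d: "10 * d \<le> N" using nN(1) N2 by simp
    have "\<theta> * real m \<le> 1 * real m" using th by (intro mult_right_mono) auto
    then have "real N \<le> real m" using N(1) by linarith
    then have Nm: "N + (d + 1) < 2 * m" using d N2 by linarith
    have T4: "4 * real N \<le> T" using N by (simp add: T_def)
    then have T1: "T \<ge> 1" "T \<ge> 2 * real d + 2" using N2 d by linarith+
    define G where "G k = F (Suc k)" for k
    have chF: "chain F r" using F by (simp add: unit_chain_def)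
    have "chain G (r - 1)" using chF unfolding chain_def G_def by auto
    moreover have Gr: "G (r - 1) = F r" using r by (simp add: G_def)
    moreover have "F r \<in> borel_measurable borel" using chF r by (intro chain_measurable) auto
    ultimately obtain p where p: "degree p \<le> d" "wnorm (\<alpha> + 1/2) (\<lambda>x. F 1 x - poly p x)
        \<le> ennreal (C2 / sqrt (real n) ^ (r - 1)) * wnorm (\<alpha> + 1/2 + real (r - 1) / 2) (F r)"
      using C2(3)[OF n0, of G] unfolding d_def by (auto simp: G_def)
    have ix: "\<alpha> + 1/2 + real (r - 1) / 2 = \<alpha> + real r / 2" using r by (simp add: of_nat_diff field_simps)
    have le1: "wnorm (\<alpha> + 1/2 + real (r - 1) / 2) (F r) \<le> 1" unfolding ix using F by (simp add: unit_chain_def)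
    have p2: "wnorm (\<alpha> + 1/2) (\<lambda>x. F 1 x - poly p x) \<le> ennreal (C2 / sqrt (real n) ^ (r - 1))"
      using order.trans[OF p(2) mult_left_mono[OF le1]] by simp
    have F1m [measurable]: "F 1 \<in> borel_measurable borel" using chF r by (intro chain_measurable) auto
    have pM: "wnorm (\<alpha> + 1/2) (poly p) \<le> ennreal M"
    proof -
      have "wnorm (\<alpha> + 1/2) (poly p) \<le> wnorm (\<alpha> + 1/2) (\<lambda>x. poly p x - F 1 x) + wnorm (\<alpha> + 1/2) (F 1)"
        by (rule wnorm_add_le; measurable)
      also have "\<dots> \<le> ennreal C2 + ennreal K1"
      proof (rule add_mono)
        have "1 \<le> sqrt (real n) ^ (r - 1)" using n1 by (intro one_le_power) auto
        then have "C2 / sqrt (real n) ^ (r - 1) \<le> C2 / 1" using C2(1) by (intro divide_left_mono) auto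
        then show "wnorm (\<alpha> + 1/2) (\<lambda>x. poly p x - F 1 x) \<le> ennreal C2"
          using p2 by (subst wnorm_minus_commute) (auto intro: order.trans ennreal_leI)
      qed (rule K1(2)[OF F])
      also have "\<dots> = ennreal M" using C2(1) K1(1) by (simp add: M_def add.commute)
      finally show ?thesis .
    qed
    define A where "A = (2 * real d + 2) * exp (2 * real d + 2) * 2 ^ d / fact d"
    have A: "A \<ge> 0" by (simp add: A_def)
    have grow: "\<bar>poly p x\<bar> \<le> M * A * x ^ d" if "x \<ge> T" for x
      unfolding A_def using that T1 M by (intro poly_growth[OF al2 p(1) _ pM]) auto
    obtain q0 where q0: "pderiv q0 = p" "degree q0 \<le> degree p + 1" using poly_antideriv by blast
    \<comment> \<open>Shifted to vanish at \<open>T\<close>: then the boundary term of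
      \<open>F 0 - q\<close> is that of \<open>F 0\<close>, and the growth of \<open>q\<close>
      beyond \<open>T\<close> follows from that of \<open>p\<close> by the mean value
      theorem.\<close>
    define q where "q = q0 - [:poly q0 T:]"
    have q: "pderiv q = p" "degree q \<le> d + 1" "poly q T = 0"
      using q0 p(1) unfolding q_def by (auto simp: pderiv_diff pderiv_pCons intro!: degree_diff_le)
    have qgrow: "\<bar>poly q z\<bar> \<le> (M * A) * z ^ (d + 1)" if z: "z > T" for z
    proof -
      obtain x where x: "T < x" "x < z" "poly q z - poly q T = (z - T) * poly (pderiv q) x"
        using poly_MVT[OF z, of q] by blast
      have "\<bar>poly q z\<bar> = (z - T) * \<bar>poly p x\<bar>" using x q z by (simp add: abs_mult)
      also have "\<dots> \<le> z * (M * A * z ^ d)"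
      proof (rule mult_mono)
        have "\<bar>poly p x\<bar> \<le> M * A * x ^ d" using x by (intro grow) auto
        also have "\<dots> \<le> M * A * z ^ d" using x T1 M A by (intro mult_left_mono power_mono) auto
        finally show "\<bar>poly p x\<bar> \<le> M * A * z ^ d" .
      qed (use T1 z in auto)
      finally show ?thesis by (simp add: mult_ac)
    qed
    have iq: "integrable (lagm \<alpha>) (poly q)" by (rule integrable_poly_lagm[OF al])
    have iF: "integrable (lagm \<alpha>) (F 0)" by (rule unit_chain_integrable[OF al r F])
    have split: "trunc_err \<alpha> m T (F 0) = trunc_err \<alpha> m T (\<lambda>x. F 0 x - poly q x) + trunc_err \<alpha> m T (poly q)"
      using iq iF by (simp add: trunc_err_def sum_subtractf algebra_simps)
    \<comment> \<open>The full Gauss rule is exact for \<open>q\<close>, so its truncation error is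
      the sum over the dropped nodes.\<close>
    have "trunc_err \<alpha> m T (poly q) = (\<Sum>z\<in>{z\<in>Zs \<alpha> m. z > T}. lamz \<alpha> m z * poly q z)"
    proof -
      have "(\<integral>x. poly q x \<partial>lagm \<alpha>) = (\<Sum>z\<in>Zs \<alpha> m. lamz \<alpha> m z * poly q z)"
        using gauss[OF al, of q m] q(2) Nm by (simp add: Lam_def)
      also have "\<dots> = (\<Sum>z\<in>{z\<in>Zs \<alpha> m. z \<le> T} \<union> {z\<in>Zs \<alpha> m. z > T}. lamz \<alpha> m z * poly q z)"
        by (intro sum.cong) auto
      also have "\<dots> = (\<Sum>z\<in>{z\<in>Zs \<alpha> m. z \<le> T}. lamz \<alpha> m z * poly q z) + (\<Sum>z\<in>{z\<in>Zs \<alpha> m. z > T}. lamz \<alpha> m z * poly q z)"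
        by (intro sum.union_disjoint) auto
      finally show ?thesis by (simp add: trunc_err_def)
    qed
    also have "\<bar>\<dots>\<bar> \<le> (M * A) * Gamma (\<alpha> + 1 + real (N + (d + 1))) / T ^ N"
      using T1 Nm M A by (intro nodes_tail_sum[OF al] qgrow) auto
    also have "\<dots> = M * (A * Gamma (\<alpha> + 1 + real (N + (d + 1))) / T ^ N)" by simp
    also have "\<dots> \<le> M * (C3 * real m powr (- real r / 2))"
      unfolding A_def T_def using M mm N d by (intro mult_left_mono C3(2)) auto
    finally have e1: "\<bar>trunc_err \<alpha> m T (poly q)\<bar> \<le> M * C3 * real m powr (- real r / 2)" by (simp add: mult.assoc)
    have "prim (F 0) (F (Suc 0))" using chF r by (simp add: chain_def)
    then have "prim (\<lambda>x. F 0 x - poly q x) (\<lambda>x. F 1 x - poly p x)"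
      using prim_diff[OF _ prim_poly[of q]] q(1) by simp
    from C1(3)[OF mm(1) this] have "ennreal \<bar>trunc_err \<alpha> m T (\<lambda>x. F 0 x - poly q x)\<bar>
       \<le> ennreal (C1 / sqrt (real m)) * wnorm (\<alpha> + 1/2) (\<lambda>x. F 1 x - poly p x) + ennreal (C1 * lag_w \<alpha> T * \<bar>F 0 T\<bar>)"
      using iq iF q(3) by (simp add: T_def)
    also have "\<dots> \<le> ennreal (C1 / sqrt (real m)) * ennreal (C2 / sqrt (real n) ^ (r - 1)) + ennreal (C1 * lag_w \<alpha> T * \<bar>F 0 T\<bar>)"
      by (intro add_right_mono mult_left_mono p2) auto
    also have "\<dots> = ennreal (C1 / sqrt (real m) * (C2 / sqrt (real n) ^ (r - 1)) + C1 * lag_w \<alpha> T * \<bar>F 0 T\<bar>)"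
    proof -
      have "ennreal (C1 / sqrt (real m) * (C2 / sqrt (real n) ^ (r - 1))) = ennreal (C1 / sqrt (real m)) * ennreal (C2 / sqrt (real n) ^ (r - 1))"
        using C1(1) C2(1) by (intro ennreal_mult) auto
      moreover have "ennreal (C1 / sqrt (real m) * (C2 / sqrt (real n) ^ (r - 1)) + C1 * lag_w \<alpha> T * \<bar>F 0 T\<bar>)
          = ennreal (C1 / sqrt (real m) * (C2 / sqrt (real n) ^ (r - 1))) + ennreal (C1 * lag_w \<alpha> T * \<bar>F 0 T\<bar>)"
        using C1(1) C2(1) by (intro ennreal_plus) auto
      ultimately show ?thesis by (simp only:)
    qed
    finally have e2: "\<bar>trunc_err \<alpha> m T (\<lambda>x. F 0 x - poly q x)\<bar>
        \<le> C1 / sqrt (real m) * (C2 / sqrt (real n) ^ (r - 1)) + C1 * lag_w \<alpha> T * \<bar>F 0 T\<bar>"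
      using C1(1) C2(1) by (subst (asm) ennreal_le_iff) auto
    have pw: "real m powr (- real r / 2) = 1 / sqrt (real m) ^ r"
    proof -
      have "(real m powr (1/2)) powr real r = sqrt (real m) ^ r"
        using mm by (subst powr_realpow) (auto simp: powr_half_sqrt)
      then have "real m powr (real r / 2) = sqrt (real m) ^ r" by (simp add: powr_powr)
      moreover have "real m powr (- real r / 2) = 1 / real m powr (real r / 2)"
        using powr_minus_divide[of "real m" "real r / 2"] by simp
      ultimately show ?thesis by simp
    qed
    have e3: "C1 / sqrt (real m) * (C2 / sqrt (real n) ^ (r - 1)) \<le> C1 * C2 / s ^ (r - 1) * real m powr (- real r / 2)"
    proof -
      have "\<theta> / 160 * real m \<le> real n"
      proof -
        have "real N < 40 * real n + 40" using nN by linarith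
        moreover have "real N \<ge> 80" using N2 by linarith
        ultimately show ?thesis using N by linarith
      qed
      then have "s * sqrt (real m) \<le> sqrt (real n)" unfolding s_def by (simp flip: real_sqrt_mult)
      then have "(s * sqrt (real m)) ^ (r - 1) \<le> sqrt (real n) ^ (r - 1)" using s by (intro power_mono) auto
      then have "C2 / sqrt (real n) ^ (r - 1) \<le> C2 / (s * sqrt (real m)) ^ (r - 1)"
        using C2(1) s mm n1 by (intro divide_left_mono mult_pos_pos zero_less_power) auto
      then have "C1 / sqrt (real m) * (C2 / sqrt (real n) ^ (r - 1)) \<le> C1 / sqrt (real m) * (C2 / (s * sqrt (real m)) ^ (r - 1))"
        using C1(1) by (intro mult_left_mono) auto
      also have "\<dots> = C1 * C2 / s ^ (r - 1) * (1 / (sqrt (real m) * sqrt (real m) ^ (r - 1)))"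
        by (simp add: power_mult_distrib)
      also have "sqrt (real m) * sqrt (real m) ^ (r - 1) = sqrt (real m) ^ r"
        using r by (simp flip: power_Suc)
      finally show ?thesis unfolding pw .
    qed
    have e4: "C1 * lag_w \<alpha> T * \<bar>F 0 T\<bar> \<le> C1 * K2 * (4 * \<theta>) powr (- real r / 2) * real m powr (- real r / 2)"
    proof -
      have "lag_w \<alpha> T = T powr (- real r / 2) * lag_w (\<alpha> + real r / 2) T"
        using T1 by (simp add: lag_w_def powr_add[symmetric] mult.assoc[symmetric])
      then have "C1 * lag_w \<alpha> T * \<bar>F 0 T\<bar> = C1 * T powr (- real r / 2) * (lag_w (\<alpha> + real r / 2) T * \<bar>F 0 T\<bar>)" by simp
      also have "\<dots> \<le> C1 * T powr (- real r / 2) * K2"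
        using C1(1) by (intro mult_left_mono K2(2)[OF F T1(1)]) auto
      also have "T powr (- real r / 2) = (4 * \<theta>) powr (- real r / 2) * real m powr (- real r / 2)"
        unfolding T_def by (rule powr_mult)
      finally show ?thesis by (simp add: mult_ac)
    qed
    have "\<bar>trunc_err \<alpha> m T (F 0)\<bar> \<le> C1 * C2 / s ^ (r - 1) * real m powr (- real r / 2)
        + C1 * K2 * (4 * \<theta>) powr (- real r / 2) * real m powr (- real r / 2) + M * C3 * real m powr (- real r / 2)"
      using e1 e2 e3 e4 unfolding split by linarith
    also have "\<dots> = C * real m powr (- real r / 2)" by (simp add: C_def distrib_right)
    finally show ?thesis unfolding T_def .
  qed
  moreover have "m0 \<ge> 1" by (simp add: m0_def)
  ultimately show ?thesis using C by blast
qed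

text \<open>Covers the finitely many \<open>m\<close> below the threshold of
  \<open>half_line_error\<close>. Point evaluation at a fixed \<open>z > 0\<close> is bounded on the
  unit chains: by \<open>unit_chain_point\<close> for \<open>z >= 1\<close>, and otherwise by
  integrating \<open>F 1\<close> from \<open>z\<close> to 1, where the weight has a positive lower
  bound.\<close>

lemma half_line_error_crude:
  fixes \<alpha> T :: real and r m :: nat
  assumes al: "\<alpha> > -1" and r: "r \<ge> 1"
  shows "\<exists>C>0. \<forall>F. unit_chain \<alpha> r F \<longrightarrow> \<bar>trunc_err \<alpha> m T (F 0)\<bar> \<le> C"
proof -
  obtain K0 where K0: "K0 > 0" "\<And>F. unit_chain \<alpha> r F \<Longrightarrow> wnorm \<alpha> (F 0) \<le> ennreal K0"
    using hardy[OF al r, of r] by auto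
  obtain K1 where K1: "K1 > 0" "\<And>F. unit_chain \<alpha> r F \<Longrightarrow> wnorm (\<alpha> + 1/2) (F 1) \<le> ennreal K1"
    using hardy[OF al r, of "r - 1"] r by auto
  obtain K2 where K2: "K2 > 0" "\<And>F x. unit_chain \<alpha> r F \<Longrightarrow> x \<ge> 1 \<Longrightarrow> lag_w (\<alpha> + real r / 2) x * \<bar>F 0 x\<bar> \<le> K2"
    using unit_chain_point[of \<alpha> r] r by (metis less_le_trans zero_less_one)
  have pt: "\<exists>c\<ge>0. \<forall>F. unit_chain \<alpha> r F \<longrightarrow> \<bar>F 0 z\<bar> \<le> c" if z: "z > 0" for z
  proof (cases "z \<ge> 1")
    case True
    have w: "lag_w (\<alpha> + real r / 2) z > 0" using z by (rule lag_w_pos)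
    have "\<bar>F 0 z\<bar> \<le> K2 / lag_w (\<alpha> + real r / 2) z" if "unit_chain \<alpha> r F" for F
      using K2(2)[OF that True] w by (simp add: field_simps)
    then show ?thesis using K2(1) w by (intro exI[of _ "K2 / lag_w (\<alpha> + real r / 2) z"]) auto
  next
    case False
    define w1 where "w1 = lag_w (\<alpha> + real r / 2) 1"
    have w1: "w1 > 0" unfolding w1_def by (rule lag_w_pos) simp
    define c where "c = min 1 (z powr (\<alpha> + 1/2)) * exp (-1)"
    have c: "c > 0" using z by (simp add: c_def)
    have "\<bar>F 0 z\<bar> \<le> K2 / w1 + K1 / c" if F: "unit_chain \<alpha> r F" for F
    proof -
      have pr: "prim (F 0) (F 1)" using F r by (simp add: unit_chain_def chain_def)
      note [measurable] = primD(1,2)[OF pr]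
      have "ennreal c * ennreal \<bar>F 0 1 - F 0 z\<bar> \<le> ennreal c * (\<integral>\<^sup>+s. indicator {z..1} s * ennreal \<bar>F 1 s\<bar> \<partial>lborel)"
        using z False by (intro mult_left_mono prim_abs_diff_le[OF pr]) auto
      also have "\<dots> = (\<integral>\<^sup>+s. ennreal c * (indicator {z..1} s * ennreal \<bar>F 1 s\<bar>) \<partial>lborel)"
        by (rule nn_integral_cmult[symmetric]) measurable
      also have "\<dots> \<le> (\<integral>\<^sup>+s. ennreal (indicator {0<..} s * lag_w (\<alpha> + 1/2) s) * ennreal \<bar>F 1 s\<bar> \<partial>lborel)"
      proof (intro nn_integral_mono)
        fix s
        show "ennreal c * (indicator {z..1} s * ennreal \<bar>F 1 s\<bar>) \<le> ennreal (indicator {0<..} s * lag_w (\<alpha> + 1/2) s) * ennreal \<bar>F 1 s\<bar>"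
        proof (cases "s \<in> {z..1}")
          case True
          have "min 1 (z powr (\<alpha> + 1/2)) \<le> s powr (\<alpha> + 1/2)"
          proof (cases "\<alpha> + 1/2 \<ge> 0")
            case True
            then have "z powr (\<alpha> + 1/2) \<le> s powr (\<alpha> + 1/2)" using \<open>s \<in> {z..1}\<close> z by (intro powr_mono2) auto
            then show ?thesis by simp
          next
            case False
            then have "1 powr (\<alpha> + 1/2) \<le> s powr (\<alpha> + 1/2)" using \<open>s \<in> {z..1}\<close> z by (intro powr_mono2') auto
            then show ?thesis by simp
          qed
          then have "c \<le> lag_w (\<alpha> + 1/2) s" unfolding c_def lag_w_def using True z by (intro mult_mono) auto
          then show ?thesis using True z by (auto intro!: mult_right_mono ennreal_leI)
        qed simp
      qed
      also have "\<dots> = wnorm (\<alpha> + 1/2) (F 1)"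
        unfolding wnorm_def by (rule nn_integral_lagm[symmetric]) measurable
      also have "\<dots> \<le> ennreal K1" by (rule K1(2)[OF F])
      finally have "c * \<bar>F 0 1 - F 0 z\<bar> \<le> K1" using c K1(1) by (simp flip: ennreal_mult)
      then have "\<bar>F 0 1 - F 0 z\<bar> \<le> K1 / c" using c by (simp add: field_simps)
      moreover have "\<bar>F 0 1\<bar> \<le> K2 / w1" using K2(2)[OF F, of 1] w1 by (simp add: w1_def field_simps)
      ultimately show ?thesis by linarith
    qed
    then show ?thesis using K1(1) K2(1) w1 c by (intro exI[of _ "K2 / w1 + K1 / c"]) auto
  qed
  then obtain c where c: "\<And>z. z > 0 \<Longrightarrow> c z \<ge> 0" "\<And>z F. z > 0 \<Longrightarrow> unit_chain \<alpha> r F \<Longrightarrow> \<bar>F 0 z\<bar> \<le> c z"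
    by metis
  have Zp: "z > 0" if "z \<in> Zs \<alpha> m" for z using Zs_props(2)[OF al] that by auto
  define C where "C = K0 + (\<Sum>z\<in>{z\<in>Zs \<alpha> m. z \<le> T}. lamz \<alpha> m z * c z)"
  have "\<bar>trunc_err \<alpha> m T (F 0)\<bar> \<le> C" if F: "unit_chain \<alpha> r F" for F
  proof -
    have iF: "integrable (lagm \<alpha>) (F 0)" by (rule unit_chain_integrable[OF al r F])
    have "ennreal \<bar>\<integral>x. F 0 x \<partial>lagm \<alpha>\<bar> \<le> wnorm \<alpha> (F 0)"
      unfolding wnorm_def using integral_norm_bound_ennreal[OF iF] by simp
    also have "\<dots> \<le> ennreal K0" by (rule K0(2)[OF F])
    finally have "\<bar>\<integral>x. F 0 x \<partial>lagm \<alpha>\<bar> \<le> K0" using K0(1) by simp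
    moreover have "\<bar>\<Sum>z\<in>{z\<in>Zs \<alpha> m. z \<le> T}. lamz \<alpha> m z * F 0 z\<bar> \<le> (\<Sum>z\<in>{z\<in>Zs \<alpha> m. z \<le> T}. lamz \<alpha> m z * c z)"
    proof (rule order.trans[OF sum_abs], rule sum_mono)
      fix z assume "z \<in> {z\<in>Zs \<alpha> m. z \<le> T}"
      then show "\<bar>lamz \<alpha> m z * F 0 z\<bar> \<le> lamz \<alpha> m z * c z"
        using lamz_pos[OF al, of z m] c(2)[OF Zp F] by (auto simp: abs_mult intro!: mult_left_mono)
    qed
    ultimately show ?thesis unfolding trunc_err_def C_def by linarith
  qed
  moreover have "C > 0" unfolding C_def using K0(1) lamz_pos[OF al] c(1) Zp
    by (intro add_pos_nonneg sum_nonneg mult_nonneg_nonneg) (auto intro: less_imp_le)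
  ultimately show ?thesis by blast
qed

text \<open>Bounds the set of \<open>m\<close> over which \<open>m_n\<close> takes its maximum. By
  the step estimate the Cotes sums up to \<open>s\<close> converge to the mass up to
  \<open>s\<close>; each interval \<open>{i + 1<..i + 2}\<close> has positive mass, hence eventually
  contains a node.\<close>

lemma many_nodes:
  assumes al: "\<alpha> > -1" and th: "0 < \<theta>" "\<theta> < 1"
  shows "\<exists>m0. \<forall>m\<ge>m0. J \<le> card {z\<in>Zs \<alpha> m. z \<le> 4 * \<theta> * real m}"
proof -
  obtain C m0 where C: "C > 0" "\<And>m. m \<ge> m0 \<Longrightarrow> \<exists>D. step_bound \<alpha> \<theta> C m D"
    using step_approximation[OF al th] by blast
  interpret finite_measure "lagm \<alpha>" by (rule finite_measure_lagm[OF al])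
  define k where "k m s = (\<Sum>z\<in>{z\<in>Zs \<alpha> m. z \<le> s}. lamz \<alpha> m z)" for m s
  have K: "\<bar>measure (lagm \<alpha>) {..s} - k m s\<bar> \<le> C * sqrt (s / real m) * lag_w \<alpha> s"
    if m: "m \<ge> m0" "s > 0" "s \<le> 4 * \<theta> * real m" for m s
  proof -
    obtain D where D: "step_bound \<alpha> \<theta> C m D" using C(2)[OF m(1)] by blast
    have ii: "integrable (lagm \<alpha>) (indicator {..s} :: real \<Rightarrow> real)" "integrable (lagm \<alpha>) (poly (step_sum \<alpha> m D s))"
      by (intro integrable_indicator_lagm integrable_poly_lagm al; simp)+
    have "k m s = Lam \<alpha> (step_sum \<alpha> m D s)" using D unfolding k_def step_bound_def by simp
    then have "measure (lagm \<alpha>) {..s} - k m s = (\<integral>x. indicator {..s} x - poly (step_sum \<alpha> m D s) x \<partial>lagm \<alpha>)"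
      using ii by (simp add: Lam_def)
    also have "ennreal (norm \<dots>) \<le> (\<integral>\<^sup>+x. ennreal (norm (indicator {..s} x - poly (step_sum \<alpha> m D s) x)) \<partial>lagm \<alpha>)"
      by (rule integral_norm_bound_ennreal) (use ii in auto)
    also have "\<dots> \<le> ennreal (C * sqrt (s / real m) * lag_w \<alpha> s)"
      using D m unfolding step_bound_def real_norm_def by blast
    finally show ?thesis using C(1) m(2) by simp
  qed
  have lim: "(\<lambda>m. k m s) \<longlonglongrightarrow> measure (lagm \<alpha>) {..s}" if s: "s > 0" for s
  proof (rule Lim_transform_bound[OF eventually_mono[OF eventually_ge_at_top[of "max m0 (nat \<lceil>s / (4 * \<theta>)\<rceil>)"]], THEN LIM_zero_cancel])
    fix m assume m: "max m0 (nat \<lceil>s / (4 * \<theta>)\<rceil>) \<le> m"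
    then have "s / (4 * \<theta>) \<le> real m" by linarith
    then have "s \<le> 4 * \<theta> * real m" using th by (simp add: field_simps)
    then show "norm (k m s - measure (lagm \<alpha>) {..s}) \<le> norm (C * sqrt (s / real m) * lag_w \<alpha> s)"
      using K[of m s] s m C(1) by (simp add: abs_mult abs_minus_commute)
  next
    have "(\<lambda>m. s / real m) \<longlonglongrightarrow> 0" by (rule lim_const_over_n)
    then have "(\<lambda>m. sqrt (s / real m)) \<longlonglongrightarrow> sqrt 0" by (rule tendsto_real_sqrt)
    then show "(\<lambda>m. C * sqrt (s / real m) * lag_w \<alpha> s) \<longlonglongrightarrow> 0"
      by (auto intro!: tendsto_mult_left_zero tendsto_mult_right_zero)
  qed
  have pos: "measure (lagm \<alpha>) {real i + 1<..real i + 2} > 0" for i :: nat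
  proof (rule ccontr)
    assume "\<not> ?thesis"
    then have "emeasure (lagm \<alpha>) {real i + 1<..real i + 2} = 0"
      using measure_nonneg[of "lagm \<alpha>" "{real i + 1<..real i + 2}"] by (simp add: emeasure_eq_measure)
    then have "(\<integral>\<^sup>+x. ennreal (indicator {0<..} x * lag_w \<alpha> x) * indicator {real i + 1<..real i + 2} x \<partial>lborel) = 0"
      by (subst nn_integral_lagm[symmetric]) auto
    then have "AE x in lborel. ennreal (indicator {0<..} x * lag_w \<alpha> x) * indicator {real i + 1<..real i + 2} x = 0"
      by (subst (asm) nn_integral_0_iff_AE) auto
    then have "AE x in lborel. x \<notin> {real i + 1<..real i + 2}"
    proof eventually_elim
      case (elim x)
      then show ?case using lag_w_pos[of x \<alpha>] by (auto simp: indicator_def split: if_splits)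
    qed
    then have "{real i + 1<..real i + 2} \<in> null_sets lborel"
      by (subst AE_iff_null_sets) auto
    then have "emeasure lborel {real i + 1<..real i + 2} = 0" by auto
    then show False by simp
  qed
  have ex: "\<forall>\<^sub>F m in sequentially. \<exists>z\<in>Zs \<alpha> m. real i + 1 < z \<and> z \<le> real i + 2" for i :: nat
  proof -
    have "(\<lambda>m. k m (real i + 2) - k m (real i + 1)) \<longlonglongrightarrow> measure (lagm \<alpha>) {..real i + 2} - measure (lagm \<alpha>) {..real i + 1}"
      by (intro tendsto_diff lim) auto
    moreover have "measure (lagm \<alpha>) {..real i + 2} - measure (lagm \<alpha>) {..real i + 1} = measure (lagm \<alpha>) {real i + 1<..real i + 2}"
    proof -
      have "{..real i + 2} - {..real i + 1} = {real i + 1<..real i + 2}" by auto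
      then show ?thesis using finite_measure_Diff[of "{..real i + 2}" "{..real i + 1}"] by auto
    qed
    ultimately have "\<forall>\<^sub>F m in sequentially. k m (real i + 2) - k m (real i + 1) > 0"
      using pos[of i] by (metis order_tendstoD(1))
    then show ?thesis
    proof eventually_elim
      case (elim m)
      show ?case
      proof (rule ccontr)
        assume "\<not> ?thesis"
        then have "{z\<in>Zs \<alpha> m. z \<le> real i + 2} = {z\<in>Zs \<alpha> m. z \<le> real i + 1}" by fastforce
        then show False using elim by (simp add: k_def)
      qed
    qed
  qed
  have "\<forall>\<^sub>F m in sequentially. (\<forall>i\<in>{..<J}. \<exists>z\<in>Zs \<alpha> m. real i + 1 < z \<and> z \<le> real i + 2) \<and> nat \<lceil>(real J + 1) / (4 * \<theta>)\<rceil> \<le> m"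
    by (intro eventually_conj eventually_ball_finite ex ballI eventually_ge_at_top) auto
  then have "\<forall>\<^sub>F m in sequentially. J \<le> card {z\<in>Zs \<alpha> m. z \<le> 4 * \<theta> * real m}"
  proof eventually_elim
    case (elim m)
    then obtain f where f: "\<And>i. i < J \<Longrightarrow> f i \<in> Zs \<alpha> m \<and> real i + 1 < f i \<and> f i \<le> real i + 2"
      by (metis lessThan_iff)
    have "(real J + 1) / (4 * \<theta>) \<le> real m" using elim by linarith
    then have J: "real J + 1 \<le> 4 * \<theta> * real m" using th by (simp add: field_simps)
    have inj: "inj_on f {..<J}"
    proof (rule inj_onI)
      fix i l assume il: "i \<in> {..<J}" "l \<in> {..<J}" "f i = f l"
      then have "real i < real l + 1" "real l < real i + 1" using f[of i] f[of l] by auto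
      then show "i = l" by linarith
    qed
    have "f ` {..<J} \<subseteq> {z\<in>Zs \<alpha> m. z \<le> 4 * \<theta> * real m}"
    proof
      fix z assume "z \<in> f ` {..<J}"
      then obtain i where i: "i < J" "z = f i" by auto
      then have "real i + 1 \<le> real J" by linarith
      then show "z \<in> {z\<in>Zs \<alpha> m. z \<le> 4 * \<theta> * real m}" using f[OF i(1)] i J by auto
    qed
    then have "card (f ` {..<J}) \<le> card {z\<in>Zs \<alpha> m. z \<le> 4 * \<theta> * real m}" by (intro card_mono) auto
    then show ?case using inj by (simp add: card_image)
  qed
  then show ?thesis by (simp add: eventually_sequentially)
qed

subsection \<open>Test functions\<close>

definition smooth :: "(real \<Rightarrow> real) \<Rightarrow> bool" where
  "smooth f \<longleftrightarrow> (\<forall>k x. ((deriv ^^ k) f) differentiable (at x))"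

text \<open>A coinduction principle: smoothness follows from any class of functions containing
  \<open>f\<close> and closed under differentiation.\<close>

lemma smooth_coinduct:
  assumes f: "P f" and step: "\<And>f. P f \<Longrightarrow> \<exists>f'. P f' \<and> (\<forall>x. (f has_real_derivative f' x) (at x))"
  shows "smooth f"
proof -
  have "P ((deriv ^^ k) f)" for k
  proof (induction k)
    case (Suc k)
    obtain f' where f': "P f'" "\<And>x. ((deriv ^^ k) f has_real_derivative f' x) (at x)"
      using step[OF Suc] by blast
    have "deriv ((deriv ^^ k) f) = f'" using f'(2) by (intro ext DERIV_imp_deriv)
    then show ?case using f'(1) by simp
  qed (use f in simp)
  then show ?thesis unfolding smooth_def using step by (meson real_differentiable_def)
qed

lemma smooth_deriv: "smooth f \<Longrightarrow> smooth (deriv f)"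
  unfolding smooth_def by (metis funpow_Suc_right comp_apply)

lemma smooth_has_deriv:
  assumes "smooth f" shows "(f has_real_derivative deriv f x) (at x)"
proof -
  have "((deriv ^^ 0) f) differentiable (at x)" using assms unfolding smooth_def by blast
  then show ?thesis by (simp add: DERIV_deriv_iff_real_differentiable)
qed

lemma smooth_continuous: "smooth f \<Longrightarrow> continuous_on S f"
  by (intro continuous_at_imp_continuous_on ballI) (rule DERIV_isCont, rule smooth_has_deriv)

lemma smooth_lincomb:
  assumes "smooth f" "smooth g"
  shows "smooth (\<lambda>x. a * f x + b * g x)"
proof (rule smooth_coinduct[where P = "\<lambda>h. \<exists>f g. smooth f \<and> smooth g \<and> h = (\<lambda>x. a * f x + b * g x)"])
  fix h assume "\<exists>f g. smooth f \<and> smooth g \<and> h = (\<lambda>x. a * f x + b * g x)"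
  then obtain f g where fg: "smooth f" "smooth g" "h = (\<lambda>x. a * f x + b * g x)" by blast
  show "\<exists>h'. (\<exists>f g. smooth f \<and> smooth g \<and> h' = (\<lambda>x. a * f x + b * g x)) \<and> (\<forall>x. (h has_real_derivative h' x) (at x))"
    using fg smooth_deriv smooth_has_deriv
    by (intro exI[of _ "\<lambda>x. a * deriv f x + b * deriv g x"] conjI exI[of _ "deriv f"] exI[of _ "deriv g"])
       (auto intro!: derivative_eq_intros)
qed (use assms in blast)

lemma smooth_antideriv:
  assumes "smooth g" "\<And>x. (f has_real_derivative g x) (at x)"
  shows "smooth f"
proof (rule smooth_coinduct[where P = "\<lambda>h. h = f \<or> smooth h"])
  fix h assume "h = f \<or> smooth h"
  then show "\<exists>h'. (h' = f \<or> smooth h') \<and> (\<forall>x. (h has_real_derivative h' x) (at x))"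
    using assms smooth_deriv smooth_has_deriv by metis
qed simp

lemma test_fun_smooth: "test_fun \<phi> \<longleftrightarrow> smooth \<phi> \<and> (\<exists>R>0. \<forall>x. \<bar>x\<bar> \<ge> R \<longrightarrow> \<phi> x = 0)"
proof -
  have "bounded {x. \<phi> x \<noteq> 0} \<longleftrightarrow> (\<exists>R>0. \<forall>x. \<bar>x\<bar> \<ge> R \<longrightarrow> \<phi> x = 0)"
  proof
    assume "bounded {x. \<phi> x \<noteq> 0}"
    then obtain B where "B > 0" "\<And>x. \<phi> x \<noteq> 0 \<Longrightarrow> \<bar>x\<bar> \<le> B" by (auto simp: bounded_pos)
    then show "\<exists>R>0. \<forall>x. \<bar>x\<bar> \<ge> R \<longrightarrow> \<phi> x = 0" by (intro exI[of _ "B + 1"]) force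
  next
    assume "\<exists>R>0. \<forall>x. \<bar>x\<bar> \<ge> R \<longrightarrow> \<phi> x = 0"
    then obtain R where "\<And>x. \<bar>x\<bar> \<ge> R \<Longrightarrow> \<phi> x = 0" by blast
    then have "\<forall>x\<in>{x. \<phi> x \<noteq> 0}. norm x \<le> R" by force
    then show "bounded {x. \<phi> x \<noteq> 0}" unfolding bounded_iff by blast
  qed
  then show ?thesis unfolding test_fun_def smooth_def by blast
qed

lemma deriv_zero_outside:
  assumes "smooth \<phi>" "\<And>x. \<bar>x\<bar> \<ge> R \<Longrightarrow> \<phi> x = 0" "\<bar>x\<bar> > R"
  shows "deriv \<phi> x = 0"
proof -
  have "((\<lambda>x. 0) has_real_derivative 0) (at x)" by simp
  moreover have "open {x::real. \<bar>x\<bar> > R}" by (intro open_Collect_less continuous_intros)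
  ultimately have "(\<phi> has_real_derivative 0) (at x)"
    using assms by (elim has_field_derivative_transform_within_open) auto
  then show ?thesis by (rule DERIV_imp_deriv)
qed

lemma test_fun_deriv:
  assumes "test_fun \<phi>" shows "test_fun (deriv \<phi>)"
proof -
  obtain R where "R > 0" "\<And>x. \<bar>x\<bar> \<ge> R \<Longrightarrow> \<phi> x = 0" "smooth \<phi>" using assms unfolding test_fun_smooth by blast
  then show ?thesis unfolding test_fun_smooth
    by (intro conjI smooth_deriv exI[of _ "R + 1"]) (auto intro!: deriv_zero_outside[of \<phi> R])
qed

section \<open>An explicit family of smooth bumps\<close>

text \<open>The functions produced by repeatedly differentiating \<open>exp (- c / x)\<close>,
  extended by 0. The parameter \<open>c\<close> is later sent to 0, so that the bumps tend to
  indicators.\<close>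

definition eexp :: "real \<Rightarrow> nat \<Rightarrow> real \<Rightarrow> real" where
  "eexp c i x = (if x > 0 then exp (- c / x) / x ^ i else 0)"

text \<open>The square makes the difference quotient at 0 tend to 0 in
  \<open>eexp_deriv\<close>.\<close>

lemma eexp_bound:
  assumes "c > 0" "x > 0"
  shows "eexp c i x \<le> (real (i + 2) / c) ^ (i + 2) * x\<^sup>2"
proof -
  have "(c / x) ^ (i + 2) \<le> real (i + 2) ^ (i + 2) * exp (c / x)"
    using assms by (intro power_le_exp) auto
  then have "exp (- c / x) * (c / x) ^ (i + 2) \<le> exp (- c / x) * (real (i + 2) ^ (i + 2) * exp (c / x))"
    by (rule mult_left_mono) simp
  also have "\<dots> = real (i + 2) ^ (i + 2) * (exp (- c / x) * exp (c / x))" by (simp only: mult_ac)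
  also have "exp (- c / x) * exp (c / x) = 1" by (simp flip: exp_add)
  finally have "exp (- c / x) * (c / x) ^ (i + 2) \<le> real (i + 2) ^ (i + 2)" by simp
  then have "exp (- c / x) \<le> real (i + 2) ^ (i + 2) / (c / x) ^ (i + 2)"
    using assms by (subst pos_le_divide_eq) auto
  also have "\<dots> = (real (i + 2) / c) ^ (i + 2) * x ^ (i + 2)"
    using assms by (simp only: power_divide) (simp add: field_simps)
  finally have "exp (- c / x) / x ^ i \<le> (real (i + 2) / c) ^ (i + 2) * x ^ (i + 2) / x ^ i"
    using assms by (intro divide_right_mono) auto
  then show ?thesis using assms by (simp add: eexp_def power_add power2_eq_square mult_ac)
qed

lemma eexp_deriv:
  assumes c: "c > 0"
  shows "(eexp c i has_real_derivative c * eexp c (i + 2) x - real i * eexp c (i + 1) x) (at x)"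
proof -
  consider "x < 0" | "x = 0" | "x > 0" by linarith
  then show ?thesis
  proof cases
    case 1
    have "((\<lambda>x. 0) has_real_derivative 0) (at x)" by simp
    then have "(eexp c i has_real_derivative 0) (at x)"
      by (rule has_field_derivative_transform_within_open[where S = "{..<0}"]) (use 1 in \<open>auto simp: eexp_def\<close>)
    then show ?thesis using 1 by (simp add: eexp_def)
  next
    case 3
    have "((\<lambda>x. exp (- c / x) / x ^ i) has_real_derivative c * eexp c (i + 2) x - real i * eexp c (i + 1) x) (at x)"
    proof -
      have 1: "((\<lambda>x. exp (- c / x)) has_real_derivative c / x\<^sup>2 * exp (- c / x)) (at x)"
        using 3 by (auto intro!: derivative_eq_intros simp: power2_eq_square)
      have 2: "((\<lambda>x. x ^ i) has_real_derivative real i * x ^ (i - 1)) (at x)"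
        by (auto intro!: derivative_eq_intros)
      show ?thesis
        by (rule DERIV_cong[OF DERIV_divide[OF 1 2]])
           (use 3 in \<open>cases i; simp add: eexp_def field_simps power2_eq_square\<close>)+
    qed
    then show ?thesis
      by (rule has_field_derivative_transform_within_open[where S = "{0<..}"]) (use 3 in \<open>auto simp: eexp_def\<close>)
  next
    case 2
    define K where "K = (real (i + 2) / c) ^ (i + 2)"
    have K: "K \<ge> 0" using c by (simp add: K_def)
    have "((\<lambda>h. (eexp c i (0 + h) - eexp c i 0) / h) \<longlongrightarrow> 0) (at 0)"
    proof (rule Lim_null_comparison)
      show "\<forall>\<^sub>F h in at 0. norm ((eexp c i (0 + h) - eexp c i 0) / h) \<le> K * \<bar>h\<bar>"
      proof (intro always_eventually allI)
        fix h :: real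
        have "eexp c i h \<ge> 0" by (simp add: eexp_def)
        show "norm ((eexp c i (0 + h) - eexp c i 0) / h) \<le> K * \<bar>h\<bar>"
        proof (cases "h > 0")
          case True
          then have "eexp c i h / h \<le> K * h\<^sup>2 / h" using eexp_bound[OF c, of h i] by (intro divide_right_mono) (auto simp: K_def)
          then show ?thesis using True \<open>eexp c i h \<ge> 0\<close> by (simp add: eexp_def power2_eq_square)
        next
          case False
          then show ?thesis using K by (simp add: eexp_def mult_nonneg_nonpos)
        qed
      qed
      show "((\<lambda>h. K * \<bar>h\<bar>) \<longlongrightarrow> 0) (at 0)"
        by (intro tendsto_mult_right_zero tendsto_rabs_zero tendsto_ident_at)
    qed
    then show ?thesis using 2 by (simp add: DERIV_def eexp_def)
  qed
qed

definition bump :: "real \<Rightarrow> real \<Rightarrow> real \<Rightarrow> real \<Rightarrow> real" where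
  "bump c a b x = eexp c 0 (x - a) * eexp c 0 (b - x)"

text \<open>The linear span of products of two \<open>eexp\<close> functions is closed under
  differentiation and serves as the class in \<open>smooth_coinduct\<close>.\<close>

inductive bumps :: "real \<Rightarrow> real \<Rightarrow> real \<Rightarrow> (real \<Rightarrow> real) \<Rightarrow> bool" for c a b where
  base: "bumps c a b (\<lambda>x. eexp c i (x - a) * eexp c j (b - x))"
| lin: "bumps c a b f \<Longrightarrow> bumps c a b g \<Longrightarrow> bumps c a b (\<lambda>x. s * f x + t * g x)"

lemma bumps_deriv:
  assumes c: "c > 0"
  shows "bumps c a b f \<Longrightarrow> \<exists>f'. bumps c a b f' \<and> (\<forall>x. (f has_real_derivative f' x) (at x))"
proof (induction rule: bumps.induct)
  case (base i j)
  let ?t = "\<lambda>i j x. eexp c i (x - a) * eexp c j (b - x)"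
  define f' where "f' = (\<lambda>x. 1 * (c * ?t (i + 2) j x + (- real i) * ?t (i + 1) j x)
      + 1 * ((- c) * ?t i (j + 2) x + real j * ?t i (j + 1) x))"
  have "bumps c a b f'" unfolding f'_def by (intro bumps.intros)
  moreover have "((?t i j) has_real_derivative f' x) (at x)" for x
  proof -
    have 1: "((\<lambda>x. eexp c i (x - a)) has_real_derivative c * eexp c (i + 2) (x - a) - real i * eexp c (i + 1) (x - a)) (at x)"
      by (rule DERIV_cong[OF DERIV_chain2[OF eexp_deriv[OF c]]]) (auto intro!: derivative_eq_intros)
    have 2: "((\<lambda>x. eexp c j (b - x)) has_real_derivative - (c * eexp c (j + 2) (b - x) - real j * eexp c (j + 1) (b - x))) (at x)"
      by (rule DERIV_cong[OF DERIV_chain2[OF eexp_deriv[OF c]]]) (auto intro!: derivative_eq_intros)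
    show ?thesis by (rule DERIV_cong[OF DERIV_mult[OF 1 2]]) (simp add: f'_def algebra_simps)
  qed
  ultimately show ?case by blast
next
  case (lin f g s t)
  then obtain f' g' where "bumps c a b f'" "\<And>x. (f has_real_derivative f' x) (at x)"
    "bumps c a b g'" "\<And>x. (g has_real_derivative g' x) (at x)" by blast
  then show ?case
    by (intro exI[of _ "\<lambda>x. s * f' x + t * g' x"] conjI allI bumps.lin) (auto intro!: derivative_eq_intros)
qed

lemma smooth_bump: "c > 0 \<Longrightarrow> smooth (bump c a b)"
  using smooth_coinduct[of "bumps c a b" "bump c a b"] bumps_deriv[of c a b] bumps.base[of c a b 0 0]
  unfolding bump_def[abs_def] by blast

lemma bump_range: "c > 0 \<Longrightarrow> 0 \<le> bump c a b x \<and> bump c a b x \<le> indicator {a<..<b} x"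
  by (auto simp: bump_def eexp_def indicator_def intro!: mult_le_one)

lemma bump_measurable [measurable]: "bump c a b \<in> borel_measurable borel"
  unfolding bump_def[abs_def] eexp_def[abs_def] by measurable

lemma bump_tendsto: "(\<lambda>n. bump (1 / real (Suc n)) a b x) \<longlonglongrightarrow> indicator {a<..<b} x"
proof -
  have e: "(\<lambda>n. eexp (1 / real (Suc n)) 0 y) \<longlonglongrightarrow> indicator {0<..} y" for y
  proof (cases "y > 0")
    case True
    have "(\<lambda>n. 1 / real (Suc n)) \<longlonglongrightarrow> 0" using LIMSEQ_inverse_real_of_nat by (simp add: inverse_eq_divide)
    then have "(\<lambda>n. - (1 / real (Suc n)) / y) \<longlonglongrightarrow> - 0 / y" using True by (intro tendsto_intros) auto
    then have "(\<lambda>n. exp (- (1 / real (Suc n)) / y)) \<longlonglongrightarrow> exp 0" by (intro tendsto_exp) simp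
    then show ?thesis using True by (simp add: eexp_def)
  qed (simp add: eexp_def)
  have "(\<lambda>n. bump (1 / real (Suc n)) a b x) \<longlonglongrightarrow> indicator {0<..} (x - a) * indicator {0<..} (b - x)"
    unfolding bump_def by (intro tendsto_mult e)
  moreover have "indicator {0<..} (x - a) * indicator {0<..} (b - x) = (indicator {a<..<b} x :: real)"
    by (auto simp: indicator_def)
  ultimately show ?thesis by simp
qed

subsection \<open>Weak derivatives on the line\<close>

lemma loc_integrable_measurable:
  assumes "loc_integrable u" shows "u \<in> borel_measurable borel"
proof (rule borel_measurable_LIMSEQ_real)
  show "(\<lambda>n. indicator {- real n..real n} x * u x) \<longlonglongrightarrow> u x" for x
  proof (rule tendsto_eventually)
    show "\<forall>\<^sub>F n in sequentially. indicator {- real n..real n} x * u x = u x"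
      using eventually_ge_at_top[of "nat \<lceil>\<bar>x\<bar>\<rceil>"]
    proof eventually_elim
      case (elim n)
      then have "\<bar>x\<bar> \<le> real n" by linarith
      then show ?case by (auto simp: indicator_def)
    qed
  qed
  show "(\<lambda>x. indicator {- real n..real n} x * u x) \<in> borel_measurable borel" for n
    using assms borel_measurable_integrable unfolding loc_integrable_def set_integrable_def by fastforce
qed

lemma loc_integrable_mult:
  assumes u: "loc_integrable u" and g: "g \<in> borel_measurable borel" "\<And>x. \<bar>g x\<bar> \<le> B * indicator {-R..R} x"
  shows "integrable lborel (\<lambda>x. u x * g x)"
proof (rule Bochner_Integration.integrable_bound)
  show "integrable lborel (\<lambda>x. B * (indicator {-R..R} x *\<^sub>R u x))"
    using u unfolding loc_integrable_def set_integrable_def by (intro integrable_mult_right) blast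
  show "(\<lambda>x. u x * g x) \<in> borel_measurable lborel" using loc_integrable_measurable[OF u] g(1) by simp
  show "AE x in lborel. norm (u x * g x) \<le> norm (B * (indicator {-R..R} x *\<^sub>R u x))"
  proof (intro AE_I2)
    fix x
    have "\<bar>u x\<bar> * \<bar>g x\<bar> \<le> \<bar>u x\<bar> * \<bar>B * indicator {-R..R} x\<bar>" by (intro mult_left_mono order.trans[OF g(2)]) auto
    then show "norm (u x * g x) \<le> norm (B * (indicator {-R..R} x *\<^sub>R u x))" by (simp add: abs_mult mult_ac)
  qed
qed

lemma compact_support_bound:
  assumes "continuous_on UNIV (g :: real \<Rightarrow> real)" "\<And>x. \<bar>x\<bar> \<ge> R \<Longrightarrow> g x = 0"
  shows "\<exists>B. \<forall>x. \<bar>g x\<bar> \<le> B * indicator {-R..R} x"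
proof -
  have "bounded (g ` {-R..R})"
    using assms by (intro compact_imp_bounded compact_continuous_image) (auto intro: continuous_on_subset)
  then obtain B where "\<forall>y\<in>g ` {-R..R}. norm y \<le> B" unfolding bounded_iff by blast
  then have B: "\<And>x. x \<in> {-R..R} \<Longrightarrow> \<bar>g x\<bar> \<le> B" by auto
  have "\<bar>g x\<bar> \<le> B * indicator {-R..R} x" for x
    using B[of x] assms(2)[of x] by (cases "x \<in> {-R..R}") auto
  then show ?thesis by blast
qed

section \<open>Primitives of locally integrable functions\<close>

text \<open>The signed indicator of the interval between 0 and \<open>x\<close>. It turns the
  oriented integral from 0 to \<open>x\<close> into an integral over the line with a jointly
  measurable kernel, ready for Fubini's theorem.\<close>

definition sgn_ivl :: "real \<Rightarrow> real \<Rightarrow> real" where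
  "sgn_ivl x s = (if 0 < s \<and> s \<le> x then 1 else if x < s \<and> s \<le> 0 then - 1 else 0)"

definition primit :: "(real \<Rightarrow> real) \<Rightarrow> real \<Rightarrow> real" where
  "primit v x = (\<integral>s. v s * sgn_ivl x s \<partial>lborel)"

lemma sgn_ivl_measurable [measurable]: "case_prod sgn_ivl \<in> borel_measurable (borel \<Otimes>\<^sub>M borel)"
  unfolding sgn_ivl_def by measurable

lemma integrable_sgn_ivl: "loc_integrable v \<Longrightarrow> integrable lborel (\<lambda>s. v s * sgn_ivl x s)"
  by (rule loc_integrable_mult[where B = 1 and R = "\<bar>x\<bar>"]) (auto simp: sgn_ivl_def indicator_def)

lemma primit_diff:
  assumes v: "loc_integrable v" and ab: "a \<le> b"
  shows "primit v b - primit v a = (LINT s:{a..b}|lborel. v s)"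
proof -
  have "primit v b - primit v a = (\<integral>s. v s * sgn_ivl b s - v s * sgn_ivl a s \<partial>lborel)"
    unfolding primit_def by (intro Bochner_Integration.integral_diff[symmetric] integrable_sgn_ivl v)
  also have "\<dots> = (\<integral>s. indicator {a<..b} s *\<^sub>R v s \<partial>lborel)"
    using ab by (intro Bochner_Integration.integral_cong) (auto simp: sgn_ivl_def indicator_def)
  also have "\<dots> = (\<integral>s. indicator {a..b} s *\<^sub>R v s \<partial>lborel)"
  proof (rule integral_cong_AE)
    have "AE s in lborel. s \<noteq> a" by (rule AE_lborel_singleton)
    then show "AE s in lborel. indicator {a<..b} s *\<^sub>R v s = indicator {a..b} s *\<^sub>R v s"
      by eventually_elim (auto simp: indicator_def)
  qed (use loc_integrable_measurable[OF v] in measurable)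
  finally show ?thesis by (simp add: set_lebesgue_integral_def)
qed

lemma continuous_primit:
  assumes v: "loc_integrable v"
  shows "continuous_on UNIV (primit v)"
proof (intro continuous_at_imp_continuous_on ballI)
  fix x :: real
  define R where "R = \<bar>x\<bar> + 1"
  have si: "set_integrable lborel {a..b} v" for a b using v unfolding loc_integrable_def by blast
  have "continuous_on {-R..R} (\<lambda>y. primit v (-R) + integral {-R..y} v)"
    using set_borel_integral_eq_integral(1)[OF si] by (intro continuous_intros indefinite_integral_continuous_1)
  moreover have "primit v (-R) + integral {-R..y} v = primit v y" if "y \<in> {-R..R}" for y
    using primit_diff[OF v, of "-R" y] set_borel_integral_eq_integral(2)[OF si, of "-R" y] that by simp
  ultimately have "continuous_on {-R..R} (primit v)" by (rule continuous_on_eq)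
  then show "isCont (primit v) x" by (rule continuous_on_interior) (auto simp: R_def)
qed

lemma primit_measurable: "loc_integrable v \<Longrightarrow> primit v \<in> borel_measurable borel"
  by (intro borel_measurable_continuous_onI continuous_primit)

lemma continuous_loc_integrable: "continuous_on UNIV g \<Longrightarrow> loc_integrable g"
  unfolding loc_integrable_def set_integrable_def
  by (intro allI borel_integrable_compact) (auto intro: continuous_on_subset)

text \<open>\<open>v\<close> is only locally integrable, so the classical rule is replaced by
  Fubini's theorem: for fixed \<open>s\<close> the integral of
  \<open>sgn_ivl x s * deriv \<phi> x\<close> over \<open>x\<close> is \<open>- \<phi> s\<close> by
  the fundamental theorem for the smooth \<open>\<phi>\<close>.\<close>

lemma primit_by_parts:
  assumes v: "loc_integrable v" and \<phi>: "test_fun \<phi>"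
  shows "(\<integral>x. primit v x * deriv \<phi> x \<partial>lborel) = - (\<integral>x. v x * \<phi> x \<partial>lborel)"
proof -
  note [measurable] = loc_integrable_measurable[OF v]
  obtain R where R: "R > 0" "\<And>x. \<bar>x\<bar> \<ge> R \<Longrightarrow> \<phi> x = 0" and sm: "smooth \<phi>"
    using \<phi> unfolding test_fun_smooth by blast
  define R1 where "R1 = R + 1"
  have d0: "deriv \<phi> x = 0" if "\<bar>x\<bar> \<ge> R1" for x
    using that by (intro deriv_zero_outside[OF sm R(2)]) (auto simp: R1_def)
  have cd: "continuous_on UNIV (deriv \<phi>)" by (intro smooth_continuous smooth_deriv sm)
  have [measurable]: "deriv \<phi> \<in> borel_measurable borel" using cd by (rule borel_measurable_continuous_onI)
  obtain B where B: "\<And>x. \<bar>deriv \<phi> x\<bar> \<le> B * indicator {-R1..R1} x"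
    using compact_support_bound[OF cd d0] by blast
  have one: "loc_integrable (\<lambda>_. 1)" by (rule continuous_loc_integrable) simp
  have id: "integrable lborel (\<lambda>x. \<bar>deriv \<phi> x\<bar>)"
    using loc_integrable_mult[OF one, of "\<lambda>x. \<bar>deriv \<phi> x\<bar>" B R1] B by simp
  define D where "D = (\<integral>x. \<bar>deriv \<phi> x\<bar> \<partial>lborel)"
  define f where "f s x = v s * sgn_ivl x s * deriv \<phi> x" for s x
  have fb: "\<bar>f s x\<bar> \<le> indicator {-R1..R1} s * \<bar>v s\<bar> * \<bar>deriv \<phi> x\<bar>" for s x
  proof (cases "\<bar>x\<bar> \<ge> R1")
    case False
    then show ?thesis by (auto simp: f_def sgn_ivl_def indicator_def abs_mult)
  qed (simp add: f_def d0)
  have [measurable]: "case_prod f \<in> borel_measurable (borel \<Otimes>\<^sub>M borel)"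
    unfolding f_def by measurable
  have fx: "integrable lborel (f s)" for s
  proof (rule Bochner_Integration.integrable_bound)
    show "integrable lborel (\<lambda>x. indicator {-R1..R1} s * \<bar>v s\<bar> * \<bar>deriv \<phi> x\<bar>)" by (intro integrable_mult_right id)
    show "f s \<in> borel_measurable lborel" unfolding f_def by measurable
    show "AE x in lborel. norm (f s x) \<le> norm (indicator {-R1..R1} s * \<bar>v s\<bar> * \<bar>deriv \<phi> x\<bar>)"
      using fb by (intro AE_I2) (auto intro: order.trans)
  qed
  have int: "integrable (lborel \<Otimes>\<^sub>M lborel) (case_prod f)"
  proof (rule lborel_pair.Fubini_integrable)
    show "integrable lborel (\<lambda>s. \<integral>x. norm (case (s, x) of (s, x) \<Rightarrow> f s x) \<partial>lborel)"
    proof (rule Bochner_Integration.integrable_bound)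
      show "integrable lborel (\<lambda>s. D * (indicator {-R1..R1} s *\<^sub>R v s))"
        using v unfolding loc_integrable_def set_integrable_def by (intro integrable_mult_right) blast
      show "AE s in lborel. norm (\<integral>x. norm (case (s, x) of (s, x) \<Rightarrow> f s x) \<partial>lborel) \<le> norm (D * (indicator {-R1..R1} s *\<^sub>R v s))"
      proof (intro AE_I2)
        fix s
        have "(\<integral>x. \<bar>f s x\<bar> \<partial>lborel) \<le> (\<integral>x. indicator {-R1..R1} s * \<bar>v s\<bar> * \<bar>deriv \<phi> x\<bar> \<partial>lborel)"
          using fx fb id by (intro integral_mono) auto
        also have "\<dots> = indicator {-R1..R1} s * \<bar>v s\<bar> * D" by (simp add: D_def)
        finally show "norm (\<integral>x. norm (case (s, x) of (s, x) \<Rightarrow> f s x) \<partial>lborel) \<le> norm (D * (indicator {-R1..R1} s *\<^sub>R v s))"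
          by (simp add: D_def abs_mult mult_ac)
      qed
    qed measurable
  qed (use fx in auto)
  have "(\<integral>x. primit v x * deriv \<phi> x \<partial>lborel) = (\<integral>x. \<integral>s. f s x \<partial>lborel \<partial>lborel)"
    unfolding primit_def f_def by simp
  also have "\<dots> = (\<integral>s. \<integral>x. f s x \<partial>lborel \<partial>lborel)" by (rule lborel_pair.Fubini_integral[OF int])
  also have "\<dots> = (\<integral>s. - (v s * \<phi> s) \<partial>lborel)"
  proof (intro Bochner_Integration.integral_cong refl)
    fix s
    have ftc: "(\<integral>x. deriv \<phi> x * indicator {a..b} x \<partial>lborel) = \<phi> b - \<phi> a" if "a \<le> b" for a b
      using that cd smooth_has_deriv[OF sm]
      by (intro integral_FTC_Icc_real) (auto simp: continuous_on_eq_continuous_at)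
    define Q where "Q = \<bar>s\<bar> + R1"
    have Q: "\<bar>s\<bar> \<le> Q" "R1 \<le> Q" "R \<le> Q" using R(1) by (auto simp: Q_def R1_def)
    have big: "deriv \<phi> x = 0" if "\<bar>x\<bar> > Q" for x using that Q by (intro d0) auto
    have "(\<integral>x. sgn_ivl x s * deriv \<phi> x \<partial>lborel) = - \<phi> s"
    proof (cases "s > 0")
      case True
      have "(\<integral>x. sgn_ivl x s * deriv \<phi> x \<partial>lborel) = (\<integral>x. deriv \<phi> x * indicator {s..Q} x \<partial>lborel)"
      proof (intro Bochner_Integration.integral_cong refl)
        fix x show "sgn_ivl x s * deriv \<phi> x = deriv \<phi> x * indicator {s..Q} x"
          using True big[of x] by (cases "\<bar>x\<bar> > Q") (auto simp: sgn_ivl_def indicator_def)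
      qed
      also have "\<dots> = \<phi> Q - \<phi> s" using Q by (intro ftc) auto
      finally show ?thesis using R Q by simp
    next
      case False
      have "(\<integral>x. sgn_ivl x s * deriv \<phi> x \<partial>lborel) = (\<integral>x. - (deriv \<phi> x * indicator {-Q..s} x) \<partial>lborel)"
      proof (rule integral_cong_AE)
        have "AE x in lborel. x \<noteq> s" by (rule AE_lborel_singleton)
        then show "AE x in lborel. sgn_ivl x s * deriv \<phi> x = - (deriv \<phi> x * indicator {-Q..s} x)"
        proof eventually_elim
          case (elim x)
          then show ?case using False big[of x] by (cases "\<bar>x\<bar> > Q") (auto simp: sgn_ivl_def indicator_def)
        qed
      qed measurable
      also have "\<dots> = - (\<phi> s - \<phi> (-Q))" using Q by (subst ftc[symmetric]) auto
      finally show ?thesis using R Q by simp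
    qed
    then show "(\<integral>x. f s x \<partial>lborel) = - (v s * \<phi> s)" unfolding f_def by (simp add: mult.assoc)
  qed
  finally show ?thesis by simp
qed

lemma bump_bound: "c > 0 \<Longrightarrow> \<bar>bump c a b x\<bar> \<le> 1 * indicator {-(\<bar>a\<bar> + \<bar>b\<bar>)..\<bar>a\<bar> + \<bar>b\<bar>} x"
proof (cases "x \<in> {a<..<b}")
  case True
  then have "x \<in> {-(\<bar>a\<bar> + \<bar>b\<bar>)..\<bar>a\<bar> + \<bar>b\<bar>}" by auto
  moreover assume "c > 0"
  ultimately show ?thesis using bump_range[of c a b x] True by (simp del: atLeastAtMost_iff)
next
  case False
  moreover assume "c > 0"
  ultimately have "bump c a b x = 0" using bump_range[of c a b x] by (simp del: greaterThanLessThan_iff)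
  then show ?thesis by simp
qed

lemma bump_integral_tendsto:
  assumes u: "loc_integrable u"
  shows "(\<lambda>n. \<integral>x. u x * bump (1 / real (Suc n)) a b x \<partial>lborel) \<longlonglongrightarrow> (\<integral>x. u x * indicator {a<..<b} x \<partial>lborel)"
proof (rule integral_dominated_convergence)
  note [measurable] = loc_integrable_measurable[OF u]
  let ?R = "\<bar>a\<bar> + \<bar>b\<bar>"
  show "integrable lborel (\<lambda>x. \<bar>u x * indicator {-?R..?R} x\<bar>)"
    using u unfolding loc_integrable_def set_integrable_def by (intro integrable_abs) (simp add: mult.commute)
  show "AE x in lborel. (\<lambda>n. u x * bump (1 / real (Suc n)) a b x) \<longlonglongrightarrow> u x * indicator {a<..<b} x"
    by (intro AE_I2 tendsto_mult_left bump_tendsto)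
  show "AE x in lborel. norm (u x * bump (1 / real (Suc n)) a b x) \<le> \<bar>u x * indicator {-?R..?R} x\<bar>" for n
  proof (intro AE_I2)
    fix x
    have "\<bar>u x\<bar> * \<bar>bump (1 / real (Suc n)) a b x\<bar> \<le> \<bar>u x\<bar> * \<bar>indicator {-?R..?R} x\<bar>"
      using bump_bound[of "1 / real (Suc n)" a b x] by (intro mult_left_mono) auto
    then show "norm (u x * bump (1 / real (Suc n)) a b x) \<le> \<bar>u x * indicator {-?R..?R} x\<bar>"
      by (simp only: real_norm_def abs_mult)
  qed
qed (use loc_integrable_measurable[OF u] in measurable)

lemma primit_has_deriv:
  assumes g: "continuous_on UNIV g"
  shows "(primit g has_real_derivative g x) (at x)"
proof -
  have lg: "loc_integrable g" by (rule continuous_loc_integrable[OF g])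
  have si: "set_integrable lborel {a..b} g" for a b using lg unfolding loc_integrable_def by blast
  have "((\<lambda>y. integral {x - 1..y} g) has_real_derivative g x) (at x within {x - 1..x + 1})"
    by (intro integral_has_real_derivative continuous_on_subset[OF g]) auto
  then have "((\<lambda>y. primit g (x - 1) + integral {x - 1..y} g) has_real_derivative g x) (at x within {x - 1..x + 1})"
    by (auto intro!: derivative_eq_intros)
  then have "(primit g has_real_derivative g x) (at x within {x - 1..x + 1})"
  proof (rule has_field_derivative_transform_within[where d = 1])
    show "primit g (x - 1) + integral {x - 1..y} g = primit g y" if "y \<in> {x - 1..x + 1}" for y
      using primit_diff[OF lg, of "x - 1" y] set_borel_integral_eq_integral(2)[OF si, of "x - 1" y] that by simp
  qed auto
  then show ?thesis by (simp add: at_within_Icc_at)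
qed

section \<open>From weak derivatives to iterated primitives\<close>

text \<open>A bump minus a multiple of a reference bump with the same integral is the derivative of
  a test function. Hence \<open>h\<close> integrates against every bump as the constant
  \<open>c\<close> does, in the limit also over every interval, and Lebesgue differentiation gives
  \<open>h = c\<close> almost everywhere.\<close>

lemma du_bois_reymond:
  assumes h: "loc_integrable h"
    and z: "\<And>\<phi>. test_fun \<phi> \<Longrightarrow> (\<integral>x. h x * deriv \<phi> x \<partial>lborel) = 0"
  shows "\<exists>c. AE x in lborel. h x = c"
proof -
  note [measurable] = loc_integrable_measurable[OF h]
  have one: "loc_integrable (\<lambda>_. 1)" by (rule continuous_loc_integrable) simp
  have ib: "integrable lborel (\<lambda>x. u x * bump c a b x)" if "loc_integrable u" "c > 0" for u c a b
    by (rule loc_integrable_mult[OF that(1) _ bump_bound[OF that(2)]]) simp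
  have ib1: "integrable lborel (bump c a b)" if "c > 0" for c a b using ib[OF one that] by simp
  have l1: "(\<lambda>n. \<integral>x. bump (1 / real (Suc n)) a b x \<partial>lborel) \<longlonglongrightarrow> b - a" if "a \<le> b" for a b
    using bump_integral_tendsto[OF one, of a b] that by simp
  have "\<forall>\<^sub>F n in sequentially. (\<integral>x. bump (1 / real (Suc n)) 0 1 x \<partial>lborel) > 0"
    using order_tendstoD(1)[OF l1[of 0 1], of 0] by simp
  then obtain c0 where c0: "c0 > 0" "(\<integral>x. bump c0 0 1 x \<partial>lborel) > 0"
    by (metis (no_types, lifting) eventually_sequentially order_refl of_nat_0_less_iff zero_less_Suc zero_less_divide_1_iff)
  define K0 where "K0 = (\<integral>x. bump c0 0 1 x \<partial>lborel)"
  define c where "c = (\<integral>x. h x * bump c0 0 1 x \<partial>lborel) / K0"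
  have eq: "(\<integral>x. h x * bump \<epsilon> a b x \<partial>lborel) = c * (\<integral>x. bump \<epsilon> a b x \<partial>lborel)" if e: "\<epsilon> > 0" for \<epsilon> a b
  proof -
    \<comment> \<open>Chosen so that \<open>\<rho>\<close> has integral 0 and its primitive has
      compact support.\<close>
    define \<kappa> where "\<kappa> = (\<integral>x. bump \<epsilon> a b x \<partial>lborel) / K0"
    define \<rho> where "\<rho> x = 1 * bump \<epsilon> a b x + (- \<kappa>) * bump c0 0 1 x" for x
    have sm: "smooth \<rho>" unfolding \<rho>_def by (intro smooth_lincomb smooth_bump e c0)
    have cont: "continuous_on UNIV \<rho>" by (rule smooth_continuous[OF sm])
    have lr: "loc_integrable \<rho>" by (rule continuous_loc_integrable[OF cont])
    have r0: "(\<integral>x. \<rho> x \<partial>lborel) = 0"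
      unfolding \<rho>_def using ib1[OF e] ib1[OF c0(1)] c0(2) by (simp add: \<kappa>_def K0_def)
    define Q where "Q = \<bar>a\<bar> + \<bar>b\<bar> + 2"
    have rz: "\<rho> x = 0" if "\<bar>x\<bar> \<ge> Q" for x
    proof -
      have "x \<notin> {-(\<bar>a\<bar> + \<bar>b\<bar>)..\<bar>a\<bar> + \<bar>b\<bar>}" "x \<notin> {-(\<bar>0\<bar> + \<bar>1\<bar>)..\<bar>0\<bar> + \<bar>1\<bar>}"
        using that by (auto simp: Q_def)
      then show ?thesis using bump_bound[OF e, of a b x] bump_bound[OF c0(1), of 0 1 x]
        by (simp add: \<rho>_def del: atLeastAtMost_iff)
    qed
    define \<phi> where "\<phi> x = primit \<rho> x - primit \<rho> (- Q)" for x
    have d\<phi>: "(\<phi> has_real_derivative \<rho> x) (at x)" for x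
      unfolding \<phi>_def by (auto intro!: derivative_eq_intros primit_has_deriv[OF cont])
    have "\<phi> x = 0" if "\<bar>x\<bar> \<ge> Q" for x
    proof (cases "x \<ge> Q")
      case True
      then have "\<phi> x = (LINT s:{-Q..x}|lborel. \<rho> s)" unfolding \<phi>_def using that by (intro primit_diff[OF lr]) (auto simp: Q_def)
      also have "\<dots> = (\<integral>s. \<rho> s \<partial>lborel)"
        unfolding set_lebesgue_integral_def
      proof (intro Bochner_Integration.integral_cong refl)
        fix s show "indicator {-Q..x} s *\<^sub>R \<rho> s = \<rho> s" using rz[of s] True by (cases "\<bar>s\<bar> \<ge> Q") (auto simp: indicator_def)
      qed
      finally show ?thesis using r0 by simp
    next
      case False
      then have "- \<phi> x = (LINT s:{x..-Q}|lborel. \<rho> s)"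
        unfolding \<phi>_def using primit_diff[OF lr, of x "-Q"] that by auto
      moreover have "(\<lambda>s. indicator {x..-Q} s *\<^sub>R \<rho> s) = (\<lambda>s. 0)"
      proof
        fix s show "indicator {x..-Q} s *\<^sub>R \<rho> s = 0" using rz[of s] by (auto simp: indicator_def Q_def)
      qed
      then have "(LINT s:{x..-Q}|lborel. \<rho> s) = 0" unfolding set_lebesgue_integral_def by simp
      ultimately show ?thesis by simp
    qed
    moreover have "Q > 0" by (simp add: Q_def)
    ultimately have "test_fun \<phi>" unfolding test_fun_smooth using smooth_antideriv[OF sm d\<phi>] by blast
    moreover have "deriv \<phi> = \<rho>" using d\<phi> by (intro ext DERIV_imp_deriv)
    ultimately have "(\<integral>x. h x * \<rho> x \<partial>lborel) = 0" using z by metis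
    moreover have "(\<integral>x. h x * \<rho> x \<partial>lborel) = (\<integral>x. h x * bump \<epsilon> a b x - \<kappa> * (h x * bump c0 0 1 x) \<partial>lborel)"
      unfolding \<rho>_def by (intro Bochner_Integration.integral_cong) (auto simp: algebra_simps)
    ultimately have "(\<integral>x. h x * bump \<epsilon> a b x \<partial>lborel) = \<kappa> * (\<integral>x. h x * bump c0 0 1 x \<partial>lborel)"
      using ib[OF h e] ib[OF h c0(1)] by simp
    then show ?thesis by (simp add: \<kappa>_def c_def)
  qed
  have int: "(\<integral>x. h x * indicator {a<..<b} x \<partial>lborel) = c * (b - a)" if "a \<le> b" for a b
  proof (rule LIMSEQ_unique[OF bump_integral_tendsto[OF h]])
    show "(\<lambda>n. \<integral>x. h x * bump (1 / real (Suc n)) a b x \<partial>lborel) \<longlonglongrightarrow> c * (b - a)"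
      using tendsto_mult_left[OF l1[OF that], of c] by (simp add: eq)
  qed
  define f where "f x = h x - c" for x
  have sh: "set_integrable lborel {a..b} h" for a b using h unfolding loc_integrable_def by blast
  have sc: "set_integrable lborel {a..b} (\<lambda>_. c)" for a b :: real
    using continuous_loc_integrable[of "\<lambda>_. c"] unfolding loc_integrable_def by simp
  have sf: "set_integrable lborel {a..b} f" for a b unfolding f_def by (rule set_integral_diff(1)[OF sh sc])
  have f0: "integral {a..b} f = 0" if "a \<le> b" for a b
  proof -
    have "integral {a..b} f = (LINT x:{a..b}|lborel. f x)" using set_borel_integral_eq_integral(2)[OF sf] by simp
    also have "\<dots> = (LINT x:{a..b}|lborel. h x) - (LINT x:{a..b}|lborel. c)"
      unfolding f_def by (rule set_integral_diff(2)[OF sh sc])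
    also have "(LINT x:{a..b}|lborel. h x) = (\<integral>x. h x * indicator {a<..<b} x \<partial>lborel)"
      unfolding set_lebesgue_integral_def
    proof (rule integral_cong_AE)
      have "AE x in lborel. x \<noteq> a \<and> x \<noteq> b" by (intro AE_conjI AE_lborel_singleton)
      then show "AE x in lborel. indicator {a..b} x *\<^sub>R h x = h x * indicator {a<..<b} x"
        by eventually_elim (auto simp: indicator_def)
    qed measurable
    also have "(LINT x:{a..b}|lborel. c) = c * (b - a)"
      using that unfolding set_lebesgue_integral_def by simp
    finally show ?thesis using int[OF that] by simp
  qed
  have "\<And>a b. f integrable_on cbox a b" using set_borel_integral_eq_integral(1)[OF sf] by simp
  then obtain N where N: "negligible N"
    "\<And>x e. x \<notin> N \<Longrightarrow> 0 < e \<Longrightarrow> \<exists>d>0. \<forall>h. 0 < h \<and> h < d \<longrightarrow> norm (integral (cbox x (x + h *\<^sub>R One)) f /\<^sub>R h ^ DIM(real) - f x) < e"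
    using integrable_ccontinuous_explicit by metis
  have "f x = 0" if nx: "x \<notin> N" for x
  proof (rule ccontr)
    assume "f x \<noteq> 0"
    then obtain d where d: "d > 0" "\<And>h. 0 < h \<Longrightarrow> h < d \<Longrightarrow> norm (integral (cbox x (x + h *\<^sub>R One)) f /\<^sub>R h ^ DIM(real) - f x) < \<bar>f x\<bar>"
      using N(2)[OF nx, of "\<bar>f x\<bar>"] by auto
    show False using d(2)[of "d / 2"] d(1) f0[of x "x + d / 2"] by simp
  qed
  moreover have "AE x in lebesgue. x \<notin> N" using N(1) by (intro AE_not_in) (simp add: negligible_iff_null_sets)
  ultimately have "AE x in lebesgue. h x = c" by (elim AE_mp) (auto simp: f_def)
  then show ?thesis unfolding AE_completion_iff by blast
qed

lemma continuous_AE_eq: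
  fixes u v :: "real \<Rightarrow> real"
  assumes "continuous_on UNIV u" "continuous_on UNIV v" "AE x in lborel. u x = v x"
  shows "u = v"
proof (rule ccontr)
  assume "u \<noteq> v"
  then obtain x where x: "u x \<noteq> v x" by auto
  have "open {x. u x \<noteq> v x}" using assms by (intro open_Collect_neq)
  then obtain e where e: "e > 0" "\<And>y. \<bar>y - x\<bar> < e \<Longrightarrow> u y \<noteq> v y"
    using x unfolding open_dist by (auto simp: dist_real_def)
  have "AE y in lborel. y \<notin> {x<..<x + e}" using assms(3) by eventually_elim (use e(2) in force)
  then have "{x<..<x + e} \<in> null_sets lborel" by (subst AE_iff_null_sets) auto
  then have "emeasure lborel {x<..<x + e} = 0" by auto
  then show False using e(1) by simp
qed

definition sobolev_chain :: "(nat \<Rightarrow> real \<Rightarrow> real) \<Rightarrow> nat \<Rightarrow> bool" where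
  "sobolev_chain F r \<longleftrightarrow> (\<forall>k\<le>r. loc_integrable (F k)) \<and>
    (\<forall>k<r. \<forall>a b. a \<le> b \<longrightarrow> F k b - F k a = (LINT s:{a..b}|lborel. F (Suc k) s))"

text \<open>Testing the k-th weak derivative with \<open>deriv \<phi>\<close> yields the next one
  tested with \<open>\<phi>\<close>, so the weak derivative of \<open>u - primit v\<close> is
  0.\<close>

lemma weak_deriv_step:
  assumes "weak_deriv k f u" "weak_deriv (Suc k) f v"
  shows "\<exists>c. AE x in lborel. u x = c + primit v x"
proof -
  have lu: "loc_integrable u" and lv: "loc_integrable v" using assms by (auto simp: weak_deriv_def)
  have lp: "loc_integrable (primit v)" by (intro continuous_loc_integrable continuous_primit lv)
  have "\<exists>c. AE x in lborel. u x - primit v x = c"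
  proof (rule du_bois_reymond)
    show "loc_integrable (\<lambda>x. u x - primit v x)"
      using lu lp unfolding loc_integrable_def by (auto intro: set_integral_diff(1))
  next
    fix \<phi> assume \<phi>: "test_fun \<phi>"
    obtain R where R: "R > 0" "\<And>x. \<bar>x\<bar> \<ge> R \<Longrightarrow> deriv \<phi> x = 0" "smooth (deriv \<phi>)"
      using test_fun_deriv[OF \<phi>] unfolding test_fun_smooth by blast
    have cd: "continuous_on UNIV (deriv \<phi>)" by (rule smooth_continuous[OF R(3)])
    obtain B where B: "\<And>x. \<bar>deriv \<phi> x\<bar> \<le> B * indicator {-R..R} x" using compact_support_bound[OF cd R(2)] by blast
    have i: "integrable lborel (\<lambda>x. w x * deriv \<phi> x)" if "loc_integrable w" for w
      by (rule loc_integrable_mult[OF that borel_measurable_continuous_onI[OF cd] B])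
    have "(-1) ^ k * (\<integral>x. u x * deriv \<phi> x \<partial>lborel) = (\<integral>x. f x * (deriv ^^ k) (deriv \<phi>) x \<partial>lborel)"
      using assms(1) test_fun_deriv[OF \<phi>] unfolding weak_deriv_def by simp
    also have "(deriv ^^ k) (deriv \<phi>) = (deriv ^^ Suc k) \<phi>" by (simp only: funpow_Suc_right o_def)
    also have "(\<integral>x. f x * (deriv ^^ Suc k) \<phi> x \<partial>lborel) = (-1) ^ Suc k * (\<integral>x. v x * \<phi> x \<partial>lborel)"
      using assms(2) \<phi> unfolding weak_deriv_def by blast
    finally have "(-1) ^ k * (\<integral>x. u x * deriv \<phi> x \<partial>lborel) = (-1) ^ k * (- (\<integral>x. v x * \<phi> x \<partial>lborel))" by simp
    then have "(\<integral>x. u x * deriv \<phi> x \<partial>lborel) = - (\<integral>x. v x * \<phi> x \<partial>lborel)"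
      by (rule mult_left_cancel[THEN iffD1, rotated]) simp
    then show "(\<integral>x. (u x - primit v x) * deriv \<phi> x \<partial>lborel) = 0"
      using i[OF lu] i[OF lp] primit_by_parts[OF lv \<phi>] by (simp add: left_diff_distrib)
  qed
  then obtain c where "AE x in lborel. u x - primit v x = c" by blast
  then have "AE x in lborel. u x = c + primit v x" by eventually_elim simp
  then show ?thesis by blast
qed

text \<open>Below order \<open>r\<close> each weak derivative is replaced by its continuous
  representative, a primitive of the next one; the top derivative stays as it is. At order 0 both
  functions are continuous, so the replacement returns \<open>f\<close> exactly.\<close>

lemma sobolev_ball_chain:
  assumes f: "f \<in> sobolev_ball \<alpha> r" and r: "r \<ge> 1"
  shows "\<exists>F. F 0 = f \<and> sobolev_chain F r \<and> (\<forall>k\<le>r. (\<integral>\<^sup>+x. ennreal \<bar>F k x * wr \<alpha> r x\<bar> \<partial>lborel) \<le> 1)"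
proof -
  obtain g where g: "g 0 = f" "continuous_on UNIV f" "\<And>k. k \<le> r \<Longrightarrow> weak_deriv k f (g k)"
      "\<And>k. k \<le> r \<Longrightarrow> integrable lborel (\<lambda>x. g k x * wr \<alpha> r x)"
      "(\<Sum>k\<le>r. \<integral>x. \<bar>g k x * wr \<alpha> r x\<bar> \<partial>lborel) \<le> 1"
    using f unfolding sobolev_ball_def by blast
  have lg: "loc_integrable (g k)" if "k \<le> r" for k using g(3)[OF that] by (simp add: weak_deriv_def)
  have "\<forall>k. \<exists>c. k < r \<longrightarrow> (AE x in lborel. g k x = c + primit (g (Suc k)) x)"
    using weak_deriv_step[OF g(3) g(3)] by (meson Suc_leI less_imp_le)
  then obtain c where c: "\<And>k. k < r \<Longrightarrow> AE x in lborel. g k x = c k + primit (g (Suc k)) x" by metis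
  define G where "G k x = c k + primit (g (Suc k)) x" for k x
  have cG: "continuous_on UNIV (G k)" if "k < r" for k
    unfolding G_def using that by (intro continuous_intros continuous_primit lg) auto
  define F where "F k = (if k < r then G k else g k)" for k
  have FG: "AE x in lborel. F k x = g k x" if "k \<le> r" for k
    using c[of k] that unfolding F_def G_def by (cases "k < r") auto
  have lF: "loc_integrable (F k)" if "k \<le> r" for k
    using cG[of k] lg[of k] that unfolding F_def by (auto intro: continuous_loc_integrable)
  have "F 0 = f"
    using r continuous_AE_eq[OF cG[of 0] g(2)] FG[of 0] by (simp add: F_def g(1))
  moreover have "F k b - F k a = (LINT s:{a..b}|lborel. F (Suc k) s)" if k: "k < r" and ab: "a \<le> b" for k a b
  proof -
    have "F k b - F k a = primit (g (Suc k)) b - primit (g (Suc k)) a" using k by (simp add: F_def G_def)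
    also have "\<dots> = (LINT s:{a..b}|lborel. g (Suc k) s)" using k by (intro primit_diff lg ab) auto
    also have "\<dots> = (LINT s:{a..b}|lborel. F (Suc k) s)"
      unfolding set_lebesgue_integral_def
    proof (rule integral_cong_AE)
      show "AE x in lborel. indicator {a..b} x *\<^sub>R g (Suc k) x = indicator {a..b} x *\<^sub>R F (Suc k) x"
        using FG[of "Suc k"] k by (auto elim!: AE_mp)
    qed (use loc_integrable_measurable[OF lg[of "Suc k"]] loc_integrable_measurable[OF lF[of "Suc k"]] k in auto)
    finally show ?thesis .
  qed
  moreover have "(\<integral>\<^sup>+x. ennreal \<bar>F k x * wr \<alpha> r x\<bar> \<partial>lborel) \<le> 1" if k: "k \<le> r" for k
  proof -
    have "(\<integral>\<^sup>+x. ennreal \<bar>F k x * wr \<alpha> r x\<bar> \<partial>lborel) = (\<integral>\<^sup>+x. ennreal \<bar>g k x * wr \<alpha> r x\<bar> \<partial>lborel)"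
      using FG[OF k] by (intro nn_integral_cong_AE) (auto elim!: AE_mp)
    also have "\<dots> = ennreal (\<integral>x. \<bar>g k x * wr \<alpha> r x\<bar> \<partial>lborel)"
      using g(4)[OF k] by (intro nn_integral_eq_integral) auto
    also have "(\<integral>x. \<bar>g k x * wr \<alpha> r x\<bar> \<partial>lborel) \<le> (\<Sum>k\<le>r. \<integral>x. \<bar>g k x * wr \<alpha> r x\<bar> \<partial>lborel)"
      using k by (intro member_le_sum) auto
    finally show ?thesis using g(5) by (meson ennreal_le_1 order.trans ennreal_leI)
  qed
  ultimately show ?thesis using lF unfolding sobolev_chain_def by (intro exI[of _ F]) blast
qed

lemma wr_eq_lag_w: "x > 0 \<Longrightarrow> wr \<alpha> r x = lag_w (\<alpha> + real r / 2) x"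
  by (simp add: wr_def lag_w_def)

lemma wr_minus [simp]: "wr \<alpha> r (- x) = wr \<alpha> r x"
  by (simp add: wr_def)

lemma wr_measurable [measurable]: "wr \<alpha> r \<in> borel_measurable borel"
  unfolding wr_def[abs_def] by measurable

text \<open>The reflected chain represents the function on the negative half-line, so estimates on
  the positive one apply to both sides.\<close>

lemma sobolev_chain_unit:
  assumes F: "sobolev_chain F r" and n: "\<And>k. k \<le> r \<Longrightarrow> (\<integral>\<^sup>+x. ennreal \<bar>F k x * wr \<alpha> r x\<bar> \<partial>lborel) \<le> 1"
  shows "unit_chain \<alpha> r F" "unit_chain \<alpha> r (\<lambda>k x. (-1) ^ k * F k (- x))"
proof -
  have l: "loc_integrable (F k)" if "k \<le> r" for k using F that unfolding sobolev_chain_def by blast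
  have d: "F k b - F k a = (LINT s:{a..b}|lborel. F (Suc k) s)" if "k < r" "a \<le> b" for k a b
    using F that unfolding sobolev_chain_def by blast
  have m: "F k \<in> borel_measurable borel" if "k \<le> r" for k by (rule loc_integrable_measurable[OF l[OF that]])
  have w: "wnorm (\<alpha> + real r / 2) u \<le> (\<integral>\<^sup>+x. ennreal \<bar>u x * wr \<alpha> r x\<bar> \<partial>lborel)"
    if [measurable]: "u \<in> borel_measurable borel" for u
    unfolding wnorm_def
    by (subst nn_integral_lagm)
       (auto intro!: nn_integral_mono simp: indicator_def wr_eq_lag_w abs_mult ennreal_mult mult.commute)
  show "unit_chain \<alpha> r F" unfolding unit_chain_def chain_def prim_def
    using m d l order.trans[OF w[OF m] n] by (auto simp: loc_integrable_def)
  let ?F = "\<lambda>k x. (-1) ^ k * F k (- x)"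
  have m': "?F k \<in> borel_measurable borel" if "k \<le> r" for k
    using m[OF that] by measurable
  have si: "set_integrable lborel {a..b} (?F k)" if "k \<le> r" for k a b
  proof -
    have "integrable lborel (\<lambda>x. indicator {- b..- a} x *\<^sub>R F k x)"
      using l[OF that] unfolding loc_integrable_def set_integrable_def by blast
    then have "integrable lborel (\<lambda>x. indicator {- b..- a} (0 + (-1) * x) *\<^sub>R F k (0 + (-1) * x))"
      by (rule lborel_integrable_real_affine) simp
    then have "integrable lborel (\<lambda>x. (-1) ^ k * (indicator {a..b} x * F k (- x)))"
      by (intro integrable_mult_right) (simp add: indicator_def conj_commute)
    then show ?thesis unfolding set_integrable_def by (simp add: mult_ac)
  qed
  have dd: "?F k b - ?F k a = (LINT s:{a..b}|lborel. ?F (Suc k) s)" if k: "k < r" "a \<le> b" for k a b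
  proof -
    have "?F k b - ?F k a = - ((-1) ^ k * (F k (- a) - F k (- b)))" by (simp add: algebra_simps)
    also have "F k (- a) - F k (- b) = (LINT s:{- b..- a}|lborel. F (Suc k) s)" using k by (intro d) auto
    also have "\<dots> = (LINT s:{x. - x \<in> {- b..- a}}|lborel. F (Suc k) (- s))" by (rule set_integral_reflect)
    also have "{x. - x \<in> {- b..- a}} = {a..b}" by auto
    also have "- ((-1) ^ k * (LINT s:{a..b}|lborel. F (Suc k) (- s))) = (LINT s:{a..b}|lborel. ?F (Suc k) s)"
      unfolding set_lebesgue_integral_def by (simp add: mult.left_commute[of "indicator _ _"])
    finally show ?thesis .
  qed
  have nn: "wnorm (\<alpha> + real r / 2) (?F k) \<le> 1" if "k \<le> r" for k
  proof -
    note [measurable] = m[OF that]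
    have "wnorm (\<alpha> + real r / 2) (?F k) \<le> (\<integral>\<^sup>+x. ennreal \<bar>?F k x * wr \<alpha> r x\<bar> \<partial>lborel)"
      by (rule w[OF m'[OF that]])
    also have "\<dots> = (\<integral>\<^sup>+x. ennreal \<bar>F k (0 + (-1) * x) * wr \<alpha> r (0 + (-1) * x)\<bar> \<partial>lborel)"
      by (intro nn_integral_cong) (simp add: abs_mult)
    also have "\<dots> = (\<integral>\<^sup>+x. ennreal \<bar>F k x * wr \<alpha> r x\<bar> \<partial>lborel)"
      using nn_integral_real_affine[of "\<lambda>x. ennreal \<bar>F k x * wr \<alpha> r x\<bar>" "-1" 0] by simp
    finally show ?thesis using n[OF that] by (rule order.trans)
  qed
  show "unit_chain \<alpha> r ?F" unfolding unit_chain_def chain_def prim_def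
    by (intro conjI allI impI m' si dd nn) auto
qed

subsection \<open>Lower bound\<close>

lemma powr_near:
  fixes c x X :: real
  assumes "X \<ge> 1" "X \<le> x" "x \<le> X + 1"
  shows "x powr c \<le> 2 powr \<bar>c\<bar> * X powr c" "X powr c \<le> 2 powr \<bar>c\<bar> * x powr c"
proof -
  have *: "u powr c \<le> 2 powr \<bar>c\<bar> * v powr c" if uv: "u > 0" "v > 0" "u \<le> 2 * v" "v \<le> 2 * u" for u v :: real
  proof (cases "c \<ge> 0")
    case True
    then have "u powr c \<le> (2 * v) powr c" using uv by (intro powr_mono2) auto
    then show ?thesis using True uv by (simp add: powr_mult)
  next
    case False
    then have "(2 * u) powr c \<le> v powr c" using uv by (intro powr_mono2') auto
    then have "2 powr (- c) * (2 powr c * u powr c) \<le> 2 powr (- c) * v powr c"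
      using uv by (simp add: powr_mult)
    moreover have "2 powr (- c) * (2 powr c * u powr c) = u powr c"
      by (simp add: mult.assoc[symmetric] flip: powr_add)
    ultimately show ?thesis using False by simp
  qed
  show "x powr c \<le> 2 powr \<bar>c\<bar> * X powr c" "X powr c \<le> 2 powr \<bar>c\<bar> * x powr c"
    using assms by (auto intro!: *)
qed

text \<open>The derivatives of \<open>(x (1 - x)) ^ (r + 1)\<close>. The exponent makes all of them
  up to order \<open>r\<close> vanish at 0 and 1, so integration by parts over the unit interval
  produces no boundary terms.\<close>

definition bpoly :: "nat \<Rightarrow> nat \<Rightarrow> real poly" where
  "bpoly r k = (pderiv ^^ k) (([:0, 1:] * [:1, - 1:]) ^ (r + 1))"

lemma bpoly_vanish:
  assumes "k \<le> r" shows "poly (bpoly r k) 0 = 0" "poly (bpoly r k) 1 = 0"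
proof -
  define q :: "real poly" where "q = [:0, 1:] * [:1, - 1:]"
  have dvd: "q ^ n dvd pderiv p" if qd: "q ^ Suc n dvd p" for n p
  proof -
    obtain s where s: "p = q ^ Suc n * s" using qd unfolding dvd_def by blast
    show ?thesis unfolding s pderiv_mult pderiv_power_Suc
      by (intro dvd_add) (auto simp: mult.assoc intro: dvd_mult dvd_mult2 dvd_smult)
  qed
  have "q ^ (r + 1 - k) dvd bpoly r k" if "k \<le> r + 1" for k
    using that
  proof (induction k)
    case 0
    then show ?case by (simp add: bpoly_def q_def)
  next
    case (Suc k)
    have "Suc (r + 1 - Suc k) = r + 1 - k" using Suc.prems by linarith
    moreover have "q ^ (r + 1 - k) dvd bpoly r k" using Suc by simp
    ultimately have "q ^ Suc (r + 1 - Suc k) dvd bpoly r k" by (simp only:)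
    then show ?case using dvd by (simp add: bpoly_def)
  qed
  from this[of k] assms have "q ^ (r + 1 - k) dvd bpoly r k" by simp
  then obtain s where s: "bpoly r k = q ^ (r + 1 - k) * s" unfolding dvd_def by blast
  have "poly q 0 = 0" "poly q 1 = 0" by (auto simp: q_def)
  then show "poly (bpoly r k) 0 = 0" "poly (bpoly r k) 1 = 0" using assms by (auto simp: s poly_power)
qed

lemma bpoly_Suc: "bpoly r (Suc k) = pderiv (bpoly r k)"
  by (simp add: bpoly_def)

definition bspline :: "nat \<Rightarrow> real \<Rightarrow> nat \<Rightarrow> real \<Rightarrow> real" where
  "bspline r X k x = indicator {X..X + 1} x * poly (bpoly r k) (x - X)"

lemma bspline_measurable [measurable]: "bspline r X k \<in> borel_measurable borel"
  unfolding bspline_def[abs_def] by measurable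

lemma bspline_integrable_mult:
  assumes "continuous_on UNIV g" shows "integrable lborel (\<lambda>x. bspline r X k x * g x)"
proof -
  have "integrable lborel (\<lambda>x. indicator {X..X + 1} x *\<^sub>R (poly (bpoly r k) (x - X) * g x))"
    by (intro borel_integrable_compact) (auto intro!: continuous_intros continuous_on_subset[OF assms])
  then show ?thesis by (simp add: bspline_def mult.assoc)
qed

lemma bspline_weak:
  assumes \<phi>: "smooth \<phi>" and k: "k < r"
  shows "(\<integral>x. bspline r X k x * deriv \<phi> x \<partial>lborel) = - (\<integral>x. bspline r X (Suc k) x * \<phi> x \<partial>lborel)"
proof -
  have dP: "((\<lambda>x. poly p (x - X)) has_real_derivative poly (pderiv p) (x - X)) (at x)" for p :: "real poly" and x
    by (rule DERIV_cong[OF DERIV_chain2[OF poly_DERIV]]) (auto intro!: derivative_eq_intros)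
  have "(\<integral>x. (poly (bpoly r k) (x - X) * deriv \<phi> x) * indicator {X..X + 1} x \<partial>lborel)
     = poly (bpoly r k) (X + 1 - X) * \<phi> (X + 1) - poly (bpoly r k) (X - X) * \<phi> X
       - (\<integral>x. (poly (bpoly r (Suc k)) (x - X) * \<phi> x) * indicator {X..X + 1} x \<partial>lborel)"
  proof (rule integral_by_parts)
    show "isCont (\<lambda>x. poly (bpoly r (Suc k)) (x - X)) x" for x by (rule DERIV_isCont[OF dP])
    show "isCont (deriv \<phi>) x" for x by (rule DERIV_isCont[OF smooth_has_deriv[OF smooth_deriv[OF \<phi>]]])
    show "((\<lambda>x. poly (bpoly r k) (x - X)) has_real_derivative poly (bpoly r (Suc k)) (x - X)) (at x)" for x
      unfolding bpoly_Suc by (rule dP)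
  qed (use smooth_has_deriv[OF \<phi>] in auto)
  then show ?thesis using bpoly_vanish[of k r] k by (simp add: bspline_def mult_ac)
qed

lemma bspline_weak_deriv:
  assumes "k \<le> r" "test_fun \<phi>"
  shows "(\<integral>x. bspline r X 0 x * (deriv ^^ k) \<phi> x \<partial>lborel) = (-1) ^ k * (\<integral>x. bspline r X k x * \<phi> x \<partial>lborel)"
  using assms
proof (induction k arbitrary: \<phi>)
  case (Suc k)
  have "(deriv ^^ Suc k) \<phi> = (deriv ^^ k) (deriv \<phi>)" by (simp only: funpow_Suc_right o_def)
  then have "(\<integral>x. bspline r X 0 x * (deriv ^^ Suc k) \<phi> x \<partial>lborel) = (-1) ^ k * (\<integral>x. bspline r X k x * deriv \<phi> x \<partial>lborel)"
    using Suc.IH[of "deriv \<phi>"] Suc.prems test_fun_deriv by simp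
  then show ?case using bspline_weak[of \<phi> k r X] Suc.prems by (simp add: test_fun_smooth)
qed simp

lemma bspline_continuous: "continuous_on UNIV (bspline r X 0)"
proof -
  \<comment> \<open>Clamping \<open>x - X\<close> to the unit interval shows continuity; the two
    forms agree since the polynomial vanishes at both ends.\<close>
  have "bspline r X 0 = (\<lambda>x. poly (bpoly r 0) (max 0 (min 1 (x - X))))"
  proof
    fix x
    consider "x < X" | "x > X + 1" | "X \<le> x \<and> x \<le> X + 1" by linarith
    then show "bspline r X 0 x = poly (bpoly r 0) (max 0 (min 1 (x - X)))"
      using bpoly_vanish[of 0 r] by cases (auto simp: bspline_def)
  qed
  then show ?thesis by (simp only:) (intro continuous_intros)
qed

lemma loc_integrable_bspline: "loc_integrable (\<lambda>x. c * bspline r X k x)"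
proof -
  have "integrable lborel (\<lambda>x. c * (bspline r X k x * 1))"
    by (intro integrable_mult_right bspline_integrable_mult) auto
  then have "integrable lborel (\<lambda>x. c * bspline r X k x)" by (simp only: mult_1_right)
  then show ?thesis unfolding loc_integrable_def set_integrable_def
    by (intro allI integrable_mult_indicator) auto
qed

text \<open>On a unit interval the weights vary by bounded factors, so \<open>exp (- X)\<close>
  cancels between the integral and the norm. What is left is the quotient of
  \<open>X powr \<alpha>\<close> by \<open>X powr (\<alpha> + r / 2)\<close>.\<close>

lemma fooling_function:
  fixes \<alpha> :: real and r :: nat
  shows "\<exists>C>0. \<forall>X\<ge>1. \<exists>f\<in>sobolev_ball \<alpha> r. (\<forall>x. x \<notin> {X<..<X + 1} \<longrightarrow> f x = 0) \<and>
    C * X powr (- real r / 2) \<le> (\<integral>x. f x * wr \<alpha> 0 x \<partial>lborel)"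
proof -
  have "\<exists>B. \<forall>x\<in>{0..1}. \<bar>poly (bpoly r k) x\<bar> \<le> B" for k
  proof -
    have "bounded (poly (bpoly r k) ` {0..1})"
      by (intro compact_imp_bounded compact_continuous_image continuous_intros) auto
    then show ?thesis unfolding bounded_iff by auto
  qed
  then obtain B where B: "\<And>k x. x \<in> {0..1} \<Longrightarrow> \<bar>poly (bpoly r k) x\<bar> \<le> B k" by metis
  have B0: "B k \<ge> 0" for k using B[of 0 k] by simp
  define M where "M = (\<Sum>k\<le>r. B k) + 1"
  have M: "M \<ge> 1" "M > 0" using B0 by (auto simp: M_def sum_nonneg add_pos_nonneg add_nonneg_pos)
  have BM: "B k \<le> M" if "k \<le> r" for k
    using member_le_sum[of k "{..r}" B] B0 that by (simp add: M_def)
  define I where "I = (\<integral>x. indicator {0..1} x * poly (bpoly r 0) x \<partial>lborel)"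
  have P0: "poly (bpoly r 0) x = (x * (1 - x)) ^ (r + 1)" for x
  proof -
    have "poly ([:0, 1:] * [:1, - 1:]) x = x * (1 - x)" by simp
    then show ?thesis unfolding bpoly_def by (simp only: funpow_0 poly_power)
  qed
  have I: "I > 0"
  proof -
    have int: "integrable lborel (\<lambda>x. indicator {0..1} x *\<^sub>R poly (bpoly r 0) x)"
      by (intro borel_integrable_compact continuous_intros) auto
    have "(\<integral>x. (1/8) ^ (r + 1) * indicator {1/4..3/4::real} x \<partial>lborel) \<le> I"
      unfolding I_def
    proof (rule integral_mono)
      fix x :: real
      show "(1/8) ^ (r + 1) * indicator {1/4..3/4} x \<le> indicator {0..1} x * poly (bpoly r 0) x"
      proof (cases "x \<in> {1/4..3/4}")
        case True
        have "1/8 \<le> x * (1 - x)"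
        proof -
          have "0 \<le> (x - 1/4) * (3/4 - x)" using True by (intro mult_nonneg_nonneg) auto
          moreover have "(x - 1/4) * (3/4 - x) = x * (1 - x) - 3/16" by (simp add: field_simps)
          ultimately show ?thesis by linarith
        qed
        then have "(1/8) ^ (r + 1) \<le> (x * (1 - x)) ^ (r + 1)" by (intro power_mono) auto
        then show ?thesis using True by (simp add: P0)
      next
        case False
        then show ?thesis by (auto simp: P0 indicator_def)
      qed
    next
      show "integrable lborel (\<lambda>x. (1/8 :: real) ^ (r + 1) * indicator {1/4..3/4::real} x)"
      proof -
        have "integrable lborel (\<lambda>x. indicator {1/4..3/4::real} x *\<^sub>R (1/8 :: real) ^ (r + 1))"
          by (intro borel_integrable_compact) auto
        then show ?thesis by (simp only: real_scaleR_def mult.commute)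
      qed
    qed (use int in auto)
    moreover have "(\<integral>x. (1/8 :: real) ^ (r + 1) * indicator {1/4..3/4::real} x \<partial>lborel) > 0" by simp
    ultimately show ?thesis by linarith
  qed
  define K where "K = 2 powr \<bar>\<alpha> + real r / 2\<bar>"
  define L where "L = 1 / (2 powr \<bar>\<alpha>\<bar> * exp 1)"
  have KL: "K > 0" "L > 0" by (auto simp: K_def L_def)
  define C where "C = L * I / ((real r + 1) * M * K)"
  have C: "C > 0" using KL I M by (simp add: C_def)
  have "\<exists>f\<in>sobolev_ball \<alpha> r. (\<forall>x. x \<notin> {X<..<X + 1} \<longrightarrow> f x = 0) \<and>
    C * X powr (- real r / 2) \<le> (\<integral>x. f x * wr \<alpha> 0 x \<partial>lborel)" if X: "X \<ge> 1" for X
  proof -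
    define W where "W = X powr \<alpha> * exp (- X)"
    have W: "W > 0" using X by (simp add: W_def)
    define U where "U = K * W * X powr (real r / 2)"
    have U: "U > 0" using KL W X by (simp add: U_def)
    have up: "wr \<alpha> r x \<le> U" if "x \<in> {X..X + 1}" for x
    proof -
      have "x powr (\<alpha> + real r / 2) * exp (- x) \<le> (K * X powr (\<alpha> + real r / 2)) * exp (- X)"
        unfolding K_def using that X by (intro mult_mono powr_near) auto
      then show ?thesis using that X by (simp add: wr_def U_def W_def powr_add mult_ac)
    qed
    have lo: "L * W \<le> wr \<alpha> 0 x" if "x \<in> {X..X + 1}" for x
    proof -
      have "X powr \<alpha> * exp (- X) \<le> (2 powr \<bar>\<alpha>\<bar> * x powr \<alpha>) * (exp 1 * exp (- x))"
        using that X by (intro mult_mono powr_near) (auto simp flip: exp_add)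
      then have "L * (X powr \<alpha> * exp (- X)) \<le> L * ((2 powr \<bar>\<alpha>\<bar> * x powr \<alpha>) * (exp 1 * exp (- x)))"
        using KL by (intro mult_left_mono) auto
      also have "\<dots> = x powr \<alpha> * exp (- x)" by (simp add: L_def)
      finally show ?thesis using that X by (simp add: wr_def W_def)
    qed
    \<comment> \<open>Each of the \<open>r + 1\<close> weighted norms is at most
      \<open>c * M * U\<close>, so this \<open>c\<close> brings their sum to at most 1.\<close>
    define c where "c = 1 / ((real r + 1) * M * U)"
    have c: "c > 0" using M U by (simp add: c_def)
    define g where "g k x = c * bspline r X k x" for k x
    have gle: "\<bar>g k x * wr \<alpha> r x\<bar> \<le> c * M * U * indicator {X..X + 1} x" if "k \<le> r" for k x
    proof (cases "x \<in> {X..X + 1}")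
      case True
      then have "\<bar>bspline r X k x\<bar> \<le> M" using B[of "x - X" k] BM[OF that] by (simp add: bspline_def)
      moreover have "\<bar>wr \<alpha> r x\<bar> \<le> U" using up[OF True] by (simp add: wr_def)
      ultimately have "\<bar>bspline r X k x\<bar> * \<bar>wr \<alpha> r x\<bar> \<le> M * U" using M by (intro mult_mono) auto
      then have "c * (\<bar>bspline r X k x\<bar> * \<bar>wr \<alpha> r x\<bar>) \<le> c * (M * U)" using c by (intro mult_left_mono) auto
      then show ?thesis using True c by (simp add: g_def abs_mult mult.assoc)
    qed (simp add: g_def bspline_def)
    have ind: "integrable lborel (\<lambda>x. c * M * U * indicator {X..X + 1} x)"
      by (intro integrable_mult_right integrable_real_indicator) auto
    have gi: "integrable lborel (\<lambda>x. g k x * wr \<alpha> r x)" if "k \<le> r" for k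
    proof (rule Bochner_Integration.integrable_bound[OF ind])
      show "(\<lambda>x. g k x * wr \<alpha> r x) \<in> borel_measurable lborel" unfolding g_def by measurable
      show "AE x in lborel. norm (g k x * wr \<alpha> r x) \<le> norm (c * M * U * indicator {X..X + 1} x)"
        unfolding real_norm_def by (intro AE_I2 order.trans[OF gle[OF that] abs_ge_self])
    qed
    have "(\<integral>x. \<bar>g k x * wr \<alpha> r x\<bar> \<partial>lborel) \<le> c * M * U" if "k \<le> r" for k
    proof -
      have "(\<integral>x. \<bar>g k x * wr \<alpha> r x\<bar> \<partial>lborel) \<le> (\<integral>x. c * M * U * indicator {X..X + 1} x \<partial>lborel)"
        using gi[OF that] gle[OF that] ind by (intro integral_mono) auto
      then show ?thesis by simp
    qed
    then have "(\<Sum>k\<le>r. \<integral>x. \<bar>g k x * wr \<alpha> r x\<bar> \<partial>lborel) \<le> (\<Sum>k\<le>r. c * M * U)" by (intro sum_mono) auto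
    also have "\<dots> = c * ((real r + 1) * M * U)" by (simp add: algebra_simps)
    also have "\<dots> = 1"
    proof -
      have "real r + 1 > 0" by simp
      then show ?thesis unfolding c_def using M(2) U by simp
    qed
    finally have s1: "(\<Sum>k\<le>r. \<integral>x. \<bar>g k x * wr \<alpha> r x\<bar> \<partial>lborel) \<le> 1" .
    have wd: "weak_deriv k (g 0) (g k)" if "k \<le> r" for k
      unfolding weak_deriv_def
    proof (intro conjI allI impI)
      show "loc_integrable (g 0)" "loc_integrable (g k)" unfolding g_def by (rule loc_integrable_bspline)+
      fix \<phi> assume "test_fun \<phi>"
      from bspline_weak_deriv[OF \<open>k \<le> r\<close> this, of X]
      show "(\<integral>x. g 0 x * (deriv ^^ k) \<phi> x \<partial>lborel) = (-1) ^ k * (\<integral>x. g k x * \<phi> x \<partial>lborel)"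
        by (simp add: g_def mult.assoc)
    qed
    have cont: "continuous_on UNIV (g 0)" unfolding g_def by (intro continuous_intros bspline_continuous)
    have ball: "g 0 \<in> sobolev_ball \<alpha> r"
      unfolding sobolev_ball_def using cont wd gi s1 by blast
    have zero: "g 0 x = 0" if "x \<notin> {X<..<X + 1}" for x
    proof -
      have "x \<notin> {X..X + 1} \<or> x = X \<or> x = X + 1" using that by auto
      then show ?thesis using bpoly_vanish[of 0 r] by (auto simp: g_def bspline_def)
    qed
    have "C * X powr (- real r / 2) \<le> (\<integral>x. g 0 x * wr \<alpha> 0 x \<partial>lborel)"
    proof -
      have i0: "integrable lborel (\<lambda>x. c * (L * W) * (bspline r X 0 x * 1))"
        by (intro integrable_mult_right bspline_integrable_mult) auto
      have bn: "bspline r X 0 x \<ge> 0" for x by (auto simp: bspline_def indicator_def P0)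
      have "(\<integral>x. c * (L * W) * (bspline r X 0 x * 1) \<partial>lborel) \<le> (\<integral>x. g 0 x * wr \<alpha> 0 x \<partial>lborel)"
      proof (rule integral_mono[OF i0])
        show "integrable lborel (\<lambda>x. g 0 x * wr \<alpha> 0 x)"
        proof -
          have "continuous_on {X..X + 1} (\<lambda>x. c * poly (bpoly r 0) (x - X) * wr \<alpha> 0 x)"
            unfolding wr_def using X by (intro continuous_intros) auto
          then have "integrable lborel (\<lambda>x. indicator {X..X + 1} x *\<^sub>R (c * poly (bpoly r 0) (x - X) * wr \<alpha> 0 x))"
            by (intro borel_integrable_compact) auto
          then show ?thesis by (simp add: g_def bspline_def mult_ac)
        qed
        fix x
        show "c * (L * W) * (bspline r X 0 x * 1) \<le> g 0 x * wr \<alpha> 0 x"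
        proof (cases "x \<in> {X..X + 1}")
          case True
          have "(c * bspline r X 0 x) * (L * W) \<le> (c * bspline r X 0 x) * wr \<alpha> 0 x"
            using c bn lo[OF True] by (intro mult_left_mono) auto
          then show ?thesis by (simp add: g_def mult_ac)
        qed (simp add: g_def bspline_def)
      qed
      moreover have "(\<integral>x. c * (L * W) * (bspline r X 0 x * 1) \<partial>lborel) = c * (L * W) * I"
      proof -
        have "(\<integral>x. bspline r X 0 x \<partial>lborel) = (\<integral>x. bspline r X 0 (X + 1 * x) \<partial>lborel)"
          by (subst lborel_integral_real_affine[of 1 _ X]) simp_all
        also have "\<dots> = I" unfolding I_def by (intro Bochner_Integration.integral_cong) (auto simp: bspline_def indicator_def)
        finally show ?thesis by simp
      qed
      moreover have "c * (L * W) * I = C * X powr (- real r / 2)"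
      proof -
        define \<rho> Y where "\<rho> = real r + 1" and "Y = X powr (real r / 2)"
        have Y: "Y > 0" "\<rho> > 0" using X by (auto simp: Y_def \<rho>_def)
        have "X powr (- real r / 2) = 1 / Y" unfolding Y_def using powr_minus_divide[of X "real r / 2"] by simp
        then show ?thesis unfolding c_def C_def U_def Y_def[symmetric] \<rho>_def[symmetric]
          using W KL M Y by (simp add: field_simps)
      qed
      ultimately show ?thesis by simp
    qed
    then show ?thesis using ball zero by blast
  qed
  then show ?thesis using C by blast
qed

lemma lower_bound:
  fixes \<alpha> :: real and r :: nat
  shows "\<exists>C>0. \<forall>n\<ge>1. ereal (C * real n powr (- 3 * real r / 4)) \<le> Int_n \<alpha> n (sobolev_ball \<alpha> r)"
proof -
  obtain C where C: "C > 0" "\<And>X. X \<ge> 1 \<Longrightarrow> \<exists>f\<in>sobolev_ball \<alpha> r. (\<forall>x. x \<notin> {X<..<X + 1} \<longrightarrow> f x = 0) \<and>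
    C * X powr (- real r / 2) \<le> (\<integral>x. f x * wr \<alpha> 0 x \<partial>lborel)"
    using fooling_function by blast
  \<comment> \<open>The free interval may lie as far out as \<open>2 n\<close>, which costs the
    factor \<open>2 powr (- r / 2)\<close>.\<close>
  define C1 where "C1 = C * 2 powr (- real r / 2)"
  have "ereal (C1 * real n powr (- 3 * real r / 4)) \<le> Int_n \<alpha> n (sobolev_ball \<alpha> r)" if n: "n \<ge> 1" for n
    unfolding Int_n_def
  proof (rule INF_greatest)
    fix Q :: "(real \<times> real) list" assume "Q \<in> {Q. length Q \<le> n}"
    then have lQ: "length Q \<le> n" by simp
    define S where "S = fst ` set Q"
    have S: "finite S" "card S \<le> n"
      unfolding S_def using card_image_le[of "set Q" fst] card_length[of Q] lQ by auto
    have "\<exists>i\<in>{n..2 * n}. \<forall>s\<in>S. s \<notin> {real i<..<real i + 1}"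
    proof (rule ccontr)
      assume "\<not> ?thesis"
      then have "\<forall>i\<in>{n..2 * n}. \<exists>s. s \<in> S \<and> s \<in> {real i<..<real i + 1}" by blast
      then obtain s where s: "\<And>i. i \<in> {n..2 * n} \<Longrightarrow> s i \<in> S \<and> s i \<in> {real i<..<real i + 1}" by metis
      have "inj_on s {n..2 * n}"
      proof (rule inj_onI)
        fix i j assume ij: "i \<in> {n..2 * n}" "j \<in> {n..2 * n}" "s i = s j"
        then have "real i < real j + 1" "real j < real i + 1" using s[OF ij(1)] s[OF ij(2)] by auto
        then show "i = j" by linarith
      qed
      then have "card {n..2 * n} \<le> card S" using s S(1) by (intro card_inj_on_le) auto
      then show False using S(2) by simp
    qed
    then obtain i where i: "n \<le> i" "i \<le> 2 * n" "\<And>s. s \<in> S \<Longrightarrow> s \<notin> {real i<..<real i + 1}" by auto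
    have i1: "real i \<ge> 1" using i n by simp
    obtain f where f: "f \<in> sobolev_ball \<alpha> r" "\<And>x. x \<notin> {real i<..<real i + 1} \<Longrightarrow> f x = 0"
      "C * real i powr (- real r / 2) \<le> (\<integral>x. f x * wr \<alpha> 0 x \<partial>lborel)"
      using C(2)[OF i1] by blast
    have "quad Q f = 0"
    proof -
      have "(case p of (x, l) \<Rightarrow> l * f x) = 0" if "p \<in> set Q" for p
        using f(2)[of "fst p"] i(3)[of "fst p"] that by (auto simp: S_def case_prod_beta)
      then have "map (\<lambda>(x, l). l * f x) Q = map (\<lambda>_. 0) Q" by (intro map_cong) auto
      then have "quad Q f = sum_list (map (\<lambda>_. 0) Q)" unfolding quad_def by (rule arg_cong)
      then show ?thesis by simp
    qed
    then have e: "quad_err \<alpha> Q f = \<bar>\<integral>x. f x * wr \<alpha> 0 x \<partial>lborel\<bar>" by (simp add: quad_err_def)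
    have "C1 * real n powr (- 3 * real r / 4) \<le> C1 * real n powr (- real r / 2)"
      using n C(1) by (intro mult_left_mono powr_mono) (auto simp: C1_def)
    also have "\<dots> = C * (2 * real n) powr (- real r / 2)" by (simp add: C1_def powr_mult)
    also have "\<dots> \<le> C * real i powr (- real r / 2)"
      using i i1 C(1) by (intro mult_left_mono powr_mono2') auto
    also have "\<dots> \<le> quad_err \<alpha> Q f" unfolding e using f(3) by linarith
    finally have "ereal (C1 * real n powr (- 3 * real r / 4)) \<le> ereal (quad_err \<alpha> Q f)" by simp
    also have "\<dots> \<le> worst_err \<alpha> (sobolev_ball \<alpha> r) Q" unfolding worst_err_def by (rule SUP_upper[OF f(1)])
    finally show "ereal (C1 * real n powr (- 3 * real r / 4)) \<le> worst_err \<alpha> (sobolev_ball \<alpha> r) Q" .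
  qed
  moreover have "C1 > 0" using C(1) by (simp add: C1_def)
  ultimately show ?thesis by blast
qed

subsection \<open>The two-sided truncated rule\<close>

lemma LINT_eq_Lam:
  "(LINT x:{0<..}|lborel. poly p x * poly q x * lag_w b x) = Lam b (p * q)"
  unfolding Lam_def by (subst integral_lagm) auto

lemma lead_coeff_lag:
  assumes "b > -1" shows "lead_coeff (lag b m) = (-1) ^ m / pochhammer (b + 1) m"
  by (simp add: degree_lag[OF assms] coeff_lag)

lemma Lam_lag_lag:
  assumes b: "b > -1"
  shows "Lam b (lag b i * lag b j) = (if i = j then lag_h b i else 0)"
proof (cases i j rule: linorder_cases)
  case less
  then show ?thesis using Lam_lag_orth[OF b, of "lag b i" j] degree_lag[OF b, of i] by (simp add: mult.commute)
next
  case equal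
  have "coeff (lag b i) i \<noteq> 0" using poch_pos[OF b, of i] by (simp add: coeff_lag)
  then show ?thesis using equal Lam_lag_lead[OF b, of "lag b i" i] degree_lag[OF b, of i] by simp
next
  case greater
  then show ?thesis using Lam_lag_orth[OF b, of "lag b j" i] degree_lag[OF b, of j] by simp
qed

lemma laguerre_orthonormal_exists:
  assumes b: "b > -1" shows "\<exists>p. laguerre_orthonormal b p"
proof -
  \<comment> \<open>The sign \<open>(-1) ^ m\<close> turns the alternating leading coefficient of
    \<open>lag\<close> positive.\<close>
  define c where "c m = (-1) ^ m / sqrt (lag_h b m)" for m
  have h: "lag_h b m > 0" for m by (rule lag_h_pos[OF b])
  have c0: "c m \<noteq> 0" for m using h[of m] by (simp add: c_def)
  have cc: "c m * c m = 1 / lag_h b m" for m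
    using h[of m] by (simp add: c_def flip: power_mult_distrib)
  have "laguerre_orthonormal b (\<lambda>m. smult (c m) (lag b m))"
    unfolding laguerre_orthonormal_def
  proof (intro conjI allI)
    fix m
    show "degree (smult (c m) (lag b m)) = m" using c0 by (simp add: degree_lag[OF b])
    have "(-1::real) ^ m * (-1) ^ m = 1" by (simp flip: power_mult_distrib)
    then have "lead_coeff (smult (c m) (lag b m)) = 1 / (sqrt (lag_h b m) * pochhammer (b + 1) m)"
      unfolding lead_coeff_smult lead_coeff_lag[OF b] c_def by simp
    then show "lead_coeff (smult (c m) (lag b m)) > 0" using h[of m] poch_pos[OF b, of m] by simp
  next
    fix i j
    show "(LINT x:{0<..}|lborel. poly (smult (c i) (lag b i)) x * poly (smult (c j) (lag b j)) x * lag_w b x) = (if i = j then 1 else 0)"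
      unfolding LINT_eq_Lam mult_smult_left mult_smult_right Lam_smult[OF b] Lam_lag_lag[OF b]
      using cc[of i] h[of i] by (cases "i = j") (auto simp flip: mult.assoc)
  qed
  then show ?thesis by blast
qed

text \<open>Determines the zeros of whichever family \<open>lag_p\<close> selects. By induction,
  \<open>p m\<close> minus the multiple of \<open>lag b m\<close> with the same leading coefficient
  is orthogonal to all lower \<open>lag b j\<close>; pairing it with the one of its own degree shows
  that it is 0.\<close>

lemma laguerre_orthonormal_unique:
  assumes b: "b > -1" and p: "laguerre_orthonormal b p"
  shows "\<exists>c. c \<noteq> 0 \<and> p m = smult c (lag b m)"
proof (induction m rule: less_induct)
  case (less m)
  have dp: "degree (p m) = m" "lead_coeff (p m) > 0" and orth: "\<And>i j. Lam b (p i * p j) = (if i = j then 1 else 0)"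
    using p unfolding laguerre_orthonormal_def LINT_eq_Lam by blast+
  have dl: "degree (lag b m) = m" by (rule degree_lag[OF b])
  have cl: "coeff (lag b k) k \<noteq> 0" for k using poch_pos[OF b, of k] by (simp add: coeff_lag)
  define c where "c = coeff (p m) m / coeff (lag b m) m"
  define q where "q = p m - smult c (lag b m)"
  have orthl: "Lam b (lag b j * q) = 0" if jm: "j < m" for j
  proof -
    obtain d where d: "d \<noteq> 0" "p j = smult d (lag b j)" using less[OF jm] by blast
    have "d * Lam b (lag b j * p m) = Lam b (p j * p m)" by (simp add: d Lam_smult[OF b])
    then have "Lam b (lag b j * p m) = 0" using orth[of j m] jm d by simp
    moreover have "Lam b (lag b j * q) = Lam b (lag b j * p m) - c * Lam b (lag b j * lag b m)"
      unfolding q_def right_diff_distrib mult_smult_right Lam_diff[OF b] Lam_smult[OF b] ..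
    ultimately show ?thesis using jm by (simp add: Lam_lag_lag[OF b])
  qed
  have "q = 0"
  proof (rule ccontr)
    assume q0: "q \<noteq> 0"
    have "degree q \<le> m" unfolding q_def using dp dl
      by (intro degree_diff_le order.trans[OF degree_smult_le]) auto
    moreover have "coeff q m = 0" using cl[of m] by (simp add: q_def c_def)
    ultimately have "degree q < m" using q0 by (metis leading_coeff_0_iff le_neq_implies_less)
    then have "Lam b (lag b (degree q) * q) = 0" by (rule orthl)
    then show False using Lam_lag_lead[OF b, of q "degree q"] q0 cl[of "degree q"] lag_h_pos[OF b, of "degree q"] by simp
  qed
  then show ?case using dp cl[of m] by (intro exI[of _ c]) (auto simp: q_def c_def)
qed

lemma lag_p_zeros:
  assumes b: "b > -1" shows "{x. poly (lag_p b m) x = 0} = Zs b m"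
proof -
  have "laguerre_orthonormal b (lag_p b)"
    unfolding lag_p_def by (rule someI_ex[OF laguerre_orthonormal_exists[OF b]])
  then obtain c where "c \<noteq> 0" "lag_p b m = smult c (lag b m)" using laguerre_orthonormal_unique[OF b] by blast
  then show ?thesis by (simp add: Zs_def)
qed

lemma lag_zero_bij:
  assumes b: "b > -1"
  shows "bij_betw (lag_zero b m) {1..m} (Zs b m)"
    "\<And>i j. 1 \<le> i \<Longrightarrow> i \<le> j \<Longrightarrow> j \<le> m \<Longrightarrow> lag_zero b m i \<le> lag_zero b m j"
proof -
  define L where "L = sorted_list_of_set (Zs b m)"
  have L: "sorted L" "distinct L" "set L = Zs b m" "length L = m"
    using Zs_props(1)[OF b, of m] by (auto simp: L_def)
  have z: "lag_zero b m k = L ! (k - 1)" for k by (simp add: lag_zero_def lag_p_zeros[OF b] L_def)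
  have "bij_betw ((!) L) {..<m} (Zs b m)" using L by (intro bij_betw_nth) auto
  moreover have "bij_betw (\<lambda>k. k - 1) {1..m} {..<m}"
    by (rule bij_betwI[where g = Suc]) auto
  ultimately have "bij_betw ((!) L \<circ> (\<lambda>k. k - 1)) {1..m} (Zs b m)" by (rule bij_betw_trans[rotated])
  then show "bij_betw (lag_zero b m) {1..m} (Zs b m)" by (simp add: z o_def cong: bij_betw_cong)
  show "lag_zero b m i \<le> lag_zero b m j" if "1 \<le> i" "i \<le> j" "j \<le> m" for i j
    unfolding z using L that by (intro sorted_nth_mono) auto
qed

lemma cotes_eq:
  assumes b: "b > -1" and k: "k \<in> {1..m}"
  shows "cotes b m k = lamz b m (lag_zero b m k)"
proof -
  note bij = lag_zero_bij(1)[OF b, of m]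
  let ?z = "lag_zero b m"
  have inj: "inj_on ?z {1..m}" and im: "?z ` {1..m} = Zs b m" using bij by (auto simp: bij_betw_def)
  have "?z ` ({1..m} - {k}) = ?z ` {1..m} - ?z ` {k}" using k by (intro inj_on_image_set_diff[OF inj]) auto
  then have bj: "bij_betw ?z ({1..m} - {k}) (Zs b m - {?z k})"
    unfolding bij_betw_def im using inj_on_subset[OF inj, of "{1..m} - {k}"] by auto
  have "lagrange_basis b m k x = poly (lbas b m (?z k)) x" for x
  proof -
    have "poly (lbas b m (?z k)) x = (\<Prod>i\<in>{1..m} - {k}. poly (smult (1 / (?z k - ?z i)) [:- ?z i, 1:]) x)"
      unfolding lbas_def poly_prod by (rule prod.reindex_bij_betw[OF bj, symmetric])
    also have "\<dots> = lagrange_basis b m k x"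
      unfolding lagrange_basis_def by (intro prod.cong refl) (simp add: diff_divide_distrib)
    finally show ?thesis ..
  qed
  then have "cotes b m k = (LINT x:{0<..}|lborel. poly (lbas b m (lag_zero b m k)) x * lag_w b x)"
    by (simp add: cotes_def)
  also have "\<dots> = lamz b m (lag_zero b m k)"
    unfolding lamz_def Lam_def by (subst integral_lagm) auto
  finally show ?thesis .
qed

text \<open>The zeros are increasing, so the admissible indices form an initial segment. The
  alternative \<open>j = 0\<close> gives \<open>GREATEST\<close> a value when no node is small
  enough.\<close>

lemma j_idx_nodes:
  assumes b: "b > -1"
  shows "j_idx b \<theta> m \<le> m" "bij_betw (lag_zero b m) {1..j_idx b \<theta> m} {z\<in>Zs b m. z \<le> 4 * \<theta> * real m}"
    "j_idx b \<theta> m = card {z\<in>Zs b m. z \<le> 4 * \<theta> * real m}"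
proof -
  define P where "P j \<longleftrightarrow> j = 0 \<or> (1 \<le> j \<and> j \<le> m \<and> lag_zero b m j \<le> 4 * \<theta> * real m)" for j
  define J where "J = j_idx b \<theta> m"
  have J: "J = (GREATEST j. P j)" by (simp add: J_def j_idx_def P_def)
  have P0: "P 0" and bd: "\<And>j. P j \<Longrightarrow> j \<le> m" by (auto simp: P_def)
  have PJ: "P J" unfolding J by (rule GreatestI_nat[of P 0 m]) (use P0 bd in auto)
  have maxJ: "j \<le> J" if "P j" for j unfolding J by (rule Greatest_le_nat[of P j m]) (use that bd in auto)
  show Jm: "j_idx b \<theta> m \<le> m" using bd[OF PJ] by (simp add: J_def)
  note bij = lag_zero_bij(1)[OF b, of m]
  have iff: "lag_zero b m k \<le> 4 * \<theta> * real m \<longleftrightarrow> k \<le> J" if "k \<in> {1..m}" for k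
  proof
    assume "lag_zero b m k \<le> 4 * \<theta> * real m"
    then show "k \<le> J" using that by (intro maxJ) (auto simp: P_def)
  next
    assume "k \<le> J"
    then have "lag_zero b m k \<le> lag_zero b m J" using that Jm by (intro lag_zero_bij(2)[OF b]) (auto simp: J_def)
    then show "lag_zero b m k \<le> 4 * \<theta> * real m" using PJ \<open>k \<le> J\<close> that by (auto simp: P_def)
  qed
  have "bij_betw (lag_zero b m) {1..J} (lag_zero b m ` {1..J})"
    using bij Jm by (intro inj_on_imp_bij_betw) (auto simp: bij_betw_def J_def intro: inj_on_subset)
  moreover have "lag_zero b m ` {1..J} = {z\<in>Zs b m. z \<le> 4 * \<theta> * real m}"
  proof
    show "lag_zero b m ` {1..J} \<subseteq> {z\<in>Zs b m. z \<le> 4 * \<theta> * real m}"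
      using bij Jm iff by (auto simp: bij_betw_def J_def)
    show "{z\<in>Zs b m. z \<le> 4 * \<theta> * real m} \<subseteq> lag_zero b m ` {1..J}"
    proof
      fix z assume z: "z \<in> {z\<in>Zs b m. z \<le> 4 * \<theta> * real m}"
      then have "z \<in> lag_zero b m ` {1..m}" using bij unfolding bij_betw_def by blast
      then obtain k where "k \<in> {1..m}" "z = lag_zero b m k" by blast
      then show "z \<in> lag_zero b m ` {1..J}" using iff[of k] z by auto
    qed
  qed
  ultimately show bJ: "bij_betw (lag_zero b m) {1..j_idx b \<theta> m} {z\<in>Zs b m. z \<le> 4 * \<theta> * real m}" by (simp add: J_def)
  show "j_idx b \<theta> m = card {z\<in>Zs b m. z \<le> 4 * \<theta> * real m}" using bij_betw_same_card[OF bJ] by simp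
qed

section \<open>Assembling both half-lines and the choice of \<open>m\<close>\<close>

lemma length_Q2TL: "length (Q2TL b \<theta> m) = 2 * j_idx b \<theta> m"
proof -
  have "length (concat (map (\<lambda>k. [f k, g k]) xs)) = 2 * length xs" for f g :: "nat \<Rightarrow> real \<times> real" and xs
    by (induction xs) auto
  then show ?thesis by (simp add: Q2TL_def)
qed

lemma quad_Q2TL:
  assumes b: "b > -1"
  shows "quad (Q2TL b \<theta> m) f = (\<Sum>z\<in>{z\<in>Zs b m. z \<le> 4 * \<theta> * real m}. lamz b m z * (f z + f (- z)))"
proof -
  let ?J = "j_idx b \<theta> m" and ?x = "lag_zero b m"
  have "quad (concat (map (\<lambda>k. [(u k, v k), (- u k, v k)]) xs)) f = (\<Sum>k\<leftarrow>xs. v k * (f (u k) + f (- u k)))"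
    for u v :: "nat \<Rightarrow> real" and xs
    by (induction xs) (auto simp: quad_def algebra_simps)
  then have "quad (Q2TL b \<theta> m) f = (\<Sum>k\<leftarrow>[1..<?J + 1]. cotes b m k * (f (?x k) + f (- ?x k)))"
    unfolding Q2TL_def by simp
  also have "\<dots> = (\<Sum>k\<in>{1..?J}. cotes b m k * (f (?x k) + f (- ?x k)))"
    by (subst sum_list_distinct_conv_sum_set) (auto intro!: sum.cong)
  also have "\<dots> = (\<Sum>k\<in>{1..?J}. lamz b m (?x k) * (f (?x k) + f (- ?x k)))"
    using j_idx_nodes(1)[OF b, of \<theta> m] by (intro sum.cong refl) (simp add: cotes_eq[OF b])
  also have "\<dots> = (\<Sum>z\<in>{z\<in>Zs b m. z \<le> 4 * \<theta> * real m}. lamz b m z * (f z + f (- z)))"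
    by (rule sum.reindex_bij_betw[OF j_idx_nodes(2)[OF b], of "\<lambda>z. lamz b m z * (f z + f (- z))"])
  finally show ?thesis .
qed

lemma integral_two_sided:
  assumes f [measurable]: "f \<in> borel_measurable borel"
    and i: "integrable (lagm \<alpha>) f" "integrable (lagm \<alpha>) (\<lambda>x. f (- x))"
  shows "(\<integral>x. f x * wr \<alpha> 0 x \<partial>lborel) = (\<integral>x. f x \<partial>lagm \<alpha>) + (\<integral>x. f (- x) \<partial>lagm \<alpha>)"
proof -
  define u where "u = (\<lambda>x. indicator {0<..} x * (f x * lag_w \<alpha> x))"
  define v where "v = (\<lambda>x. indicator {0<..} x * (f (- x) * lag_w \<alpha> x))"
  have iu: "integrable lborel u" using i(1) by (subst (asm) integrable_lagm_iff) (auto simp: set_integrable_def u_def)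
  have iv: "integrable lborel v" using i(2) by (subst (asm) integrable_lagm_iff) (auto simp: set_integrable_def v_def)
  have iv': "integrable lborel (\<lambda>x. v (- x))" using lborel_integrable_real_affine[OF iv, of "-1" 0] by simp
  \<comment> \<open>At \<open>x = 0\<close> both sides vanish, since \<open>0 powr a = 0\<close> for
    every exponent.\<close>
  have "f x * wr \<alpha> 0 x = u x + v (- x)" for x
  proof -
    consider "x > 0" | "x = 0" | "x < 0" by linarith
    then show ?thesis by cases (auto simp: u_def v_def wr_def lag_w_def)
  qed
  then have "(\<integral>x. f x * wr \<alpha> 0 x \<partial>lborel) = (\<integral>x. u x \<partial>lborel) + (\<integral>x. v (- x) \<partial>lborel)"
    using iu iv' by simp
  also have "(\<integral>x. v (- x) \<partial>lborel) = (\<integral>x. v x \<partial>lborel)"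
    using lborel_integral_real_affine[of "-1" v 0] by simp
  also have "(\<integral>x. u x \<partial>lborel) = (\<integral>x. f x \<partial>lagm \<alpha>)"
    by (subst integral_lagm) (auto simp: set_lebesgue_integral_def u_def)
  also have "(\<integral>x. v x \<partial>lborel) = (\<integral>x. f (- x) \<partial>lagm \<alpha>)"
    by (subst integral_lagm) (auto simp: set_lebesgue_integral_def v_def)
  finally show ?thesis .
qed

lemma quad_err_le:
  assumes al: "\<alpha> > -1" and r: "r \<ge> 1" and f: "f \<in> sobolev_ball \<alpha> r"
    and B: "\<And>F. unit_chain \<alpha> r F \<Longrightarrow> \<bar>trunc_err \<alpha> m (4 * \<theta> * real m) (F 0)\<bar> \<le> B"
  shows "quad_err \<alpha> (Q2TL \<alpha> \<theta> m) f \<le> 2 * B"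
proof -
  obtain F where F: "F 0 = f" "sobolev_chain F r" "\<And>k. k \<le> r \<Longrightarrow> (\<integral>\<^sup>+x. ennreal \<bar>F k x * wr \<alpha> r x\<bar> \<partial>lborel) \<le> 1"
    using sobolev_ball_chain[OF f r] by blast
  note uc = sobolev_chain_unit[OF F(2,3)]
  define F' where "F' = (\<lambda>k x. (-1) ^ k * F k (- x))"
  have F'0: "F' 0 = (\<lambda>x. f (- x))" by (simp add: F'_def F(1))
  have uc': "unit_chain \<alpha> r F'" unfolding F'_def by (rule uc(2))
  have i1: "integrable (lagm \<alpha>) f" using unit_chain_integrable[OF al r uc(1)] F(1) by simp
  have i2: "integrable (lagm \<alpha>) (\<lambda>x. f (- x))" using unit_chain_integrable[OF al r uc'] F'0 by simp
  have fm: "f \<in> borel_measurable borel"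
    using f by (intro borel_measurable_continuous_onI) (auto simp: sobolev_ball_def)
  let ?T = "4 * \<theta> * real m"
  have "(\<integral>x. f x * wr \<alpha> 0 x \<partial>lborel) - quad (Q2TL \<alpha> \<theta> m) f = trunc_err \<alpha> m ?T (F 0) + trunc_err \<alpha> m ?T (F' 0)"
    unfolding integral_two_sided[OF fm i1 i2] quad_Q2TL[OF al] trunc_err_def F'0 F(1)
    by (simp add: distrib_left sum.distrib)
  then show ?thesis unfolding quad_err_def using B[OF uc(1)] B[OF uc'] by linarith
qed

text \<open>By \<open>many_nodes\<close> the admissible \<open>m\<close> are bounded, so the maximum
  exists. As \<open>j_idx\<close> is at most \<open>m\<close>, the value \<open>n div 2\<close> is
  admissible, and \<open>m_n\<close> is at least of order \<open>n\<close>.\<close>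

lemma m_n_props:
  assumes al: "\<alpha> > -1" and th: "0 < \<theta>" "\<theta> < 1"
  shows "2 * j_idx \<alpha> \<theta> (m_n \<alpha> \<theta> n) \<le> n" "n div 2 \<le> m_n \<alpha> \<theta> n"
proof -
  define P where "P m \<longleftrightarrow> 2 * j_idx \<alpha> \<theta> m \<le> n" for m
  obtain M where M: "\<And>m. m \<ge> M \<Longrightarrow> n + 1 \<le> card {z\<in>Zs \<alpha> m. z \<le> 4 * \<theta> * real m}"
    using many_nodes[OF al th] by blast
  have bd: "m \<le> M" if "P m" for m
    using M[of m] that unfolding P_def j_idx_nodes(3)[OF al] by (cases "m \<le> M") auto
  have Pn: "P (n div 2)" unfolding P_def using j_idx_nodes(1)[OF al, of \<theta> "n div 2"] by linarith
  have m: "m_n \<alpha> \<theta> n = (GREATEST m. P m)" by (simp add: m_n_def P_def)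
  have "P (m_n \<alpha> \<theta> n)" unfolding m by (rule GreatestI_nat[of P "n div 2" M]) (use Pn bd in auto)
  then show "2 * j_idx \<alpha> \<theta> (m_n \<alpha> \<theta> n) \<le> n" by (simp add: P_def)
  show "n div 2 \<le> m_n \<alpha> \<theta> n" unfolding m by (rule Greatest_le_nat[of P "n div 2" M]) (use Pn bd in auto)
qed

lemma upper_bound:
  fixes \<alpha> \<theta> :: real and r :: nat
  assumes al: "\<alpha> > -1" and r: "r \<ge> 1" and th: "0 < \<theta>" "\<theta> < 1"
  shows "\<exists>C>0. \<forall>n\<ge>1. worst_err \<alpha> (sobolev_ball \<alpha> r) (Q2TL \<alpha> \<theta> (m_n \<alpha> \<theta> n)) \<le> ereal (C * real n powr (- real r / 2))"
proof -
  obtain C m0 where C: "C > 0" "m0 \<ge> 1" "\<And>m F. m \<ge> m0 \<Longrightarrow> unit_chain \<alpha> r F \<Longrightarrow>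
      \<bar>trunc_err \<alpha> m (4 * \<theta> * real m) (F 0)\<bar> \<le> C * real m powr (- real r / 2)"
    using half_line_error[OF al r th] by blast
  have "\<forall>m. \<exists>c>0. \<forall>F. unit_chain \<alpha> r F \<longrightarrow> \<bar>trunc_err \<alpha> m (4 * \<theta> * real m) (F 0)\<bar> \<le> c"
    using half_line_error_crude[OF al r] by blast
  then obtain c where c: "\<And>m. c m > 0" "\<And>m F. unit_chain \<alpha> r F \<Longrightarrow> \<bar>trunc_err \<alpha> m (4 * \<theta> * real m) (F 0)\<bar> \<le> c m"
    by metis
  \<comment> \<open>A single bound for all crude constants with \<open>m < m0\<close>.\<close>
  define D where "D = (\<Sum>m<m0. c m)"
  have D: "D \<ge> 0" unfolding D_def using c(1) by (intro sum_nonneg) (auto intro: less_imp_le)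
  \<comment> \<open>From \<open>n <= 2 m + 1\<close> one gets \<open>n <= 3 m\<close> when
    \<open>m >= 1\<close>, and \<open>n <= 2 m0 + 1\<close> when \<open>m < m0\<close>; these are
    the two bases of the powers.\<close>
  define E where "E = 2 * C * 3 powr (real r / 2) + 2 * D * (2 * real m0 + 1) powr (real r / 2)"
  have E: "E > 0" "2 * C * 3 powr (real r / 2) \<le> E" "2 * D * (2 * real m0 + 1) powr (real r / 2) \<le> E"
    using C(1) D by (auto simp: E_def intro!: add_pos_nonneg)
  have "worst_err \<alpha> (sobolev_ball \<alpha> r) (Q2TL \<alpha> \<theta> (m_n \<alpha> \<theta> n)) \<le> ereal (E * real n powr (- real r / 2))" if n: "n \<ge> 1" for n
    unfolding worst_err_def
  proof (rule SUP_least)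
    fix f assume f: "f \<in> sobolev_ball \<alpha> r"
    define m where "m = m_n \<alpha> \<theta> n"
    have "n div 2 \<le> m" unfolding m_def by (rule m_n_props(2)[OF al th])
    then have nm: "n \<le> 2 * m + 1" by linarith
    have pn: "x powr (- real r / 2) \<le> y powr (real r / 2) * real n powr (- real r / 2)"
      if "x > 0" "y > 0" "real n \<le> y * x" for x y
    proof -
      have "(y * x) powr (- real r / 2) \<le> real n powr (- real r / 2)" using n that by (intro powr_mono2') auto
      then have "y powr (real r / 2) * ((y * x) powr (- real r / 2)) \<le> y powr (real r / 2) * real n powr (- real r / 2)"
        by (intro mult_left_mono) auto
      moreover have "y powr (real r / 2) * ((y * x) powr (- real r / 2)) = x powr (- real r / 2)"
        using that by (simp add: powr_mult mult.assoc[symmetric] flip: powr_add)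
      ultimately show ?thesis by simp
    qed
    have "quad_err \<alpha> (Q2TL \<alpha> \<theta> m) f \<le> E * real n powr (- real r / 2)"
    proof (cases "m \<ge> m0")
      case True
      have m1: "m \<ge> 1" using True C(2) by simp
      have "quad_err \<alpha> (Q2TL \<alpha> \<theta> m) f \<le> 2 * (C * real m powr (- real r / 2))"
        by (rule quad_err_le[OF al r f]) (rule C(3)[OF True])
      also have "\<dots> \<le> 2 * (C * (3 powr (real r / 2) * real n powr (- real r / 2)))"
        using nm m1 C(1) by (intro mult_left_mono pn) auto
      also have "\<dots> = 2 * C * 3 powr (real r / 2) * real n powr (- real r / 2)" by simp
      also have "\<dots> \<le> E * real n powr (- real r / 2)" using E by (intro mult_right_mono) auto
      finally show ?thesis .
    next
      case False
      have "quad_err \<alpha> (Q2TL \<alpha> \<theta> m) f \<le> 2 * c m"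
        by (rule quad_err_le[OF al r f]) (rule c(2))
      also have "c m \<le> D" unfolding D_def using False c(1) by (intro member_le_sum) (auto intro: less_imp_le)
      also have "2 * D \<le> 2 * D * ((2 * real m0 + 1) powr (real r / 2) * real n powr (- real r / 2))"
      proof -
        have "1 powr (- real r / 2) \<le> (2 * real m0 + 1) powr (real r / 2) * real n powr (- real r / 2)"
          using nm False by (intro pn) auto
        then have "2 * D * 1 \<le> 2 * D * ((2 * real m0 + 1) powr (real r / 2) * real n powr (- real r / 2))"
          using D by (intro mult_left_mono) auto
        then show ?thesis by simp
      qed
      also have "\<dots> \<le> E * real n powr (- real r / 2)"
        unfolding mult.assoc[symmetric] using E by (intro mult_right_mono) auto
      finally show ?thesis by simp
    qed
    then show "ereal (quad_err \<alpha> (Q2TL \<alpha> \<theta> (m_n \<alpha> \<theta> n)) f) \<le> ereal (E * real n powr (- real r / 2))"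
      by (simp add: m_def)
  qed
  then show ?thesis using E(1) by blast
qed

theorem theorem2p2:
  fixes \<alpha> \<theta> :: real and r :: nat
  assumes "\<alpha> > -1" and "r \<ge> 1" and "0 < \<theta>" and "\<theta> < 1"
  shows "(\<forall>n\<ge>1. length (Q2TL \<alpha> \<theta> (m_n \<alpha> \<theta> n)) \<le> n) \<and>
    (\<exists>C1 C2. C1 > 0 \<and> C2 > 0 \<and> (\<forall>n::nat. n \<ge> 1 \<longrightarrow>
       ereal (C1 * real n powr (- 3 * real r / 4)) \<le> Int_n \<alpha> n (sobolev_ball \<alpha> r) \<and>
       Int_n \<alpha> n (sobolev_ball \<alpha> r) \<le> worst_err \<alpha> (sobolev_ball \<alpha> r) (Q2TL \<alpha> \<theta> (m_n \<alpha> \<theta> n)) \<and>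
       worst_err \<alpha> (sobolev_ball \<alpha> r) (Q2TL \<alpha> \<theta> (m_n \<alpha> \<theta> n)) \<le> ereal (C2 * real n powr (- real r / 2))))"
proof -
  have len: "length (Q2TL \<alpha> \<theta> (m_n \<alpha> \<theta> n)) \<le> n" for n
    unfolding length_Q2TL by (rule m_n_props(1)[OF assms(1,3,4)])
  have mid: "Int_n \<alpha> n (sobolev_ball \<alpha> r) \<le> worst_err \<alpha> (sobolev_ball \<alpha> r) (Q2TL \<alpha> \<theta> (m_n \<alpha> \<theta> n))" for n
    unfolding Int_n_def using len[of n] by (intro INF_lower) simp
  obtain C1 where C1: "C1 > 0" "\<And>n. n \<ge> 1 \<Longrightarrow> ereal (C1 * real n powr (- 3 * real r / 4)) \<le> Int_n \<alpha> n (sobolev_ball \<alpha> r)"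
    using lower_bound[where \<alpha> = \<alpha> and r = r] by blast
  obtain C2 where C2: "C2 > 0" "\<And>n. n \<ge> 1 \<Longrightarrow>
      worst_err \<alpha> (sobolev_ball \<alpha> r) (Q2TL \<alpha> \<theta> (m_n \<alpha> \<theta> n)) \<le> ereal (C2 * real n powr (- real r / 2))"
    using upper_bound[OF assms] by blast
  show ?thesis
    using len mid C1 C2 by (intro conjI exI[of _ C1] exI[of _ C2] allI impI) simp_all
qed

end
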